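(* Let $s\in L_{2,loc}(\mathbb{R}_+)$ be complex-valued and let $L_0$ be the minimal operator constructed from $s$. Suppose there exist two complex-valued functions $f,g\in L_{2,unif}(\mathbb{R}_+)$, a number $d>0$ and real numbers $\alpha,\beta$ with $0\le\beta-\alpha<\pi$, $|\alpha|<\pi$, $|\beta|<\pi$, such that for all $x,t\in\mathbb{R}_+$ with $0\le x-t\le d$ $$\arg\bigl(s(x)+f(x)-s(t)-g(t)\bigr)\in[\alpha,\beta].$$ Then $L_0$ has extensions with compact resolvents if and only if for every $A>0$ and every sequence of squares $\Delta_n=[a_n,a_n+d]\times[a_n,a_n+d]$, $n\in\mathbb{N}$, with $a_n\to+\infty$ as $n\to\infty$, $$\lim_{n\to+\infty}\mu\bigl\{(x,t)\in\Delta_n:\ |s(x)-s(t)|<A\bigr\}=0,$$ where $\mu$ is the Lebesgue measure on $\mathbb{R}^2$.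
   Context: $\mathbb{R}_+=[0,+\infty)$; the subscript "loc" means the property holds on every segment $[0,R]$. Minimal operator constructed from a complex-valued $s\in L_{2,loc}(\mathbb{R}_+)$: for $y\in AC_{loc}(\mathbb{R}_+)$ put $y^{[1]}=y'-sy$, and if $y^{[1]}\in AC_{loc}(\mathbb{R}_+)$ put $l(y)=-(y^{[1]})'-sy^{[1]}-s^2y$ (a regularization of $-y''+s'y$). Let $$\mathscr{D}_0=\{y\in L_2(\mathbb{R}_+): y,y^{[1]}\in AC_{loc}(\mathbb{R}_+),\ l(y)\in L_2(\mathbb{R}_+),\ y(0)=y^{[1]}(0)=0,\ \operatorname{supp}y\text{ compact}\}.$$ The minimal operator $L_0$ acts in $L_2(\mathbb{R}_+)$ by $L_0y=l(y)$ on the domain $\mathscr{D}_0$. "$L_0$ has extensions with compact resolvents" means that there is a linear operator $L$ in $L_2(\mathbb{R}_+)$ extending $L_0$ with non-empty resolvent set and with $(L-\lambda)^{-1}$ compact for $\lambda$ in the resolvent set. $\arg z\in[\alpha,\beta]$ means $z=re^{i\varphi}$ with some $r\ge0$, $\varphi\in[\alpha,\beta]$ (so $z=0$ is allowed). $\sigma\in L_{p,unif}(\mathbb{R}_+)$ ($p\ge1$) means $\sigma\in L_{p,loc}(\mathbb{R}_+)$ and $\sup_{x\in\mathbb{R}_+}\int_x^{x+1}|\sigma(\xi)|^p\,d\xi<+\infty$. *)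

theory Defs
  imports "HOL-Analysis.Analysis"
begin

abbreviation half_line :: "real measure" where
  "half_line \<equiv> lebesgue_on {0..}"

text \<open>Functions on the half-line are total functions whose values on the negative reals are
  never used.\<close>

definition L2_loc :: "(real \<Rightarrow> complex) \<Rightarrow> bool" where
  "L2_loc \<sigma> \<longleftrightarrow> \<sigma> \<in> borel_measurable half_line \<and>
     (\<forall>R\<ge>0. integrable (lebesgue_on {0..R}) (\<lambda>x. (cmod (\<sigma> x))\<^sup>2))"

definition L2_unif :: "(real \<Rightarrow> complex) \<Rightarrow> bool" where
  "L2_unif \<sigma> \<longleftrightarrow> L2_loc \<sigma> \<and>
     bdd_above ((\<lambda>x. \<integral>\<xi>. (cmod (\<sigma> \<xi>))\<^sup>2 \<partial>lebesgue_on {x..x+1}) ` {0..})"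

definition abs_cont_on_interval :: "real \<Rightarrow> real \<Rightarrow> (real \<Rightarrow> complex) \<Rightarrow> bool" where
  "abs_cont_on_interval a b y \<longleftrightarrow>
     (\<forall>\<epsilon>>0. \<exists>\<delta>>0. \<forall>(n::nat) p q.
        (\<forall>i<n. a \<le> p i \<and> p i \<le> q i \<and> q i \<le> b) \<longrightarrow>
        disjoint_family_on (\<lambda>i. {p i<..<q i}) {..<n} \<longrightarrow>
        (\<Sum>i<n. q i - p i) < \<delta> \<longrightarrow>
        (\<Sum>i<n. cmod (y (q i) - y (p i))) < \<epsilon>)"

definition AC_loc :: "(real \<Rightarrow> complex) \<Rightarrow> bool" where
  "AC_loc y \<longleftrightarrow> (\<forall>R\<ge>0. abs_cont_on_interval 0 R y)"

definition square_integrable :: "(real \<Rightarrow> complex) \<Rightarrow> bool" where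
  "square_integrable f \<longleftrightarrow> f \<in> borel_measurable half_line \<and>
     integrable half_line (\<lambda>x. (cmod (f x))\<^sup>2)"

definition l2_eq :: "(real \<Rightarrow> complex) \<Rightarrow> (real \<Rightarrow> complex) \<Rightarrow> bool" where
  "l2_eq f g \<longleftrightarrow> square_integrable f \<and> square_integrable g \<and> (AE x in half_line. f x = g x)"

lemma square_integrable_0: "square_integrable (\<lambda>x. 0)"
  by (simp add: square_integrable_def)

lemma square_integrable_scale:
  assumes "square_integrable f" shows "square_integrable (\<lambda>x. c * f x)"
  using assms by (auto simp: square_integrable_def norm_mult power_mult_distrib)

lemma square_integrable_add:
  assumes "square_integrable f" "square_integrable g"
  shows "square_integrable (\<lambda>x. f x + g x)"
proof -
  have m: "f \<in> borel_measurable half_line" "g \<in> borel_measurable half_line"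
    and i: "integrable half_line (\<lambda>x. (cmod (f x))\<^sup>2)" "integrable half_line (\<lambda>x. (cmod (g x))\<^sup>2)"
    using assms by (auto simp: square_integrable_def)
  have le: "(cmod (f x + g x))\<^sup>2 \<le> 2 * (cmod (f x))\<^sup>2 + 2 * (cmod (g x))\<^sup>2" for x
  proof -
    have "(cmod (f x + g x))\<^sup>2 \<le> (cmod (f x) + cmod (g x))\<^sup>2"
      by (intro power_mono norm_triangle_ineq) auto
    also have "\<dots> \<le> 2 * (cmod (f x))\<^sup>2 + 2 * (cmod (g x))\<^sup>2"
      using sum_squares_bound[of "cmod (f x)" "cmod (g x)"] by (simp add: power2_sum)
    finally show ?thesis .
  qed
  have "integrable half_line (\<lambda>x. (cmod (f x + g x))\<^sup>2)"
  proof (rule Bochner_Integration.integrable_bound)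
    show "integrable half_line (\<lambda>x. 2 * (cmod (f x))\<^sup>2 + 2 * (cmod (g x))\<^sup>2)"
      using i by auto
  qed (use m le in auto)
  with m show ?thesis by (auto simp: square_integrable_def)
qed

lemma square_integrable_inner:
  assumes "square_integrable f" "square_integrable g"
  shows "integrable half_line (\<lambda>x. f x \<bullet> g x)"
proof (rule Bochner_Integration.integrable_bound)
  show "integrable half_line (\<lambda>x. (cmod (f x))\<^sup>2 + (cmod (g x))\<^sup>2)"
    using assms by (auto simp: square_integrable_def)
  show "(\<lambda>x. f x \<bullet> g x) \<in> borel_measurable half_line"
    using assms by (auto simp: square_integrable_def)
  have "\<bar>f x \<bullet> g x\<bar> \<le> (cmod (f x))\<^sup>2 + (cmod (g x))\<^sup>2" for x
  proof -
    have "\<bar>f x \<bullet> g x\<bar> \<le> cmod (f x) * cmod (g x)" by (rule Cauchy_Schwarz_ineq2)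
    also have "\<dots> \<le> (cmod (f x))\<^sup>2 + (cmod (g x))\<^sup>2"
      using sum_squares_bound[of "cmod (f x)" "cmod (g x)"]
        mult_nonneg_nonneg[of "cmod (f x)" "cmod (g x)"]
      unfolding mult.assoc by (smt (verit) norm_ge_zero)
    finally show ?thesis .
  qed
  then show "AE x in half_line. norm (f x \<bullet> g x) \<le> norm ((cmod (f x))\<^sup>2 + (cmod (g x))\<^sup>2)"
    by (auto simp: real_norm_def)
qed

quotient_type l2 = "real \<Rightarrow> complex" / partial: l2_eq
  morphisms rep_l2 l2_class
proof (rule part_equivpI)
  show "\<exists>f. l2_eq f f"
    by (rule exI[of _ "\<lambda>x. 0"]) (simp add: l2_eq_def square_integrable_0)
  show "symp l2_eq"
    by (auto simp: symp_def l2_eq_def elim: eventually_mono)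
  show "transp l2_eq"
    by (auto simp: transp_def l2_eq_def elim: eventually_elim2)
qed

lift_definition l2_scale :: "complex \<Rightarrow> l2 \<Rightarrow> l2" is "\<lambda>c f x. c * f x"
  by (auto simp: l2_eq_def square_integrable_scale elim: eventually_mono)

text \<open>The inner product below is the real part of the Hermitian one; it induces the same norm.
  Linearity of operators refers to the complex scaling \<open>l2_scale\<close>.\<close>

instantiation l2 :: real_inner
begin

lift_definition zero_l2 :: l2 is "\<lambda>x. 0"
  by (simp add: l2_eq_def square_integrable_0)

lift_definition plus_l2 :: "l2 \<Rightarrow> l2 \<Rightarrow> l2" is "\<lambda>f g x. f x + g x"
  by (auto simp: l2_eq_def square_integrable_add elim: eventually_elim2)

lift_definition uminus_l2 :: "l2 \<Rightarrow> l2" is "\<lambda>f x. - f x"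
  using square_integrable_scale[of _ "-1"]
  by (auto simp: l2_eq_def elim: eventually_mono)

definition minus_l2 :: "l2 \<Rightarrow> l2 \<Rightarrow> l2" where
  "minus_l2 u v = u + (- v)"

definition scaleR_l2 :: "real \<Rightarrow> l2 \<Rightarrow> l2" where
  "scaleR_l2 r u = l2_scale (of_real r) u"

lift_definition inner_l2 :: "l2 \<Rightarrow> l2 \<Rightarrow> real" is "\<lambda>f g. \<integral>x. f x \<bullet> g x \<partial>half_line"
proof -
  fix f f' g g' assume "l2_eq f f'" "l2_eq g g'"
  then show "(\<integral>x. f x \<bullet> g x \<partial>half_line) = (\<integral>x. f' x \<bullet> g' x \<partial>half_line)"
    by (intro integral_cong_AE)
      (auto simp: l2_eq_def square_integrable_def elim: eventually_elim2)
qed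

definition norm_l2 :: "l2 \<Rightarrow> real" where
  "norm_l2 u = sqrt (inner u u)"

definition dist_l2 :: "l2 \<Rightarrow> l2 \<Rightarrow> real" where
  "dist_l2 u v = norm (u - v)"

definition sgn_l2 :: "l2 \<Rightarrow> l2" where
  "sgn_l2 u = inverse (norm u) *\<^sub>R u"

definition uniformity_l2 :: "(l2 \<times> l2) filter" where
  "uniformity_l2 = (INF e\<in>{0<..}. principal {(u, v). dist u v < e})"

definition open_l2 :: "l2 set \<Rightarrow> bool" where
  "open_l2 U \<longleftrightarrow> (\<forall>u\<in>U. eventually (\<lambda>(u', v). u' = u \<longrightarrow> v \<in> U) uniformity)"

instance
proof
  fix u v w :: l2 and a b :: real
  show "u + v + w = u + (v + w)"
    by transfer (auto simp: l2_eq_def square_integrable_add add.assoc)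
  show "u + v = v + u"
    by transfer (auto simp: l2_eq_def square_integrable_add add.commute)
  show "0 + u = u"
    by transfer (auto simp: l2_eq_def)
  show "- u + u = 0"
    by transfer (auto simp: l2_eq_def square_integrable_0)
  show "u - v = u + - v"
    by (simp add: minus_l2_def)
  show "a *\<^sub>R (u + v) = a *\<^sub>R u + a *\<^sub>R v"
    unfolding scaleR_l2_def
    by transfer (auto simp: l2_eq_def square_integrable_add square_integrable_scale ring_distribs)
  show "(a + b) *\<^sub>R u = a *\<^sub>R u + b *\<^sub>R u"
    unfolding scaleR_l2_def
    by transfer (auto simp: l2_eq_def square_integrable_add square_integrable_scale
      ring_distribs)
  show "a *\<^sub>R b *\<^sub>R u = (a * b) *\<^sub>R u"
    unfolding scaleR_l2_def
    by transfer (auto simp: l2_eq_def square_integrable_scale mult.assoc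
        intro!: square_integrable_scale)
  show "1 *\<^sub>R u = u"
    unfolding scaleR_l2_def by transfer (auto simp: l2_eq_def)
  show "dist u v = norm (u - v)" by (rule dist_l2_def)
  show "sgn u = inverse (norm u) *\<^sub>R u" by (rule sgn_l2_def)
  show "(uniformity :: (l2 \<times> l2) filter) = (INF e\<in>{0<..}. principal {(x, y). dist x y < e})"
    by (rule uniformity_l2_def)
  show "open U = (\<forall>x\<in>U. \<forall>\<^sub>F (x', y) in uniformity. x' = x \<longrightarrow> y \<in> U)" for U :: "l2 set"
    by (rule open_l2_def)
  show "u \<bullet> v = v \<bullet> u"
    by transfer (simp add: inner_commute)
  show "(u + v) \<bullet> w = u \<bullet> w + v \<bullet> w"
    by transfer (simp add: l2_eq_def inner_add_left square_integrable_inner)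
  show "a *\<^sub>R u \<bullet> v = a * (u \<bullet> v)"
    unfolding scaleR_l2_def
    by transfer (simp flip: scaleR_conv_of_real)
  show "0 \<le> u \<bullet> u"
    by transfer simp
  show "(u \<bullet> u = 0) = (u = 0)"
  proof transfer
    fix f assume f: "l2_eq f f"
    then have i: "integrable half_line (\<lambda>x. f x \<bullet> f x)"
      by (simp add: l2_eq_def square_integrable_inner)
    have "(\<integral>x. f x \<bullet> f x \<partial>half_line) = 0 \<longleftrightarrow> (AE x in half_line. f x \<bullet> f x = 0)"
      using i by (intro integral_nonneg_eq_0_iff_AE) auto
    with f show "(\<integral>x. f x \<bullet> f x \<partial>half_line) = 0 \<longleftrightarrow> l2_eq f (\<lambda>x. 0)"
      by (simp add: l2_eq_def square_integrable_0)
  qed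
  show "norm u = sqrt (u \<bullet> u)" by (rule norm_l2_def)
qed

end

global_interpretation l2: vector_space l2_scale
proof
  fix a b :: complex and u v :: l2
  show "l2_scale a (u + v) = l2_scale a u + l2_scale a v"
    by transfer (auto simp: l2_eq_def square_integrable_add square_integrable_scale ring_distribs)
  show "l2_scale (a + b) u = l2_scale a u + l2_scale b u"
    by transfer (auto simp: l2_eq_def square_integrable_add square_integrable_scale ring_distribs)
  show "l2_scale a (l2_scale b u) = l2_scale (a * b) u"
    by transfer (auto simp: l2_eq_def square_integrable_scale mult.assoc
        intro!: square_integrable_scale)
  show "l2_scale 1 u = u"
    by transfer (auto simp: l2_eq_def)
qed

lemma norm_l2_class:
  assumes "square_integrable f"
  shows "norm (l2_class f) = sqrt (\<integral>x. (cmod (f x))\<^sup>2 \<partial>half_line)"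
  using assms by (simp add: norm_l2_def inner_l2.abs_eq l2_eq_def power2_norm_eq_inner)

text \<open>An operator is given by its domain and a map that is only relevant on that domain.\<close>

definition linear_operator :: "l2 set \<Rightarrow> (l2 \<Rightarrow> l2) \<Rightarrow> bool" where
  "linear_operator D T \<longleftrightarrow> l2.subspace D \<and>
     (\<forall>u\<in>D. \<forall>v\<in>D. T (u + v) = T u + T v) \<and>
     (\<forall>c. \<forall>u\<in>D. T (l2_scale c u) = l2_scale c (T u))"

definition resolvent_set :: "l2 set \<Rightarrow> (l2 \<Rightarrow> l2) \<Rightarrow> complex set" where
  "resolvent_set D T = {z. bij_betw (\<lambda>u. T u - l2_scale z u) D UNIV \<and>
     (\<exists>C. \<forall>u\<in>D. norm u \<le> C * norm (T u - l2_scale z u))}"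

definition resolvent :: "l2 set \<Rightarrow> (l2 \<Rightarrow> l2) \<Rightarrow> complex \<Rightarrow> l2 \<Rightarrow> l2" where
  "resolvent D T z = inv_into D (\<lambda>u. T u - l2_scale z u)"

definition compact_operator :: "(l2 \<Rightarrow> l2) \<Rightarrow> bool" where
  "compact_operator K \<longleftrightarrow> linear_operator UNIV K \<and>
     (\<forall>B. bounded B \<longrightarrow> compact (closure (K ` B)))"

definition has_compact_resolvent :: "l2 set \<Rightarrow> (l2 \<Rightarrow> l2) \<Rightarrow> bool" where
  "has_compact_resolvent D T \<longleftrightarrow> resolvent_set D T \<noteq> {} \<and>
     (\<forall>z\<in>resolvent_set D T. compact_operator (resolvent D T z))"

text \<open>The quasi-derivative \<open>y' - s y\<close> is only determined almost everywhere. It belongs to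
  \<open>AC_loc\<close> iff it has a representative \<open>u\<close> in \<open>AC_loc\<close>; the values of such a \<open>u\<close> on the
  half-line are unique. As \<open>y\<close> and \<open>u\<close> are differentiable almost everywhere, the arbitrary
  value of \<open>vector_derivative\<close> elsewhere is immaterial.\<close>

definition has_quasi_derivative ::
    "(real \<Rightarrow> complex) \<Rightarrow> (real \<Rightarrow> complex) \<Rightarrow> (real \<Rightarrow> complex) \<Rightarrow> bool" where
  "has_quasi_derivative s y u \<longleftrightarrow> AC_loc y \<and> AC_loc u \<and>
     (AE x in half_line. u x = vector_derivative y (at x) - s x * y x)"

definition l_expr ::
    "(real \<Rightarrow> complex) \<Rightarrow> (real \<Rightarrow> complex) \<Rightarrow> (real \<Rightarrow> complex) \<Rightarrow> real \<Rightarrow> complex" where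
  "l_expr s y u x = - vector_derivative u (at x) - s x * u x - (s x)\<^sup>2 * y x"

definition in_minimal_domain ::
    "(real \<Rightarrow> complex) \<Rightarrow> (real \<Rightarrow> complex) \<Rightarrow> (real \<Rightarrow> complex) \<Rightarrow> bool" where
  "in_minimal_domain s y u \<longleftrightarrow> square_integrable y \<and> has_quasi_derivative s y u \<and>
     square_integrable (l_expr s y u) \<and> y 0 = 0 \<and> u 0 = 0 \<and>
     compact (closure {x. 0 \<le> x \<and> y x \<noteq> 0})"

definition minimal_operator :: "(real \<Rightarrow> complex) \<Rightarrow> (l2 \<times> l2) set" where
  "minimal_operator s = {(l2_class y, l2_class (l_expr s y u)) | y u. in_minimal_domain s y u}"

definition extends_operator :: "l2 set \<Rightarrow> (l2 \<Rightarrow> l2) \<Rightarrow> (l2 \<times> l2) set \<Rightarrow> bool" where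
  "extends_operator D T G \<longleftrightarrow> (\<forall>(u, v)\<in>G. u \<in> D \<and> T u = v)"

definition has_extensions_with_compact_resolvent :: "(l2 \<times> l2) set \<Rightarrow> bool" where
  "has_extensions_with_compact_resolvent G \<longleftrightarrow>
     (\<exists>D T. linear_operator D T \<and> extends_operator D T G \<and> has_compact_resolvent D T)"

definition arg_in :: "complex \<Rightarrow> real \<Rightarrow> real \<Rightarrow> bool" where
  "arg_in z \<alpha> \<beta> \<longleftrightarrow> (\<exists>r\<ge>0. \<exists>\<phi>\<in>{\<alpha>..\<beta>}. z = rcis r \<phi>)"

end

theory Submission
  imports Defs
begin

text \<open>The argument rests on a structural fact about \<open>s\<close>. Writing complex numbers in coordinates along the two edges
of the sector turns the hypothesis into two scalar conditions of the form
\<open>\<sigma> t + \<gamma> t \<le> \<sigma> x + \<psi> x\<close> for \<open>0 \<le> x - t \<le> d\<close>. A running supremum shows that such a \<open>\<sigma>\<close> is, up to a linear term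
and an error controlled by \<open>\<psi>\<close> and \<open>\<gamma>\<close>, a nondecreasing function. Hence
\<open>s x = e1 * m1 x + e2 * m2 x + \<gamma> * x + r x\<close> with nondecreasing \<open>m1\<close>, \<open>m2\<close>, unit numbers \<open>e1\<close>, \<open>e2\<close> and \<open>r\<close>
uniformly locally square integrable (\<open>sector_decomposition\<close>). As the sector together with the positive half-axis
spans an angle less than \<open>pi\<close>, one rotation \<open>\<omega>\<close> makes \<open>1\<close>, \<open>e1\<close> and \<open>e2\<close> have real part at least \<open>\<kappa> > 0\<close>.
The operator has an extension with compact resolvents iff the increments of \<open>m1 + m2\<close> over intervals of any fixed
small length tend to infinity, and this growth is what the condition on squares measures.

\<^bold>\<open>Growth gives compactness.\<close> For \<open>y\<close> in the minimal domain, integration by parts gives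
\<open>\<integral> l(y) * cnj y = \<integral> \<bar>y'\<bar>\<^sup>2 - \<integral> s * (\<bar>y\<bar>\<^sup>2)'\<close>. Second mean values on a grid of mesh \<open>h\<close> replace
\<open>- \<integral> m * (\<bar>y\<bar>\<^sup>2)'\<close> by the nonnegative sum of the increments of \<open>m\<close> times values of \<open>\<bar>y\<bar>\<^sup>2\<close> in the cells, while \<open>r\<close>
is absorbed by Sobolev's inequality on unit cells (\<open>energy_lower_bound\<close>). So the rotated and shifted operator is
coercive, and in the set where its values have norm at most \<open>1\<close> the functions have bounded energy. On cells where \<open>m1 + m2\<close>
increases by at least \<open>1\<close> such a function is small in the mean, and on the finitely many remaining cells it is close
to a step function (\<open>step_approximation\<close>): the set is totally bounded. A coercive operator with this property has an
extension with compact resolvents. The inverse of its closure is only defined on the closed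
range \<open>M\<close>; with \<open>P\<close> the orthogonal projection onto \<open>M\<close> and \<open>B\<close> the inverse composed with \<open>P\<close>, the operator
\<open>B - B\<^sup>* (1 - P)\<close> is compact, everywhere defined and, because it is accretive and the domain is dense, injective
(\<open>compact_accretive_extension\<close>).

\<^bold>\<open>Compactness gives growth.\<close> If \<open>s\<close> stays within bounded mean square distance of constants \<open>c n\<close> on short intervals
\<open>[t n, t n + \<delta>]\<close> with \<open>t n\<close> tending to infinity, the Riccati equation gives a nowhere vanishing \<open>\<phi>\<close> on each interval
with \<open>\<phi>' = (s - c n + v) \<phi>\<close> in which the singular part of the potential cancels: for smooth bumps \<open>z\<close> the product \<open>\<phi> * z\<close> lies in
the minimal domain and \<open>l(\<phi> * z)\<close> is bounded in norm independently of \<open>n\<close> (\<open>minimal_domain_products\<close>). These products are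
orthogonal for distant intervals and bounded below in norm, which contradicts compactness
(\<open>no_compact_resolvent_if_flat_intervals\<close>). The same products show that the minimal domain is dense.

\<^bold>\<open>Squares.\<close> If \<open>m1 + m2\<close> increases by less than \<open>1\<close> over an interval, then \<open>s\<close> varies boundedly on at least half of it, which
fills a set of definite area in a square (\<open>squares_imply_growth\<close>). Conversely, a sublevel set of definite area contains a point
\<open>(x, t)\<close> with \<open>x - t\<close> bounded below and \<open>f\<close>, \<open>g\<close> bounded at both coordinates; the sector condition applied on
\<open>[t, \<xi>]\<close> and \<open>[\<xi>, x]\<close> then bounds \<open>s \<xi> - s t\<close> for all \<open>\<xi>\<close> between, since two vectors of a sector narrower than a
half-plane cannot cancel (\<open>small_square_yields_flat_interval\<close>).\<close>

section \<open>Absolutely continuous functions\<close>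

lemma abs_cont_on_intervalI:
  assumes "\<And>\<epsilon>. \<epsilon> > 0 \<Longrightarrow> \<exists>\<delta>>0. \<forall>(n::nat) p q. (\<forall>i<n. a \<le> p i \<and> p i \<le> q i \<and> q i \<le> b) \<longrightarrow>
        disjoint_family_on (\<lambda>i. {p i<..<q i}) {..<n} \<longrightarrow>
        (\<Sum>i<n. q i - p i) < \<delta> \<longrightarrow> (\<Sum>i<n. cmod (y (q i) - y (p i))) < \<epsilon>"
  shows "abs_cont_on_interval a b y"
  unfolding abs_cont_on_interval_def using assms by blast

text \<open>The definition speaks of families indexed by an initial segment of the natural numbers; here the index set is any
finite set, so that families refining other families can be indexed by pairs.\<close>

lemma abs_cont_on_interval_finite:
  assumes "abs_cont_on_interval a b y" "\<epsilon> > 0"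
  shows "\<exists>\<delta>>0. \<forall>(I::'i set) p q. finite I \<longrightarrow>
     (\<forall>i\<in>I. a \<le> p i \<and> p i \<le> q i \<and> q i \<le> b) \<longrightarrow>
     disjoint_family_on (\<lambda>i. {p i<..<q i}) I \<longrightarrow> (\<Sum>i\<in>I. q i - p i) < \<delta> \<longrightarrow>
     (\<Sum>i\<in>I. cmod (y (q i) - y (p i))) < \<epsilon>"
proof -
  obtain \<delta> where "\<delta> > 0" and *: "\<forall>(n::nat) p q. (\<forall>i<n. a \<le> p i \<and> p i \<le> q i \<and> q i \<le> b) \<longrightarrow>
        disjoint_family_on (\<lambda>i. {p i<..<q i}) {..<n} \<longrightarrow>
        (\<Sum>i<n. q i - p i) < \<delta> \<longrightarrow> (\<Sum>i<n. cmod (y (q i) - y (p i))) < \<epsilon>"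
    using assms(1)[unfolded abs_cont_on_interval_def, THEN spec, THEN mp, OF assms(2)] by blast
  note \<delta> = *[rule_format]
  show ?thesis
  proof (intro exI[of _ \<delta>] conjI allI impI \<open>\<delta> > 0\<close>)
    fix I :: "'i set" and p q
    assume fin: "finite I" and "\<forall>i\<in>I. a \<le> p i \<and> p i \<le> q i \<and> q i \<le> b"
      and dis: "disjoint_family_on (\<lambda>i. {p i<..<q i}) I" and len: "(\<Sum>i\<in>I. q i - p i) < \<delta>"
    then have pq: "\<And>i. i \<in> I \<Longrightarrow> a \<le> p i \<and> p i \<le> q i \<and> q i \<le> b" by blast
    obtain h where h: "bij_betw h {..<card I} I"
      using ex_bij_betw_nat_finite[OF fin] by (auto simp: atLeast0LessThan)
    have "(\<Sum>i<card I. cmod (y ((q \<circ> h) i) - y ((p \<circ> h) i))) < \<epsilon>"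
    proof (rule \<delta>)
      show "a \<le> (p \<circ> h) i \<and> (p \<circ> h) i \<le> (q \<circ> h) i \<and> (q \<circ> h) i \<le> b" if "i < card I" for i
        using pq[of "h i"] h that by (auto simp: bij_betw_def)
      show "disjoint_family_on (\<lambda>i. {(p \<circ> h) i<..<(q \<circ> h) i}) {..<card I}"
        using dis h unfolding disjoint_family_on_def bij_betw_def inj_on_def by (metis comp_apply imageI)
      show "(\<Sum>i<card I. (q \<circ> h) i - (p \<circ> h) i) < \<delta>"
        using len sum.reindex_bij_betw[OF h, of "\<lambda>i. q i - p i"] by simp
    qed
    then show "(\<Sum>i\<in>I. cmod (y (q i) - y (p i))) < \<epsilon>"
      using sum.reindex_bij_betw[OF h, of "\<lambda>i. cmod (y (q i) - y (p i))"] by simp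
  qed
qed

lemma abs_cont_on_interval_subset:
  assumes "abs_cont_on_interval a b y" "a \<le> a'" "b' \<le> b"
  shows "abs_cont_on_interval a' b' y"
proof (rule abs_cont_on_intervalI)
  fix \<epsilon> :: real assume \<epsilon>: "\<epsilon> > 0"
  obtain \<delta> where "\<delta> > 0" and *: "\<forall>(n::nat) p q. (\<forall>i<n. a \<le> p i \<and> p i \<le> q i \<and> q i \<le> b) \<longrightarrow>
        disjoint_family_on (\<lambda>i. {p i<..<q i}) {..<n} \<longrightarrow>
        (\<Sum>i<n. q i - p i) < \<delta> \<longrightarrow> (\<Sum>i<n. cmod (y (q i) - y (p i))) < \<epsilon>"
    using assms(1)[unfolded abs_cont_on_interval_def, THEN spec, THEN mp, OF \<epsilon>] by blast
  note \<delta> = *[rule_format]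
  show "\<exists>\<delta>>0. \<forall>(n::nat) p q. (\<forall>i<n. a' \<le> p i \<and> p i \<le> q i \<and> q i \<le> b') \<longrightarrow>
        disjoint_family_on (\<lambda>i. {p i<..<q i}) {..<n} \<longrightarrow>
        (\<Sum>i<n. q i - p i) < \<delta> \<longrightarrow> (\<Sum>i<n. cmod (y (q i) - y (p i))) < \<epsilon>"
  proof (intro exI[of _ \<delta>] conjI allI impI \<open>\<delta> > 0\<close>)
    fix n :: nat and p q
    assume pq: "\<forall>i<n. a' \<le> p i \<and> p i \<le> q i \<and> q i \<le> b'"
      and *: "disjoint_family_on (\<lambda>i. {p i<..<q i}) {..<n}" "(\<Sum>i<n. q i - p i) < \<delta>"
    have "a \<le> p i \<and> p i \<le> q i \<and> q i \<le> b" if "i < n" for i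
      using pq[rule_format, OF that] assms(2,3) by linarith
    from \<delta>[OF this *] show "(\<Sum>i<n. cmod (y (q i) - y (p i))) < \<epsilon>" .
  qed
qed

text \<open>The supremum of these sums over families in \<open>[a, x]\<close> is the positive variation of \<open>F\<close> up to \<open>x\<close>.\<close>

definition increment_sums :: "(real \<Rightarrow> real) \<Rightarrow> real \<Rightarrow> real \<Rightarrow> real set" where
  "increment_sums F a b = {\<Sum>i\<in>I. F (q i) - F (p i) | (I::nat set) p q. finite I \<and>
     (\<forall>i\<in>I. a \<le> p i \<and> p i \<le> q i \<and> q i \<le> b) \<and> disjoint_family_on (\<lambda>i. {p i<..<q i}) I}"

lemma increment_sumsI:
  assumes "finite (I::nat set)" "\<And>i. i \<in> I \<Longrightarrow> a \<le> p i \<and> p i \<le> q i \<and> q i \<le> b"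
    "disjoint_family_on (\<lambda>i. {p i<..<q i}) I"
  shows "(\<Sum>i\<in>I. F (q i) - F (p i)) \<in> increment_sums F a b"
  unfolding increment_sums_def using assms by blast

lemma increment_sumsE:
  assumes "v \<in> increment_sums F a b"
  obtains I p q where "finite (I::nat set)" "\<And>i. i \<in> I \<Longrightarrow> a \<le> p i \<and> p i \<le> q i \<and> q i \<le> b"
    "disjoint_family_on (\<lambda>i. {p i<..<q i}) I" "v = (\<Sum>i\<in>I. F (q i) - F (p i))"
  using assms unfolding increment_sums_def by blast

lemma zero_in_increment_sums: "0 \<in> increment_sums F a b"
  using increment_sumsI[of "{}" a "\<lambda>_. 0" "\<lambda>_. 0" b F] by (simp add: disjoint_family_on_def)

text \<open>Cut every interval of the family at \<open>c\<close>; intervals on one side of \<open>c\<close> leave a degenerate interval on the other.\<close>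

lemma increment_sums_split:
  assumes "v \<in> increment_sums F a b" "a \<le> c" "c \<le> b"
  shows "\<exists>v1\<in>increment_sums F a c. \<exists>v2\<in>increment_sums F c b. v = v1 + v2"
proof -
  obtain I p q where I: "finite (I::nat set)" "\<And>i. i \<in> I \<Longrightarrow> a \<le> p i \<and> p i \<le> q i \<and> q i \<le> b"
    "disjoint_family_on (\<lambda>i. {p i<..<q i}) I" "v = (\<Sum>i\<in>I. F (q i) - F (p i))"
    using increment_sumsE[OF assms(1)] by blast
  have 1: "(\<Sum>i\<in>I. F (min (q i) c) - F (min (p i) c)) \<in> increment_sums F a c"
  proof (rule increment_sumsI)
    show "disjoint_family_on (\<lambda>i. {min (p i) c<..<min (q i) c}) I"
      using I(3) unfolding disjoint_family_on_def by (fastforce simp: set_eq_iff)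
  qed (use I assms in \<open>auto simp: min_def, force+\<close>)
  have 2: "(\<Sum>i\<in>I. F (max (q i) c) - F (max (p i) c)) \<in> increment_sums F c b"
  proof (rule increment_sumsI)
    show "disjoint_family_on (\<lambda>i. {max (p i) c<..<max (q i) c}) I"
      using I(3) unfolding disjoint_family_on_def by (fastforce simp: set_eq_iff)
  qed (use I assms in \<open>auto simp: max_def, force+\<close>)
  have "v = (\<Sum>i\<in>I. (F (min (q i) c) - F (min (p i) c)) + (F (max (q i) c) - F (max (p i) c)))"
    unfolding I(4) by (rule sum.cong) (auto simp: min_def max_def)
  then have "v = (\<Sum>i\<in>I. F (min (q i) c) - F (min (p i) c)) + (\<Sum>i\<in>I. F (max (q i) c) - F (max (p i) c))"
    by (simp only: sum.distrib)
  then show ?thesis using 1 2 by blast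
qed

lemma sum_lengths_disjoint_intervals:
  fixes p q :: "'i \<Rightarrow> real"
  assumes fin: "finite I" and pq: "\<And>i. i \<in> I \<Longrightarrow> a \<le> p i \<and> p i \<le> q i \<and> q i \<le> b"
    and dis: "disjoint_family_on (\<lambda>i. {p i<..<q i}) I" and ab: "a \<le> b"
  shows "(\<Sum>i\<in>I. q i - p i) \<le> b - a"
proof -
  have "(\<Sum>i\<in>I. q i - p i) = (\<Sum>i\<in>I. measure lborel {p i<..<q i})"
    using pq by (intro sum.cong) auto
  also have "\<dots> = measure lborel (\<Union>i\<in>I. {p i<..<q i})"
    using fin dis pq by (intro measure_finite_Union[symmetric]) auto
  also have "\<dots> \<le> measure lborel {a..b}"
    using pq fin by (intro measure_mono_fmeasurable fmeasurable_compact) fastforce+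
  finally show ?thesis using ab by simp
qed

text \<open>Absolute continuity bounds the sums by \<open>1\<close> on intervals shorter than \<open>\<delta>\<close>, and finitely many such intervals
cover \<open>[a, b]\<close>.\<close>

lemma bdd_above_increment_sums:
  assumes ac: "abs_cont_on_interval a b (\<lambda>x. complex_of_real (F x))" and ab: "a \<le> b"
  shows "bdd_above (increment_sums F a b)"
proof -
  obtain \<delta> where "\<delta> > 0" and *: "\<forall>(I::nat set) p q. finite I \<longrightarrow>
     (\<forall>i\<in>I. a \<le> p i \<and> p i \<le> q i \<and> q i \<le> b) \<longrightarrow>
     disjoint_family_on (\<lambda>i. {p i<..<q i}) I \<longrightarrow> (\<Sum>i\<in>I. q i - p i) < \<delta> \<longrightarrow>
     (\<Sum>i\<in>I. cmod (complex_of_real (F (q i)) - complex_of_real (F (p i)))) < 1"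
    using abs_cont_on_interval_finite[OF ac zero_less_one] by blast
  note \<delta> = *[rule_format]
  have short: "v \<le> 1" if v: "v \<in> increment_sums F c e" and ce: "a \<le> c" "c \<le> e" "e \<le> b" "e - c < \<delta>" for v c e
  proof -
    obtain I p q where I: "finite (I::nat set)" "\<And>i. i \<in> I \<Longrightarrow> c \<le> p i \<and> p i \<le> q i \<and> q i \<le> e"
      "disjoint_family_on (\<lambda>i. {p i<..<q i}) I" "v = (\<Sum>i\<in>I. F (q i) - F (p i))"
      using increment_sumsE[OF v] by blast
    have "(\<Sum>i\<in>I. cmod (complex_of_real (F (q i)) - complex_of_real (F (p i)))) < 1"
    proof (rule \<delta>)
      show "a \<le> p i \<and> p i \<le> q i \<and> q i \<le> b" if "i \<in> I" for i using I(2)[OF that] ce by linarith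
      show "(\<Sum>i\<in>I. q i - p i) < \<delta>"
        using sum_lengths_disjoint_intervals[OF I(1,2,3) ce(2)] ce by linarith
    qed (use I in auto)
    moreover have "v \<le> (\<Sum>i\<in>I. cmod (complex_of_real (F (q i)) - complex_of_real (F (p i))))"
      unfolding I(4) by (rule sum_mono) (metis abs_ge_self norm_of_real of_real_diff)
    ultimately show ?thesis by linarith
  qed
  have "bdd_above (increment_sums F a (min b (a + real k * (\<delta>/2))))" for k
  proof (induction k)
    case 0
    have "v \<le> 1" if "v \<in> increment_sums F a (min b (a + real 0 * (\<delta>/2)))" for v
      by (rule short[OF that]) (use ab \<open>\<delta> > 0\<close> in auto)
    then show ?case by (rule bdd_aboveI)
  next
    case (Suc k)
    let ?c = "min b (a + real k * (\<delta>/2))" and ?e = "min b (a + real (Suc k) * (\<delta>/2))"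
    from Suc obtain C where C: "\<And>v. v \<in> increment_sums F a ?c \<Longrightarrow> v \<le> C" by (auto simp: bdd_above_def)
    have e: "?c \<le> ?e" "?e - ?c < \<delta>" using \<open>\<delta> > 0\<close> by (auto simp: min_def field_simps)
    have ac: "a \<le> ?c" using ab \<open>\<delta> > 0\<close> by (auto simp: min_def)
    have "v \<le> C + 1" if v: "v \<in> increment_sums F a ?e" for v
    proof -
      obtain v1 v2 where "v1 \<in> increment_sums F a ?c" "v2 \<in> increment_sums F ?c ?e" "v = v1 + v2"
        using increment_sums_split[OF v ac e(1)] by auto
      then show ?thesis using C short[of v2 ?c ?e] ac e by fastforce
    qed
    then show ?case by (rule bdd_aboveI)
  qed
  moreover obtain k where "real k * (\<delta>/2) > b - a"
    using reals_Archimedean3[of "\<delta>/2"] \<open>\<delta> > 0\<close> by (metis half_gt_zero)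
  ultimately show ?thesis
    by (metis add.commute less_diff_eq less_eq_real_def min.absorb1 diff_less_eq)
qed

text \<open>The Jordan decomposition inside the class of absolutely continuous functions: both \<open>P\<close> and \<open>P - F\<close> are
nondecreasing. The increments of \<open>P\<close> over disjoint intervals are nearly attained by sums over subfamilies of these
intervals, whose total length is no larger, so \<open>P\<close> inherits the modulus of absolute continuity of \<open>F\<close>.\<close>

lemma positive_variation:
  fixes F :: "real \<Rightarrow> real"
  assumes ac: "abs_cont_on_interval a b (\<lambda>x. complex_of_real (F x))" and ab: "a \<le> b"
  obtains P where
    "\<And>x y. a \<le> x \<Longrightarrow> x \<le> y \<Longrightarrow> y \<le> b \<Longrightarrow> P x \<le> P y"
    "\<And>x y. a \<le> x \<Longrightarrow> x \<le> y \<Longrightarrow> y \<le> b \<Longrightarrow> F y - F x \<le> P y - P x"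
    "abs_cont_on_interval a b (\<lambda>x. complex_of_real (P x))"
proof
  define P where "P x = Sup (increment_sums F a x)" for x
  have sub: "increment_sums F c e \<subseteq> increment_sums F c' e'" if "c' \<le> c" "e \<le> e'" for c e c' e'
    using that unfolding increment_sums_def by (fastforce intro: order_trans)
  have bdd: "bdd_above (increment_sums F c e)" if "a \<le> c" "e \<le> b" for c e
    by (rule bdd_above_mono[OF bdd_above_increment_sums[OF ac ab] sub[OF that]])
  have ne: "increment_sums F c e \<noteq> {}" for c e using zero_in_increment_sums by blast
  show "P x \<le> P y" if "a \<le> x" "x \<le> y" "y \<le> b" for x y
    unfolding P_def using that by (intro cSup_subset_mono ne bdd sub) auto
  show "F y - F x \<le> P y - P x" if xy: "a \<le> x" "x \<le> y" "y \<le> b" for x y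
  proof -
    have "v \<le> P y - (F y - F x)" if v: "v \<in> increment_sums F a x" for v
    proof -
      obtain I p q where I: "finite (I::nat set)" "\<And>i. i \<in> I \<Longrightarrow> a \<le> p i \<and> p i \<le> q i \<and> q i \<le> x"
        "disjoint_family_on (\<lambda>i. {p i<..<q i}) I" "v = (\<Sum>i\<in>I. F (q i) - F (p i))"
        using increment_sumsE[OF v] by blast
      obtain j where j: "j \<notin> I" using ex_new_if_finite[OF infinite_UNIV_nat I(1)] by blast
      have "(\<Sum>i\<in>insert j I. F ((q(j:=y)) i) - F ((p(j:=x)) i)) \<in> increment_sums F a y"
      proof (rule increment_sumsI)
        show "disjoint_family_on (\<lambda>i. {(p(j := x)) i<..<(q(j := y)) i}) (insert j I)"
          unfolding disjoint_family_on_insert[OF j]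
        proof
          show "{(p(j := x)) j<..<(q(j := y)) j} \<inter> (\<Union>i\<in>I. {(p(j := x)) i<..<(q(j := y)) i}) = {}"
          proof -
            have "i \<noteq> j" "q i \<le> x" if "i \<in> I" for i using I(2)[OF that] j that by auto
            then show ?thesis by fastforce
          qed
          show "disjoint_family_on (\<lambda>i. {(p(j := x)) i<..<(q(j := y)) i}) I"
            using I(3) j unfolding disjoint_family_on_def by (metis fun_upd_apply)
        qed
      next
        fix i assume "i \<in> insert j I"
        then show "a \<le> (p(j := x)) i \<and> (p(j := x)) i \<le> (q(j := y)) i \<and> (q(j := y)) i \<le> y"
          using I(2)[of i] xy by auto
      qed (use I in auto)
      also have "(\<Sum>i\<in>insert j I. F ((q(j:=y)) i) - F ((p(j:=x)) i)) = (F y - F x) + v"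
        unfolding I(4) using I(1) j by (simp, intro sum.cong) auto
      finally show ?thesis unfolding P_def using cSup_upper[OF _ bdd] xy by force
    qed
    then have "P x \<le> P y - (F y - F x)" unfolding P_def[of x] by (intro cSup_least ne)
    then show ?thesis by simp
  qed
  have le: "P y - P x \<le> Sup (increment_sums F x y)" if xy: "a \<le> x" "x \<le> y" "y \<le> b" for x y
  proof -
    have "v \<le> P x + Sup (increment_sums F x y)" if v: "v \<in> increment_sums F a y" for v
    proof -
      obtain v1 v2 where "v1 \<in> increment_sums F a x" "v2 \<in> increment_sums F x y" "v = v1 + v2"
        using increment_sums_split[OF v xy(1,2)] by auto
      then show ?thesis unfolding P_def
        using cSup_upper[OF _ bdd[of a x]] cSup_upper[OF _ bdd[of x y]] xy by (simp add: add_mono)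
    qed
    then have "P y \<le> P x + Sup (increment_sums F x y)" unfolding P_def[of y] by (intro cSup_least ne)
    then show ?thesis by simp
  qed
  show "abs_cont_on_interval a b (\<lambda>x. complex_of_real (P x))"
  proof (rule abs_cont_on_intervalI)
    fix \<epsilon> :: real assume "\<epsilon> > 0"
    then have e2: "\<epsilon>/2 > 0" by simp
    obtain \<delta> where "\<delta> > 0" and *: "\<forall>(I::(nat\<times>nat) set) p q. finite I \<longrightarrow>
     (\<forall>i\<in>I. a \<le> p i \<and> p i \<le> q i \<and> q i \<le> b) \<longrightarrow>
     disjoint_family_on (\<lambda>i. {p i<..<q i}) I \<longrightarrow> (\<Sum>i\<in>I. q i - p i) < \<delta> \<longrightarrow>
     (\<Sum>i\<in>I. cmod (complex_of_real (F (q i)) - complex_of_real (F (p i)))) < \<epsilon>/2"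
    using abs_cont_on_interval_finite[OF ac e2] by blast
  note \<delta> = *[rule_format]
    have "(\<Sum>i<n. cmod (complex_of_real (P (q i)) - complex_of_real (P (p i)))) < \<epsilon>"
      if pq: "\<forall>i<n. a \<le> p i \<and> p i \<le> q i \<and> q i \<le> b"
        and dis: "disjoint_family_on (\<lambda>i. {p i<..<q i}) {..<n}"
        and len: "(\<Sum>i<n. q i - p i) < \<delta>" for n :: nat and p q
    proof -
      define \<eta> where "\<eta> = \<epsilon> / (2 * (real n + 1))"
      have "\<eta> > 0" using \<open>\<epsilon> > 0\<close> by (simp add: \<eta>_def)
      have "\<exists>v\<in>increment_sums F (p i) (q i). Sup (increment_sums F (p i) (q i)) - \<eta> < v" for i
        using less_cSup_iff[OF ne bdd] \<open>\<eta> > 0\<close> less_cSupD[OF ne, of "Sup (increment_sums F (p i) (q i)) - \<eta>" "p i" "q i"]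
        by auto
      then obtain v where v: "\<And>i. v i \<in> increment_sums F (p i) (q i)"
        "\<And>i. Sup (increment_sums F (p i) (q i)) - \<eta> < v i" by metis
      have "\<exists>t. finite (fst t :: nat set) \<and> (\<forall>j\<in>fst t. p i \<le> fst (snd t) j \<and> fst (snd t) j \<le> snd (snd t) j \<and> snd (snd t) j \<le> q i) \<and>
        disjoint_family_on (\<lambda>j. {fst (snd t) j<..<snd (snd t) j}) (fst t) \<and>
        v i = (\<Sum>j\<in>fst t. F (snd (snd t) j) - F (fst (snd t) j))" (is "\<exists>t. ?X i t") for i
      proof (rule increment_sumsE[OF v(1)[of i]])
        fix I p' q' assume "finite (I :: nat set)" "\<And>j. j \<in> I \<Longrightarrow> p i \<le> p' j \<and> p' j \<le> q' j \<and> q' j \<le> q i"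
          "disjoint_family_on (\<lambda>j. {p' j<..<q' j}) I" "v i = (\<Sum>j\<in>I. F (q' j) - F (p' j))"
        then show "\<exists>t. ?X i t" by (intro exI[of _ "(I, p', q')"]) simp
      qed
      then have "\<exists>t. \<forall>i. ?X i (t i)" by (intro choice) blast
      then obtain t where t: "\<And>i. ?X i (t i)" by blast
      define I p' q' where "I i = fst (t i)" and "p' i = fst (snd (t i))" and "q' i = snd (snd (t i))" for i
      have I: "\<And>i. finite (I i)"
        "\<And>i j. j \<in> I i \<Longrightarrow> p i \<le> p' i j \<and> p' i j \<le> q' i j \<and> q' i j \<le> q i"
        "\<And>i. disjoint_family_on (\<lambda>j. {p' i j<..<q' i j}) (I i)"
        "\<And>i. v i = (\<Sum>j\<in>I i. F (q' i j) - F (p' i j))"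
        using t unfolding I_def p'_def q'_def by blast+
      \<comment> \<open>all subfamilies taken together form one disjoint family of small total length\<close>
      define S where "S = Sigma {..<n} I"
      have "(\<Sum>ij\<in>S. cmod (complex_of_real (F (case_prod q' ij)) - complex_of_real (F (case_prod p' ij)))) < \<epsilon>/2"
      proof (rule \<delta>)
        show "finite S" unfolding S_def using I(1) by auto
        show "a \<le> case_prod p' i \<and> case_prod p' i \<le> case_prod q' i \<and> case_prod q' i \<le> b" if "i \<in> S" for i
        proof -
          obtain k j where "i = (k,j)" by (metis surj_pair)
          then show ?thesis using that I(2)[of j k] pq[rule_format, of k] by (auto simp: S_def)
        qed
        show "disjoint_family_on (\<lambda>i. {case_prod p' i<..<case_prod q' i}) S"
          unfolding disjoint_family_on_def
        proof (intro ballI impI)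
          fix x y assume xy: "x \<in> S" "y \<in> S" "x \<noteq> y"
          obtain i j k l where ij: "x = (i,j)" "y = (k,l)" by (metis surj_pair)
          have in1: "i < n" "k < n" "j \<in> I i" "l \<in> I k" using xy ij by (auto simp: S_def)
          show "{case_prod p' x<..<case_prod q' x} \<inter> {case_prod p' y<..<case_prod q' y} = {}"
          proof (cases "i = k")
            case True
            then show ?thesis using I(3)[of i] in1 xy ij unfolding disjoint_family_on_def by auto
          next
            case False
            have "{p' i j<..<q' i j} \<subseteq> {p i<..<q i}" "{p' k l<..<q' k l} \<subseteq> {p k<..<q k}"
              using I(2)[OF in1(3)] I(2)[OF in1(4)] by (auto)
            then show ?thesis using dis False in1 ij unfolding disjoint_family_on_def by fastforce
          qed
        qed
        have "(\<Sum>x\<in>S. case_prod q' x - case_prod p' x) = (\<Sum>i<n. \<Sum>j\<in>I i. q' i j - p' i j)"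
          unfolding S_def using I(1) by (subst sum.Sigma) (auto intro!: sum.cong)
        also have "\<dots> \<le> (\<Sum>i<n. q i - p i)"
        proof (rule sum_mono)
          fix i assume "i \<in> {..<n}"
          then show "(\<Sum>j\<in>I i. q' i j - p' i j) \<le> q i - p i"
            using pq by (intro sum_lengths_disjoint_intervals I) auto
        qed
        finally show "(\<Sum>x\<in>S. case_prod q' x - case_prod p' x) < \<delta>" using len by linarith
      qed
      moreover have "(\<Sum>i<n. v i) = (\<Sum>ij\<in>S. F (case_prod q' ij) - F (case_prod p' ij))"
        unfolding S_def I(4) using I(1) by (subst sum.Sigma) (auto intro!: sum.cong)
      moreover have "\<dots> \<le> (\<Sum>ij\<in>S. cmod (complex_of_real (F (case_prod q' ij)) - complex_of_real (F (case_prod p' ij))))"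
        by (rule sum_mono) (metis abs_ge_self norm_of_real of_real_diff)
      ultimately have vs: "(\<Sum>i<n. v i) < \<epsilon>/2" by linarith
      have "(\<Sum>i<n. cmod (complex_of_real (P (q i)) - complex_of_real (P (p i)))) \<le> (\<Sum>i<n. v i + \<eta>)"
      proof (rule sum_mono)
        fix i assume "i \<in> {..<n}"
        then have i: "a \<le> p i" "p i \<le> q i" "q i \<le> b" using pq by auto
        have "P (p i) \<le> P (q i)" unfolding P_def using i by (intro cSup_subset_mono ne bdd sub) auto
        then show "cmod (complex_of_real (P (q i)) - complex_of_real (P (p i))) \<le> v i + \<eta>"
          using le[OF i] v(2)[of i] by (simp flip: of_real_diff)
      qed
      also have "\<dots> = (\<Sum>i<n. v i) + real n * \<eta>" by (simp add: sum.distrib)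
      also have "real n * \<eta> \<le> \<epsilon>/2" using \<open>\<epsilon> > 0\<close> by (simp add: \<eta>_def field_simps)
      finally show ?thesis using vs by linarith
    qed
    then show "\<exists>\<delta>>0. \<forall>(n::nat) p q. (\<forall>i<n. a \<le> p i \<and> p i \<le> q i \<and> q i \<le> b) \<longrightarrow>
        disjoint_family_on (\<lambda>i. {p i<..<q i}) {..<n} \<longrightarrow>
        (\<Sum>i<n. q i - p i) < \<delta> \<longrightarrow> (\<Sum>i<n. cmod (complex_of_real (P (q i)) - complex_of_real (P (p i)))) < \<epsilon>"
      using \<open>\<delta> > 0\<close> by blast
  qed
qed

lemma abs_cont_on_interval_continuous:
  assumes "abs_cont_on_interval a b y"
  shows "continuous_on {a..b} y"
proof (clarsimp simp: continuous_on_iff)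
  fix x e :: real assume x: "a \<le> x" "x \<le> b" and e: "e > 0"
  obtain \<delta> where "\<delta> > 0" and *: "\<forall>(n::nat) p q. (\<forall>i<n. a \<le> p i \<and> p i \<le> q i \<and> q i \<le> b) \<longrightarrow>
        disjoint_family_on (\<lambda>i. {p i<..<q i}) {..<n} \<longrightarrow>
        (\<Sum>i<n. q i - p i) < \<delta> \<longrightarrow> (\<Sum>i<n. cmod (y (q i) - y (p i))) < e"
    using assms[unfolded abs_cont_on_interval_def, THEN spec, THEN mp, OF e] by blast
  have "dist (y x') (y x) < e" if x': "x' \<in> {a..b}" "dist x' x < \<delta>" for x'
    using *[rule_format, of "Suc 0" "\<lambda>_. min x x'" "\<lambda>_. max x x'"] x x'
    by (cases "x \<le> x'") (auto simp: disjoint_family_on_def dist_norm norm_minus_commute)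
  then show "\<exists>d>0. \<forall>x'\<in>{a..b}. dist x' x < d \<longrightarrow> dist (y x') (y x) < e"
    using \<open>\<delta> > 0\<close> by blast
qed

text \<open>A Lebesgue null compact set is covered by finitely many grid intervals lying in an open set of small measure; the
increments of \<open>P\<close> over them add up to a small number. The function \<open>Q\<close> extends \<open>P\<close> by constants, because a
Stieltjes measure needs a function on the whole line.\<close>

lemma emeasure_interval_measure_compact_null:
  fixes P :: "real \<Rightarrow> real"
  assumes ab: "a \<le> b" and mono: "\<And>x y. a \<le> x \<Longrightarrow> x \<le> y \<Longrightarrow> y \<le> b \<Longrightarrow> P x \<le> P y"
    and ac: "abs_cont_on_interval a b (\<lambda>x. complex_of_real (P x))"
    and Q: "Q = (\<lambda>x. P (max a (min b x)))"
    and K: "compact K" and null: "emeasure lborel K = 0"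
  shows "emeasure (interval_measure Q) K = 0"
proof -
  have contP: "continuous_on {a..b} P"
    using continuous_on_Re[OF abs_cont_on_interval_continuous[OF ac]] by simp
  have contQ: "continuous_on UNIV Q"
    unfolding Q by (rule continuous_on_compose2[OF contP]) (use ab in \<open>auto intro!: continuous_intros\<close>)
  have rc: "\<And>x. continuous (at_right x) Q"
    using contQ by (simp add: continuous_on_eq_continuous_at continuous_at_imp_continuous_within)
  have mQ: "\<And>x y. x \<le> y \<Longrightarrow> Q x \<le> Q y" unfolding Q using ab by (intro mono) auto
  have "emeasure (interval_measure Q) K \<le> ennreal \<epsilon>" if \<epsilon>: "\<epsilon> > 0" for \<epsilon>
  proof -
    obtain \<delta> where "\<delta> > 0" and *: "\<forall>(I::int set) p q. finite I \<longrightarrow>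
     (\<forall>i\<in>I. a \<le> p i \<and> p i \<le> q i \<and> q i \<le> b) \<longrightarrow>
     disjoint_family_on (\<lambda>i. {p i<..<q i}) I \<longrightarrow> (\<Sum>i\<in>I. q i - p i) < \<delta> \<longrightarrow>
     (\<Sum>i\<in>I. cmod (complex_of_real (P (q i)) - complex_of_real (P (p i)))) < \<epsilon>"
      using abs_cont_on_interval_finite[OF ac \<epsilon>] by blast
    obtain U where U: "open U" "K \<subseteq> U" "emeasure lborel (U - K) < \<delta>"
      using outer_regular_lborel[OF borel_compact[OF K] \<open>\<delta> > 0\<close>] by blast
    have "emeasure lborel U \<le> emeasure lborel (U - K) + emeasure lborel K"
    proof -
      have "U \<in> sets lborel" "K \<in> sets lborel" using U K by (auto simp: borel_compact)
      then have "emeasure lborel U \<le> emeasure lborel ((U - K) \<union> K)" by (intro emeasure_mono) auto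
      also have "\<dots> \<le> emeasure lborel (U - K) + emeasure lborel K"
        using \<open>U \<in> sets lborel\<close> \<open>K \<in> sets lborel\<close> by (intro emeasure_subadditive) auto
      finally show ?thesis .
    qed
    then have U\<delta>: "emeasure lborel U < \<delta>" using U null by simp
    obtain e where e: "e > 0" "(\<Union>x\<in>K. ball x e) \<subseteq> U"
      using compact_subset_open_imp_ball_epsilon_subset[OF K U(1,2)] by blast
    define w where "w = e/2"
    have w: "w > 0" using e by (simp add: w_def)
    let ?C = "\<lambda>k::int. {real_of_int k * w<..(real_of_int k + 1) * w}"
    define I where "I = {k. ?C k \<inter> K \<noteq> {}}"
    have Ix: "x \<in> ?C (\<lceil>x / w\<rceil> - 1)" for x
    proof -
      have "real_of_int \<lceil>x / w\<rceil> - 1 < x / w" "x / w \<le> real_of_int \<lceil>x / w\<rceil>" by linarith+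
      then have "(real_of_int \<lceil>x / w\<rceil> - 1) * w < x" "x \<le> real_of_int \<lceil>x / w\<rceil> * w"
        using w by (simp only: pos_less_divide_eq, simp only: pos_divide_le_eq)
      then show ?thesis by simp
    qed
    obtain B where B: "\<And>x. x \<in> K \<Longrightarrow> \<bar>x\<bar> \<le> B" using compact_imp_bounded[OF K] by (auto simp: bounded_iff)
    have "I \<subseteq> {\<lfloor>-B/w\<rfloor> - 1..\<lceil>B/w\<rceil>}"
    proof
      fix k assume "k \<in> I"
      then obtain x where x: "x \<in> K" "real_of_int k * w < x" "x \<le> (real_of_int k + 1) * w" by (auto simp: I_def)
      have "real_of_int k < B / w" "-B / w \<le> real_of_int k + 1"
        using x B[OF x(1)] w by (auto simp: field_simps)
      then show "k \<in> {\<lfloor>-B/w\<rfloor> - 1..\<lceil>B/w\<rceil>}" by (auto; linarith)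
    qed
    then have fin: "finite I" using finite_subset by blast
    have KI: "K \<subseteq> (\<Union>k\<in>I. ?C k)" using Ix unfolding I_def by blast
    have IU: "(\<Union>k\<in>I. ?C k) \<subseteq> U"
    proof
      fix z assume "z \<in> (\<Union>k\<in>I. ?C k)"
      then obtain k where k: "k \<in> I" "z \<in> ?C k" by blast
      then obtain x where x: "x \<in> K" "x \<in> ?C k" unfolding I_def by blast
      have "dist x z < e" using k x e unfolding dist_real_def w_def by (auto simp: field_simps abs_if)
      then have "z \<in> (\<Union>x\<in>K. ball x e)" using x by auto
      then show "z \<in> U" using e by blast
    qed
    have disj: "disjoint_family_on ?C I"
      unfolding disjoint_family_on_def
    proof (intro ballI impI)
      fix i j :: int assume "i \<noteq> j"
      have False if "x \<in> ?C i" "x \<in> ?C j" "i < j" for x and i j :: int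
      proof -
        have "(real_of_int i + 1) * w \<le> real_of_int j * w" using \<open>i < j\<close> w by (intro mult_right_mono) auto
        then show False using that by auto
      qed
      from this[of _ i j] this[of _ j i] \<open>i \<noteq> j\<close> show "?C i \<inter> ?C j = {}" by (metis disjoint_iff linorder_neqE)
    qed
    define p q where "p k = max a (min b (real_of_int k * w))" and "q k = max a (min b ((real_of_int k + 1) * w))" for k
    have pq: "a \<le> p k" "p k \<le> q k" "q k \<le> b" "q k - p k \<le> w" for k
      using ab w unfolding p_def q_def by (auto simp: max_def min_def algebra_simps)
    have "(\<Sum>k\<in>I. ennreal w) = emeasure lborel (\<Union>k\<in>I. ?C k)"
      using fin disj w by (subst sum_emeasure[symmetric]) (auto simp: algebra_simps intro!: sum.cong)
    also have "\<dots> \<le> emeasure lborel U" using IU U by (intro emeasure_mono) auto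
    finally have "ennreal (\<Sum>k\<in>I. w) < \<delta>" using U\<delta> w by (simp add: sum_ennreal ennreal_mult'' ennreal_of_nat_eq_real_of_nat)
    then have "(\<Sum>k\<in>I. w) < \<delta>" by (simp add: ennreal_less_iff w less_imp_le)
    moreover have "(\<Sum>k\<in>I. q k - p k) \<le> (\<Sum>k\<in>I. w)" using pq by (intro sum_mono) auto
    ultimately have len: "(\<Sum>k\<in>I. q k - p k) < \<delta>" by linarith
    have sub: "{p k<..<q k} \<subseteq> ?C k" for k unfolding p_def q_def by (auto simp: max_def min_def split: if_splits)
    have dis: "disjoint_family_on (\<lambda>i. {p i<..<q i}) I"
      using disj sub unfolding disjoint_family_on_def by blast
    have small: "(\<Sum>k\<in>I. cmod (complex_of_real (P (q k)) - complex_of_real (P (p k)))) < \<epsilon>"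
      using *[rule_format, OF fin _ dis len] pq by blast
    have "emeasure (interval_measure Q) K \<le> emeasure (interval_measure Q) (\<Union>k\<in>I. ?C k)"
      using KI fin by (intro emeasure_mono) auto
    also have "\<dots> \<le> (\<Sum>k\<in>I. emeasure (interval_measure Q) (?C k))"
      by (intro emeasure_subadditive_finite fin) auto
    also have "\<dots> = (\<Sum>k\<in>I. ennreal (P (q k) - P (p k)))"
    proof (rule sum.cong)
      fix k assume "k \<in> I"
      show "emeasure (interval_measure Q) (?C k) = ennreal (P (q k) - P (p k))"
        using w by (subst emeasure_interval_measure_Ioc[OF _ mQ rc]) (auto simp: Q p_def q_def algebra_simps)
    qed simp
    also have "\<dots> = ennreal (\<Sum>k\<in>I. P (q k) - P (p k))"
      using pq mono by (intro sum_ennreal) auto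
    also have "\<dots> \<le> ennreal \<epsilon>"
    proof (rule ennreal_leI)
      have "(\<Sum>k\<in>I. P (q k) - P (p k)) \<le> (\<Sum>k\<in>I. cmod (complex_of_real (P (q k)) - complex_of_real (P (p k))))"
        by (rule sum_mono) (metis abs_ge_self norm_of_real of_real_diff)
      then show "(\<Sum>k\<in>I. P (q k) - P (p k)) \<le> \<epsilon>" using small by linarith
    qed
    finally show ?thesis .
  qed
  then have "emeasure (interval_measure Q) K \<le> 0 + ennreal \<epsilon>" if "\<epsilon> > 0" for \<epsilon> using that by simp
  then have "emeasure (interval_measure Q) K \<le> 0" by (rule ennreal_le_epsilon)
  then show ?thesis by simp
qed

text \<open>By inner regularity every null set is null for the Stieltjes measure of \<open>P\<close>, so the Radon-Nikodym theorem
provides a density, which is the derivative of \<open>P\<close>.\<close>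

lemma mono_abs_cont_primitive:
  fixes P :: "real \<Rightarrow> real"
  assumes ab: "a \<le> b" and mono: "\<And>x y. a \<le> x \<Longrightarrow> x \<le> y \<Longrightarrow> y \<le> b \<Longrightarrow> P x \<le> P y"
    and ac: "abs_cont_on_interval a b (\<lambda>x. complex_of_real (P x))"
  shows "\<exists>f. f absolutely_integrable_on {a..b} \<and> (\<forall>x\<in>{a..b}. (f has_integral (P x - P a)) {a..x})"
proof -
  define Q where "Q = (\<lambda>x. P (max a (min b x)))"
  have contP: "continuous_on {a..b} P"
    using continuous_on_Re[OF abs_cont_on_interval_continuous[OF ac]] by simp
  have contQ: "continuous_on UNIV Q"
    unfolding Q_def by (rule continuous_on_compose2[OF contP]) (use ab in \<open>auto intro!: continuous_intros\<close>)
  have rc: "\<And>x. continuous (at_right x) Q"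
    using contQ by (simp add: continuous_on_eq_continuous_at continuous_at_imp_continuous_within)
  have mQ: "\<And>x y. x \<le> y \<Longrightarrow> Q x \<le> Q y" unfolding Q_def using ab by (intro mono) auto
  let ?\<mu> = "interval_measure Q"
  have "emeasure ?\<mu> UNIV \<le> ennreal (P b - P a)"
  proof -
    have "(\<Union>i. {- real i<..real i}) = (UNIV :: real set)"
    proof (rule UNIV_eq_I[symmetric])
      fix x :: real
      obtain n where "\<bar>x\<bar> < real n" using reals_Archimedean2 by blast
      then show "x \<in> (\<Union>i. {- real i<..real i})" by (intro UN_I[of n]) auto
    qed
    then have "emeasure ?\<mu> UNIV = emeasure ?\<mu> (\<Union>i. {- real i<..real i})" by (rule arg_cong[OF sym])
    also have "\<dots> = (SUP n. emeasure ?\<mu> {- real n<..real n})"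
      by (rule SUP_emeasure_incseq[symmetric]) (auto simp: incseq_def)
    also have "\<dots> \<le> ennreal (P b - P a)"
    proof (rule SUP_least)
      fix n :: nat
      have "Q (real n) \<le> P b" "P a \<le> Q (- real n)" unfolding Q_def using ab by (auto intro!: mono)
      then show "emeasure ?\<mu> {- real n<..real n} \<le> ennreal (P b - P a)"
        by (subst emeasure_interval_measure_Ioc[OF _ mQ rc]) (auto intro!: ennreal_leI)
    qed
    finally show ?thesis .
  qed
  then have fin: "emeasure ?\<mu> (space ?\<mu>) \<noteq> \<infinity>" by (auto simp: top_unique)
  have acm: "absolutely_continuous lborel ?\<mu>"
    unfolding absolutely_continuous_def
  proof
    fix N :: "real set" assume N: "N \<in> null_sets lborel"
    then have Nb: "N \<in> sets borel" by (simp add: null_sets_def)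
    have "emeasure ?\<mu> N = (SUP K \<in> {K. K \<subseteq> N \<and> compact K}. emeasure ?\<mu> K)"
      by (rule inner_regular[OF _ fin Nb]) simp
    also have "\<dots> \<le> 0"
    proof (rule SUP_least)
      fix K assume "K \<in> {K. K \<subseteq> N \<and> compact K}"
      moreover then have "emeasure lborel K = 0"
        using N by (metis (mono_tags, lifting) emeasure_mono le_zero_eq mem_Collect_eq null_setsD1 null_setsD2)
      ultimately show "emeasure ?\<mu> K \<le> 0"
        using emeasure_interval_measure_compact_null[OF ab mono ac Q_def] by auto
    qed
    finally show "N \<in> null_sets ?\<mu>" using Nb by (auto simp: null_sets_def)
  qed
  then obtain f where f: "f \<in> borel_measurable lborel" "density lborel f = ?\<mu>"
    using sigma_finite_measure.Radon_Nikodym[OF sigma_finite_lborel acm] by auto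
  have fI: "(\<integral>\<^sup>+t. f t * indicator {a<..x} t \<partial>lborel) = ennreal (P x - P a)" if x: "x \<in> {a..b}" for x
  proof -
    have "(\<integral>\<^sup>+t. f t * indicator {a<..x} t \<partial>lborel) = emeasure ?\<mu> {a<..x}"
      using f by (subst f(2)[symmetric], subst emeasure_density) auto
    also have "\<dots> = ennreal (P x - P a)"
      using x by (subst emeasure_interval_measure_Ioc[OF _ mQ rc]) (auto simp: Q_def)
    finally show ?thesis .
  qed
  have AEfin: "AE t in lborel. f t * indicator {a<..b} t \<noteq> \<infinity>"
    using f(1) fI[of b] ab by (intro nn_integral_PInf_AE) auto
  define g where "g t = enn2real (f t)" for t
  have g0: "g t \<ge> 0" for t by (simp add: g_def)
  have gm[measurable]: "g \<in> borel_measurable borel" using f(1) unfolding g_def by simp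
  have gI: "(g has_integral (P x - P a)) {a..x}" if x: "x \<in> {a..b}" for x
  proof -
    have "(\<integral>\<^sup>+t. ennreal (indicator {a<..x} t *\<^sub>R g t) \<partial>lebesgue) = (\<integral>\<^sup>+t. ennreal (indicator {a<..x} t *\<^sub>R g t) \<partial>lborel)"
      by (rule nn_integral_completion)
    also have "\<dots> = (\<integral>\<^sup>+t. f t * indicator {a<..x} t \<partial>lborel)"
    proof (rule nn_integral_cong_AE)
      show "AE t in lborel. ennreal (indicator {a<..x} t *\<^sub>R g t) = f t * indicator {a<..x} t"
        using AEfin
      proof (rule eventually_mono)
        fix t assume "f t * indicator {a<..b} t \<noteq> \<infinity>"
        then show "ennreal (indicator {a<..x} t *\<^sub>R g t) = f t * indicator {a<..x} t"
          using x by (auto simp: g_def indicator_def less_top split: if_splits)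
      qed
    qed
    also have "\<dots> = ennreal (P x - P a)" by (rule fI[OF x])
    finally have "((\<lambda>t. indicator {a<..x} t *\<^sub>R g t) has_integral (P x - P a)) UNIV"
      using mono[of a x] x g0 by (subst has_integral_iff_nn_integral_lebesgue) (auto simp: indicator_def measurable_completion)
    then have "((\<lambda>t. if t \<in> {a<..x} then g t else 0) has_integral (P x - P a)) UNIV"
      by (rule has_integral_eq[rotated]) (auto simp: indicator_def)
    then have "(g has_integral (P x - P a)) {a<..x}" by (simp only: has_integral_restrict_UNIV)
    then show ?thesis
      by (rule has_integral_spike_set_eq[THEN iffD1, rotated 2]) (rule negligible_subset[of "{a}"], simp, fastforce)+
  qed
  have "g absolutely_integrable_on {a..b}"
    using gI[of b] ab g0 by (intro nonnegative_absolutely_integrable_1) auto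
  then show ?thesis using gI by blast
qed

text \<open>Apply the monotone case to the positive variation \<open>P\<close> and to \<open>P - F\<close>.\<close>

lemma abs_cont_primitive_real:
  fixes F :: "real \<Rightarrow> real"
  assumes ab: "a \<le> b" and ac: "abs_cont_on_interval a b (\<lambda>x. complex_of_real (F x))"
  shows "\<exists>f. f absolutely_integrable_on {a..b} \<and> (\<forall>x\<in>{a..b}. (f has_integral (F x - F a)) {a..x})"
proof -
  obtain P where P: "\<And>x y. a \<le> x \<Longrightarrow> x \<le> y \<Longrightarrow> y \<le> b \<Longrightarrow> P x \<le> P y"
    "\<And>x y. a \<le> x \<Longrightarrow> x \<le> y \<Longrightarrow> y \<le> b \<Longrightarrow> F y - F x \<le> P y - P x"
    "abs_cont_on_interval a b (\<lambda>x. complex_of_real (P x))"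
    using positive_variation[OF ac ab] by metis
  have acN: "abs_cont_on_interval a b (\<lambda>x. complex_of_real (P x - F x))"
  proof (rule abs_cont_on_intervalI)
    fix \<epsilon> :: real assume "\<epsilon> > 0"
    then have e2: "\<epsilon>/2 > 0" by simp
    obtain d1 where "d1 > 0" and d1: "\<forall>(n::nat) p q. (\<forall>i<n. a \<le> p i \<and> p i \<le> q i \<and> q i \<le> b) \<longrightarrow>
        disjoint_family_on (\<lambda>i. {p i<..<q i}) {..<n} \<longrightarrow> (\<Sum>i<n. q i - p i) < d1 \<longrightarrow>
        (\<Sum>i<n. cmod (complex_of_real (P (q i)) - complex_of_real (P (p i)))) < \<epsilon>/2"
      using P(3)[unfolded abs_cont_on_interval_def, THEN spec, THEN mp, OF e2] by blast
    obtain d2 where "d2 > 0" and d2: "\<forall>(n::nat) p q. (\<forall>i<n. a \<le> p i \<and> p i \<le> q i \<and> q i \<le> b) \<longrightarrow>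
        disjoint_family_on (\<lambda>i. {p i<..<q i}) {..<n} \<longrightarrow> (\<Sum>i<n. q i - p i) < d2 \<longrightarrow>
        (\<Sum>i<n. cmod (complex_of_real (F (q i)) - complex_of_real (F (p i)))) < \<epsilon>/2"
      using ac[unfolded abs_cont_on_interval_def, THEN spec, THEN mp, OF e2] by blast
    show "\<exists>\<delta>>0. \<forall>(n::nat) p q. (\<forall>i<n. a \<le> p i \<and> p i \<le> q i \<and> q i \<le> b) \<longrightarrow>
        disjoint_family_on (\<lambda>i. {p i<..<q i}) {..<n} \<longrightarrow> (\<Sum>i<n. q i - p i) < \<delta> \<longrightarrow>
        (\<Sum>i<n. cmod (complex_of_real (P (q i) - F (q i)) - complex_of_real (P (p i) - F (p i)))) < \<epsilon>"
    proof (intro exI[of _ "min d1 d2"] conjI allI impI)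
      fix n :: nat and p q
      assume h: "\<forall>i<n. a \<le> p i \<and> p i \<le> q i \<and> q i \<le> b" "disjoint_family_on (\<lambda>i. {p i<..<q i}) {..<n}"
         "(\<Sum>i<n. q i - p i) < min d1 d2"
      have "(\<Sum>i<n. cmod (complex_of_real (P (q i) - F (q i)) - complex_of_real (P (p i) - F (p i))))
        \<le> (\<Sum>i<n. cmod (complex_of_real (P (q i)) - complex_of_real (P (p i))) + cmod (complex_of_real (F (q i)) - complex_of_real (F (p i))))"
        by (rule sum_mono) (simp flip: of_real_diff)
      then show "(\<Sum>i<n. cmod (complex_of_real (P (q i) - F (q i)) - complex_of_real (P (p i) - F (p i)))) < \<epsilon>"
        using d1[rule_format, of n p q] d2[rule_format, of n p q] h by (simp add: sum.distrib)
    qed (use \<open>d1 > 0\<close> \<open>d2 > 0\<close> in auto)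
  qed
  obtain f where f: "f absolutely_integrable_on {a..b}" "\<And>x. x\<in>{a..b} \<Longrightarrow> (f has_integral (P x - P a)) {a..x}"
    using mono_abs_cont_primitive[OF ab P(1,3)] by blast
  have "\<And>x y. a \<le> x \<Longrightarrow> x \<le> y \<Longrightarrow> y \<le> b \<Longrightarrow> P x - F x \<le> P y - F y" using P(2) by fastforce
  from mono_abs_cont_primitive[OF ab this acN]
  obtain g where g: "g absolutely_integrable_on {a..b}" "\<And>x. x\<in>{a..b} \<Longrightarrow> (g has_integral ((P x - F x) - (P a - F a))) {a..x}"
    by auto
  have "((\<lambda>t. f t - g t) has_integral (F x - F a)) {a..x}" if "x \<in> {a..b}" for x
    using has_integral_diff[OF f(2)[OF that] g(2)[OF that]] by (simp add: algebra_simps)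
  moreover have "(\<lambda>t. f t - g t) absolutely_integrable_on {a..b}" using f(1) g(1) by (rule set_integral_diff(1))
  ultimately show ?thesis by blast
qed

lemma abs_cont_on_interval_Re_Im:
  assumes "abs_cont_on_interval a b y"
  shows "abs_cont_on_interval a b (\<lambda>x. complex_of_real (Re (y x)))" "abs_cont_on_interval a b (\<lambda>x. complex_of_real (Im (y x)))"
proof -
  have *: "abs_cont_on_interval a b (\<lambda>x. complex_of_real (R (y x)))" if R: "\<And>u v. \<bar>R u - R v\<bar> \<le> cmod (u - v)" for R :: "complex \<Rightarrow> real"
  proof (rule abs_cont_on_intervalI)
    fix \<epsilon> :: real assume e: "\<epsilon> > 0"
    obtain \<delta> where "\<delta> > 0" and *: "\<forall>(n::nat) p q. (\<forall>i<n. a \<le> p i \<and> p i \<le> q i \<and> q i \<le> b) \<longrightarrow>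
        disjoint_family_on (\<lambda>i. {p i<..<q i}) {..<n} \<longrightarrow>
        (\<Sum>i<n. q i - p i) < \<delta> \<longrightarrow> (\<Sum>i<n. cmod (y (q i) - y (p i))) < \<epsilon>"
      using assms[unfolded abs_cont_on_interval_def, THEN spec, THEN mp, OF e] by blast
    show "\<exists>\<delta>>0. \<forall>(n::nat) p q. (\<forall>i<n. a \<le> p i \<and> p i \<le> q i \<and> q i \<le> b) \<longrightarrow>
        disjoint_family_on (\<lambda>i. {p i<..<q i}) {..<n} \<longrightarrow>
        (\<Sum>i<n. q i - p i) < \<delta> \<longrightarrow> (\<Sum>i<n. cmod (complex_of_real (R (y (q i))) - complex_of_real (R (y (p i))))) < \<epsilon>"
    proof (intro exI[of _ \<delta>] conjI allI impI \<open>\<delta> > 0\<close>)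
      fix n :: nat and p q
      assume h: "\<forall>i<n. a \<le> p i \<and> p i \<le> q i \<and> q i \<le> b" "disjoint_family_on (\<lambda>i. {p i<..<q i}) {..<n}"
         "(\<Sum>i<n. q i - p i) < \<delta>"
      have "(\<Sum>i<n. cmod (complex_of_real (R (y (q i))) - complex_of_real (R (y (p i))))) \<le> (\<Sum>i<n. cmod (y (q i) - y (p i)))"
        by (rule sum_mono) (simp add: R flip: of_real_diff)
      then show "(\<Sum>i<n. cmod (complex_of_real (R (y (q i))) - complex_of_real (R (y (p i))))) < \<epsilon>"
        using *[rule_format, of n p q] h by force
    qed
  qed
  show "abs_cont_on_interval a b (\<lambda>x. complex_of_real (Re (y x)))"
    by (rule *) (metis abs_Re_le_cmod minus_complex.sel(1))
  show "abs_cont_on_interval a b (\<lambda>x. complex_of_real (Im (y x)))"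
    by (rule *) (metis abs_Im_le_cmod minus_complex.sel(2))
qed

lemma abs_cont_primitive:
  assumes ab: "a \<le> b" and ac: "abs_cont_on_interval a b y"
  shows "\<exists>v. v absolutely_integrable_on {a..b} \<and> (\<forall>x\<in>{a..b}. (v has_integral (y x - y a)) {a..x})"
proof -
  obtain f where f: "f absolutely_integrable_on {a..b}" "\<And>x. x\<in>{a..b} \<Longrightarrow> (f has_integral (Re (y x) - Re (y a))) {a..x}"
    using abs_cont_primitive_real[OF ab abs_cont_on_interval_Re_Im(1)[OF ac]] by blast
  obtain g where g: "g absolutely_integrable_on {a..b}" "\<And>x. x\<in>{a..b} \<Longrightarrow> (g has_integral (Im (y x) - Im (y a))) {a..x}"
    using abs_cont_primitive_real[OF ab abs_cont_on_interval_Re_Im(2)[OF ac]] by blast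
  define v where "v t = complex_of_real (f t) + \<i> * complex_of_real (g t)" for t
  have "(v has_integral (y x - y a)) {a..x}" if "x \<in> {a..b}" for x
  proof -
    have "(v has_integral (complex_of_real (Re (y x) - Re (y a)) + \<i> * complex_of_real (Im (y x) - Im (y a)))) {a..x}"
      unfolding v_def by (intro has_integral_add has_integral_mult_right has_integral_of_real f g that)
    also have "complex_of_real (Re (y x) - Re (y a)) + \<i> * complex_of_real (Im (y x) - Im (y a)) = y x - y a"
      by (simp add: complex_eq_iff)
    finally show ?thesis .
  qed
  moreover have "v absolutely_integrable_on {a..b}"
    unfolding v_def using f(1) g(1)
    by (intro set_integral_add(1) set_integrable_mult_right) (auto simp: set_integrable_def scaleR_conv_of_real simp flip: of_real_mult)
  ultimately show ?thesis by blast
qed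

text \<open>The one-sided differentiation theorem for integrals over cubes with a corner at \<open>x\<close>, applied to \<open>f\<close> and to its
reflection, gives both sides.\<close>

lemma lebesgue_differentiation_real:
  fixes f :: "real \<Rightarrow> 'b::euclidean_space"
  assumes f: "\<And>a b. f integrable_on {a..b}"
  obtains N where "negligible N"
    "\<And>x e. x \<notin> N \<Longrightarrow> 0 < e \<Longrightarrow> \<exists>d>0. \<forall>h. 0 < h \<and> h < d \<longrightarrow>
       norm (integral {x..x+h} f - h *\<^sub>R f x) < e * h \<and> norm (integral {x-h..x} f - h *\<^sub>R f x) < e * h"
proof -
  obtain N1 where N1: "negligible N1" "\<And>x e. x \<notin> N1 \<Longrightarrow> 0 < e \<Longrightarrow>
     \<exists>d>0. \<forall>h. 0 < h \<and> h < d \<longrightarrow> norm (integral (cbox x (x + h *\<^sub>R One)) f /\<^sub>R h ^ DIM(real) - f x) < e"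
    using integrable_ccontinuous_explicit[of f] f by (metis interval_cbox)
  have fm: "(\<lambda>x. f (- x)) integrable_on {a..b}" for a b
    using f[of "-b" "-a"] by (metis Henstock_Kurzweil_Integration.integrable_reflect_real minus_minus)
  obtain N2 where N2: "negligible N2" "\<And>x e. x \<notin> N2 \<Longrightarrow> 0 < e \<Longrightarrow>
     \<exists>d>0. \<forall>h. 0 < h \<and> h < d \<longrightarrow> norm (integral (cbox x (x + h *\<^sub>R One)) (\<lambda>x. f (- x)) /\<^sub>R h ^ DIM(real) - f (- x)) < e"
    using integrable_ccontinuous_explicit[of "\<lambda>x. f (- x)"] fm by (metis interval_cbox)
  have neg: "negligible (uminus ` N2)"
    using N2(1) by (intro negligible_differentiable_image_negligible) (auto intro!: derivative_intros simp: differentiable_on_def)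
  show ?thesis
  proof (rule that[of "N1 \<union> uminus ` N2"])
    show "negligible (N1 \<union> uminus ` N2)" using N1(1) neg by (rule negligible_Un)
    fix x e :: real assume x: "x \<notin> N1 \<union> uminus ` N2" and e: "0 < e"
    then have x1: "x \<notin> N1" and x2: "- x \<notin> N2" by (auto simp: image_iff)
    obtain d1 where d1: "d1 > 0" "\<And>h. 0 < h \<Longrightarrow> h < d1 \<Longrightarrow> norm (integral {x..x+h} f /\<^sub>R h - f x) < e"
      using N1(2)[OF x1 e] by auto
    obtain d2 where d2: "d2 > 0" "\<And>h. 0 < h \<Longrightarrow> h < d2 \<Longrightarrow> norm (integral {-x..-x+h} (\<lambda>x. f (-x)) /\<^sub>R h - f x) < e"
      using N2(2)[OF x2 e] by auto
    have scale: "norm (I - h *\<^sub>R v) < e * h" if "norm (I /\<^sub>R h - v) < e" "h > 0" for I v :: 'b and h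
    proof -
      have "I - h *\<^sub>R v = h *\<^sub>R (I /\<^sub>R h - v)" using that by (simp add: scaleR_diff_right)
      then have "norm (I - h *\<^sub>R v) = h * norm (I /\<^sub>R h - v)" using that by simp
      then show ?thesis using that by simp
    qed
    show "\<exists>d>0. \<forall>h. 0 < h \<and> h < d \<longrightarrow>
       norm (integral {x..x+h} f - h *\<^sub>R f x) < e * h \<and> norm (integral {x-h..x} f - h *\<^sub>R f x) < e * h"
    proof (intro exI[of _ "min d1 d2"] conjI allI impI)
      fix h assume h: "0 < h \<and> h < min d1 d2"
      show "norm (integral {x..x+h} f - h *\<^sub>R f x) < e * h" using d1(2)[of h] h by (intro scale) auto
      have "integral {-x..-x+h} (\<lambda>x. f (-x)) = integral {x-h..x} f"
        using Henstock_Kurzweil_Integration.integral_reflect_real[of x "x-h" f] by (simp add: algebra_simps)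
      then show "norm (integral {x-h..x} f - h *\<^sub>R f x) < e * h" using d2(2)[of h] h by (intro scale) auto
    qed (use d1 d2 in auto)
  qed
qed

text \<open>The end point \<open>0\<close> of the half-line is negligible, so it need not be considered.\<close>

lemma AE_half_lineI:
  assumes "negligible N" "\<And>x. 0 < x \<Longrightarrow> x \<notin> N \<Longrightarrow> P x"
  shows "AE x in half_line. P x"
proof -
  have "negligible (insert 0 N)" using assms by simp
  then have "AE x in lebesgue. x \<notin> insert 0 N" unfolding negligible_iff_null_sets by (rule AE_not_in)
  then have "AE x in lebesgue. x \<in> {0..} \<longrightarrow> P x"
    by (rule eventually_mono) (auto intro: assms(2) simp: less_le)
  then show ?thesis by (subst AE_restrict_space_iff) auto
qed

lemma AE_half_lineE:
  assumes "AE x in half_line. P x"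
  obtains N where "negligible N" "\<And>x. 0 \<le> x \<Longrightarrow> x \<notin> N \<Longrightarrow> P x"
proof -
  have "AE x in lebesgue. x \<in> {0..} \<longrightarrow> P x" using assms by (subst (asm) AE_restrict_space_iff) auto
  then obtain N where "N \<in> null_sets lebesgue" "{x \<in> space lebesgue. \<not> (x \<in> {0..} \<longrightarrow> P x)} \<subseteq> N"
    unfolding eventually_ae_filter by blast
  then show ?thesis using that[of N] unfolding negligible_iff_null_sets[symmetric] by auto
qed

lemma primitive_has_vector_derivative_AE:
  assumes v: "\<And>R. 0 \<le> R \<Longrightarrow> v integrable_on {0..R}"
    and y: "\<And>x. 0 \<le> x \<Longrightarrow> y x = c + integral {0..x} (v :: real \<Rightarrow> complex)"
  shows "AE x in half_line. (y has_vector_derivative v x) (at x)"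
proof -
  define f where "f = (\<lambda>x. if x \<in> {0..} then v x else 0)"
  have f: "f integrable_on {a..b}" for a b
  proof -
    have "(\<lambda>x. if x \<in> {0..} then v x else 0) integrable_on {- max \<bar>a\<bar> \<bar>b\<bar>..max \<bar>a\<bar> \<bar>b\<bar>}"
    proof (subst integrable_restrict_Int)
      have "{0..} \<inter> {- max \<bar>a\<bar> \<bar>b\<bar>..max \<bar>a\<bar> \<bar>b\<bar>} = {0..max \<bar>a\<bar> \<bar>b\<bar>}" by auto
      then show "v integrable_on {0..} \<inter> {- max \<bar>a\<bar> \<bar>b\<bar>..max \<bar>a\<bar> \<bar>b\<bar>}" using v[of "max \<bar>a\<bar> \<bar>b\<bar>"] by simp
    qed
    then have "f integrable_on {- max \<bar>a\<bar> \<bar>b\<bar>..max \<bar>a\<bar> \<bar>b\<bar>}" unfolding f_def .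
    then show ?thesis by (rule integrable_subinterval_real) auto
  qed
  obtain N where N: "negligible N"
    "\<And>x e. x \<notin> N \<Longrightarrow> 0 < e \<Longrightarrow> \<exists>d>0. \<forall>h. 0 < h \<and> h < d \<longrightarrow>
       norm (integral {x..x+h} f - h *\<^sub>R f x) < e * h \<and> norm (integral {x-h..x} f - h *\<^sub>R f x) < e * h"
    using lebesgue_differentiation_real[OF f] by blast
  have yd: "y q - y p = integral {p..q} f" if "0 \<le> p" "p \<le> q" for p q
  proof -
    have "integral {0..q} v = integral {0..p} v + integral {p..q} v"
      using that v by (intro Henstock_Kurzweil_Integration.integral_combine[symmetric]) auto
    moreover have "integral {p..q} v = integral {p..q} f"
      using that by (intro integral_cong) (auto simp: f_def)
    ultimately show ?thesis using y[of p] y[of q] that by simp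
  qed
  show ?thesis
  proof (rule AE_half_lineI[OF N(1)])
    fix x :: real assume x: "0 < x" "x \<notin> N"
    have fx: "f x = v x" using x by (simp add: f_def)
    show "(y has_vector_derivative v x) (at x)"
      unfolding has_vector_derivative_def has_derivative_at'
    proof (intro conjI allI impI bounded_linear_scaleR_left)
      fix e :: real assume "0 < e"
      then obtain d where d: "d > 0" "\<And>h. 0 < h \<Longrightarrow> h < d \<Longrightarrow>
         norm (integral {x..x+h} f - h *\<^sub>R f x) < e * h" "\<And>h. 0 < h \<Longrightarrow> h < d \<Longrightarrow> norm (integral {x-h..x} f - h *\<^sub>R f x) < e * h"
        using N(2)[OF x(2)] by metis
      show "\<exists>d>0. \<forall>x'. 0 < norm (x' - x) \<and> norm (x' - x) < d \<longrightarrow>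
           norm (y x' - y x - (x' - x) *\<^sub>R v x) / norm (x' - x) < e"
      proof (intro exI[of _ "min d x"] conjI allI impI)
        fix x' assume x': "0 < norm (x' - x) \<and> norm (x' - x) < min d x"
        show "norm (y x' - y x - (x' - x) *\<^sub>R v x) / norm (x' - x) < e"
        proof (cases "x' > x")
          case True
          then have "norm (y x' - y x - (x' - x) *\<^sub>R v x) < e * (x' - x)"
            using d(2)[of "x' - x"] x x' yd[of x x'] fx by simp
          then show ?thesis using True by (simp add: pos_divide_less_eq)
        next
          case False
          then have "x' < x" using x' by auto
          then have "norm (integral {x'..x} f - (x - x') *\<^sub>R f x) < e * (x - x')"
            using d(3)[of "x - x'"] x' by auto
          moreover have "y x' - y x - (x' - x) *\<^sub>R v x = - (integral {x'..x} f - (x - x') *\<^sub>R f x)"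
            using yd[of x' x] x x' \<open>x' < x\<close> fx by (simp add: algebra_simps)
          ultimately show ?thesis using \<open>x' < x\<close> by (simp add: pos_divide_less_eq norm_minus_commute)
        qed
      qed (use d x in auto)
    qed
  qed
qed

text \<open>The part of \<open>v\<close> above a high level has small integral. This yields absolute continuity of the integral: over sets
of small measure the truncated part is small trivially.\<close>

lemma absolutely_integrable_tail_small:
  fixes v :: "real \<Rightarrow> 'b::euclidean_space"
  assumes v: "v absolutely_integrable_on {a..b}" and "\<epsilon> > 0"
  shows "\<exists>n::nat. (\<lambda>x. max 0 (norm (v x) - real n)) integrable_on {a..b} \<and>
     integral {a..b} (\<lambda>x. max 0 (norm (v x) - real n)) < \<epsilon>"
proof -
  have nv: "(\<lambda>x. norm (v x)) absolutely_integrable_on {a..b}" using v by (rule set_integrable_norm)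
  have *: "(\<lambda>x. max 0 (norm (v x) - real n)) integrable_on {a..b}" for n
  proof -
    have "(\<lambda>x. norm (v x) - real n) absolutely_integrable_on {a..b}"
      using nv by (intro set_integral_diff(1)) (auto intro: absolutely_integrable_continuous_real)
    moreover have "(\<lambda>x::real. 0::real) absolutely_integrable_on {a..b}" by (auto intro: absolutely_integrable_continuous_real)
    ultimately have "(\<lambda>x. max 0 (norm (v x) - real n)) absolutely_integrable_on {a..b}"
      by (intro absolutely_integrable_max_1)
    then show ?thesis by (rule set_lebesgue_integral_eq_integral(1))
  qed
  have "(\<lambda>n. integral {a..b} (\<lambda>x. max 0 (norm (v x) - real n))) \<longlonglongrightarrow> integral {a..b} (\<lambda>x. 0::real)"
  proof (rule dominated_convergence(2))
    show "(\<lambda>x. norm (v x)) integrable_on {a..b}" using nv set_lebesgue_integral_eq_integral(1) by blast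
    show "(\<lambda>n. max 0 (norm (v x) - real n)) \<longlonglongrightarrow> 0" if "x \<in> {a..b}" for x
    proof (rule tendsto_eventually)
      obtain m where "norm (v x) < real m" using reals_Archimedean2 by blast
      then show "\<forall>\<^sub>F n in sequentially. max 0 (norm (v x) - real n) = 0"
        by (intro eventually_sequentiallyI[of m]) (auto simp: max_def)
    qed
  qed (use * in auto)
  then have "\<forall>\<^sub>F n in sequentially. integral {a..b} (\<lambda>x. max 0 (norm (v x) - real n)) < \<epsilon>"
    using \<open>\<epsilon> > 0\<close> by (intro order_tendstoD(2)) auto
  then show ?thesis using * by (meson eventually_False_sequentially eventually_mono not_eventuallyD)
qed

lemma primitive_abs_cont_on_interval:
  assumes v: "v absolutely_integrable_on {a..b}"
    and y: "\<And>p q. a \<le> p \<Longrightarrow> p \<le> q \<Longrightarrow> q \<le> b \<Longrightarrow> y q - y p = integral {p..q} (v :: real \<Rightarrow> complex)"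
  shows "abs_cont_on_interval a b y"
proof (rule abs_cont_on_intervalI)
  fix \<epsilon> :: real assume "\<epsilon> > 0"
  then have "\<epsilon>/2 > 0" by simp
  from absolutely_integrable_tail_small[OF v this] obtain N :: nat where
    gi: "(\<lambda>x. max 0 (norm (v x) - real N)) integrable_on {a..b}" and
    gl: "integral {a..b} (\<lambda>x. max 0 (norm (v x) - real N)) < \<epsilon>/2" by blast
  define g where "g x = max 0 (norm (v x) - real N)" for x
  have g0: "g x \<ge> 0" for x by (simp add: g_def)
  have gi: "g integrable_on {a..b}" and gl: "integral {a..b} g < \<epsilon>/2" using gi gl unfolding g_def by auto
  have nv: "(\<lambda>x. norm (v x)) integrable_on {a..b}" using v by (simp add: absolutely_integrable_on_def)
  have vi: "v integrable_on {a..b}" using v by (simp add: absolutely_integrable_on_def)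
  show "\<exists>\<delta>>0. \<forall>(n::nat) p q. (\<forall>i<n. a \<le> p i \<and> p i \<le> q i \<and> q i \<le> b) \<longrightarrow>
        disjoint_family_on (\<lambda>i. {p i<..<q i}) {..<n} \<longrightarrow>
        (\<Sum>i<n. q i - p i) < \<delta> \<longrightarrow> (\<Sum>i<n. cmod (y (q i) - y (p i))) < \<epsilon>"
  proof (intro exI[of _ "\<epsilon> / (2 * (real N + 1))"] conjI allI impI)
    fix n :: nat and p q
    assume h: "\<forall>i<n. a \<le> p i \<and> p i \<le> q i \<and> q i \<le> b" "disjoint_family_on (\<lambda>i. {p i<..<q i}) {..<n}"
       "(\<Sum>i<n. q i - p i) < \<epsilon> / (2 * (real N + 1))"
    have "cmod (y (q i) - y (p i)) \<le> real N * (q i - p i) + integral {p i<..<q i} g" if "i \<in> {..<n}" for i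
    proof -
      have i: "a \<le> p i" "p i \<le> q i" "q i \<le> b" using h that by auto
      have sub: "{p i..q i} \<subseteq> {a..b}" using i by auto
      have "cmod (y (q i) - y (p i)) = cmod (integral {p i..q i} v)" using y[OF i] by simp
      also have "\<dots> \<le> integral {p i..q i} (\<lambda>x. real N + g x)"
      proof (rule integral_norm_bound_integral)
        show "v integrable_on {p i..q i}" using integrable_subinterval_real[OF vi sub] .
        show "(\<lambda>x. real N + g x) integrable_on {p i..q i}"
          using integrable_subinterval_real[OF gi sub] by (intro integrable_add) auto
      qed (auto simp: g_def)
      also have "\<dots> = real N * (q i - p i) + integral {p i..q i} g"
        using integrable_subinterval_real[OF gi sub] i
        by (subst Henstock_Kurzweil_Integration.integral_add) (auto simp: mult.commute)
      finally show ?thesis by (simp add: integral_open_interval_real)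
    qed
    then have "(\<Sum>i<n. cmod (y (q i) - y (p i))) \<le> (\<Sum>i<n. real N * (q i - p i) + integral {p i<..<q i} g)"
      by (rule sum_mono)
    also have "\<dots> = real N * (\<Sum>i<n. q i - p i) + (\<Sum>i<n. integral {p i<..<q i} g)"
      by (simp add: sum.distrib sum_distrib_left)
    also have "(\<Sum>i<n. integral {p i<..<q i} g) \<le> integral {a..b} g"
    proof -
      have gio: "g integrable_on {p i<..<q i}" if "i < n" for i
        using h that integrable_subinterval_real[OF gi, of "p i" "q i"] by (subst integrable_on_open_interval_real) auto
      have hI: "(g has_integral (\<Sum>i<n. integral {p i<..<q i} g)) (\<Union>i<n. {p i<..<q i})"
      proof (rule has_integral_UN)
        show "pairwise (\<lambda>i i'. negligible ({p i<..<q i} \<inter> {p i'<..<q i'})) {..<n}"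
          using h(2) unfolding pairwise_def disjoint_family_on_def by auto
      qed (use gio in \<open>auto intro: integrable_integral\<close>)
      have "(\<Union>i<n. {p i<..<q i}) \<subseteq> {a..b}" using h(1) by fastforce
      then show ?thesis
        by (rule has_integral_subset_le[OF _ hI integrable_integral[OF gi]]) (use g0 in auto)
    qed
    also have "real N * (\<Sum>i<n. q i - p i) \<le> real N * (\<epsilon> / (2 * (real N + 1)))"
      using h(3) by (intro mult_left_mono) auto
    also have "\<dots> \<le> \<epsilon>/2" using \<open>\<epsilon> > 0\<close> by (simp add: field_simps)
    finally show "(\<Sum>i<n. cmod (y (q i) - y (p i))) < \<epsilon>" using gl by linarith
  qed (use \<open>\<epsilon> > 0\<close> in auto)
qed

lemma primitive_AC_loc:
  assumes v: "\<And>R. 0 \<le> R \<Longrightarrow> v absolutely_integrable_on {0..R}"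
    and y: "\<And>x. 0 \<le> x \<Longrightarrow> y x = c + integral {0..x} (v :: real \<Rightarrow> complex)"
  shows "AC_loc y" "AE x in half_line. (y has_vector_derivative v x) (at x)"
proof -
  have vi: "v integrable_on {0..R}" if "0 \<le> R" for R using v[OF that] by (simp add: absolutely_integrable_on_def)
  show "AE x in half_line. (y has_vector_derivative v x) (at x)"
    by (rule primitive_has_vector_derivative_AE[OF vi y])
  have yd: "y q - y p = integral {p..q} v" if "0 \<le> p" "p \<le> q" for p q
  proof -
    have "integral {0..q} v = integral {0..p} v + integral {p..q} v"
      using that vi by (intro Henstock_Kurzweil_Integration.integral_combine[symmetric]) auto
    then show ?thesis using y[of p] y[of q] that by simp
  qed
  show "AC_loc y" unfolding AC_loc_def
    using v yd by (intro allI impI primitive_abs_cont_on_interval[where v=v]) auto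
qed

text \<open>On each \<open>[0, n]\<close> the function \<open>y\<close> is a primitive of some integrable \<open>v n\<close>, and \<open>v n\<close> is the derivative of \<open>y\<close>
almost everywhere by Lebesgue differentiation; the exceptional sets for all \<open>n\<close> are negligible together.\<close>

lemma AC_loc_FTC:
  assumes "AC_loc y"
  shows AC_loc_absolutely_integrable_derivative:
      "0 \<le> a \<Longrightarrow> (\<lambda>x. vector_derivative y (at x)) absolutely_integrable_on {a..b}"
    and AC_loc_has_integral:
      "0 \<le> a \<Longrightarrow> a \<le> b \<Longrightarrow> ((\<lambda>x. vector_derivative y (at x)) has_integral (y b - y a)) {a..b}"
    and AC_loc_has_vector_derivative:
      "AE x in half_line. (y has_vector_derivative vector_derivative y (at x)) (at x)"
proof -
  have "\<exists>v. v absolutely_integrable_on {0..real n} \<and> (\<forall>x\<in>{0..real n}. (v has_integral (y x - y 0)) {0..x})" for n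
    using assms by (intro abs_cont_primitive) (auto simp: AC_loc_def)
  then obtain v where v: "\<And>n. v n absolutely_integrable_on {0..real n}"
    "\<And>n x. x \<in> {0..real n} \<Longrightarrow> (v n has_integral (y x - y 0)) {0..x}" by metis
  have "\<exists>N. negligible N \<and> (\<forall>x. 0 < x \<longrightarrow> x < real n \<longrightarrow> x \<notin> N \<longrightarrow> (y has_vector_derivative v n x) (at x))" for n
  proof -
    define w where "w x = (if x \<in> {0..real n} then v n x else 0)" for x
    define z where "z x = y 0 + integral {0..x} w" for x
    have wi: "w integrable_on {0..R}" if "0 \<le> R" for R
    proof -
      have "{0..real n} \<inter> {0..R} = {0..min (real n) R}" by auto
      moreover have "v n integrable_on {0..min (real n) R}"
        using v(1)[of n] by (auto simp: absolutely_integrable_on_def intro: integrable_subinterval_real)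
      ultimately show ?thesis unfolding w_def using integrable_restrict_Int[of "{0..real n}" "v n" "{0..R}"] by simp
    qed
    obtain N where N: "negligible N" "\<And>x. 0 \<le> x \<Longrightarrow> x \<notin> N \<Longrightarrow> (z has_vector_derivative w x) (at x)"
      using AE_half_lineE[OF primitive_has_vector_derivative_AE[OF wi z_def]] by blast
    have zy: "z t = y t" if "t \<in> {0<..<real n}" for t
    proof -
      have "integral {0..t} w = integral {0..t} (v n)" using that by (intro integral_cong) (auto simp: w_def)
      then show ?thesis using v(2)[of t n] that by (auto simp: z_def dest: integral_unique)
    qed
    have "(y has_vector_derivative v n x) (at x)" if "0 < x" "x < real n" "x \<notin> N" for x
    proof -
      have x: "x \<in> {0<..<real n}" using that by auto
      have "(z has_vector_derivative v n x) (at x)" using N(2)[of x] that by (simp add: w_def)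
      then show "(y has_vector_derivative v n x) (at x)"
        by (rule has_vector_derivative_transform_within_open[OF _ open_greaterThanLessThan x zy])
    qed
    then show ?thesis using N(1) by blast
  qed
  then obtain N where N: "\<And>n::nat. negligible (N n)"
    "\<And>n x. 0 < x \<Longrightarrow> x < real n \<Longrightarrow> x \<notin> N n \<Longrightarrow> (y has_vector_derivative v n x) (at x)" by metis
  have neg: "negligible (\<Union>n. N n)" using N(1) by (intro negligible_countable_Union) auto
  have yv: "vector_derivative y (at x) = v n x" if "0 < x" "x < real n" "x \<notin> N n" for n x
    using N(2)[OF that] by (rule vector_derivative_at)
  have negn: "negligible (N n \<union> {0, real n})" for n using N(1)[of n] by simp
  show "AE x in half_line. (y has_vector_derivative vector_derivative y (at x)) (at x)"
  proof (rule AE_half_lineI[OF neg])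
    fix x :: real assume x: "0 < x" "x \<notin> (\<Union>n. N n)"
    obtain n where "x < real n" using reals_Archimedean2 by blast
    then show "(y has_vector_derivative vector_derivative y (at x)) (at x)"
      using N(2)[of x n] yv[of x n] x by auto
  qed
  have ai: "(\<lambda>x. vector_derivative y (at x)) absolutely_integrable_on {0..real n}" for n
    by (rule absolutely_integrable_spike[OF v(1) negn[of n]]) (use yv[of _ n] in auto)
  show "(\<lambda>x. vector_derivative y (at x)) absolutely_integrable_on {a..b}" if "0 \<le> a"
  proof -
    obtain n where "b < real n" using reals_Archimedean2 by blast
    then show ?thesis using that by (intro absolutely_integrable_on_subinterval[OF ai[of n]]) auto
  qed
  have hi: "((\<lambda>x. vector_derivative y (at x)) has_integral (y b - y 0)) {0..b}" if "0 \<le> b" for b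
  proof -
    obtain n where n: "b < real n" using reals_Archimedean2 by blast
    show ?thesis
      by (rule has_integral_spike[OF negn[of n] _ v(2)[of b n]]) (use yv[of _ n] n that in auto)
  qed
  show "((\<lambda>x. vector_derivative y (at x)) has_integral (y b - y a)) {a..b}" if ab: "0 \<le> a" "a \<le> b"
  proof -
    let ?f = "\<lambda>x. vector_derivative y (at x)"
    have i: "?f integrable_on {0..b}" using hi[of b] ab by (auto simp: integrable_on_def)
    then have "?f integrable_on {a..b}" by (rule integrable_subinterval_real) (use ab in auto)
    moreover have "integral {a..b} ?f = y b - y a"
      using Henstock_Kurzweil_Integration.integral_combine[OF ab i] integral_unique[OF hi[of a]] integral_unique[OF hi[of b]] ab
      by (auto simp: algebra_simps)
    ultimately show ?thesis by (metis integrable_integral)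
  qed
qed

lemma AC_locD: "AC_loc y \<Longrightarrow> 0 \<le> a \<Longrightarrow> abs_cont_on_interval a b y"
  unfolding AC_loc_def by (rule abs_cont_on_interval_subset[of 0 "max 0 b"]) auto

lemma AC_loc_continuous_on: "AC_loc y \<Longrightarrow> continuous_on {0..} y"
proof -
  assume "AC_loc y"
  then have "continuous_on {0..x+1} y" if "0 \<le> x" for x
    using that by (auto simp: AC_loc_def intro!: abs_cont_on_interval_continuous)
  then have "continuous (at x within {0..x+1}) y" if "0 \<le> x" for x
    using that by (simp add: continuous_on_eq_continuous_within)
  moreover have "at x within {0..} = at x within {0..x+1}" for x :: real
    by (rule at_within_nhd[of x "{x-1<..<x+1}"]) auto
  ultimately have "continuous (at x within {0..}) y" if "0 \<le> x" for x
    using that by (simp add: continuous_within)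
  then show ?thesis by (simp add: continuous_on_eq_continuous_within)
qed

lemma AC_loc_continuous_on_Icc: "AC_loc y \<Longrightarrow> 0 \<le> a \<Longrightarrow> continuous_on {a..b} y"
  by (rule abs_cont_on_interval_continuous[OF AC_locD])

text \<open>The source of the closure properties below: the increments of a sum, product, conjugate, exponential or Lipschitz
function are dominated by increments of the arguments.\<close>

lemma AC_loc_dominated:
  assumes y1: "AC_loc y1" and y2: "AC_loc y2"
    and dom: "\<And>R. 0 \<le> R \<Longrightarrow> \<exists>C\<ge>0. \<forall>p\<in>{0..R}. \<forall>q\<in>{0..R}. cmod (z q - z p) \<le> C * (cmod (y1 q - y1 p) + cmod (y2 q - y2 p))"
  shows "AC_loc z"
  unfolding AC_loc_def
proof (intro allI impI abs_cont_on_intervalI)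
  fix R \<epsilon> :: real assume R: "0 \<le> R" and e: "\<epsilon> > 0"
  obtain C where C: "C \<ge> 0" "\<And>p q. p \<in> {0..R} \<Longrightarrow> q \<in> {0..R} \<Longrightarrow> cmod (z q - z p) \<le> C * (cmod (y1 q - y1 p) + cmod (y2 q - y2 p))"
    using dom[OF R] by blast
  define e' where "e' = \<epsilon> / (C + 1) / 2"
  have e': "e' > 0" using e C by (simp add: e'_def)
  obtain d1 where "d1 > 0" and d1: "\<forall>(n::nat) p q. (\<forall>i<n. 0 \<le> p i \<and> p i \<le> q i \<and> q i \<le> R) \<longrightarrow>
        disjoint_family_on (\<lambda>i. {p i<..<q i}) {..<n} \<longrightarrow> (\<Sum>i<n. q i - p i) < d1 \<longrightarrow>
        (\<Sum>i<n. cmod (y1 (q i) - y1 (p i))) < e'"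
    using AC_locD[OF y1 order_refl, of R, unfolded abs_cont_on_interval_def, THEN spec, THEN mp, OF e'] by blast
  obtain d2 where "d2 > 0" and d2: "\<forall>(n::nat) p q. (\<forall>i<n. 0 \<le> p i \<and> p i \<le> q i \<and> q i \<le> R) \<longrightarrow>
        disjoint_family_on (\<lambda>i. {p i<..<q i}) {..<n} \<longrightarrow> (\<Sum>i<n. q i - p i) < d2 \<longrightarrow>
        (\<Sum>i<n. cmod (y2 (q i) - y2 (p i))) < e'"
    using AC_locD[OF y2 order_refl, of R, unfolded abs_cont_on_interval_def, THEN spec, THEN mp, OF e'] by blast
  show "\<exists>\<delta>>0. \<forall>(n::nat) p q. (\<forall>i<n. 0 \<le> p i \<and> p i \<le> q i \<and> q i \<le> R) \<longrightarrow>
        disjoint_family_on (\<lambda>i. {p i<..<q i}) {..<n} \<longrightarrow> (\<Sum>i<n. q i - p i) < \<delta> \<longrightarrow>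
        (\<Sum>i<n. cmod (z (q i) - z (p i))) < \<epsilon>"
  proof (intro exI[of _ "min d1 d2"] conjI allI impI)
    fix n :: nat and p q
    assume h: "\<forall>i<n. 0 \<le> p i \<and> p i \<le> q i \<and> q i \<le> R" "disjoint_family_on (\<lambda>i. {p i<..<q i}) {..<n}"
       "(\<Sum>i<n. q i - p i) < min d1 d2"
    have s1: "(\<Sum>i<n. cmod (y1 (q i) - y1 (p i))) < e'" using d1 h by force
    have s2: "(\<Sum>i<n. cmod (y2 (q i) - y2 (p i))) < e'" using d2 h by force
    have "(\<Sum>i<n. cmod (z (q i) - z (p i))) \<le> (\<Sum>i<n. C * (cmod (y1 (q i) - y1 (p i)) + cmod (y2 (q i) - y2 (p i))))"
    proof (rule sum_mono)
      fix i assume "i \<in> {..<n}"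
      then have "0 \<le> p i" "p i \<le> q i" "q i \<le> R" using h(1) by auto
      then show "cmod (z (q i) - z (p i)) \<le> C * (cmod (y1 (q i) - y1 (p i)) + cmod (y2 (q i) - y2 (p i)))"
        by (intro C) auto
    qed
    also have "\<dots> = C * ((\<Sum>i<n. cmod (y1 (q i) - y1 (p i))) + (\<Sum>i<n. cmod (y2 (q i) - y2 (p i))))"
      by (simp flip: sum_distrib_left sum.distrib)
    also have "\<dots> \<le> C * (e' + e')" using s1 s2 C(1) by (intro mult_left_mono) auto
    also have "\<dots> < (C + 1) * (e' + e')" using e' by (simp add: algebra_simps)
    also have "\<dots> = (C + 1) * (\<epsilon> / (C + 1))" by (simp only: e'_def field_sum_of_halves)
    also have "\<dots> = \<epsilon>" using C(1) by simp
    finally show "(\<Sum>i<n. cmod (z (q i) - z (p i))) < \<epsilon>" .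
  qed (use \<open>d1 > 0\<close> \<open>d2 > 0\<close> in auto)
qed

lemma AC_loc_bounded:
  assumes "AC_loc y"
  obtains C where "C > 0" "\<And>x. x \<in> {0..R} \<Longrightarrow> cmod (y x) \<le> C"
proof -
  have "compact (y ` {0..R})"
    by (intro compact_continuous_image AC_loc_continuous_on_Icc assms) auto
  then have "bounded (y ` {0..R})" by (rule compact_imp_bounded)
  then show ?thesis using that unfolding bounded_pos by auto
qed

lemma AC_loc_const: "AC_loc (\<lambda>x. c)"
  unfolding AC_loc_def abs_cont_on_interval_def by (auto intro: exI[of _ 1])

lemma AC_loc_of_real: "AC_loc complex_of_real"
  unfolding AC_loc_def
proof (intro allI impI abs_cont_on_intervalI)
  fix \<epsilon> R :: real assume e: "\<epsilon> > 0"
  have "(\<Sum>i<n. cmod (complex_of_real (q i) - complex_of_real (p i))) = (\<Sum>i<n. q i - p i)"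
    if "\<forall>i<n. 0 \<le> p i \<and> p i \<le> q i \<and> q i \<le> R" for n :: nat and p q :: "nat \<Rightarrow> real"
  proof (rule sum.cong)
    fix i assume "i \<in> {..<n}"
    then have "p i \<le> q i" using that by auto
    then show "cmod (complex_of_real (q i) - complex_of_real (p i)) = q i - p i" by (simp flip: of_real_diff)
  qed simp
  then show "\<exists>\<delta>>0. \<forall>(n::nat) p q. (\<forall>i<n. 0 \<le> p i \<and> p i \<le> q i \<and> q i \<le> R) \<longrightarrow>
        disjoint_family_on (\<lambda>i. {p i<..<q i}) {..<n} \<longrightarrow> (\<Sum>i<n. q i - p i) < \<delta> \<longrightarrow>
        (\<Sum>i<n. cmod (complex_of_real (q i) - complex_of_real (p i))) < \<epsilon>"
    using e by (intro exI[of _ \<epsilon>]) auto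
qed

lemma AC_loc_lipschitz:
  assumes "\<And>x x'. 0 \<le> x \<Longrightarrow> 0 \<le> x' \<Longrightarrow> cmod (z x - z x') \<le> C * \<bar>x - x'\<bar>"
  shows "AC_loc z"
proof (rule AC_loc_dominated[OF AC_loc_of_real AC_loc_of_real])
  fix R :: real assume "0 \<le> R"
  have "cmod (z q - z p) \<le> \<bar>C\<bar> * (cmod (complex_of_real q - complex_of_real p) + cmod (complex_of_real q - complex_of_real p))"
    if "p \<in> {0..R}" "q \<in> {0..R}" for p q
  proof -
    have "cmod (z q - z p) \<le> C * \<bar>q - p\<bar>" using that by (intro assms) auto
    also have "\<dots> \<le> \<bar>C\<bar> * (\<bar>q - p\<bar> + \<bar>q - p\<bar>)" by (intro mult_mono) auto
    finally show ?thesis by (simp flip: of_real_diff)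
  qed
  then show "\<exists>C\<ge>0. \<forall>p\<in>{0..R}. \<forall>q\<in>{0..R}. cmod (z q - z p) \<le> C * (cmod (complex_of_real q - complex_of_real p) + cmod (complex_of_real q - complex_of_real p))"
    by (intro exI[of _ "\<bar>C\<bar>"]) auto
qed

lemma AC_loc_add:
  assumes "AC_loc y" "AC_loc z" shows "AC_loc (\<lambda>x. y x + z x)"
proof (rule AC_loc_dominated[OF assms])
  fix R :: real
  have "cmod ((y q + z q) - (y p + z p)) \<le> 1 * (cmod (y q - y p) + cmod (z q - z p))" for p q
    using norm_triangle_ineq[of "y q - y p" "z q - z p"] by (simp add: algebra_simps)
  then show "\<exists>C\<ge>0. \<forall>p\<in>{0..R}. \<forall>q\<in>{0..R}. cmod ((y q + z q) - (y p + z p)) \<le> C * (cmod (y q - y p) + cmod (z q - z p))"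
    by (intro exI[of _ 1]) auto
qed

lemma AC_loc_mult:
  assumes "AC_loc y" "AC_loc z" shows "AC_loc (\<lambda>x. y x * z x)"
proof (rule AC_loc_dominated[OF assms])
  fix R :: real
  obtain A where A: "A > 0" "\<And>x. x \<in> {0..R} \<Longrightarrow> cmod (y x) \<le> A" using AC_loc_bounded[OF assms(1)] by blast
  obtain B where B: "B > 0" "\<And>x. x \<in> {0..R} \<Longrightarrow> cmod (z x) \<le> B" using AC_loc_bounded[OF assms(2)] by blast
  have "cmod (y q * z q - y p * z p) \<le> (A + B) * (cmod (y q - y p) + cmod (z q - z p))"
    if "p \<in> {0..R}" "q \<in> {0..R}" for p q
  proof -
    have "y q * z q - y p * z p = y q * (z q - z p) + (y q - y p) * z p" by (simp add: algebra_simps)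
    then have "cmod (y q * z q - y p * z p) \<le> cmod (y q) * cmod (z q - z p) + cmod (y q - y p) * cmod (z p)"
      by (metis norm_mult norm_triangle_ineq)
    also have "\<dots> \<le> A * cmod (z q - z p) + cmod (y q - y p) * B"
      using A(2)[OF that(2)] B(2)[OF that(1)] by (intro add_mono mult_mono) (use A in auto)
    also have "\<dots> \<le> (A + B) * (cmod (y q - y p) + cmod (z q - z p))"
      using A(1) B(1) by (simp add: algebra_simps)
    finally show ?thesis .
  qed
  then show "\<exists>C\<ge>0. \<forall>p\<in>{0..R}. \<forall>q\<in>{0..R}. cmod (y q * z q - y p * z p) \<le> C * (cmod (y q - y p) + cmod (z q - z p))"
    using A(1) B(1) by (intro exI[of _ "A + B"]) auto
qed

lemma AC_loc_cmult: "AC_loc y \<Longrightarrow> AC_loc (\<lambda>x. c * y x)"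
  by (rule AC_loc_mult[OF AC_loc_const])

lemma AC_loc_cnj: assumes "AC_loc y" shows "AC_loc (\<lambda>x. cnj (y x))"
proof (rule AC_loc_dominated[OF assms assms])
  fix R :: real
  have "cmod (cnj (y q) - cnj (y p)) \<le> 1 * (cmod (y q - y p) + cmod (y q - y p))" for p q
    by (simp flip: complex_cnj_diff)
  then show "\<exists>C\<ge>0. \<forall>p\<in>{0..R}. \<forall>q\<in>{0..R}. cmod (cnj (y q) - cnj (y p)) \<le> C * (cmod (y q - y p) + cmod (y q - y p))"
    by (intro exI[of _ 1]) auto
qed

lemma AC_loc_exp: assumes "AC_loc y" shows "AC_loc (\<lambda>x. exp (y x))"
proof (rule AC_loc_dominated[OF assms assms])
  fix R :: real
  obtain A where A: "A > 0" "\<And>x. x \<in> {0..R} \<Longrightarrow> cmod (y x) \<le> A" using AC_loc_bounded[OF assms(1)] by blast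
  have "cmod (exp (y q) - exp (y p)) \<le> exp A * (cmod (y q - y p) + cmod (y q - y p))"
    if "p \<in> {0..R}" "q \<in> {0..R}" for p q
  proof -
    have "cmod (exp (y q) - exp (y p)) \<le> exp A * cmod (y q - y p)"
    proof (rule field_differentiable_bound[of "cball 0 A" exp exp])
      show "cmod (exp z) \<le> exp A" if "z \<in> cball 0 A" for z
        using that complex_Re_le_cmod[of z] by (simp add: norm_exp_eq_Re)
    qed (use A that in \<open>auto intro: DERIV_exp has_field_derivative_at_within\<close>)
    also have "\<dots> \<le> exp A * (cmod (y q - y p) + cmod (y q - y p))" by (intro mult_left_mono) auto
    finally show ?thesis .
  qed
  then show "\<exists>C\<ge>0. \<forall>p\<in>{0..R}. \<forall>q\<in>{0..R}. cmod (exp (y q) - exp (y p)) \<le> C * (cmod (y q - y p) + cmod (y q - y p))"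
    by (intro exI[of _ "exp A"]) auto
qed

text \<open>The integral does not depend on the choice of the derivative on a negligible set; this is the form in which
integration by parts is used.\<close>

lemma AC_loc_integral:
  assumes y: "AC_loc y" and w: "AE x in half_line. (y has_vector_derivative w x) (at x)" and ab: "0 \<le> a"
  shows AC_loc_derivative_absolutely_integrable: "w absolutely_integrable_on {a..b}"
    and AC_loc_derivative_has_integral: "a \<le> b \<Longrightarrow> (w has_integral (y b - y a)) {a..b}"
proof -
  obtain N where N: "negligible N" "\<And>x. 0 \<le> x \<Longrightarrow> x \<notin> N \<Longrightarrow> (y has_vector_derivative w x) (at x)"
    using AE_half_lineE[OF w] by blast
  have eq: "w x = vector_derivative y (at x)" if "x \<in> {a..b} - N" for x
    using N(2)[of x] that ab by (auto simp: vector_derivative_at)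
  show "w absolutely_integrable_on {a..b}"
    by (rule absolutely_integrable_spike[OF AC_loc_absolutely_integrable_derivative[OF y ab] N(1) eq])
  show "(w has_integral (y b - y a)) {a..b}" if "a \<le> b"
    by (rule has_integral_spike[OF N(1) eq AC_loc_has_integral[OF y ab that]])
qed

section \<open>Square integrable functions on intervals\<close>

definition L2_on :: "real \<Rightarrow> real \<Rightarrow> (real \<Rightarrow> complex) \<Rightarrow> bool" where
  "L2_on a b f \<longleftrightarrow> f \<in> borel_measurable (lebesgue_on {a..b}) \<and> (\<lambda>x. (cmod (f x))\<^sup>2) integrable_on {a..b}"

lemma L2_onD:
  assumes "L2_on a b f"
  shows "f \<in> borel_measurable (lebesgue_on {a..b})" "(\<lambda>x. (cmod (f x))\<^sup>2) integrable_on {a..b}"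
  using assms by (auto simp: L2_on_def)

lemma L2_on_bound:
  assumes "f \<in> borel_measurable (lebesgue_on {a..b})" "g integrable_on {a..b}" "\<And>x. x \<in> {a..b} \<Longrightarrow> (cmod (f x))\<^sup>2 \<le> g x"
  shows "L2_on a b f"
  unfolding L2_on_def
proof
  show "(\<lambda>x. (cmod (f x))\<^sup>2) integrable_on {a..b}"
  proof (rule measurable_bounded_by_integrable_imp_integrable[OF _ assms(2)])
    show "(\<lambda>x. (cmod (f x))\<^sup>2) \<in> borel_measurable (lebesgue_on {a..b})" using assms(1) by simp
    show "norm ((cmod (f x))\<^sup>2) \<le> g x" if "x \<in> {a..b}" for x using assms(3)[OF that] by simp
  qed simp
qed (rule assms)

lemma L2_on_subinterval:
  assumes "L2_on a b f" "a \<le> a'" "b' \<le> b" shows "L2_on a' b' f"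
proof -
  have sub: "{a'..b'} \<subseteq> {a..b}" using assms by auto
  show ?thesis
    using assms(1) integrable_subinterval_real[OF _ sub] measurable_restrict_mono[OF _ sub] unfolding L2_on_def by blast
qed

lemma L2_on_continuous:
  assumes "continuous_on {a..b} f" shows "L2_on a b f"
  unfolding L2_on_def
proof
  show "f \<in> borel_measurable (lebesgue_on {a..b})" using assms by (intro continuous_imp_measurable_on_sets_lebesgue) auto
  show "(\<lambda>x. (cmod (f x))\<^sup>2) integrable_on {a..b}"
    using assms by (intro integrable_continuous_real continuous_intros)
qed

lemma L2_on_const: "L2_on a b (\<lambda>x. c)"
  by (rule L2_on_continuous) auto

lemma norm_add_sq_le: "(norm (x + y))\<^sup>2 \<le> 2 * (norm x)\<^sup>2 + 2 * (norm y)\<^sup>2" for x y :: "'a::real_normed_vector"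
proof -
  have "(norm (x + y))\<^sup>2 \<le> (norm x + norm y)\<^sup>2" by (intro power_mono norm_triangle_ineq) auto
  also have "\<dots> \<le> 2 * (norm x)\<^sup>2 + 2 * (norm y)\<^sup>2"
    using sum_squares_bound[of "norm x" "norm y"] by (simp add: power2_sum)
  finally show ?thesis .
qed

lemma L2_on_add:
  assumes "L2_on a b f" "L2_on a b g" shows "L2_on a b (\<lambda>x. f x + g x)"
  by (rule L2_on_bound[of _ _ _ "\<lambda>x. 2 * (cmod (f x))\<^sup>2 + 2 * (cmod (g x))\<^sup>2"])
    (use assms norm_add_sq_le in \<open>auto simp: L2_on_def intro!: integrable_add integrable_on_mult_right\<close>)

lemma L2_on_cmult:
  assumes "L2_on a b f" shows "L2_on a b (\<lambda>x. c * f x)"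
  by (rule L2_on_bound[of _ _ _ "\<lambda>x. (cmod c)\<^sup>2 * (cmod (f x))\<^sup>2"])
    (use assms in \<open>auto simp: L2_on_def norm_mult power_mult_distrib intro!: integrable_on_mult_right\<close>)

lemma L2_on_diff:
  assumes "L2_on a b f" "L2_on a b g" shows "L2_on a b (\<lambda>x. f x - g x)"
  using L2_on_add[OF assms(1) L2_on_cmult[OF assms(2), of "-1"]] by simp

lemma L2_on_cnj: assumes "L2_on a b f" shows "L2_on a b (\<lambda>x. cnj (f x))"
proof (rule L2_on_bound[OF _ L2_onD(2)[OF assms]])
  show "(\<lambda>x. cnj (f x)) \<in> borel_measurable (lebesgue_on {a..b})"
    by (rule measurable_compose[OF L2_onD(1)[OF assms] borel_measurable_continuous_onI]) (intro continuous_intros)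
qed simp

lemma L2_on_continuous_mult:
  assumes c: "continuous_on {a..b} c" and f: "L2_on a b f" shows "L2_on a b (\<lambda>x. c x * f x)"
proof -
  have "compact (c ` {a..b})" using c by (rule compact_continuous_image) auto
  then obtain C where C: "C > 0" "\<And>x. x \<in> {a..b} \<Longrightarrow> cmod (c x) \<le> C"
    using compact_imp_bounded[OF \<open>compact (c ` {a..b})\<close>] unfolding bounded_pos by blast
  show ?thesis
  proof (rule L2_on_bound[of _ _ _ "\<lambda>x. C\<^sup>2 * (cmod (f x))\<^sup>2"])
    have "c \<in> borel_measurable (lebesgue_on {a..b})" using c by (intro continuous_imp_measurable_on_sets_lebesgue) auto
    then show "(\<lambda>x. c x * f x) \<in> borel_measurable (lebesgue_on {a..b})" using f by (auto simp: L2_on_def)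
    show "(\<lambda>x. C\<^sup>2 * (cmod (f x))\<^sup>2) integrable_on {a..b}" using f by (auto simp: L2_on_def intro!: integrable_on_mult_right)
    show "(cmod (c x * f x))\<^sup>2 \<le> C\<^sup>2 * (cmod (f x))\<^sup>2" if "x \<in> {a..b}" for x
      using C(2)[OF that] by (simp add: norm_mult power_mult_distrib mult_right_mono power_mono)
  qed
qed

lemma mult_le_sum_squares: "x * y \<le> (x\<^sup>2 + y\<^sup>2) / 2" for x y :: real
  using sum_squares_bound[of x y] by simp

lemma L2_on_mult:
  assumes f: "L2_on a b f" and g: "L2_on a b g"
  shows "(\<lambda>x. f x * g x) absolutely_integrable_on {a..b}"
proof (rule measurable_bounded_by_integrable_imp_absolutely_integrable)
  show "(\<lambda>x. f x * g x) \<in> borel_measurable (lebesgue_on {a..b})" using f g by (auto simp: L2_on_def)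
  show "(\<lambda>x. (cmod (f x))\<^sup>2 + (cmod (g x))\<^sup>2) integrable_on {a..b}"
    using f g by (auto simp: L2_on_def intro!: integrable_add)
  show "norm (f x * g x) \<le> (cmod (f x))\<^sup>2 + (cmod (g x))\<^sup>2" for x
    using mult_le_sum_squares[of "cmod (f x)" "cmod (g x)"] zero_le_power2[of "cmod (f x)"] zero_le_power2[of "cmod (g x)"]
    unfolding norm_mult by argo
qed auto

lemma L2_on_absolutely_integrable:
  assumes "L2_on a b f" shows "f absolutely_integrable_on {a..b}"
  using L2_on_mult[OF assms L2_on_const[of a b 1]] by simp

text \<open>Integrate \<open>\<bar>f\<bar> \<le> \<eta> / 2 + \<bar>f\<bar>\<^sup>2 / (2 * \<eta>)\<close>. The free parameter replaces square roots in the estimates.\<close>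

lemma L2_on_norm_integral_le:
  assumes f: "L2_on a b f" and ab: "a \<le> b" and "\<eta> > 0"
  shows "integral {a..b} (\<lambda>x. cmod (f x)) \<le> \<eta> / 2 * (b - a) + integral {a..b} (\<lambda>x. (cmod (f x))\<^sup>2) / (2 * \<eta>)"
proof -
  have i: "(\<lambda>x. (cmod (f x))\<^sup>2 / (2 * \<eta>)) integrable_on {a..b}"
    by (rule integrable_on_divide[OF L2_onD(2)[OF f]])
  have "integral {a..b} (\<lambda>x. cmod (f x)) \<le> integral {a..b} (\<lambda>x. \<eta> / 2 + (cmod (f x))\<^sup>2 / (2 * \<eta>))"
  proof (rule integral_le)
    show "(\<lambda>x. cmod (f x)) integrable_on {a..b}"
      using L2_on_absolutely_integrable[OF f] by (simp add: absolutely_integrable_on_def)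
    show "(\<lambda>x. \<eta> / 2 + (cmod (f x))\<^sup>2 / (2 * \<eta>)) integrable_on {a..b}"
      using i by (intro integrable_add) auto
    show "cmod (f x) \<le> \<eta> / 2 + (cmod (f x))\<^sup>2 / (2 * \<eta>)" for x
    proof -
      have "0 \<le> (cmod (f x) - \<eta>)\<^sup>2" by simp
      then have "2 * \<eta> * cmod (f x) \<le> \<eta>\<^sup>2 + (cmod (f x))\<^sup>2" by (simp add: power2_diff algebra_simps)
      then show ?thesis using \<open>\<eta> > 0\<close> by (simp add: field_simps power2_eq_square)
    qed
  qed
  also have "\<dots> = \<eta> / 2 * (b - a) + integral {a..b} (\<lambda>x. (cmod (f x))\<^sup>2) / (2 * \<eta>)"
    using i ab by (subst Henstock_Kurzweil_Integration.integral_add) auto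
  finally show ?thesis .
qed

lemma integral_cmod_sq_mono:
  assumes "L2_on a b f" "a \<le> a'" "b' \<le> b"
  shows "integral {a'..b'} (\<lambda>x. (cmod (f x))\<^sup>2) \<le> integral {a..b} (\<lambda>x. (cmod (f x))\<^sup>2)"
  using assms L2_on_subinterval[OF assms] by (intro integral_subset_le) (auto simp: L2_on_def)

lemma L2_on_square: "L2_on a b f \<Longrightarrow> (\<lambda>x. (f x)\<^sup>2) absolutely_integrable_on {a..b}"
  using L2_on_mult[of a b f f] by (simp add: power2_eq_square)

lemma norm_integral_square_le:
  assumes "L2_on a b f"
  shows "cmod (integral {a..b} (\<lambda>x. (f x)\<^sup>2)) \<le> integral {a..b} (\<lambda>x. (cmod (f x))\<^sup>2)"
  using assms L2_on_square[OF assms]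
  by (intro integral_norm_bound_integral) (auto simp: L2_on_def norm_power absolutely_integrable_on_def)

section \<open>The Riccati equation\<close>

text \<open>The map \<open>v \<mapsto> - \<integral> (\<sigma> + v)\<^sup>2\<close> is a contraction of the ball of radius \<open>4 * S\<close> in the space of bounded continuous
functions, provided that the interval is short compared with \<open>1 / S\<close>. Only the product of \<open>S\<close> with the length of
the interval matters, not its position.\<close>

lemma riccati_solution:
  assumes \<sigma>: "L2_on a b \<sigma>" and ab: "a \<le> b" and S: "integral {a..b} (\<lambda>x. (cmod (\<sigma> x))\<^sup>2) \<le> S" "S > 0"
    and small: "64 * S * (b - a) \<le> 1"
  shows "\<exists>v. continuous_on UNIV v \<and> (\<forall>x. cmod (v x) \<le> 4 * S) \<and>
     (\<forall>x\<in>{a..b}. v x = - integral {a..x} (\<lambda>t. (\<sigma> t + v t)\<^sup>2))"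
proof -
  define X where "X = cball (0 :: real \<Rightarrow>\<^sub>C complex) (4 * S)"
  \<comment> \<open>clamping the argument keeps all iterates defined, continuous and bounded on the whole line\<close>
  define c where "c x = max a (min b x)" for x :: real
  have cab: "c x \<in> {a..b}" for x using ab by (auto simp: c_def)
  have cc: "continuous_on UNIV c" unfolding c_def by (intro continuous_intros)
  define I where "I w x = - integral {a..c x} (\<lambda>t. (\<sigma> t + w t)\<^sup>2)" for w :: "real \<Rightarrow> complex" and x
  have Xn: "cmod (apply_bcontfun w x) \<le> 4 * S" if "w \<in> X" for w x
    using norm_bounded[of w x] that by (simp add: X_def)
  have L2w: "L2_on a b (\<lambda>t. \<sigma> t + apply_bcontfun w t)" for w
    by (intro L2_on_add \<sigma> L2_on_continuous) simp
  have contI: "continuous_on UNIV (I w)" for w :: "real \<Rightarrow>\<^sub>C complex"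
  proof -
    have "continuous_on {a..b} (\<lambda>x. integral {a..x} (\<lambda>t. (\<sigma> t + w t)\<^sup>2))"
      using L2_on_square[OF L2w] by (intro indefinite_integral_continuous_1) (auto simp: absolutely_integrable_on_def)
    then have "continuous_on UNIV (\<lambda>x. integral {a..c x} (\<lambda>t. (\<sigma> t + w t)\<^sup>2))"
      by (rule continuous_on_compose2[OF _ cc]) (use cab in auto)
    then show ?thesis unfolding I_def by (intro continuous_intros)
  qed
  have bI: "cmod (I w x) \<le> 4 * S" if w: "w \<in> X" for w x
  proof -
    have "cmod (I w x) \<le> integral {a..c x} (\<lambda>t. (cmod (\<sigma> t + w t))\<^sup>2)"
      unfolding I_def norm_minus_cancel
      by (rule norm_integral_square_le[OF L2_on_subinterval[OF L2w]]) (use cab[of x] in auto)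
    also have "\<dots> \<le> integral {a..b} (\<lambda>t. (cmod (\<sigma> t + w t))\<^sup>2)"
      by (rule integral_cmod_sq_mono[OF L2w]) (use cab[of x] in auto)
    also have "\<dots> \<le> integral {a..b} (\<lambda>t. 2 * (cmod (\<sigma> t))\<^sup>2 + 2 * (4 * S)\<^sup>2)"
    proof (rule integral_le)
      show "(cmod (\<sigma> t + w t))\<^sup>2 \<le> 2 * (cmod (\<sigma> t))\<^sup>2 + 2 * (4 * S)\<^sup>2" for t
        using norm_add_sq_le[of "\<sigma> t" "w t"] power_mono[OF Xn[OF w, of t], of 2] by simp
    qed (use \<sigma> L2w in \<open>auto simp: L2_on_def intro!: integrable_add integrable_on_mult_right\<close>)
    also have "\<dots> = 2 * integral {a..b} (\<lambda>t. (cmod (\<sigma> t))\<^sup>2) + 2 * (4 * S)\<^sup>2 * (b - a)"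
      using \<sigma> ab by (subst Henstock_Kurzweil_Integration.integral_add) (auto simp: L2_on_def intro!: integrable_on_mult_right)
    also have "\<dots> \<le> 2 * S + (64 * S * (b - a)) * S"
    proof (rule add_mono)
      have "0 \<le> S * S * (b - a)" using S ab by simp
      then show "2 * (4 * S)\<^sup>2 * (b - a) \<le> (64 * S * (b - a)) * S" by (simp add: power2_eq_square algebra_simps)
    qed (use S in simp)
    also have "\<dots> \<le> 2 * S + 1 * S" using small S by (intro add_left_mono mult_right_mono) auto
    finally show ?thesis using S by linarith
  qed
  have memI: "I w \<in> bcontfun" if "w \<in> X" for w :: "real \<Rightarrow>\<^sub>C complex"
    by (rule bcontfun_normI[OF contI bI[OF that]])
  \<comment> \<open>bounds for \<open>I w\<close> are available for \<open>w\<close> in \<open>X\<close>, which suffices for the contraction principle on \<open>X\<close>\<close>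
  define F where "F w = Bcontfun (I w)" for w :: "real \<Rightarrow>\<^sub>C complex"
  have FI: "apply_bcontfun (F w) = I w" if "w \<in> X" for w
    unfolding F_def by (rule Bcontfun_inverse[OF memI[OF that]])
  have "\<exists>!w. w \<in> X \<and> F w = w"
  proof (rule Banach_fix[of _ "1/2"])
    show "complete X" unfolding X_def by (simp add: complete_eq_closed)
    show "X \<noteq> {}" unfolding X_def using S by auto
    show "F ` X \<subseteq> X"
    proof (rule image_subsetI)
      fix w assume w: "w \<in> X"
      show "F w \<in> X" unfolding X_def using bI[OF w] by (simp add: FI[OF w] norm_bound)
    qed
    show "dist (F w) (F w') \<le> 1/2 * dist w w'" if w: "w \<in> X" "w' \<in> X" for w w'
    proof (rule dist_bound)
      fix x
      let ?d = "dist w w'"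
      have i1: "(\<lambda>t. (\<sigma> t + apply_bcontfun w t)\<^sup>2) integrable_on {a..c x}" for w
        using L2_on_square[OF L2_on_subinterval[OF L2w]] cab[of x] by (auto simp: absolutely_integrable_on_def)
      have ni: "(\<lambda>t. cmod (\<sigma> t)) integrable_on {a..b}"
        using L2_on_absolutely_integrable[OF \<sigma>] by (simp add: absolutely_integrable_on_def)
      have nic: "(\<lambda>t. cmod (\<sigma> t)) integrable_on {a..c x}"
        by (rule integrable_subinterval_real[OF ni]) (use cab[of x] in auto)
      have "dist (F w x) (F w' x) = cmod (integral {a..c x} (\<lambda>t. (\<sigma> t + w t)\<^sup>2 - (\<sigma> t + w' t)\<^sup>2))"
        unfolding FI[OF w(1)] FI[OF w(2)] dist_norm I_def
        by (subst Henstock_Kurzweil_Integration.integral_diff[OF i1 i1]) (simp add: norm_minus_commute)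
      also have "\<dots> \<le> integral {a..c x} (\<lambda>t. ?d * (2 * cmod (\<sigma> t) + 8 * S))"
      proof (rule integral_norm_bound_integral)
        show "(\<lambda>t. (\<sigma> t + w t)\<^sup>2 - (\<sigma> t + w' t)\<^sup>2) integrable_on {a..c x}" by (rule integrable_diff[OF i1 i1])
        show "(\<lambda>t. ?d * (2 * cmod (\<sigma> t) + 8 * S)) integrable_on {a..c x}"
          by (intro integrable_on_mult_right integrable_add nic) auto
        fix t
        have "(\<sigma> t + w t)\<^sup>2 - (\<sigma> t + w' t)\<^sup>2 = (w t - w' t) * (2 * \<sigma> t + w t + w' t)" by (simp add: power2_eq_square algebra_simps)
        then have "cmod ((\<sigma> t + w t)\<^sup>2 - (\<sigma> t + w' t)\<^sup>2) = dist (w t) (w' t) * cmod (2 * \<sigma> t + w t + w' t)"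
          by (simp add: norm_mult dist_norm)
        also have "\<dots> \<le> ?d * (2 * cmod (\<sigma> t) + 8 * S)"
        proof (intro mult_mono dist_bounded)
          show "cmod (2 * \<sigma> t + w t + w' t) \<le> 2 * cmod (\<sigma> t) + 8 * S"
            using norm_triangle_ineq[of "2 * \<sigma> t + w t" "w' t"] norm_triangle_ineq[of "2 * \<sigma> t" "w t"] Xn[OF w(1), of t] Xn[OF w(2), of t]
            by (simp add: norm_mult)
        qed auto
        finally show "cmod ((\<sigma> t + w t)\<^sup>2 - (\<sigma> t + w' t)\<^sup>2) \<le> ?d * (2 * cmod (\<sigma> t) + 8 * S)" .
      qed
      also have "\<dots> \<le> integral {a..b} (\<lambda>t. ?d * (2 * cmod (\<sigma> t) + 8 * S))"
        using cab[of x] S ab nic ni by (intro integral_subset_le integrable_on_mult_right integrable_add) auto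
      also have "\<dots> = ?d * (2 * integral {a..b} (\<lambda>t. cmod (\<sigma> t)) + 8 * S * (b - a))"
      proof -
        have "integral {a..b} (\<lambda>t. 2 * cmod (\<sigma> t) + 8 * S) = 2 * integral {a..b} (\<lambda>t. cmod (\<sigma> t)) + 8 * S * (b - a)"
          using ni ab by (subst Henstock_Kurzweil_Integration.integral_add) (auto intro!: integrable_on_mult_right)
        then show ?thesis by simp
      qed
      also have "\<dots> \<le> ?d * (1/2)"
      proof (rule mult_left_mono)
        have "integral {a..b} (\<lambda>t. cmod (\<sigma> t)) \<le> 8 * S / 2 * (b - a) + integral {a..b} (\<lambda>x. (cmod (\<sigma> x))\<^sup>2) / (2 * (8 * S))"
          using S by (intro L2_on_norm_integral_le \<sigma> ab) auto
        also have "\<dots> \<le> 8 * S / 2 * (b - a) + S / (2 * (8 * S))" using S by (intro add_left_mono divide_right_mono) auto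
        also have "\<dots> = 4 * S * (b - a) + 1/16" using S by simp
        finally show "2 * integral {a..b} (\<lambda>t. cmod (\<sigma> t)) + 8 * S * (b - a) \<le> 1/2" using small by linarith
      qed simp
      finally show "dist (F w x) (F w' x) \<le> 1/2 * ?d" by simp
    qed
  qed auto
  then obtain w where w: "w \<in> X" "F w = w" by blast
  have "apply_bcontfun w x = - integral {a..x} (\<lambda>t. (\<sigma> t + w t)\<^sup>2)" if "x \<in> {a..b}" for x
  proof -
    have "c x = x" using that by (auto simp: c_def)
    have "apply_bcontfun w x = apply_bcontfun (F w) x" by (simp only: w(2))
    also have "\<dots> = - integral {a..x} (\<lambda>t. (\<sigma> t + w t)\<^sup>2)" unfolding FI[OF w(1)] I_def \<open>c x = x\<close> ..
    finally show ?thesis .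
  qed
  then show ?thesis using Xn[OF w(1)] by (intro exI[of _ "apply_bcontfun w"]) auto
qed

section \<open>Integrals over the half-line\<close>

lemma L2_loc_L2_on:
  assumes "L2_loc s" "0 \<le> a" shows "L2_on a b s"
proof -
  have sm: "s \<in> borel_measurable half_line" and si: "\<forall>R\<ge>0. integrable (lebesgue_on {0..R}) (\<lambda>x. (cmod (s x))\<^sup>2)"
    using assms(1) unfolding L2_loc_def by blast+
  have "integrable (lebesgue_on {0..max 0 b}) (\<lambda>x. (cmod (s x))\<^sup>2)" by (rule si[rule_format]) simp
  then have "(\<lambda>x. (cmod (s x))\<^sup>2) integrable_on {0..max 0 b}" by (rule integrable_on_lebesgue_on) simp
  moreover have "s \<in> borel_measurable (lebesgue_on {0..max 0 b})"
    by (rule measurable_restrict_mono[OF sm]) auto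
  ultimately have "L2_on 0 (max 0 b) s" by (simp add: L2_on_def)
  then show ?thesis by (rule L2_on_subinterval) (use assms in auto)
qed

lemma borel_measurable_half_line:
  fixes f :: "real \<Rightarrow> 'b::euclidean_space"
  assumes "\<And>n::nat. f \<in> borel_measurable (lebesgue_on {0..real n})"
  shows "f \<in> borel_measurable half_line"
proof (rule borel_measurable_LIMSEQ_metric)
  let ?g = "\<lambda>n x. if x \<in> {0..real n} then f x else 0"
  show "?g n \<in> borel_measurable half_line" for n
  proof -
    have "?g n \<in> borel_measurable lebesgue" using assms[of n] by (intro borel_measurable_if_I) auto
    then show ?thesis by (rule measurable_restrict_space1)
  qed
  fix x assume "x \<in> space half_line"
  then have x: "0 \<le> x" by simp
  show "(\<lambda>n. ?g n x) \<longlonglongrightarrow> f x"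
  proof (rule tendsto_eventually)
    obtain m where "x < real m" using reals_Archimedean2 by blast
    then show "\<forall>\<^sub>F n in sequentially. ?g n x = f x"
      using x by (intro eventually_sequentiallyI[of m]) auto
  qed
qed

lemma AC_loc_measurable: "AC_loc y \<Longrightarrow> y \<in> borel_measurable half_line"
  by (intro continuous_imp_measurable_on_sets_lebesgue AC_loc_continuous_on) auto

lemma AC_loc_derivative_measurable:
  assumes "AC_loc y" shows "(\<lambda>x. vector_derivative y (at x)) \<in> borel_measurable half_line"
  by (intro borel_measurable_half_line absolutely_integrable_imp_borel_measurable
      AC_loc_absolutely_integrable_derivative[OF assms]) auto

lemma l_expr_measurable:
  assumes "L2_loc s" "AC_loc y" "AC_loc u"
  shows "l_expr s y u \<in> borel_measurable half_line"
proof -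
  have "s \<in> borel_measurable half_line" using assms(1) by (simp add: L2_loc_def)
  then show ?thesis
    unfolding l_expr_def
    using AC_loc_measurable[OF assms(2)] AC_loc_measurable[OF assms(3)] AC_loc_derivative_measurable[OF assms(3)]
    by (intro borel_measurable_diff borel_measurable_uminus borel_measurable_times borel_measurable_power)
qed

text \<open>Translates Lebesgue integrals over the half-line of functions with compact support into gauge integrals over an
interval, for which the calculus of primitives is available.\<close>

lemma half_line_integral_support:
  fixes g :: "real \<Rightarrow> 'b::euclidean_space"
  assumes a: "0 \<le> a" and gm: "g \<in> borel_measurable half_line"
    and supp: "AE x in half_line. x \<notin> {a..b} \<longrightarrow> g x = 0" and g: "g absolutely_integrable_on {a..b}"
  shows "integrable half_line g" "integral\<^sup>L half_line g = integral {a..b} g"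
proof -
  let ?h = "\<lambda>x. indicat_real {a..b} x *\<^sub>R g x"
  have h: "integrable lebesgue ?h" using g by (simp add: set_integrable_def)
  have hI: "integral\<^sup>L lebesgue ?h = integral {a..b} g"
    using set_lebesgue_integral_eq_integral(2)[OF g] by (simp add: set_lebesgue_integral_def)
  have e: "indicat_real {0..} x *\<^sub>R ?h x = ?h x" for x using a by (auto simp: indicator_def)
  have h2: "integrable half_line ?h" 
    by (subst integrable_restrict_space) (use h in \<open>simp_all only: e space_completion space_lborel, auto\<close>)
  have hI2: "integral\<^sup>L half_line ?h = integral {a..b} g"
    by (subst integral_restrict_space) (use hI in \<open>simp_all only: e space_completion space_lborel, auto\<close>)
  have ae: "AE x in half_line. g x = ?h x" using supp by (rule eventually_mono) (auto simp: indicator_def)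
  show "integrable half_line g" using integrable_cong_AE[OF gm borel_measurable_integrable[OF h2] ae] h2 by simp
  show "integral\<^sup>L half_line g = integral {a..b} g"
    using integral_cong_AE[OF gm borel_measurable_integrable[OF h2] ae] hI2 by simp
qed

lemma square_integrable_support:
  assumes a: "0 \<le> a" and f: "f \<in> borel_measurable half_line"
    and supp: "AE x in half_line. x \<notin> {a..b} \<longrightarrow> f x = 0" and f2: "L2_on a b f"
  shows "square_integrable f" "(\<integral>x. (cmod (f x))\<^sup>2 \<partial>half_line) = integral {a..b} (\<lambda>x. (cmod (f x))\<^sup>2)"
proof -
  have m: "(\<lambda>x. (cmod (f x))\<^sup>2) \<in> borel_measurable half_line" using f by simp
  have s: "AE x in half_line. x \<notin> {a..b} \<longrightarrow> (cmod (f x))\<^sup>2 = 0" using supp by (rule eventually_mono) simp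
  have ai: "(\<lambda>x. (cmod (f x))\<^sup>2) absolutely_integrable_on {a..b}"
    using f2 by (intro nonnegative_absolutely_integrable_1) (auto simp: L2_on_def)
  show "(\<integral>x. (cmod (f x))\<^sup>2 \<partial>half_line) = integral {a..b} (\<lambda>x. (cmod (f x))\<^sup>2)"
    by (rule half_line_integral_support(2)[OF a m s ai])
  show "square_integrable f" using half_line_integral_support(1)[OF a m s ai] f by (simp add: square_integrable_def)
qed

lemma AE_half_line_nonneg: "AE x in half_line. 0 \<le> x"
  using AE_space[of half_line] by (rule eventually_mono) simp

lemma AE_half_line_neq: "AE x in half_line. x \<noteq> c"
  by (rule AE_half_lineI[of "{c}"]) auto

section \<open>Elements of the minimal domain on short intervals\<close>

lemma norm_vector_derivative_le_lipschitz:
  fixes f :: "real \<Rightarrow> 'b::real_normed_vector"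
  assumes d: "(f has_vector_derivative f') (at x)" and lip: "\<And>y. norm (f y - f x) \<le> L * \<bar>y - x\<bar>"
  shows "norm f' \<le> L"
proof (rule field_le_epsilon)
  fix e :: real assume e: "0 < e"
  obtain r where r: "r > 0" "\<And>y. 0 < norm (y - x) \<Longrightarrow> norm (y - x) < r \<Longrightarrow> norm (f y - f x - (y - x) *\<^sub>R f') / norm (y - x) < e"
    using d e unfolding has_vector_derivative_def has_derivative_at' by blast
  define h where "h = r / 2"
  have h: "0 < h" "h < r" using r by (auto simp: h_def)
  have "norm (f (x + h) - f x - h *\<^sub>R f') < e * h" using r(2)[of "x + h"] h by (simp add: pos_divide_less_eq)
  moreover have "norm (h *\<^sub>R f') \<le> norm (f (x + h) - f x) + norm (f (x + h) - f x - h *\<^sub>R f')"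
    using norm_triangle_ineq4[of "f (x + h) - f x" "f (x + h) - f x - h *\<^sub>R f'"] by simp
  ultimately have "h * norm f' \<le> h * (L + e)" using lip[of "x + h"] h by (simp add: algebra_simps)
  then show "norm f' \<le> L + e" using h by simp
qed

lemma absolutely_integrable_restrict_Int:
  fixes f :: "'a::euclidean_space \<Rightarrow> 'b::euclidean_space"
  shows "(\<lambda>x. if x \<in> S then f x else 0) absolutely_integrable_on T \<longleftrightarrow> f absolutely_integrable_on S \<inter> T"
proof -
  have "(\<lambda>x. norm (if x \<in> S then f x else 0)) = (\<lambda>x. if x \<in> S then norm (f x) else 0)" by auto
  then show ?thesis unfolding absolutely_integrable_on_def by (simp only: integrable_restrict_Int)
qed

text \<open>Let \<open>v\<close> solve \<open>v' = - (s - c + v)\<^sup>2\<close> and put \<open>q = s - c + v\<close>, \<open>\<phi> = exp (\<integral> q)\<close>. Then \<open>\<phi>' - s * \<phi> = (v - c) * \<phi>\<close> is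
absolutely continuous and \<open>l \<phi> = 0\<close> on the interval, although \<open>s\<close> has no regularity. For a product \<open>\<phi> * z\<close> all terms
with the derivative of \<open>s\<close> or with \<open>s\<^sup>2\<close> cancel and \<open>l (\<phi> * z) = - 2 * q * \<phi> * z' - \<phi> * z''\<close> remains, which is square
integrable when \<open>z'\<close> is Lipschitz. The constants only depend on the length of the interval and on the Lipschitz
constant \<open>L\<close> of \<open>z'\<close>, whatever the size of \<open>c\<close> and the position of the interval.\<close>

theorem minimal_domain_products:
  fixes s :: "real \<Rightarrow> complex"
  assumes s: "L2_loc s" and a: "0 \<le> a" and ab: "a < b"
    and S: "integral {a..b} (\<lambda>x. (cmod (s x - c))\<^sup>2) \<le> S" "S > 0" and small: "64 * S * (b - a) \<le> 1"
  shows "\<exists>\<phi>. AC_loc \<phi> \<and> (\<forall>x\<ge>0. 1/2 \<le> cmod (\<phi> x) \<and> cmod (\<phi> x) \<le> 2) \<and>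
     (\<forall>z \<zeta> L. (\<forall>x. (z has_real_derivative \<zeta> x) (at x)) \<longrightarrow> (\<forall>x x'. \<bar>\<zeta> x - \<zeta> x'\<bar> \<le> L * \<bar>x - x'\<bar>) \<longrightarrow>
        (\<forall>x. x \<notin> {a..b} \<longrightarrow> z x = 0 \<and> \<zeta> x = 0) \<longrightarrow>
        (\<exists>u. in_minimal_domain s (\<lambda>x. \<phi> x * complex_of_real (z x)) u \<and>
          (norm (l2_class (l_expr s (\<lambda>x. \<phi> x * complex_of_real (z x)) u)))\<^sup>2 \<le> 10 * L\<^sup>2 * (b - a)))"
proof -
  have ab': "a \<le> b" using ab by simp
  define \<sigma> where "\<sigma> x = s x - c" for x
  have \<sigma>2: "L2_on a b \<sigma>" unfolding \<sigma>_def by (intro L2_on_diff L2_loc_L2_on s a L2_on_const)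
  obtain v where v: "continuous_on UNIV v" "\<And>x. cmod (v x) \<le> 4 * S"
      "\<And>x. x \<in> {a..b} \<Longrightarrow> v x = - integral {a..x} (\<lambda>t. (\<sigma> t + v t)\<^sup>2)"
    using riccati_solution[OF \<sigma>2 ab' S(1)[folded \<sigma>_def] S(2) small] by blast
  define q where "q x = (if x \<in> {a..b} then \<sigma> x + v x else 0)" for x
  have vL2: "L2_on a b v" using v(1) by (intro L2_on_continuous) (rule continuous_on_subset, auto)
  have q2: "L2_on a b (\<lambda>x. \<sigma> x + v x)" by (intro L2_on_add \<sigma>2 vL2)
  have qint: "integral {a..b} (\<lambda>x. (cmod (\<sigma> x + v x))\<^sup>2) \<le> 3 * S"
  proof -
    have "integral {a..b} (\<lambda>t. (cmod (\<sigma> t + v t))\<^sup>2) \<le> integral {a..b} (\<lambda>t. 2 * (cmod (\<sigma> t))\<^sup>2 + 2 * (4 * S)\<^sup>2)"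
    proof (rule integral_le)
      show "(cmod (\<sigma> t + v t))\<^sup>2 \<le> 2 * (cmod (\<sigma> t))\<^sup>2 + 2 * (4 * S)\<^sup>2" for t
        using norm_add_sq_le[of "\<sigma> t" "v t"] power_mono[OF v(2)[of t], of 2] by simp
    qed (use \<sigma>2 q2 in \<open>auto simp: L2_on_def intro!: integrable_add integrable_on_mult_right\<close>)
    also have "\<dots> = 2 * integral {a..b} (\<lambda>t. (cmod (\<sigma> t))\<^sup>2) + 2 * (4 * S)\<^sup>2 * (b - a)"
      using \<sigma>2 ab by (subst Henstock_Kurzweil_Integration.integral_add) (auto simp: L2_on_def intro!: integrable_on_mult_right)
    also have "\<dots> \<le> 2 * S + (64 * S * (b - a)) * S"
    proof (rule add_mono)
      have "0 \<le> S * S * (b - a)" using S ab by simp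
      then show "2 * (4 * S)\<^sup>2 * (b - a) \<le> (64 * S * (b - a)) * S" by (simp add: power2_eq_square algebra_simps)
    qed (use S in \<open>simp add: \<sigma>_def\<close>)
    also have "\<dots> \<le> 2 * S + 1 * S" using small S by (intro add_left_mono mult_right_mono) auto
    finally show ?thesis by simp
  qed
  have split: "(\<lambda>x. if x \<in> {a..b} then F x else 0) absolutely_integrable_on {0..R}"
    if F: "F absolutely_integrable_on {a..b}" for F :: "real \<Rightarrow> complex" and R
  proof -
    have "{a..b} \<inter> {0..R} = {a..min b R}" using a by auto
    then have "F absolutely_integrable_on {a..b} \<inter> {0..R}"
      using F by (auto intro: absolutely_integrable_on_subinterval)
    then show ?thesis using absolutely_integrable_restrict_Int[where S="{a..b}" and T="{0..R}" and f=F] by simp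
  qed
  have qai: "q absolutely_integrable_on {0..R}" for R
    using split[OF L2_on_absolutely_integrable[OF q2], of R] by (simp add: q_def[abs_def])
  have q2ai: "(\<lambda>x. (q x)\<^sup>2) absolutely_integrable_on {0..R}" for R
  proof -
    have "(\<lambda>x. (q x)\<^sup>2) = (\<lambda>x. if x \<in> {a..b} then (\<sigma> x + v x)\<^sup>2 else 0)" by (auto simp: q_def)
    then show ?thesis using split[OF L2_on_square[OF q2], of R] by simp
  qed
  define \<Phi> where "\<Phi> x = integral {0..x} q" for x
  \<comment> \<open>\<open>W\<close> continues \<open>v - c\<close> by constants, so that \<open>q = s + W\<close> on the interval\<close>
  define W where "W x = - c + - integral {0..x} (\<lambda>t. (q t)\<^sup>2)" for x
  have \<Phi>: "AC_loc \<Phi>" "AE x in half_line. (\<Phi> has_vector_derivative q x) (at x)"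
    using primitive_AC_loc[of q \<Phi> 0] qai by (auto simp: \<Phi>_def)
  have W: "AC_loc W" "AE x in half_line. (W has_vector_derivative - (q x)\<^sup>2) (at x)"
  proof -
    have "(\<lambda>x. - (q x)\<^sup>2) absolutely_integrable_on {0..R}" for R
      using q2ai[of R] integrable_neg[of "\<lambda>x. (q x)\<^sup>2" "{0..R}"] by (auto simp: absolutely_integrable_on_def)
    moreover have "W x = - c + integral {0..x} (\<lambda>x. - (q x)\<^sup>2)" for x by (simp add: W_def)
    ultimately show "AC_loc W" "AE x in half_line. (W has_vector_derivative - (q x)\<^sup>2) (at x)"
      using primitive_AC_loc[of "\<lambda>x. - (q x)\<^sup>2" W "- c"] by auto
  qed
  have qW: "q x = s x + W x" if x: "x \<in> {a..b}" for x
  proof -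
    have i: "(\<lambda>t. (q t)\<^sup>2) integrable_on {0..x}" using q2ai by (simp add: absolutely_integrable_on_def)
    have "integral {0..x} (\<lambda>t. (q t)\<^sup>2) = integral {0..a} (\<lambda>t. (q t)\<^sup>2) + integral {a..x} (\<lambda>t. (q t)\<^sup>2)"
      using i x a by (intro Henstock_Kurzweil_Integration.integral_combine[symmetric]) auto
    also have "integral {0..a} (\<lambda>t. (q t)\<^sup>2) = integral {0..a} (\<lambda>t. 0)"
      by (rule integral_spike[of "{a}"]) (auto simp: q_def)
    also have "integral {a..x} (\<lambda>t. (q t)\<^sup>2) = integral {a..x} (\<lambda>t. (\<sigma> t + v t)\<^sup>2)"
      using x by (intro integral_cong) (auto simp: q_def)
    also have "\<dots> = - v x" using v(3)[OF x] by simp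
    finally have "W x = - c + v x" by (simp add: W_def)
    then show ?thesis using x by (simp add: q_def \<sigma>_def)
  qed
  define \<phi> where "\<phi> x = exp (\<Phi> x)" for x
  have \<phi>AC: "AC_loc \<phi>" unfolding \<phi>_def by (rule AC_loc_exp[OF \<Phi>(1)])
  have \<phi>D: "AE x in half_line. (\<phi> has_vector_derivative q x * \<phi> x) (at x)"
    using \<Phi>(2)
  proof (rule eventually_mono)
    fix x assume "(\<Phi> has_vector_derivative q x) (at x)"
    then show "(\<phi> has_vector_derivative q x * \<phi> x) (at x)"
      unfolding \<phi>_def using field_vector_diff_chain_at[of \<Phi> "q x" x exp "exp (\<Phi> x)"] by (simp add: o_def mult.commute)
  qed
  have \<Phi>b: "cmod (\<Phi> x) \<le> 1/2" if "0 \<le> x" for x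
  proof -
    have nq: "(\<lambda>t. cmod (q t)) integrable_on {0..x}" using qai by (simp add: absolutely_integrable_on_def)
    have "cmod (\<Phi> x) \<le> integral {0..x} (\<lambda>t. cmod (q t))"
      unfolding \<Phi>_def using qai nq by (intro integral_norm_bound_integral) (auto simp: absolutely_integrable_on_def)
    also have "\<dots> \<le> integral {0..max x b} (\<lambda>t. cmod (q t))"
      using qai by (intro integral_subset_le) (auto simp: absolutely_integrable_on_def)
    also have "\<dots> = integral {0..max x b} (\<lambda>t. if t \<in> {a..b} then cmod (\<sigma> t + v t) else 0)"
      by (intro integral_cong) (auto simp: q_def)
    also have "\<dots> = integral ({a..b} \<inter> {0..max x b}) (\<lambda>t. cmod (\<sigma> t + v t))" by (rule integral_restrict_Int)
    also have "{a..b} \<inter> {0..max x b} = {a..b}" using a by auto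
    also have "integral {a..b} (\<lambda>t. cmod (\<sigma> t + v t)) \<le> 16 * S / 2 * (b - a) + integral {a..b} (\<lambda>t. (cmod (\<sigma> t + v t))\<^sup>2) / (2 * (16 * S))"
      using S by (intro L2_on_norm_integral_le q2 ab') auto
    also have "\<dots> \<le> 16 * S / 2 * (b - a) + (3 * S) / (2 * (16 * S))"
      using S qint by (intro add_left_mono divide_right_mono) auto
    also have "\<dots> \<le> 1/2" using S small by (simp add: algebra_simps)
    finally show ?thesis .
  qed
  have \<phi>b: "1/2 \<le> cmod (\<phi> x) \<and> cmod (\<phi> x) \<le> 2" if "0 \<le> x" for x
  proof -
    have r: "\<bar>Re (\<Phi> x)\<bar> \<le> 1/2" using \<Phi>b[OF that] abs_Re_le_cmod[of "\<Phi> x"] by linarith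
    then have "exp (Re (\<Phi> x)) \<le> exp (1/2)" "exp (- (1/2)) \<le> exp (Re (\<Phi> x))" by auto
    moreover have "exp (- (1/2::real)) \<ge> 1/2"
      using exp_half_le2 by (simp add: exp_minus field_simps)
    ultimately have "1/2 \<le> exp (Re (\<Phi> x))" "exp (Re (\<Phi> x)) \<le> 2" using exp_half_le2 by linarith+
    then show ?thesis by (simp add: \<phi>_def norm_exp_eq_Re)
  qed
  show ?thesis
  proof (rule exI[of _ \<phi>], intro conjI \<phi>AC allI impI)
    fix x :: real assume "0 \<le> x"
    then show "1/2 \<le> cmod (\<phi> x)" "cmod (\<phi> x) \<le> 2" using \<phi>b by auto
  next
    fix z \<zeta> :: "real \<Rightarrow> real" and L :: real
    assume zd: "\<forall>x. (z has_real_derivative \<zeta> x) (at x)" and lip: "\<forall>x x'. \<bar>\<zeta> x - \<zeta> x'\<bar> \<le> L * \<bar>x - x'\<bar>"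
      and supp: "\<forall>x. x \<notin> {a..b} \<longrightarrow> z x = 0 \<and> \<zeta> x = 0"
    have L0: "0 \<le> L" using lip[rule_format, of 0 1] by simp
    let ?z = "\<lambda>x. complex_of_real (z x)" and ?\<zeta> = "\<lambda>x. complex_of_real (\<zeta> x)"
    define \<zeta>' where "\<zeta>' x = vector_derivative ?\<zeta> (at x)" for x
    have \<zeta>AC: "AC_loc ?\<zeta>" by (rule AC_loc_lipschitz[of _ L]) (use lip in \<open>simp flip: of_real_diff\<close>)
    have \<zeta>D: "AE x in half_line. (?\<zeta> has_vector_derivative \<zeta>' x) (at x)"
      unfolding \<zeta>'_def by (rule AC_loc_has_vector_derivative[OF \<zeta>AC])
    have zD: "(?z has_vector_derivative ?\<zeta> x) (at x)" for x
      by (rule has_vector_derivative_of_real[OF zd[rule_format]])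
    have \<zeta>b: "\<bar>\<zeta> x\<bar> \<le> L * (b - a)" for x
    proof (cases "x \<in> {a..b}")
      case True
      have "\<bar>\<zeta> x\<bar> \<le> L * (b - a + e)" if "e > 0" for e
      proof -
        have "\<zeta> (b + e) = 0" using supp that by auto
        then have "\<bar>\<zeta> x\<bar> \<le> L * \<bar>x - (b + e)\<bar>" using lip[rule_format, of x "b + e"] by simp
        also have "\<dots> \<le> L * (b - a + e)" using True that L0 by (intro mult_left_mono) auto
        finally show ?thesis .
      qed
      then have "\<bar>\<zeta> x\<bar> \<le> L * (b - a) + e" if "e > 0" for e
      proof -
        have "L * (b - a + e / (L + 1)) \<le> L * (b - a) + e"
        proof -
          have "L * (e / (L + 1)) \<le> e" using L0 that by (simp add: field_simps)
          then show ?thesis by (simp add: algebra_simps)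
        qed
        then show ?thesis using \<open>\<And>e. e > 0 \<Longrightarrow> \<bar>\<zeta> x\<bar> \<le> L * (b - a + e)\<close>[of "e / (L + 1)"] L0 that by force
      qed
      then show ?thesis by (rule field_le_epsilon)
    qed (use supp L0 ab in auto)
    have zAC: "AC_loc ?z"
    proof (rule AC_loc_lipschitz[of _ "L * (b - a)"])
      fix x x' :: real
      have "norm (z x - z x') \<le> L * (b - a) * norm (x - x')"
        by (rule field_differentiable_bound[of UNIV z \<zeta>]) (use zd \<zeta>b in auto)
      then show "cmod (?z x - ?z x') \<le> L * (b - a) * \<bar>x - x'\<bar>" by (simp flip: of_real_diff)
    qed
    define y where "y x = \<phi> x * ?z x" for x
    \<comment> \<open>the quasi-derivative \<open>y' - s * y = \<phi> * z' + (q - s) * y\<close>\<close>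
    define u where "u x = \<phi> x * ?\<zeta> x + W x * y x" for x
    have yAC: "AC_loc y" unfolding y_def by (intro AC_loc_mult \<phi>AC zAC)
    have uAC: "AC_loc u" unfolding u_def by (intro AC_loc_add AC_loc_mult \<phi>AC \<zeta>AC W yAC)
    have yD: "AE x in half_line. (y has_vector_derivative q x * y x + \<phi> x * ?\<zeta> x) (at x)"
      using \<phi>D
    proof (rule eventually_mono)
      fix x assume d: "(\<phi> has_vector_derivative q x * \<phi> x) (at x)"
      show "(y has_vector_derivative q x * y x + \<phi> x * ?\<zeta> x) (at x)"
        unfolding y_def using has_vector_derivative_mult[OF d zD[of x]] by (simp add: algebra_simps)
    qed
    have uD: "AE x in half_line. (u has_vector_derivative
        q x * \<phi> x * ?\<zeta> x + \<phi> x * \<zeta>' x - (q x)\<^sup>2 * y x + W x * (q x * y x + \<phi> x * ?\<zeta> x)) (at x)"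
      using \<phi>D \<zeta>D W(2) yD
    proof eventually_elim
      case (elim x)
      show ?case
        unfolding u_def
        using has_vector_derivative_add[OF has_vector_derivative_mult[OF elim(1,2)] has_vector_derivative_mult[OF elim(3,4)]]
        by (simp add: algebra_simps)
    qed
    have hq: "has_quasi_derivative s y u"
      unfolding has_quasi_derivative_def
    proof (intro conjI yAC uAC)
      show "AE x in half_line. u x = vector_derivative y (at x) - s x * y x"
        using yD
      proof (rule eventually_mono)
        fix x assume "(y has_vector_derivative q x * y x + \<phi> x * ?\<zeta> x) (at x)"
        then have d: "vector_derivative y (at x) = q x * y x + \<phi> x * ?\<zeta> x" by (rule vector_derivative_at)
        show "u x = vector_derivative y (at x) - s x * y x"
        proof (cases "x \<in> {a..b}")
          case True
          then show ?thesis unfolding d qW[OF True] u_def by (simp add: algebra_simps)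
        next
          case False
          then show ?thesis using supp unfolding d u_def y_def by simp
        qed
      qed
    qed
    have lD: "AE x in half_line. l_expr s y u x = (if x \<in> {a..b} then - 2 * q x * \<phi> x * ?\<zeta> x - \<phi> x * \<zeta>' x else 0)"
      using uD AE_half_line_neq[of a] AE_half_line_neq[of b]
    proof eventually_elim
      case (elim x)
      have d: "vector_derivative u (at x) = q x * \<phi> x * ?\<zeta> x + \<phi> x * \<zeta>' x - (q x)\<^sup>2 * y x + W x * (q x * y x + \<phi> x * ?\<zeta> x)"
        using elim(1) by (rule vector_derivative_at)
      show ?case
      proof (cases "x \<in> {a..b}")
        case True
        have sq: "s x = q x - W x" using qW[OF True] by simp
        show ?thesis using True unfolding l_expr_def d u_def sq by (simp add: algebra_simps power2_eq_square)
      next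
        case False
        have o: "open (- {a..b})" by (simp add: open_Compl)
        have "(?\<zeta> has_vector_derivative 0) (at x)"
        proof (rule has_vector_derivative_transform_within_open[OF has_vector_derivative_const o])
          show "x \<in> - {a..b}" using False by simp
          show "0 = ?\<zeta> x'" if "x' \<in> - {a..b}" for x' using supp that by auto
        qed
        then have "\<zeta>' x = 0" unfolding \<zeta>'_def by (rule vector_derivative_at)
        moreover have "z x = 0" "\<zeta> x = 0" using False supp by blast+
        ultimately show ?thesis using False unfolding l_expr_def d u_def y_def by auto
      qed
    qed
    have \<zeta>'b: "AE x in half_line. cmod (\<zeta>' x) \<le> L"
      using \<zeta>D
    proof (rule eventually_mono)
      fix x assume "(?\<zeta> has_vector_derivative \<zeta>' x) (at x)"
      then show "cmod (\<zeta>' x) \<le> L"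
        by (rule norm_vector_derivative_le_lipschitz) (use lip in \<open>simp flip: of_real_diff\<close>)
    qed
    have lm: "l_expr s y u \<in> borel_measurable half_line" by (rule l_expr_measurable[OF s yAC uAC])
    define B where "B x = 32 * L\<^sup>2 * (b - a)\<^sup>2 * (cmod (\<sigma> x + v x))\<^sup>2 + 8 * L\<^sup>2" for x
    have lB: "AE x in half_line. x \<in> {a..b} \<longrightarrow> (cmod (l_expr s y u x))\<^sup>2 \<le> B x"
      using lD \<zeta>'b AE_half_line_nonneg
    proof eventually_elim
      case (elim x)
      show ?case
      proof
        assume x: "x \<in> {a..b}"
        have "(cmod (l_expr s y u x))\<^sup>2 = (cmod ((- 2 * q x * \<phi> x * ?\<zeta> x) + (- \<phi> x * \<zeta>' x)))\<^sup>2"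
          using elim(1) x by simp
        also have "\<dots> \<le> 2 * (cmod (- 2 * q x * \<phi> x * ?\<zeta> x))\<^sup>2 + 2 * (cmod (- \<phi> x * \<zeta>' x))\<^sup>2" by (rule norm_add_sq_le)
        also have "\<dots> \<le> 2 * (2 * cmod (q x) * 2 * (L * (b - a)))\<^sup>2 + 2 * (2 * L)\<^sup>2"
        proof (intro add_mono mult_left_mono power_mono)
          show "cmod (- \<phi> x * \<zeta>' x) \<le> 2 * L" unfolding norm_mult norm_minus_cancel using \<phi>b[OF elim(3)] elim(2) by (intro mult_mono) auto
          show "cmod (- 2 * q x * \<phi> x * ?\<zeta> x) \<le> 2 * cmod (q x) * 2 * (L * (b - a))"
            unfolding norm_mult norm_minus_cancel using \<phi>b[OF elim(3)] \<zeta>b[of x] by (intro mult_mono) auto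
        qed auto
        also have "\<dots> = B x" using x unfolding B_def q_def by (simp add: power_mult_distrib)
        finally show "(cmod (l_expr s y u x))\<^sup>2 \<le> B x" .
      qed
    qed
    have Bi: "B integrable_on {a..b}"
      unfolding B_def using q2 by (auto simp: L2_on_def intro!: integrable_add integrable_on_mult_right)
    have lsupp: "AE x in half_line. x \<notin> {a..b} \<longrightarrow> l_expr s y u x = 0"
      using lD by (rule eventually_mono) simp
    obtain N where N: "negligible N" "\<And>x. 0 \<le> x \<Longrightarrow> x \<notin> N \<Longrightarrow> x \<in> {a..b} \<longrightarrow> (cmod (l_expr s y u x))\<^sup>2 \<le> B x"
      using AE_half_lineE[OF lB] by blast
    \<comment> \<open>the bound holds only almost everywhere; on the null set \<open>N\<close> it is replaced by the function itself\<close>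
    define Bt where "Bt x = (if x \<in> N then (cmod (l_expr s y u x))\<^sup>2 else B x)" for x
    have Bt: "Bt integrable_on {a..b}" by (rule integrable_spike[OF Bi N(1)]) (simp add: Bt_def)
    have BtI: "integral {a..b} Bt = integral {a..b} B" by (rule integral_spike[OF N(1)]) (simp add: Bt_def)
    have lBt: "(cmod (l_expr s y u x))\<^sup>2 \<le> Bt x" if "x \<in> {a..b}" for x using N(2)[of x] that a by (auto simp: Bt_def)
    have l2: "L2_on a b (l_expr s y u)"
      by (rule L2_on_bound[OF measurable_restrict_mono[OF lm] Bt lBt]) (use a in auto)
    have lint: "integral {a..b} (\<lambda>x. (cmod (l_expr s y u x))\<^sup>2) \<le> integral {a..b} B"
      unfolding BtI[symmetric] using l2 Bt lBt by (intro integral_le) (auto simp: L2_on_def)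
    have "integral {a..b} B = 32 * L\<^sup>2 * (b - a)\<^sup>2 * integral {a..b} (\<lambda>x. (cmod (\<sigma> x + v x))\<^sup>2) + 8 * L\<^sup>2 * (b - a)"
      unfolding B_def using q2 ab
      by (subst Henstock_Kurzweil_Integration.integral_add) (auto simp: L2_on_def intro!: integrable_on_mult_right)
    also have "\<dots> \<le> 32 * L\<^sup>2 * (b - a)\<^sup>2 * (3 * S) + 8 * L\<^sup>2 * (b - a)"
      using qint by (intro add_right_mono mult_left_mono) auto
    also have "32 * L\<^sup>2 * (b - a)\<^sup>2 * (3 * S) = (3/2) * (L\<^sup>2 * (b - a)) * (64 * S * (b - a))"
      by (simp add: power2_eq_square algebra_simps)
    also have "\<dots> \<le> (3/2) * (L\<^sup>2 * (b - a)) * 1" using small ab by (intro mult_left_mono) auto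
    finally have B1: "integral {a..b} B \<le> (3/2) * (L\<^sup>2 * (b - a)) * 1 + 8 * L\<^sup>2 * (b - a)" by simp
    have "0 \<le> L\<^sup>2 * (b - a)" using ab by simp
    with B1 have Bint: "integral {a..b} B \<le> 10 * L\<^sup>2 * (b - a)" by (simp only: mult.assoc)
    have sql: "square_integrable (l_expr s y u)" and
      nl: "(\<integral>x. (cmod (l_expr s y u x))\<^sup>2 \<partial>half_line) = integral {a..b} (\<lambda>x. (cmod (l_expr s y u x))\<^sup>2)"
      using square_integrable_support[OF a lm lsupp l2] by auto
    have sqy: "square_integrable y"
    proof (rule square_integrable_support(1)[OF a AC_loc_measurable[OF yAC]])
      show "AE x in half_line. x \<notin> {a..b} \<longrightarrow> y x = 0" using supp by (simp add: y_def)
      show "L2_on a b y" by (intro L2_on_continuous AC_loc_continuous_on_Icc yAC a)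
    qed
    have zlip: "\<bar>z x - z x'\<bar> \<le> L * (b - a) * \<bar>x - x'\<bar>" for x x'
      using field_differentiable_bound[of UNIV z \<zeta> "L * (b - a)" x x'] zd \<zeta>b by auto
    \<comment> \<open>if \<open>a = 0\<close> then \<open>0\<close> belongs to \<open>[a, b]\<close>, and the boundary values vanish by continuity from the left\<close>
    have van: "F 0 = 0" if l: "\<And>x x'. \<bar>F x - F x'\<bar> \<le> C * \<bar>x - x'\<bar>" and F0: "\<And>x. x \<notin> {a..b} \<Longrightarrow> F x = 0"
      for F :: "real \<Rightarrow> real" and C
    proof -
      have "\<bar>F 0\<bar> \<le> 0 + e" if "e > 0" for e
      proof -
        have "e / (\<bar>C\<bar> + 1) > 0" using that by (simp add: add_nonneg_pos)
        then have "F (- (e / (\<bar>C\<bar> + 1))) = 0" using a by (intro F0) auto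
        then have "\<bar>F 0\<bar> \<le> C * \<bar>e / (\<bar>C\<bar> + 1)\<bar>" using l[of 0 "- (e / (\<bar>C\<bar> + 1))"] by simp
        also have "\<dots> \<le> (\<bar>C\<bar> + 1) * (e / (\<bar>C\<bar> + 1))" using that by (intro mult_mono) auto
        finally show ?thesis by simp
      qed
      then have "\<bar>F 0\<bar> \<le> 0" by (rule field_le_epsilon)
      then show ?thesis by simp
    qed
    have z0: "z 0 = 0 \<and> \<zeta> 0 = 0" using van[OF zlip] van[of \<zeta> L] lip supp by auto
    have dom: "in_minimal_domain s y u"
      unfolding in_minimal_domain_def
    proof (intro conjI sqy hq sql)
      show "y 0 = 0" "u 0 = 0" using z0 by (auto simp: y_def u_def)
      have "{x. 0 \<le> x \<and> y x \<noteq> 0} \<subseteq> {a..b}" using supp by (auto simp: y_def)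
      then have "bounded {x. 0 \<le> x \<and> y x \<noteq> 0}" using bounded_subset bounded_closed_interval by blast
      then show "compact (closure {x. 0 \<le> x \<and> y x \<noteq> 0})" by (simp add: compact_closure)
    qed
    have "(norm (l2_class (l_expr s y u)))\<^sup>2 \<le> 10 * L\<^sup>2 * (b - a)"
    proof -
      have "(norm (l2_class (l_expr s y u)))\<^sup>2 = (\<integral>x. (cmod (l_expr s y u x))\<^sup>2 \<partial>half_line)"
        by (simp add: norm_l2_class sql)
      then show ?thesis using nl lint Bint by linarith
    qed
    then show "\<exists>u. in_minimal_domain s (\<lambda>x. \<phi> x * ?z x) u \<and> (norm (l2_class (l_expr s (\<lambda>x. \<phi> x * ?z x) u)))\<^sup>2 \<le> 10 * L\<^sup>2 * (b - a)"
      using dom unfolding y_def by blast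
  qed
qed

section \<open>Completeness of the Hilbert space\<close>

lemma l2_eq_refl_iff: "l2_eq f f \<longleftrightarrow> square_integrable f"
  by (auto simp: l2_eq_def)

lemma square_integrable_rep_l2: "square_integrable (rep_l2 u)"
  using Quotient_rep_reflp[OF Quotient_l2, of u] by (simp add: l2_eq_refl_iff)

lemma l2_class_rep_l2 [simp]: "l2_class (rep_l2 u) = u"
  by (rule Quotient_abs_rep[OF Quotient_l2])

lemma l2_class_cases: obtains f where "square_integrable f" "u = l2_class f"
  using square_integrable_rep_l2 l2_class_rep_l2 by metis

lemma l2_class_eq_iff:
  assumes "square_integrable f" "square_integrable g"
  shows "l2_class f = l2_class g \<longleftrightarrow> (AE x in half_line. f x = g x)"
  using Quotient_rel[OF Quotient_l2, of f g] assms by (auto simp: l2_eq_def)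

lemma l2_class_add:
  assumes "square_integrable f" "square_integrable g"
  shows "l2_class f + l2_class g = l2_class (\<lambda>x. f x + g x)"
  using assms by (simp add: plus_l2.abs_eq l2_eq_refl_iff)

lemma l2_class_scale:
  assumes "square_integrable f"
  shows "l2_scale c (l2_class f) = l2_class (\<lambda>x. c * f x)"
  using assms by (simp add: l2_scale.abs_eq l2_eq_refl_iff)

lemma l2_class_minus:
  assumes "square_integrable f"
  shows "- l2_class f = l2_class (\<lambda>x. - f x)"
  using assms by (simp add: uminus_l2.abs_eq l2_eq_refl_iff)

lemma square_integrable_minus: "square_integrable f \<Longrightarrow> square_integrable (\<lambda>x. - f x)"
  using square_integrable_scale[of f "-1"] by simp

lemma square_integrable_diff:
  assumes "square_integrable f" "square_integrable g"
  shows "square_integrable (\<lambda>x. f x - g x)"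
  using square_integrable_add[OF assms(1) square_integrable_minus[OF assms(2)]] by simp

lemma l2_class_diff:
  assumes "square_integrable f" "square_integrable g"
  shows "l2_class f - l2_class g = l2_class (\<lambda>x. f x - g x)"
  using assms by (simp add: minus_l2_def l2_class_minus l2_class_add square_integrable_minus)

lemma l2_class_inner:
  assumes "square_integrable f" "square_integrable g"
  shows "inner (l2_class f) (l2_class g) = (\<integral>x. f x \<bullet> g x \<partial>half_line)"
  using assms by (simp add: inner_l2.abs_eq l2_eq_refl_iff)

lemma nn_integral_l2_class:
  assumes "square_integrable f"
  shows "(\<integral>\<^sup>+x. ennreal ((cmod (f x))\<^sup>2) \<partial>half_line) = ennreal ((norm (l2_class f))\<^sup>2)"
proof -
  have "(\<integral>\<^sup>+x. ennreal ((cmod (f x))\<^sup>2) \<partial>half_line) = ennreal (\<integral>x. (cmod (f x))\<^sup>2 \<partial>half_line)"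
    using assms by (intro nn_integral_eq_integral) (auto simp: square_integrable_def)
  then show ?thesis using assms by (simp add: norm_l2_class)
qed

lemma square_integrableI_nn_integral:
  assumes "f \<in> borel_measurable half_line" "(\<integral>\<^sup>+x. ennreal ((cmod (f x))\<^sup>2) \<partial>half_line) < \<infinity>"
  shows "square_integrable f"
  using assms unfolding square_integrable_def by (auto intro!: integrableI_nonneg)

text \<open>As in the Riesz-Fischer theorem: the sum \<open>h\<close> of the moduli of the successive differences is square integrable by
monotone convergence, so the representatives converge almost everywhere, and Fatou's lemma gives convergence in norm.\<close>

lemma l2_fast_Cauchy_convergent:
  fixes X :: "nat \<Rightarrow> l2"
  assumes fast: "\<And>k m. k \<le> m \<Longrightarrow> norm (X m - X k) \<le> 1 / 2 ^ k"
  shows "convergent X"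
proof -
  define f where "f k = rep_l2 (X k)" for k
  have sq: "square_integrable (f k)" and X: "X k = l2_class (f k)" for k
    by (simp_all add: f_def square_integrable_rep_l2)
  have fm[measurable]: "f k \<in> borel_measurable half_line" for k using sq by (simp add: square_integrable_def)
  define h where "h n x = (\<Sum>k<n. cmod (f (Suc k) x - f k x))" for n x
  have hm[measurable]: "h n \<in> borel_measurable half_line" for n unfolding h_def by measurable
  define dk where "dk k x = complex_of_real (cmod (f (Suc k) x - f k x))" for k x
  have dk: "square_integrable (dk k)" for k
    using square_integrable_diff[OF sq[of "Suc k"] sq[of k]] unfolding square_integrable_def dk_def by auto
  have ndk: "norm (l2_class (dk k)) \<le> 1 / 2 ^ k" for k
  proof -
    have "norm (l2_class (dk k)) = norm (X (Suc k) - X k)"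
      by (simp add: X l2_class_diff sq square_integrable_diff norm_l2_class dk del: ) (simp add: dk_def)
    then show ?thesis using fast[of k "Suc k"] by simp
  qed
  have hsq: "square_integrable (\<lambda>x. complex_of_real (h n x)) \<and> l2_class (\<lambda>x. complex_of_real (h n x)) = (\<Sum>k<n. l2_class (dk k))" for n
  proof (induction n)
    case 0
    then show ?case by (simp add: h_def square_integrable_0 zero_l2.abs_eq)
  next
    case (Suc n)
    have "(\<lambda>x. complex_of_real (h (Suc n) x)) = (\<lambda>x. complex_of_real (h n x) + dk n x)"
      by (auto simp: h_def dk_def)
    then show ?case using Suc dk[of n] by (simp add: square_integrable_add flip: l2_class_add)
  qed
  have hn: "(\<integral>\<^sup>+x. ennreal ((h n x)\<^sup>2) \<partial>half_line) \<le> 4" for n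
  proof -
    have "norm (\<Sum>k<n. l2_class (dk k)) \<le> (\<Sum>k<n. 1 / 2 ^ k)"
      by (rule order_trans[OF norm_sum]) (intro sum_mono ndk)
    also have "(\<Sum>k<n. 1 / 2 ^ k) = 2 - 2 / (2::real) ^ n" by (induction n) (auto simp: field_simps)
    also have "\<dots> \<le> 2" by simp
    finally have "(norm (l2_class (\<lambda>x. complex_of_real (h n x))))\<^sup>2 \<le> 2\<^sup>2"
      using hsq[of n] by (intro power_mono) auto
    then have "ennreal ((norm (l2_class (\<lambda>x. complex_of_real (h n x))))\<^sup>2) \<le> ennreal 4" by (intro ennreal_leI) simp
    then show ?thesis using nn_integral_l2_class[of "\<lambda>x. complex_of_real (h n x)"] hsq[of n] by simp
  qed
  have "(\<integral>\<^sup>+x. (SUP n. ennreal ((h n x)\<^sup>2)) \<partial>half_line) = (SUP n. \<integral>\<^sup>+x. ennreal ((h n x)\<^sup>2) \<partial>half_line)"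
  proof (rule nn_integral_monotone_convergence_SUP)
    show "incseq (\<lambda>n x. ennreal ((h n x)\<^sup>2))"
      unfolding incseq_def le_fun_def h_def by (auto intro!: ennreal_leI power_mono sum_mono2 sum_nonneg)
  qed measurable
  also have "\<dots> \<le> 4" using hn by (intro SUP_least)
  finally have "AE x in half_line. (SUP n. ennreal ((h n x)\<^sup>2)) \<noteq> \<infinity>"
    by (intro nn_integral_PInf_AE) (auto simp: top_unique)
  then have conv: "AE x in half_line. convergent (\<lambda>n. f n x)"
  proof (rule eventually_mono)
    fix x assume "(SUP n. ennreal ((h n x)\<^sup>2)) \<noteq> \<infinity>"
    then obtain C where C: "0 \<le> C" "(SUP n. ennreal ((h n x)\<^sup>2)) = ennreal C" by (cases "SUP n. ennreal ((h n x)\<^sup>2)") auto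
    have "(h n x)\<^sup>2 \<le> C" for n
      using SUP_upper[of n UNIV "\<lambda>n. ennreal ((h n x)\<^sup>2)"] C by (simp add: ennreal_le_iff)
    then have "h n x \<le> sqrt C" for n by (simp add: real_le_rsqrt)
    then have "summable (\<lambda>k. cmod (f (Suc k) x - f k x))"
      unfolding h_def by (intro summableI_nonneg_bounded[of _ "sqrt C"]) auto
    then have "summable (\<lambda>k. f (Suc k) x - f k x)" by (rule summable_norm_cancel)
    then have "convergent (\<lambda>n. \<Sum>k<n. f (Suc k) x - f k x)" by (simp add: summable_iff_convergent)
    then have "convergent (\<lambda>n. f n x - f 0 x)" by (simp only: sum_lessThan_telescope[of "\<lambda>k. f k x"])
    then show "convergent (\<lambda>n. f n x)" using convergent_diff_const_right_iff by blast
  qed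
  define F where "F x = lim (\<lambda>n. f n x)" for x
  have Fm[measurable]: "F \<in> borel_measurable half_line" unfolding F_def by measurable
  have bound: "(\<integral>\<^sup>+x. ennreal ((cmod (F x - f k x))\<^sup>2) \<partial>half_line) \<le> ennreal ((1/2^k)\<^sup>2)" for k
  proof -
    have "(\<integral>\<^sup>+x. ennreal ((cmod (F x - f k x))\<^sup>2) \<partial>half_line) = (\<integral>\<^sup>+x. liminf (\<lambda>m. ennreal ((cmod (f m x - f k x))\<^sup>2)) \<partial>half_line)"
    proof (rule nn_integral_cong_AE, use conv in \<open>rule eventually_mono\<close>)
      fix x assume "convergent (\<lambda>n. f n x)"
      then have "(\<lambda>n. f n x) \<longlonglongrightarrow> F x" by (simp add: F_def convergent_LIMSEQ_iff)
      then have "(\<lambda>m. ennreal ((cmod (f m x - f k x))\<^sup>2)) \<longlonglongrightarrow> ennreal ((cmod (F x - f k x))\<^sup>2)"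
        by (intro tendsto_intros tendsto_ennrealI)
      then show "ennreal ((cmod (F x - f k x))\<^sup>2) = liminf (\<lambda>m. ennreal ((cmod (f m x - f k x))\<^sup>2))"
        using lim_imp_Liminf[OF trivial_limit_sequentially] by metis
    qed
    also have "\<dots> \<le> liminf (\<lambda>m. \<integral>\<^sup>+x. ennreal ((cmod (f m x - f k x))\<^sup>2) \<partial>half_line)"
    proof (rule nn_integral_liminf)
      show "(\<lambda>x. ennreal ((cmod (f m x - f k x))\<^sup>2)) \<in> borel_measurable half_line" for m by measurable
    qed
    also have "\<dots> \<le> ennreal ((1/2^k)\<^sup>2)"
    proof (rule Liminf_le)
      show "\<forall>\<^sub>F m in sequentially. (\<integral>\<^sup>+x. ennreal ((cmod (f m x - f k x))\<^sup>2) \<partial>half_line) \<le> ennreal ((1/2^k)\<^sup>2)"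
      proof (rule eventually_sequentiallyI[of k])
        fix m assume "k \<le> m"
        then have "(norm (X m - X k))\<^sup>2 \<le> (1/2^k)\<^sup>2" using fast by (intro power_mono) auto
        then show "(\<integral>\<^sup>+x. ennreal ((cmod (f m x - f k x))\<^sup>2) \<partial>half_line) \<le> ennreal ((1/2^k)\<^sup>2)"
          using nn_integral_l2_class[OF square_integrable_diff[OF sq[of m] sq[of k]]]
          by (simp add: X l2_class_diff sq ennreal_leI)
      qed
    qed simp
    finally show ?thesis .
  qed
  have sqd: "square_integrable (\<lambda>x. F x - f k x)" for k
    by (rule square_integrableI_nn_integral) (use bound[of k] in \<open>auto intro: le_less_trans\<close>)
  have sqF: "square_integrable F" using square_integrable_add[OF sqd[of 0] sq[of 0]] by simp
  have "norm (X k - l2_class F) \<le> 1 / 2 ^ k" for k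
  proof -
    have "ennreal ((norm (l2_class F - X k))\<^sup>2) = (\<integral>\<^sup>+x. ennreal ((cmod (F x - f k x))\<^sup>2) \<partial>half_line)"
      unfolding X l2_class_diff[OF sqF sq] by (rule nn_integral_l2_class[OF sqd, symmetric])
    also note bound[of k]
    finally have "(norm (l2_class F - X k))\<^sup>2 \<le> (1/2^k)\<^sup>2"
      by (subst (asm) ennreal_le_iff) (rule zero_le_power2)
    then have "norm (l2_class F - X k) \<le> 1/2^k" by (rule power2_le_imp_le) simp
    then show ?thesis by (simp add: norm_minus_commute)
  qed
  moreover have "(\<lambda>k. 1 / 2 ^ k :: real) \<longlonglongrightarrow> 0"
    using LIMSEQ_power_zero[of "1/2::real"] by (simp add: power_one_over)
  ultimately have "(\<lambda>k. X k - l2_class F) \<longlonglongrightarrow> 0"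
    using Lim_null_comparison[of "\<lambda>k. X k - l2_class F" "\<lambda>k. 1 / 2 ^ k" sequentially]
    by (simp add: eventually_sequentially)
  then show ?thesis using LIM_zero_iff convergent_def by blast
qed

instance l2 :: complete_space
proof
  fix X :: "nat \<Rightarrow> l2" assume X: "Cauchy X"
  have "\<forall>k. \<exists>N. \<forall>m\<ge>N. \<forall>n\<ge>N. norm (X m - X n) < 1 / 2 ^ k"
    using X unfolding Cauchy_iff by simp
  then obtain N where N: "\<And>k m n. N k \<le> m \<Longrightarrow> N k \<le> n \<Longrightarrow> norm (X m - X n) < 1 / 2 ^ k" by metis
  define r where "r k = (\<Sum>i\<le>k. N i) + k" for k
  have rm: "strict_mono r" by (auto simp: strict_mono_Suc_iff r_def)
  have rN: "N k \<le> r k" for k unfolding r_def by (rule trans_le_add1, rule member_le_sum) auto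
  have "norm ((X \<circ> r) m - (X \<circ> r) k) \<le> 1 / 2 ^ k" if "k \<le> m" for k m
  proof -
    have "r k \<le> r m" using rm that by (simp add: strict_mono_less_eq)
    then show ?thesis using N[of k "r m" "r k"] rN[of k] by simp
  qed
  then have "convergent (X \<circ> r)" by (rule l2_fast_Cauchy_convergent)
  then obtain L where L: "(X \<circ> r) \<longlonglongrightarrow> L" by (auto simp: convergent_def)
  have "X \<longlonglongrightarrow> L"
  proof (rule metric_LIMSEQ_I)
    fix e :: real assume "e > 0"
    then obtain M where M: "\<And>m n. m \<ge> M \<Longrightarrow> n \<ge> M \<Longrightarrow> dist (X m) (X n) < e/2"
      using X unfolding Cauchy_def by (meson half_gt_zero)
    obtain M' where M': "\<And>n. n \<ge> M' \<Longrightarrow> dist ((X \<circ> r) n) L < e/2"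
      using metric_LIMSEQ_D[OF L, of "e/2"] \<open>e > 0\<close> by auto
    have "dist (X n) L < e" if "n \<ge> M" for n
    proof -
      have "max M M' \<le> r (max M M')" using seq_suble[OF rm] .
      then have "dist (X n) (X (r (max M M'))) < e/2" using that by (intro M) auto
      moreover have "dist (X (r (max M M'))) L < e/2" using M'[of "max M M'"] by simp
      ultimately show ?thesis by (metis dist_triangle_half_l dist_commute)
    qed
    then show "\<exists>no. \<forall>n\<ge>no. dist (X n) L < e" by blast
  qed
  then show "convergent X" by (auto simp: convergent_def)
qed

section \<open>Precompact sets and orthogonal projections\<close>

lemma compact_closure_if_totally_bounded:
  fixes S :: "'a::complete_space set"
  assumes "\<And>e. e > 0 \<Longrightarrow> \<exists>k. finite k \<and> S \<subseteq> (\<Union>x\<in>k. ball x e)"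
  shows "compact (closure S)"
  unfolding compact_eq_totally_bounded
proof (intro conjI allI impI)
  show "complete (closure S)" by (simp add: complete_eq_closed)
  fix e :: real assume "e > 0"
  then obtain k where k: "finite k" "S \<subseteq> (\<Union>x\<in>k. ball x (e/2))" using assms[of "e/2"] by auto
  have "closed (\<Union>x\<in>k. cball x (e/2))" using k(1) by (intro closed_UN) auto
  moreover have "(\<Union>x\<in>k. ball x (e/2)) \<subseteq> (\<Union>x\<in>k. cball x (e/2))" by (intro UN_mono) auto
  then have "S \<subseteq> (\<Union>x\<in>k. cball x (e/2))" using k(2) by (rule order_trans[rotated])
  ultimately have "closure S \<subseteq> (\<Union>x\<in>k. cball x (e/2))" by (rule closure_minimal[rotated])
  also have "\<dots> \<subseteq> (\<Union>x\<in>k. ball x e)" using \<open>e > 0\<close> by (intro UN_mono) auto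
  finally show "\<exists>k. finite k \<and> closure S \<subseteq> (\<Union>x\<in>k. ball x e)" using k(1) by blast
qed

lemma compact_closure_subset:
  fixes S :: "'a::t2_space set"
  assumes "compact C" "S \<subseteq> C" shows "compact (closure S)"
  by (metis assms closure_minimal compact_Int_closed compact_imp_closed closed_closure inf.absorb2)

text \<open>The minimizer of \<open>J x = norm x ^ 2 - 2 * \<phi> x\<close> on \<open>M\<close> represents \<open>\<phi>\<close>. Minimizing sequences are Cauchy by the
parallelogram law. For \<open>\<phi> = inner h\<close> this is the orthogonal projection of \<open>h\<close> onto \<open>M\<close>, for \<open>M = UNIV\<close> it provides
adjoints.\<close>

lemma riesz_representation_subspace:
  fixes M :: "'a::{real_inner,complete_space} set" and \<phi> :: "'a \<Rightarrow> real"
  assumes sub: "subspace M" and clo: "closed M" and phi: "bounded_linear \<phi>"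
  obtains a where "a \<in> M" "\<And>x. x \<in> M \<Longrightarrow> \<phi> x = inner a x"
proof -
  interpret \<phi>: bounded_linear \<phi> by (rule phi)
  define J where "J x = inner x x - 2 * \<phi> x" for x
  obtain K where K: "\<And>x. norm (\<phi> x) \<le> norm x * K" using \<phi>.bounded by blast
  have lower: "- K\<^sup>2 \<le> J x" for x
  proof -
    have "\<phi> x \<le> norm x * K" using K[of x] by simp
    then have "J x \<ge> (norm x)\<^sup>2 - 2 * (norm x * K)" unfolding J_def by (simp add: power2_norm_eq_inner)
    moreover have "(norm x)\<^sup>2 - 2 * (norm x * K) + K\<^sup>2 = (norm x - K)\<^sup>2" by (simp add: power2_diff)
    moreover have "0 \<le> (norm x - K)\<^sup>2" by simp
    ultimately show ?thesis by linarith
  qed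
  have bdd: "bdd_below (J ` M)" using lower by (intro bdd_belowI2)
  have ne: "J ` M \<noteq> {}" using subspace_0[OF sub] by blast
  define I where "I = Inf (J ` M)"
  have IM: "I \<le> J x" if "x \<in> M" for x unfolding I_def using that bdd by (intro cInf_lower) auto
  have "\<exists>x\<in>M. J x < I + 1 / (real n + 1)" for n
  proof -
    have "Inf (J ` M) < I + 1 / (real n + 1)" by (simp add: I_def add_pos_nonneg)
    then show ?thesis using cInf_lessD[OF ne] by blast
  qed
  then obtain x where x: "\<And>n. x n \<in> M" "\<And>n. J (x n) < I + 1 / (real n + 1)" by metis
  have par: "(norm (u - v))\<^sup>2 \<le> 2 * (J u - I) + 2 * (J v - I)" if "u \<in> M" "v \<in> M" for u v
  proof -
    define w where "w = (1/2) *\<^sub>R (u + v)"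
    have "w \<in> M" unfolding w_def using that sub by (intro subspace_scale subspace_add)
    then have 1: "I \<le> J w" by (rule IM)
    have 2: "4 * J w = 2 * J u + 2 * J v - (norm (u - v))\<^sup>2"
      unfolding J_def w_def power2_norm_eq_inner
      by (simp add: \<phi>.scaleR \<phi>.add inner_add_left inner_add_right inner_diff_left inner_diff_right inner_commute algebra_simps)
    have "n \<le> 2 * (a - I) + 2 * (b - I)" if "I \<le> j" "4 * j = 2 * a + 2 * b - n" for n a b j :: real
      using that by (simp add: algebra_simps)
    from this[OF 1 2] show ?thesis .
  qed
  have "Cauchy x"
  proof (rule CauchyI)
    fix e :: real assume "0 < e"
    then obtain N where N: "4 / e\<^sup>2 < real N" using reals_Archimedean2 by blast
    show "\<exists>M. \<forall>m\<ge>M. \<forall>n\<ge>M. norm (x m - x n) < e"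
    proof (intro exI[of _ N] allI impI)
      fix m n assume mn: "m \<ge> N" "n \<ge> N"
      have b: "1 / (real k + 1) \<le> 1 / (real N + 1)" if "k \<ge> N" for k using that by (simp add: frac_le)
      have "4 / (real N + 1) < e\<^sup>2"
      proof -
        have "4 < real N * e\<^sup>2" using N \<open>0 < e\<close> by (simp add: pos_divide_less_eq)
        also have "\<dots> \<le> (real N + 1) * e\<^sup>2" by (intro mult_right_mono) auto
        finally show ?thesis by (simp add: pos_divide_less_eq mult.commute add_nonneg_pos)
      qed
      moreover have "(norm (x m - x n))\<^sup>2 \<le> 4 * (1 / (real N + 1))"
      proof -
        have "J (x m) - I \<le> 1 / (real N + 1)" "J (x n) - I \<le> 1 / (real N + 1)"
          using x(2)[of m] x(2)[of n] b[OF mn(1)] b[OF mn(2)] by linarith+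
        moreover have "2 * a + 2 * b \<le> 4 * d" if "a \<le> d" "b \<le> d" for a b d :: real using that by linarith
        ultimately have "2 * (J (x m) - I) + 2 * (J (x n) - I) \<le> 4 * (1 / (real N + 1))" by blast
        then show ?thesis using par[OF x(1)[of m] x(1)[of n]] by (rule order_trans[rotated])
      qed
      ultimately have "(norm (x m - x n))\<^sup>2 < e\<^sup>2" by simp
      then show "norm (x m - x n) < e" using \<open>0 < e\<close> by (simp add: power_less_imp_less_base)
    qed
  qed
  then obtain a where a: "x \<longlonglongrightarrow> a" using Cauchy_convergent convergent_def by blast
  have aM: "a \<in> M" using clo x(1) a closed_sequentially by blast
  have "(\<lambda>n. J (x n)) \<longlonglongrightarrow> J a" unfolding J_def by (intro tendsto_intros \<phi>.tendsto a)
  moreover have "(\<lambda>n. I + 1 / (real n + 1)) \<longlonglongrightarrow> I + 0"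
    using LIMSEQ_inverse_real_of_nat by (intro tendsto_intros) (simp add: inverse_eq_divide add.commute)
  ultimately have "J a \<le> I + 0" by (rule LIMSEQ_le) (use x(2) less_imp_le in blast)
  then have Ja: "J a \<le> I" by simp
  show ?thesis
  proof (rule that[OF aM])
    fix z assume z: "z \<in> M"
    define c where "c = inner a z - \<phi> z"
    have q: "0 \<le> 2 * t * c + t\<^sup>2 * inner z z" for t
    proof -
      have "a + t *\<^sub>R z \<in> M" using sub aM z by (intro subspace_add subspace_scale)
      then have "J a \<le> J (a + t *\<^sub>R z)" using IM Ja by force
      then show ?thesis unfolding J_def c_def
        by (simp add: \<phi>.add \<phi>.scaleR inner_add_left inner_add_right inner_commute algebra_simps power2_eq_square)
    qed
    have "c = 0"
    proof (rule ccontr)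
      assume "c \<noteq> 0"
      define k where "k = inner z z + 1"
      have k: "k > 0" by (simp add: k_def add_nonneg_pos)
      have "0 \<le> 2 * (- c / k) * c + (- c / k)\<^sup>2 * inner z z" by (rule q)
      also have "\<dots> \<le> 2 * (- c / k) * c + (- c / k)\<^sup>2 * k" by (intro add_left_mono mult_left_mono) (auto simp: k_def)
      also have "\<dots> = - c\<^sup>2 / k" using k by (simp add: power2_eq_square field_simps)
      finally show False using k \<open>c \<noteq> 0\<close> by (simp add: divide_le_0_iff zero_le_divide_iff)
    qed
    then show "\<phi> z = inner a z" by (simp add: c_def)
  qed
qed

section \<open>Extending an accretive relation to a compact operator\<close>

text \<open>The kernel of an accretive operator is orthogonal to its range: the quadratic function
\<open>t \<mapsto> inner (K (h + t z)) (h + t z)\<close> is nonnegative and has a zero at \<open>t = 0\<close>, so its linear coefficient vanishes.\<close>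

lemma accretive_ker:
  fixes K :: "'a::real_inner \<Rightarrow> 'a"
  assumes lin: "linear K" and acc: "\<And>h. 0 \<le> inner (K h) h" and h: "K h = 0"
  shows "inner (K z) h = 0"
proof -
  have q: "0 \<le> t * inner (K z) h + t\<^sup>2 * inner (K z) z" for t
    using acc[of "h + t *\<^sub>R z"] h
    by (simp add: linear_add[OF lin] linear_scale[OF lin] inner_add_right power2_eq_square)
  define c k where "c = inner (K z) h" and "k = inner (K z) z + 1"
  have k: "k > 0" using acc[of z] by (simp add: k_def)
  have "0 \<le> (- c / k) * c + (- c / k)\<^sup>2 * inner (K z) z" using q[of "- c / k"] by (simp add: c_def)
  also have "inner (K z) z = k - 1" by (simp add: k_def)
  also have "(- c / k) * c + (- c / k)\<^sup>2 * (k - 1) = - c\<^sup>2 / k\<^sup>2" using k by (simp add: power2_eq_square field_simps)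
  finally show ?thesis using k by (simp add: c_def divide_le_0_iff zero_le_divide_iff)
qed

lemma subspace_closure:
  fixes S :: "'a::real_normed_vector set"
  assumes "subspace S" shows "subspace (closure S)"
  unfolding subspace_def
proof (intro conjI ballI allI)
  show "0 \<in> closure S" using subspace_0[OF assms] closure_subset by blast
next
  fix x y assume "x \<in> closure S" "y \<in> closure S"
  then obtain u v where "\<And>n. u n \<in> S" "u \<longlonglongrightarrow> x" "\<And>n. v n \<in> S" "v \<longlonglongrightarrow> y"
    unfolding closure_sequential by blast
  then show "x + y \<in> closure S"
    unfolding closure_sequential using subspace_add[OF assms] by (intro exI[of _ "\<lambda>n. u n + v n"]) (auto intro: tendsto_add)
next
  fix c :: real and x assume "x \<in> closure S"
  then obtain u where "\<And>n. u n \<in> S" "u \<longlonglongrightarrow> x" unfolding closure_sequential by blast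
  then show "c *\<^sub>R x \<in> closure S"
    unfolding closure_sequential using subspace_scale[OF assms] by (intro exI[of _ "\<lambda>n. c *\<^sub>R u n"]) (auto intro: tendsto_scaleR)
qed

lemma bounded_linear_skew_closure:
  fixes R :: "('a::real_normed_vector \<times> 'a) set"
  assumes J: "bounded_linear J" and inv: "\<And>g x. (g, x) \<in> R \<Longrightarrow> (J g, J x) \<in> R" and gx: "(g, x) \<in> closure R"
  shows "(J g, J x) \<in> closure R"
proof -
  let ?h = "\<lambda>p. (J (fst p), J (snd p))"
  have "continuous_on (closure R) ?h"
    by (intro continuous_intros bounded_linear.continuous_on[OF J])
  moreover have "?h ` R \<subseteq> closure R" using inv closure_subset by fastforce
  ultimately have "?h ` closure R \<subseteq> closure R" by (intro image_closure_subset) auto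
  then show ?thesis using gx by force
qed

text \<open>The relation \<open>R\<close> consists of the pairs (value, argument) of the operator to be extended, so \<open>R\<close> is the
graph of its inverse. Its closure is the graph of a contraction \<open>T\<close> on a closed subspace \<open>M\<close>. Let \<open>P\<close> be the
projection onto \<open>M\<close>, let \<open>B = T P\<close> and \<open>K = B - B\<^sup>* (1 - P)\<close>. The cross terms in
\<open>inner (K h) h = inner (B h) (P h)\<close> cancel, so \<open>K\<close> is accretive; thus the kernel of \<open>K\<close> is orthogonal to its range,
which contains a dense set. The last conclusion says that \<open>K\<close> commutes with every skew operator \<open>J\<close> that
respects \<open>R\<close>; it yields complex linearity from a construction in a real Hilbert space.\<close>

theorem compact_accretive_extension:
  fixes R :: "('a::{real_inner,complete_space} \<times> 'a) set"
  assumes sub: "subspace R"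
    and acc: "\<And>g x. (g, x) \<in> R \<Longrightarrow> (norm x)\<^sup>2 \<le> inner g x"
    and cpt: "compact (closure {x. \<exists>g. (g, x) \<in> R \<and> norm g \<le> 1})"
    and dense: "\<And>h. (\<And>g x. (g, x) \<in> R \<Longrightarrow> inner x h = 0) \<Longrightarrow> h = 0"
  shows "\<exists>K. bounded_linear K \<and> inj K \<and> (\<forall>g x. (g, x) \<in> R \<longrightarrow> K g = x) \<and>
    (\<forall>S. bounded S \<longrightarrow> compact (closure (K ` S))) \<and>
    (\<forall>J h. bounded_linear J \<longrightarrow> (\<forall>x y. inner (J x) y = - inner x (J y)) \<longrightarrow>
       (\<forall>g x. (g, x) \<in> R \<longrightarrow> (J g, J x) \<in> R) \<longrightarrow> K (J h) = J (K h))"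
proof -
  \<comment> \<open>passing to the closure makes the domain \<open>M\<close> of the inverse closed\<close>
  define Q where "Q = closure R"
  have subQ: "subspace Q" unfolding Q_def by (rule subspace_closure[OF sub])
  have RQ: "R \<subseteq> Q" unfolding Q_def by (rule closure_subset)
  have accQ: "(norm x)\<^sup>2 \<le> inner g x" if "(g, x) \<in> Q" for g x
  proof -
    have "closed {p :: 'a \<times> 'a. (norm (snd p))\<^sup>2 \<le> inner (fst p) (snd p)}"
      by (intro closed_Collect_le continuous_intros)
    moreover have "R \<subseteq> {p. (norm (snd p))\<^sup>2 \<le> inner (fst p) (snd p)}" using acc by auto
    ultimately have "Q \<subseteq> {p. (norm (snd p))\<^sup>2 \<le> inner (fst p) (snd p)}" unfolding Q_def by (rule closure_minimal[rotated])
    then show ?thesis using that by auto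
  qed
  have nQ: "norm x \<le> norm g" if "(g, x) \<in> Q" for g x
  proof -
    have "(norm x)\<^sup>2 \<le> norm g * norm x" using accQ[OF that] norm_cauchy_schwarz[of g x] by linarith
    then have "norm x * norm x \<le> norm g * norm x" by (simp add: power2_eq_square)
    then show ?thesis by (cases "norm x = 0") (auto simp: mult_le_cancel_right)
  qed
  have addQ: "(g + g', x + x') \<in> Q" if "(g, x) \<in> Q" "(g', x') \<in> Q" for g x g' x'
    using subspace_add[OF subQ that] by simp
  have scaleQ: "(c *\<^sub>R g, c *\<^sub>R x) \<in> Q" if "(g, x) \<in> Q" for g x c
    using subspace_scale[OF subQ that] by simp
  have diffQ: "(g - g', x - x') \<in> Q" if "(g, x) \<in> Q" "(g', x') \<in> Q" for g x g' x'
    using subspace_diff[OF subQ that] by simp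
  have uniq: "x = x'" if "(g, x) \<in> Q" "(g, x') \<in> Q" for g x x'
    using nQ[OF diffQ[OF that]] by simp
  define M where "M = fst ` Q"
  have subM: "subspace M" unfolding M_def by (rule linear_subspace_image[OF _ subQ]) (rule linear_fst)
  define T where "T g = (SOME x. (g, x) \<in> Q)" for g
  have TQ: "(g, T g) \<in> Q" if "g \<in> M" for g
    unfolding T_def by (rule someI_ex) (use that in \<open>auto simp: M_def\<close>)
  have Tu: "T g = x" if "(g, x) \<in> Q" for g x
  proof -
    have "g \<in> M" using that unfolding M_def by force
    then show ?thesis using uniq[OF TQ that] by simp
  qed
  have cloM: "closed M"
    unfolding closed_sequential_limits
  proof (intro allI impI, elim conjE)
    fix g l assume g: "\<forall>n. g n \<in> M" "g \<longlonglongrightarrow> l"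
    have "Cauchy g" using g(2) LIMSEQ_imp_Cauchy by blast
    have "Cauchy (\<lambda>n. T (g n))"
    proof (rule CauchyI)
      fix e :: real assume "0 < e"
      then obtain N where "\<forall>m\<ge>N. \<forall>n\<ge>N. norm (g m - g n) < e" using CauchyD[OF \<open>Cauchy g\<close>] by blast
      then show "\<exists>N. \<forall>m\<ge>N. \<forall>n\<ge>N. norm (T (g m) - T (g n)) < e"
        using nQ[OF diffQ[OF TQ TQ]] g(1) by (meson le_less_trans)
    qed
    then obtain x where "(\<lambda>n. T (g n)) \<longlonglongrightarrow> x" using Cauchy_convergent convergent_def by blast
    then have "(\<lambda>n. (g n, T (g n))) \<longlonglongrightarrow> (l, x)" using g(2) by (intro tendsto_Pair)
    moreover have "closed Q" by (simp add: Q_def)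
    moreover have "(g n, T (g n)) \<in> Q" for n using g(1) by (intro TQ) blast
    ultimately have "(l, x) \<in> Q" using closed_sequentially[of Q "\<lambda>n. (g n, T (g n))" "(l, x)"] by blast
    then show "l \<in> M" unfolding M_def by force
  qed
  have "\<exists>a. a \<in> M \<and> (\<forall>x\<in>M. inner h x = inner a x)" for h
    using riesz_representation_subspace[OF subM cloM bounded_linear_inner_right[of h]] by metis
  then obtain P where P: "\<And>h. P h \<in> M" "\<And>h x. x \<in> M \<Longrightarrow> inner h x = inner (P h) x" by metis
  have Pu: "P h = a" if "a \<in> M" "\<And>x. x \<in> M \<Longrightarrow> inner h x = inner a x" for h a
  proof -
    have "P h - a \<in> M" using P(1) that(1) subM by (intro subspace_diff)
    then have "inner (P h - a) (P h - a) = 0"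
      using that(2)[of "P h - a"] P(2)[of "P h - a" h] by (simp add: inner_diff_left)
    then show ?thesis by simp
  qed
  have Padd: "P (u + v) = P u + P v" for u v
  proof (rule Pu)
    show "P u + P v \<in> M" by (intro subspace_add[OF subM] P(1))
    show "inner (u + v) x = inner (P u + P v) x" if "x \<in> M" for x
      using P(2)[OF that, of u] P(2)[OF that, of v] by (simp add: inner_add_left)
  qed
  have Pscale: "P (c *\<^sub>R u) = c *\<^sub>R P u" for c u
  proof (rule Pu)
    show "c *\<^sub>R P u \<in> M" by (intro subspace_scale[OF subM] P(1))
    show "inner (c *\<^sub>R u) x = inner (c *\<^sub>R P u) x" if "x \<in> M" for x
      using P(2)[OF that, of u] by simp
  qed
  have PM: "P h = h" if "h \<in> M" for h by (rule Pu) (use that in auto)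
  have Pn: "norm (P h) \<le> norm h" for h
  proof -
    have "(norm (P h))\<^sup>2 = inner h (P h)" using P(2)[OF P(1)[of h], of h] by (simp add: power2_norm_eq_inner)
    then have "norm (P h) * norm (P h) \<le> norm h * norm (P h)"
      using norm_cauchy_schwarz[of h "P h"] by (simp add: power2_eq_square)
    then show ?thesis by (cases "norm (P h) = 0") (auto simp: mult_le_cancel_right)
  qed
  define B where "B h = T (P h)" for h
  have BQ: "(P h, B h) \<in> Q" for h unfolding B_def by (rule TQ[OF P(1)])
  have Badd: "B (u + v) = B u + B v" for u v unfolding B_def[of "u + v"] Padd by (rule Tu[OF addQ[OF BQ BQ]])
  have Bscale: "B (c *\<^sub>R u) = c *\<^sub>R B u" for c u unfolding B_def[of "c *\<^sub>R u"] Pscale by (rule Tu[OF scaleQ[OF BQ]])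
  have Bn: "norm (B h) \<le> norm h" for h using nQ[OF BQ[of h]] Pn[of h] by linarith
  have Bbl: "bounded_linear B" by (rule bounded_linear_intro[of B 1]) (auto simp: Badd Bscale Bn)
  have "\<exists>a. \<forall>x. inner (B x) y = inner a x" for y
    using riesz_representation_subspace[OF subspace_UNIV closed_UNIV bounded_linear_compose[OF bounded_linear_inner_left[of y] Bbl]]
    by (metis UNIV_I)
  then obtain Bs where Bs: "\<And>x y. inner (B x) y = inner (Bs y) x" by metis
  have Bsu: "Bs y = a" if "\<And>x. inner (B x) y = inner a x" for y a
  proof -
    have "inner (Bs y - a) (Bs y - a) = 0" using that[of "Bs y - a"] Bs[of "Bs y - a" y] by (simp add: inner_diff_left)
    then show ?thesis by simp
  qed
  have Bsadd: "Bs (u + v) = Bs u + Bs v" for u v by (rule Bsu) (simp add: Bs inner_add_left inner_add_right)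
  have Bsscale: "Bs (c *\<^sub>R u) = c *\<^sub>R Bs u" for c u by (rule Bsu) (simp add: Bs)
  have Bsdiff: "Bs (u - v) = Bs u - Bs v" for u v
    using Bsadd[of u "- v"] Bsscale[of "-1" v] by simp
  have Bsn: "norm (Bs y) \<le> norm y" for y
  proof -
    have "(norm (Bs y))\<^sup>2 = inner (B (Bs y)) y" by (simp add: Bs power2_norm_eq_inner)
    also have "\<dots> \<le> norm (B (Bs y)) * norm y" by (rule norm_cauchy_schwarz)
    also have "\<dots> \<le> norm (Bs y) * norm y" using Bn by (intro mult_right_mono) auto
    finally have "norm (Bs y) * norm (Bs y) \<le> norm y * norm (Bs y)" by (simp add: power2_eq_square mult.commute)
    then show ?thesis by (cases "norm (Bs y) = 0") (auto simp: mult_le_cancel_right)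
  qed
  define K where "K h = B h - Bs (h - P h)" for h
  have Kadd: "K (u + v) = K u + K v" for u v
    by (simp add: K_def Badd Bsadd Bsdiff Padd algebra_simps)
  have Kscale: "K (c *\<^sub>R u) = c *\<^sub>R K u" for c u
    by (simp add: K_def Bscale Bsscale Bsdiff Pscale scaleR_diff_right)
  have Kbl: "bounded_linear K"
  proof (rule bounded_linear_intro[of K 3])
    fix h
    have "norm (K h) \<le> norm (B h) + norm (Bs (h - P h))" unfolding K_def by (rule norm_triangle_ineq4)
    moreover have "norm (Bs (h - P h)) \<le> norm h + norm (P h)" using Bsn[of "h - P h"] norm_triangle_ineq4[of h "P h"] by linarith
    ultimately show "norm (K h) \<le> norm h * 3" using Bn[of h] Pn[of h] by linarith
  qed (auto simp: Kadd Kscale)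
  have Klin: "linear K" using Kbl by (rule bounded_linear.linear)
  have Kacc: "0 \<le> inner (K h) h" for h
  proof -
    have "inner (K h) h = inner (B h) (P h)"
      by (simp add: K_def inner_diff_left inner_diff_right flip: Bs)
    also have "\<dots> \<ge> (norm (B h))\<^sup>2" using accQ[OF BQ[of h]] by (simp add: inner_commute)
    finally show ?thesis by (meson order_trans zero_le_power2)
  qed
  have KR: "K g = x" if "(g, x) \<in> R" for g x
  proof -
    have gx: "(g, x) \<in> Q" using that RQ by blast
    then have "g \<in> M" unfolding M_def by force
    moreover have "Bs 0 = 0" using Bsscale[of 0 0] by simp
    ultimately show ?thesis using Tu[OF gx] by (simp add: K_def B_def PM)
  qed
  have Kinj: "inj K"
  proof (rule linear_injective_0[OF Klin, THEN iffD2], intro allI impI)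
    fix h assume h: "K h = 0"
    show "h = 0"
    proof (rule dense)
      fix g x assume "(g, x) \<in> R"
      then show "inner x h = 0" using accretive_ker[OF Klin Kacc h, of g] KR by simp
    qed
  qed
  define C where "C = closure {x. \<exists>g. (g, x) \<in> R \<and> norm g \<le> 1}"
  have QC: "x \<in> C" if "(g, x) \<in> Q" "norm g < 1" for g x
  proof -
    obtain p where p: "\<And>n. p n \<in> R" "p \<longlonglongrightarrow> (g, x)" using \<open>(g, x) \<in> Q\<close> unfolding Q_def closure_sequential by blast
    have f: "(\<lambda>n. fst (p n)) \<longlonglongrightarrow> g" and s: "(\<lambda>n. snd (p n)) \<longlonglongrightarrow> x"
      using tendsto_fst[OF p(2)] tendsto_snd[OF p(2)] by auto
    have "\<forall>\<^sub>F n in sequentially. norm (fst (p n)) < 1" using tendsto_norm[OF f] \<open>norm g < 1\<close> by (rule order_tendstoD(2))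
    then have "\<forall>\<^sub>F n in sequentially. snd (p n) \<in> C"
    proof (rule eventually_mono)
      fix n assume "norm (fst (p n)) < 1"
      moreover have "(fst (p n), snd (p n)) \<in> R" using p(1)[of n] by simp
      ultimately have "snd (p n) \<in> {x. \<exists>g. (g, x) \<in> R \<and> norm g \<le> 1}"
        by (intro CollectI exI[of _ "fst (p n)"] conjI less_imp_le)
      then show "snd (p n) \<in> C" unfolding C_def by (rule subsetD[OF closure_subset])
    qed
    then show ?thesis using s by (intro Lim_in_closed_set[of C]) (auto simp: C_def)
  qed
  have cB: "compact (closure (B ` S))" if S: "bounded S" for S
  proof -
    obtain r where r: "r > 0" "\<And>h. h \<in> S \<Longrightarrow> norm h \<le> r" using S unfolding bounded_pos by blast
    have "B ` S \<subseteq> (\<lambda>x. (r + 1) *\<^sub>R x) ` C"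
    proof (rule image_subsetI)
      fix h assume h: "h \<in> S"
      have "norm (P ((1 / (r+1)) *\<^sub>R h)) \<le> norm h / (r + 1)" using Pn[of "(1 / (r+1)) *\<^sub>R h"] r by simp
      also have "\<dots> < 1" using r(1) r(2)[OF h] by simp
      finally have "B ((1 / (r+1)) *\<^sub>R h) \<in> C" by (rule QC[OF BQ])
      moreover have "B h = (r + 1) *\<^sub>R B ((1 / (r+1)) *\<^sub>R h)" using r by (simp add: Bscale)
      ultimately show "B h \<in> (\<lambda>x. (r + 1) *\<^sub>R x) ` C" by blast
    qed
    moreover have "compact ((\<lambda>x. (r + 1) *\<^sub>R x) ` C)" using cpt unfolding C_def by (rule compact_scaling)
    ultimately show ?thesis by (rule compact_closure_subset[rotated])
  qed
  have cBs: "compact (closure (Bs ` S))" if S: "bounded S" for S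
  proof (rule compact_closure_if_totally_bounded)
    fix e :: real assume e: "e > 0"
    obtain r where r: "r > 0" "\<And>h. h \<in> S \<Longrightarrow> norm h \<le> r" using S unfolding bounded_pos by blast
    have "bounded (Bs ` S)" unfolding bounded_iff using r Bsn order_trans by (metis imageE)
    then have "compact (closure (B ` (Bs ` S)))" by (rule cB)
    define \<eta> where "\<eta> = e\<^sup>2 / (2 * r)"
    have \<eta>: "\<eta> > 0" using e r by (simp add: \<eta>_def)
    have cov: "closure (B ` (Bs ` S)) \<subseteq> (\<Union>z\<in>S. ball (B (Bs z)) \<eta>)"
    proof
      fix w assume "w \<in> closure (B ` (Bs ` S))"
      then obtain v where "v \<in> B ` (Bs ` S)" "dist v w < \<eta>" using \<eta> unfolding closure_approachable by blast
      then show "w \<in> (\<Union>z\<in>S. ball (B (Bs z)) \<eta>)" by auto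
    qed
    obtain S' where S': "S' \<subseteq> S" "finite S'" "closure (B ` (Bs ` S)) \<subseteq> (\<Union>z\<in>S'. ball (B (Bs z)) \<eta>)"
      using compactE_image[OF \<open>compact (closure (B ` (Bs ` S)))\<close> _ cov] by blast
    show "\<exists>k. finite k \<and> Bs ` S \<subseteq> (\<Union>x\<in>k. ball x e)"
    proof (intro exI[of _ "Bs ` S'"] conjI image_subsetI)
      show "finite (Bs ` S')" using S' by simp
      fix y assume y: "y \<in> S"
      then have "B (Bs y) \<in> closure (B ` (Bs ` S))" by (intro subsetD[OF closure_subset] imageI)
      then obtain z where z: "z \<in> S'" "dist (B (Bs z)) (B (Bs y)) < \<eta>" using S' by auto
      have nd: "norm (B (Bs z - Bs y)) < \<eta>"
        using z(2) Badd[of "Bs z" "- Bs y"] Bscale[of "-1" "Bs y"] by (simp add: dist_norm)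
      \<comment> \<open>the adjoint of a compact operator is compact: \<open>\<bar>B\<^sup>* w\<bar>\<^sup>2\<close> is controlled by \<open>B B\<^sup>* w\<close>\<close>
      have "(norm (Bs z - Bs y))\<^sup>2 = inner (B (Bs z - Bs y)) (z - y)"
        by (simp add: Bs Bsdiff power2_norm_eq_inner)
      also have "\<dots> \<le> norm (B (Bs z - Bs y)) * norm (z - y)" by (rule norm_cauchy_schwarz)
      also have "\<dots> \<le> norm (B (Bs z - Bs y)) * (2 * r)"
        using norm_triangle_ineq4[of z y] r(2)[OF y] r(2)[of z] z S' by (intro mult_left_mono) auto
      also have "\<dots> < \<eta> * (2 * r)" using nd r by (intro mult_strict_right_mono) auto
      also have "\<dots> = e\<^sup>2" using r by (simp add: \<eta>_def)
      finally have "norm (Bs z - Bs y) < e" using e by (simp add: power_less_imp_less_base)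
      then show "Bs y \<in> (\<Union>x\<in>Bs ` S'. ball x e)" using z(1) by (auto simp: dist_norm)
    qed
  qed
  have cK: "compact (closure (K ` S))" if S: "bounded S" for S
  proof -
    obtain r where r: "r > 0" "\<And>h. h \<in> S \<Longrightarrow> norm h \<le> r" using S unfolding bounded_pos by blast
    have "norm (h - P h) \<le> 2 * r" if "h \<in> S" for h
      using norm_triangle_ineq4[of h "P h"] Pn[of h] r(2)[OF that] by linarith
    then have "bounded ((\<lambda>h. h - P h) ` S)" unfolding bounded_iff by blast
    then have "compact (closure (Bs ` ((\<lambda>h. h - P h) ` S)))" by (rule cBs)
    with cB[OF S] have "compact {x - y | x y. x \<in> closure (B ` S) \<and> y \<in> closure (Bs ` ((\<lambda>h. h - P h) ` S))}"
      by (rule compact_differences)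
    moreover have "K ` S \<subseteq> {x - y | x y. x \<in> closure (B ` S) \<and> y \<in> closure (Bs ` ((\<lambda>h. h - P h) ` S))}"
      unfolding K_def using closure_subset[of "B ` S"] closure_subset[of "Bs ` ((\<lambda>h. h - P h) ` S)"] by blast
    ultimately show ?thesis by (rule compact_closure_subset)
  qed
  have KJ: "K (J h) = J (K h)"
    if J: "bounded_linear J" and skew: "\<And>x y. inner (J x) y = - inner x (J y)"
      and inv: "\<And>g x. (g, x) \<in> R \<Longrightarrow> (J g, J x) \<in> R" for J h
  proof -
    interpret J: bounded_linear J by (rule J)
    have JQ: "(J g, J x) \<in> Q" if "(g, x) \<in> Q" for g x
      using bounded_linear_skew_closure[OF J inv] that unfolding Q_def by blast
    have JM: "J g \<in> M" if "g \<in> M" for g using JQ[OF TQ[OF that]] unfolding M_def by force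
    have PJ: "P (J h) = J (P h)" for h
    proof (rule Pu)
      show "J (P h) \<in> M" by (rule JM[OF P(1)])
      show "inner (J h) x = inner (J (P h)) x" if "x \<in> M" for x
        using P(2)[OF JM[OF that], of h] by (simp add: skew)
    qed
    have BJ: "B (J h) = J (B h)" for h
      unfolding B_def[of "J h"] PJ by (rule Tu[OF JQ[OF BQ]])
    have BsJ: "Bs (J y) = J (Bs y)" for y
    proof (rule Bsu)
      fix x
      have "inner (B x) (J y) = - inner (J (B x)) y" by (simp add: skew)
      also have "\<dots> = - inner (Bs y) (J x)" by (simp add: Bs flip: BJ)
      also have "\<dots> = inner (J (Bs y)) x" by (simp add: skew)
      finally show "inner (B x) (J y) = inner (J (Bs y)) x" .
    qed
    show ?thesis by (simp add: K_def BJ PJ BsJ J.diff flip: BsJ)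
  qed
  show ?thesis using Kbl Kinj KR cK KJ by (intro exI[of _ K] conjI allI impI) auto
qed

section \<open>Compact resolvents in the complex Hilbert space\<close>

lemma norm_l2_scale: "norm (l2_scale c u) = cmod c * norm u"
proof (cases u rule: l2_class_cases)
  case (1 f)
  have "norm (l2_class (\<lambda>x. c * f x)) = sqrt ((cmod c)\<^sup>2 * (\<integral>x. (cmod (f x))\<^sup>2 \<partial>half_line))"
    using 1 by (simp add: norm_l2_class square_integrable_scale norm_mult power_mult_distrib)
  then show ?thesis using 1 by (simp add: l2_class_scale norm_l2_class real_sqrt_mult)
qed

lemma inner_l2_scale: "inner (l2_scale c u) v = inner u (l2_scale (cnj c) v)"
proof (cases u rule: l2_class_cases)
  case (1 f)
  show ?thesis
  proof (cases v rule: l2_class_cases)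
    case (1 g)
    have "(c * f x) \<bullet> g x = f x \<bullet> (cnj c * g x)" for x
      by (simp add: inner_complex_def algebra_simps)
    then show ?thesis using 1 \<open>u = l2_class f\<close> \<open>square_integrable f\<close>
      by (simp add: l2_class_scale l2_class_inner square_integrable_scale)
  qed
qed

lemma scaleR_l2_eq: "r *\<^sub>R u = l2_scale (complex_of_real r) u"
  by (rule scaleR_l2_def)

lemma bounded_linear_l2_scale: "bounded_linear (l2_scale c)"
  by (rule bounded_linear_intro[of _ "cmod c"])
    (simp_all add: l2.scale_right_distrib scaleR_l2_eq mult.commute norm_l2_scale)

lemma l2_scale_decompose: "l2_scale c u = Re c *\<^sub>R u + Im c *\<^sub>R l2_scale \<i> u"
proof -
  have "c = complex_of_real (Re c) + complex_of_real (Im c) * \<i>" by (simp add: complex_eq_iff)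
  then have "l2_scale c u = l2_scale (complex_of_real (Re c) + complex_of_real (Im c) * \<i>) u" by simp
  then show ?thesis by (simp add: scaleR_l2_eq l2.scale_left_distrib)
qed

text \<open>By the resolvent identity, resolvents at two points differ by a bounded factor, so compactness at one point
implies compactness at all points.\<close>

lemma has_compact_resolventI:
  assumes lin: "linear_operator D T" and z0: "z0 \<in> resolvent_set D T"
    and cpt: "\<And>S. bounded S \<Longrightarrow> compact (closure (resolvent D T z0 ` S))"
  shows "has_compact_resolvent D T"
  unfolding has_compact_resolvent_def
proof (intro conjI ballI)
  show "resolvent_set D T \<noteq> {}" using z0 by blast
  fix z assume z: "z \<in> resolvent_set D T"
  have subD: "l2.subspace D" and Tadd: "\<And>u v. u \<in> D \<Longrightarrow> v \<in> D \<Longrightarrow> T (u + v) = T u + T v"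
    and Tsc: "\<And>c u. u \<in> D \<Longrightarrow> T (l2_scale c u) = l2_scale c (T u)"
    using lin by (auto simp: linear_operator_def)
  have bij: "bij_betw (\<lambda>u. T u - l2_scale z u) D UNIV" if "z \<in> resolvent_set D T" for z
    using that by (simp add: resolvent_set_def)
  have RD: "resolvent D T z v \<in> D" and RT: "T (resolvent D T z v) - l2_scale z (resolvent D T z v) = v"
    if "z \<in> resolvent_set D T" for z v
    using bij[OF that] unfolding resolvent_def bij_betw_def
    by (auto intro: inv_into_into f_inv_into_f[where f="\<lambda>u. T u - l2_scale z u"])
  have Ru: "resolvent D T z v = u" if "z \<in> resolvent_set D T" "u \<in> D" "T u - l2_scale z u = v" for z u v
    using bij[OF that(1)] that(2,3) RD[OF that(1), of v] RT[OF that(1), of v] unfolding bij_betw_def inj_on_def by metis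
  have linR: "linear_operator UNIV (resolvent D T z)"
    unfolding linear_operator_def
  proof (intro conjI ballI allI)
    show "l2.subspace UNIV" by (rule l2.subspace_UNIV)
    fix u v :: l2
    show "resolvent D T z (u + v) = resolvent D T z u + resolvent D T z v"
    proof (rule Ru[OF z])
      show "resolvent D T z u + resolvent D T z v \<in> D" using RD[OF z] subD by (intro l2.subspace_add)
      show "T (resolvent D T z u + resolvent D T z v) - l2_scale z (resolvent D T z u + resolvent D T z v) = u + v"
        using RT[OF z, of u] RT[OF z, of v] RD[OF z] by (simp add: Tadd l2.scale_right_distrib algebra_simps)
    qed
    fix c
    show "resolvent D T z (l2_scale c u) = l2_scale c (resolvent D T z u)"
    proof (rule Ru[OF z])
      show "l2_scale c (resolvent D T z u) \<in> D" using RD[OF z] subD by (intro l2.subspace_scale)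
      have "T (l2_scale c (resolvent D T z u)) - l2_scale z (l2_scale c (resolvent D T z u)) =
        l2_scale c (T (resolvent D T z u) - l2_scale z (resolvent D T z u))"
        using RD[OF z] by (simp add: Tsc l2.scale_right_diff_distrib mult.commute)
      then show "T (l2_scale c (resolvent D T z u)) - l2_scale z (l2_scale c (resolvent D T z u)) = l2_scale c u"
        by (simp add: RT[OF z])
    qed
  qed
  show "compact_operator (resolvent D T z)"
    unfolding compact_operator_def
  proof (intro conjI linR allI impI)
    fix S :: "l2 set" assume S: "bounded S"
    obtain C where C: "\<And>u. u \<in> D \<Longrightarrow> norm u \<le> C * norm (T u - l2_scale z u)"
      using z by (auto simp: resolvent_set_def)
    have nR: "norm (resolvent D T z v) \<le> C * norm v" for v using C[OF RD[OF z, of v]] by (simp add: RT[OF z])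
    define F where "F v = v + l2_scale (z - z0) (resolvent D T z v)" for v
    obtain r where r: "\<And>v. v \<in> S \<Longrightarrow> norm v \<le> r" using S unfolding bounded_iff by blast
    have "norm (F v) \<le> r + cmod (z - z0) * (\<bar>C\<bar> * r)" if "v \<in> S" for v
    proof -
      have "C * norm v \<le> \<bar>C\<bar> * r" using r[OF that] by (intro mult_mono) auto
      then have "norm (resolvent D T z v) \<le> \<bar>C\<bar> * r" using nR[of v] by linarith
      then have "cmod (z - z0) * norm (resolvent D T z v) \<le> cmod (z - z0) * (\<bar>C\<bar> * r)" by (intro mult_left_mono) auto
      then show ?thesis unfolding F_def using norm_triangle_ineq[of v "l2_scale (z - z0) (resolvent D T z v)"] r[OF that]
        by (simp add: norm_l2_scale)
    qed
    then have "bounded (F ` S)" unfolding bounded_iff by blast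
    then have "compact (closure (resolvent D T z0 ` (F ` S)))" by (rule cpt)
    moreover have "resolvent D T z v = resolvent D T z0 (F v)" for v
    proof (rule Ru[OF z0 RD[OF z], symmetric])
      show "T (resolvent D T z v) - l2_scale z0 (resolvent D T z v) = F v"
        using RT[OF z, of v] unfolding F_def by (simp add: l2.scale_left_diff_distrib algebra_simps)
    qed
    then have "resolvent D T z ` S = resolvent D T z0 ` (F ` S)" by (auto simp: image_image)
    ultimately show "compact (closure (resolvent D T z ` S))" by simp
  qed
qed

text \<open>The rotated and shifted relation \<open>\<omega> (G + \<mu>)\<close> is accretive, so its inverse extends to a compact injective operator
\<open>K\<close>. Then \<open>\<omega>\<inverse> K\<inverse> - \<mu>\<close> extends \<open>G\<close>, and its resolvent at \<open>- \<mu>\<close> is \<open>K\<close> composed with the rotation.\<close>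

theorem coercive_has_compact_extension:
  fixes G :: "(l2 \<times> l2) set" and \<omega> \<mu> :: complex
  assumes G0: "(0, 0) \<in> G"
    and Gadd: "\<And>x v x' v'. (x, v) \<in> G \<Longrightarrow> (x', v') \<in> G \<Longrightarrow> (x + x', v + v') \<in> G"
    and Gscale: "\<And>c x v. (x, v) \<in> G \<Longrightarrow> (l2_scale c x, l2_scale c v) \<in> G"
    and dense: "\<And>h. (\<And>x v. (x, v) \<in> G \<Longrightarrow> inner x h = 0) \<Longrightarrow> h = 0"
    and \<omega>: "cmod \<omega> = 1"
    and coercive: "\<And>x v. (x, v) \<in> G \<Longrightarrow> (norm x)\<^sup>2 \<le> inner (l2_scale \<omega> (v + l2_scale \<mu> x)) x"
    and cpt: "compact (closure {x. \<exists>v. (x, v) \<in> G \<and> norm (v + l2_scale \<mu> x) \<le> 1})"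
  shows "has_extensions_with_compact_resolvent G"
proof -
  define R where "R = {(l2_scale \<omega> (v + l2_scale \<mu> x), x) | x v. (x, v) \<in> G}"
  have \<omega>0: "\<omega> \<noteq> 0" using \<omega> by auto
  have Rsc: "(l2_scale c g, l2_scale c x) \<in> R" if gx: "(g, x) \<in> R" for c g x
  proof -
    obtain v where v: "(x, v) \<in> G" "g = l2_scale \<omega> (v + l2_scale \<mu> x)" using gx by (auto simp: R_def)
    have "l2_scale c g = l2_scale \<omega> (l2_scale c v + l2_scale \<mu> (l2_scale c x))"
      unfolding v(2) by (simp add: l2.scale_right_distrib mult.commute mult.left_commute)
    then show ?thesis using Gscale[OF v(1), of c] unfolding R_def by blast
  qed
  have subR: "subspace R"
    unfolding subspace_def
  proof (intro conjI ballI allI)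
    show "0 \<in> R" using G0 unfolding R_def by (force simp: zero_prod_def)
  next
    fix p q assume "p \<in> R" "q \<in> R"
    then obtain x v x' v' where p: "(x, v) \<in> G" "p = (l2_scale \<omega> (v + l2_scale \<mu> x), x)"
      "(x', v') \<in> G" "q = (l2_scale \<omega> (v' + l2_scale \<mu> x'), x')" unfolding R_def by blast
    have "p + q = (l2_scale \<omega> ((v + v') + l2_scale \<mu> (x + x')), x + x')"
      unfolding p by (simp add: l2.scale_right_distrib algebra_simps)
    then show "p + q \<in> R" using Gadd[OF p(1,3)] unfolding R_def by blast
  next
    fix c :: real and p assume "p \<in> R"
    then show "c *\<^sub>R p \<in> R" using Rsc[of "fst p" "snd p" "complex_of_real c"] by (simp add: scaleR_l2_eq scaleR_prod_def)
  qed
  have acc: "(norm x)\<^sup>2 \<le> inner g x" if "(g, x) \<in> R" for g x using that coercive by (auto simp: R_def)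
  have "{x. \<exists>g. (g, x) \<in> R \<and> norm g \<le> 1} = {x. \<exists>v. (x, v) \<in> G \<and> norm (v + l2_scale \<mu> x) \<le> 1}"
    by (auto simp: R_def norm_l2_scale \<omega>)
  then have cptR: "compact (closure {x. \<exists>g. (g, x) \<in> R \<and> norm g \<le> 1})" using cpt by simp
  have denseR: "h = 0" if "\<And>g x. (g, x) \<in> R \<Longrightarrow> inner x h = 0" for h
  proof (rule dense)
    fix x v assume "(x, v) \<in> G"
    then show "inner x h = 0" by (intro that[of "l2_scale \<omega> (v + l2_scale \<mu> x)"]) (auto simp: R_def)
  qed
  have "\<exists>K. bounded_linear K \<and> inj K \<and> (\<forall>g x. (g, x) \<in> R \<longrightarrow> K g = x) \<and>
    (\<forall>S. bounded S \<longrightarrow> compact (closure (K ` S))) \<and>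
    (\<forall>J h. bounded_linear J \<longrightarrow> (\<forall>x y. inner (J x) y = - inner x (J y)) \<longrightarrow>
       (\<forall>g x. (g, x) \<in> R \<longrightarrow> (J g, J x) \<in> R) \<longrightarrow> K (J h) = J (K h))"
  proof (rule compact_accretive_extension[OF subR _ cptR])
    show "(norm x)\<^sup>2 \<le> inner g x" if "(g, x) \<in> R" for g x using that by (rule acc)
    show "h = 0" if "\<And>g x. (g, x) \<in> R \<Longrightarrow> inner x h = 0" for h using that by (rule denseR)
  qed
  then obtain K where K: "bounded_linear K" "inj K" "\<forall>g x. (g, x) \<in> R \<longrightarrow> K g = x"
    "\<forall>S. bounded S \<longrightarrow> compact (closure (K ` S))"
    "\<forall>J h. bounded_linear J \<longrightarrow> (\<forall>x y. inner (J x) y = - inner x (J y)) \<longrightarrow>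
       (\<forall>g x. (g, x) \<in> R \<longrightarrow> (J g, J x) \<in> R) \<longrightarrow> K (J h) = J (K h)"
    by (elim exE conjE) (rule that)
  note K = K(1,2) K(3-5)[rule_format]
  interpret K: bounded_linear K by (rule K(1))
  \<comment> \<open>the construction of \<open>K\<close> is real linear; multiplication by \<open>\<i>\<close> is skew and respects the complex linear relation\<close>
  have Ki: "K (l2_scale \<i> h) = l2_scale \<i> (K h)" for h
  proof (rule K(5)[OF bounded_linear_l2_scale])
    show "(l2_scale \<i> g, l2_scale \<i> x) \<in> R" if "(g, x) \<in> R" for g x using that by (rule Rsc)
    show "inner (l2_scale \<i> x) y = - inner x (l2_scale \<i> y)" for x y
      by (simp add: inner_l2_scale)
  qed
  have Ksc: "K (l2_scale c h) = l2_scale c (K h)" for c h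
    by (simp add: l2_scale_decompose[of c] K.add K.scaleR Ki)
  define D where "D = range K"
  define T where "T u = l2_scale (inverse \<omega>) (inv K u) - l2_scale \<mu> u" for u
  have invK: "inv K (K h) = h" for h using K(2) by simp
  have subD: "l2.subspace D"
    unfolding l2.subspace_def D_def
  proof (intro conjI ballI allI)
    show "0 \<in> range K" using K.zero by (metis rangeI)
    show "x + y \<in> range K" if "x \<in> range K" "y \<in> range K" for x y using that by (auto simp flip: K.add)
    show "l2_scale c x \<in> range K" if "x \<in> range K" for c x using that by (auto simp flip: Ksc)
  qed
  have TK: "T (K h) = l2_scale (inverse \<omega>) h - l2_scale \<mu> (K h)" for h by (simp add: T_def invK)
  have lin: "linear_operator D T"
    unfolding linear_operator_def
  proof (intro conjI subD ballI allI)
    fix u v assume "u \<in> D" "v \<in> D"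
    then obtain g h where uv: "u = K g" "v = K h" by (auto simp: D_def)
    show "T (u + v) = T u + T v" unfolding uv K.add[symmetric] TK
      by (simp add: l2.scale_right_distrib K.add algebra_simps)
  next
    fix c u assume "u \<in> D"
    then obtain g where u: "u = K g" by (auto simp: D_def)
    show "T (l2_scale c u) = l2_scale c (T u)" unfolding u Ksc[symmetric] TK
      by (simp add: l2.scale_right_diff_distrib Ksc mult.commute)
  qed
  have ext: "extends_operator D T G"
    unfolding extends_operator_def
  proof (clarify)
    fix x v assume xv: "(x, v) \<in> G"
    then have "(l2_scale \<omega> (v + l2_scale \<mu> x), x) \<in> R" by (auto simp: R_def)
    then have Kx: "x = K (l2_scale \<omega> (v + l2_scale \<mu> x))" using K(3) by simp
    then have "T x = l2_scale (inverse \<omega>) (l2_scale \<omega> (v + l2_scale \<mu> x)) - l2_scale \<mu> x"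
      by (metis TK)
    then show "x \<in> D \<and> T x = v" using Kx \<omega>0 by (auto simp: D_def)
  qed
  have TL: "T (K h) - l2_scale (- \<mu>) (K h) = l2_scale (inverse \<omega>) h" for h by (simp add: TK)
  have res: "- \<mu> \<in> resolvent_set D T"
    unfolding resolvent_set_def
  proof (intro CollectI conjI)
    show "bij_betw (\<lambda>u. T u - l2_scale (- \<mu>) u) D UNIV"
      unfolding bij_betw_def
    proof
      show "inj_on (\<lambda>u. T u - l2_scale (- \<mu>) u) D"
      proof (rule inj_onI)
        fix u v assume uv: "u \<in> D" "v \<in> D" "T u - l2_scale (- \<mu>) u = T v - l2_scale (- \<mu>) v"
        then obtain g h where gh: "u = K g" "v = K h" by (auto simp: D_def)
        then have "l2_scale (inverse \<omega>) g = l2_scale (inverse \<omega>) h" using uv(3) by (simp only: TL)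
        then show "u = v" using \<omega>0 gh by simp
      qed
      show "(\<lambda>u. T u - l2_scale (- \<mu>) u) ` D = UNIV"
      proof (rule UNIV_eq_I[symmetric])
        fix w
        have "T (K (l2_scale \<omega> w)) - l2_scale (- \<mu>) (K (l2_scale \<omega> w)) = w" unfolding TL using \<omega>0 by simp
        then show "w \<in> (\<lambda>u. T u - l2_scale (- \<mu>) u) ` D" unfolding D_def by (metis (no_types, lifting) imageI rangeI)
      qed
    qed
    obtain B where B: "\<And>h. norm (K h) \<le> norm h * B" using K.bounded by blast
    have "norm u \<le> B * norm (T u - l2_scale (- \<mu>) u)" if "u \<in> D" for u
    proof -
      obtain h where h: "u = K h" using \<open>u \<in> D\<close> by (auto simp: D_def)
      show ?thesis using B[of h] unfolding h TL by (simp add: norm_l2_scale norm_inverse \<omega> mult.commute)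
    qed
    then show "\<exists>C. \<forall>u\<in>D. norm u \<le> C * norm (T u - l2_scale (- \<mu>) u)" by blast
  qed
  have resK: "resolvent D T (- \<mu>) w = K (l2_scale \<omega> w)" for w
    unfolding resolvent_def
  proof (rule inv_into_f_eq)
    show "inj_on (\<lambda>u. T u - l2_scale (- \<mu>) u) D" using res by (auto simp: resolvent_set_def bij_betw_def)
    show "K (l2_scale \<omega> w) \<in> D" by (simp add: D_def)
    show "T (K (l2_scale \<omega> w)) - l2_scale (- \<mu>) (K (l2_scale \<omega> w)) = w" unfolding TL using \<omega>0 by simp
  qed
  have "has_compact_resolvent D T"
  proof (rule has_compact_resolventI[OF lin res])
    fix S :: "l2 set" assume S: "bounded S"
    then have "bounded (l2_scale \<omega> ` S)" by (rule bounded_linear_image[OF _ bounded_linear_l2_scale])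
    then have "compact (closure (K ` (l2_scale \<omega> ` S)))" by (rule K(4))
    moreover have "resolvent D T (- \<mu>) ` S = K ` (l2_scale \<omega> ` S)" by (auto simp: resK image_image)
    ultimately show "compact (closure (resolvent D T (- \<mu>) ` S))" by simp
  qed
  then show ?thesis unfolding has_extensions_with_compact_resolvent_def using lin ext by blast
qed

section \<open>Bump functions\<close>

text \<open>A rise from \<open>0\<close> to \<open>1\<close> on the unit interval, made of two parabolas, whose derivative is Lipschitz.\<close>

definition smooth_step :: "real \<Rightarrow> real" where
  "smooth_step t = 2 * (max 0 t)\<^sup>2 - 4 * (max 0 (t - 1/2))\<^sup>2 + 2 * (max 0 (t - 1))\<^sup>2"

definition smooth_step' :: "real \<Rightarrow> real" where
  "smooth_step' t = 4 * max 0 t - 8 * max 0 (t - 1/2) + 4 * max 0 (t - 1)"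

lemma has_real_derivative_max0_sq: "((\<lambda>t. (max 0 (t - c))\<^sup>2) has_real_derivative 2 * max 0 (x - c)) (at x)"
proof -
  have b: "\<bar>(max 0 (y - c))\<^sup>2 - (max 0 (x - c))\<^sup>2 - 2 * max 0 (x - c) * (y - x)\<bar> \<le> (y - x)\<^sup>2" for y
  proof -
    define A B where "A = y - c" and "B = x - c"
    have yx: "y - x = A - B" by (simp add: A_def B_def)
    have "\<bar>(max 0 A)\<^sup>2 - (max 0 B)\<^sup>2 - 2 * max 0 B * (A - B)\<bar> \<le> (A - B)\<^sup>2"
    proof (cases "A \<ge> 0"; cases "B \<ge> 0")
      assume AB: "A \<ge> 0" "B \<ge> 0"
      then have "(max 0 A)\<^sup>2 - (max 0 B)\<^sup>2 - 2 * max 0 B * (A - B) = (A - B)\<^sup>2"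
        by (simp add: power2_eq_square algebra_simps)
      then show ?thesis by simp
    next
      assume AB: "A \<ge> 0" "\<not> B \<ge> 0"
      then have "A\<^sup>2 \<le> (A - B)\<^sup>2" by (intro power_mono) auto
      then show ?thesis using AB by simp
    next
      assume AB: "\<not> A \<ge> 0" "B \<ge> 0"
      have "(max 0 A)\<^sup>2 - (max 0 B)\<^sup>2 - 2 * max 0 B * (A - B) = B * (B - 2 * A)"
        using AB by (simp add: power2_eq_square algebra_simps)
      moreover have "0 \<le> B * (B - 2 * A)" using AB by (intro mult_nonneg_nonneg) auto
      moreover have "B * (B - 2 * A) \<le> (A - B)\<^sup>2" by (simp add: power2_eq_square algebra_simps)
      ultimately show ?thesis by simp
    next
      assume "\<not> A \<ge> 0" "\<not> B \<ge> 0" then show ?thesis by simp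
    qed
    then show ?thesis unfolding yx A_def B_def .
  qed
  show ?thesis
    unfolding has_field_derivative_def has_derivative_at'
  proof (intro conjI allI impI bounded_linear_mult_right)
    fix e :: real assume "0 < e"
    have "norm ((max 0 (y - c))\<^sup>2 - (max 0 (x - c))\<^sup>2 - 2 * max 0 (x - c) * (y - x)) / norm (y - x) < e"
      if "0 < norm (y - x)" "norm (y - x) < e" for y
    proof -
      have "norm ((max 0 (y - c))\<^sup>2 - (max 0 (x - c))\<^sup>2 - 2 * max 0 (x - c) * (y - x)) \<le> norm (y - x) * norm (y - x)"
        using b[of y] by (simp add: power2_eq_square)
      also have "\<dots> < e * norm (y - x)" using that by (intro mult_strict_right_mono)
      finally show ?thesis using that by (simp add: pos_divide_less_eq)
    qed
    then show "\<exists>d>0. \<forall>y. 0 < norm (y - x) \<and> norm (y - x) < d \<longrightarrow>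
      norm ((max 0 (y - c))\<^sup>2 - (max 0 (x - c))\<^sup>2 - 2 * max 0 (x - c) * (y - x)) / norm (y - x) < e"
      using \<open>0 < e\<close> by blast
  qed
qed

lemma smooth_step_derivative: "(smooth_step has_real_derivative smooth_step' t) (at t)"
proof -
  have "((\<lambda>t. 2 * (max 0 (t - 0))\<^sup>2 - 4 * (max 0 (t - 1/2))\<^sup>2 + 2 * (max 0 (t - 1))\<^sup>2) has_real_derivative
     2 * (2 * max 0 (t - 0)) - 4 * (2 * max 0 (t - 1/2)) + 2 * (2 * max 0 (t - 1))) (at t)"
    by (intro DERIV_add DERIV_diff DERIV_cmult has_real_derivative_max0_sq)
  then show ?thesis by (simp add: smooth_step_def[abs_def] smooth_step'_def)
qed

lemma smooth_step_neg: "t \<le> 0 \<Longrightarrow> smooth_step t = 0 \<and> smooth_step' t = 0"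
  by (simp add: smooth_step_def smooth_step'_def)

lemma smooth_step_ge1: "t \<ge> 1 \<Longrightarrow> smooth_step t = 1"
  by (simp add: smooth_step_def power2_eq_square algebra_simps)

lemma smooth_step_bounds: "0 \<le> smooth_step t" "smooth_step t \<le> 1"
proof -
  consider "t \<le> 0" | "0 \<le> t" "t \<le> 1/2" | "1/2 \<le> t" "t \<le> 1" | "1 \<le> t" by linarith
  then have "0 \<le> smooth_step t \<and> smooth_step t \<le> 1"
  proof cases
    case 2
    then have "t\<^sup>2 \<le> (1/2)\<^sup>2" by (intro power_mono) auto
    then show ?thesis using 2 by (simp add: smooth_step_def power2_eq_square)
  next
    case 3
    then have e: "smooth_step t = 1 - 2 * (1 - t)\<^sup>2" by (simp add: smooth_step_def power2_eq_square algebra_simps)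
    have "(1 - t)\<^sup>2 \<le> (1/2)\<^sup>2" using 3 by (intro power_mono) auto
    then show ?thesis unfolding e by (simp add: power2_eq_square)
  qed (auto simp: smooth_step_neg smooth_step_ge1)
  then show "0 \<le> smooth_step t" "smooth_step t \<le> 1" by auto
qed

lemma smooth_step'_bounds: "\<bar>smooth_step' t\<bar> \<le> 2" "\<bar>smooth_step' t - smooth_step' t'\<bar> \<le> 16 * \<bar>t - t'\<bar>"
proof -
  show "\<bar>smooth_step' t\<bar> \<le> 2" by (auto simp: smooth_step'_def max_def)
  have m: "\<bar>max 0 (t - c) - max 0 (t' - c)\<bar> \<le> \<bar>t - t'\<bar>" for c by (auto simp: max_def)
  show "\<bar>smooth_step' t - smooth_step' t'\<bar> \<le> 16 * \<bar>t - t'\<bar>"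
  proof -
    have "\<bar>4 * A - 8 * B + 4 * C - (4 * A' - 8 * B' + 4 * C')\<bar> \<le> 16 * D"
      if "\<bar>A - A'\<bar> \<le> D" "\<bar>B - B'\<bar> \<le> D" "\<bar>C - C'\<bar> \<le> D" for A A' B B' C C' D :: real
      using that unfolding abs_le_iff by linarith
    from this[OF _ m[of "1/2"] m[of 1], of "max 0 t" "max 0 t'"] show ?thesis
      using m[of 0] unfolding smooth_step'_def by simp
  qed
qed

lemma smooth_step_lipschitz: "\<bar>smooth_step t - smooth_step t'\<bar> \<le> 2 * \<bar>t - t'\<bar>"
  using field_differentiable_bound[of UNIV smooth_step smooth_step' 2 t t']
    smooth_step_derivative smooth_step'_bounds by auto

definition bump :: "real \<Rightarrow> real \<Rightarrow> real \<Rightarrow> real \<Rightarrow> real" where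
  "bump p r n x = smooth_step (n * (x - p)) * smooth_step (n * (r - x))"

definition bump' :: "real \<Rightarrow> real \<Rightarrow> real \<Rightarrow> real \<Rightarrow> real" where
  "bump' p r n x = n * smooth_step' (n * (x - p)) * smooth_step (n * (r - x))
     - n * smooth_step (n * (x - p)) * smooth_step' (n * (r - x))"

lemma bump_derivative: "(bump p r n has_real_derivative bump' p r n x) (at x)"
proof -
  have 1: "((\<lambda>x. smooth_step (n * (x - p))) has_real_derivative smooth_step' (n * (x - p)) * n) (at x)"
    by (rule DERIV_chain'[OF _ smooth_step_derivative]) (auto intro!: derivative_eq_intros)
  have 2: "((\<lambda>x. smooth_step (n * (r - x))) has_real_derivative smooth_step' (n * (r - x)) * (- n)) (at x)"
    by (rule DERIV_chain'[OF _ smooth_step_derivative]) (auto intro!: derivative_eq_intros)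
  show ?thesis
    unfolding bump_def[abs_def] bump'_def using DERIV_mult[OF 1 2] by (simp add: algebra_simps)
qed

lemma bump'_lipschitz:
  assumes "n \<ge> 0" shows "\<bar>bump' p r n x - bump' p r n x'\<bar> \<le> 40 * n\<^sup>2 * \<bar>x - x'\<bar>"
proof -
  have prod: "\<bar>A * B - A' * B'\<bar> \<le> 20 * n * \<bar>x - x'\<bar>"
    if "\<bar>A - A'\<bar> \<le> 16 * (n * \<bar>x - x'\<bar>)" "\<bar>B - B'\<bar> \<le> 2 * (n * \<bar>x - x'\<bar>)" "\<bar>A'\<bar> \<le> 2" "\<bar>B\<bar> \<le> 1" for A A' B B' :: real
  proof -
    have "A * B - A' * B' = (A - A') * B + A' * (B - B')" by (simp add: algebra_simps)
    then have "\<bar>A * B - A' * B'\<bar> \<le> \<bar>A - A'\<bar> * \<bar>B\<bar> + \<bar>A'\<bar> * \<bar>B - B'\<bar>" by (metis abs_mult abs_triangle_ineq)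
    also have "\<dots> \<le> 16 * (n * \<bar>x - x'\<bar>) * 1 + 2 * (2 * (n * \<bar>x - x'\<bar>))"
      using that assms by (intro add_mono mult_mono) auto
    finally show ?thesis by simp
  qed
  have e: "\<bar>n * (x - p) - n * (x' - p)\<bar> = n * \<bar>x - x'\<bar>" "\<bar>n * (r - x) - n * (r - x')\<bar> = n * \<bar>x - x'\<bar>"
    using assms by (simp_all add: abs_mult flip: right_diff_distrib) (simp add: abs_minus_commute)
  have s1: "\<bar>smooth_step b\<bar> \<le> 1" for b using smooth_step_bounds[of b] by simp
  have 1: "\<bar>smooth_step' (n * (x - p)) * smooth_step (n * (r - x)) - smooth_step' (n * (x' - p)) * smooth_step (n * (r - x'))\<bar> \<le> 20 * n * \<bar>x - x'\<bar>"
    using smooth_step'_bounds smooth_step_lipschitz[of "n * (r - x)" "n * (r - x')"] smooth_step'_bounds(2)[of "n * (x - p)" "n * (x' - p)"] s1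
    unfolding e by (intro prod) auto
  have 2: "\<bar>smooth_step' (n * (r - x)) * smooth_step (n * (x - p)) - smooth_step' (n * (r - x')) * smooth_step (n * (x' - p))\<bar> \<le> 20 * n * \<bar>x - x'\<bar>"
    using smooth_step'_bounds smooth_step_lipschitz[of "n * (x - p)" "n * (x' - p)"] smooth_step'_bounds(2)[of "n * (r - x)" "n * (r - x')"] s1
    unfolding e by (intro prod) auto
  have "bump' p r n x - bump' p r n x' =
     n * (smooth_step' (n * (x - p)) * smooth_step (n * (r - x)) - smooth_step' (n * (x' - p)) * smooth_step (n * (r - x')))
     - n * (smooth_step' (n * (r - x)) * smooth_step (n * (x - p)) - smooth_step' (n * (r - x')) * smooth_step (n * (x' - p)))"
    unfolding bump'_def by (simp add: algebra_simps)
  also have "\<bar>\<dots>\<bar> \<le> n * (20 * n * \<bar>x - x'\<bar>) + n * (20 * n * \<bar>x - x'\<bar>)"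
    using assms 1 2 by (intro order_trans[OF abs_triangle_ineq4] add_mono) (simp_all add: abs_mult mult_left_mono)
  finally show ?thesis by (simp add: power2_eq_square algebra_simps)
qed

lemma bump_outside: "n \<ge> 0 \<Longrightarrow> x \<notin> {p..r} \<Longrightarrow> bump p r n x = 0 \<and> bump' p r n x = 0"
  using smooth_step_neg[of "n * (x - p)"] smooth_step_neg[of "n * (r - x)"]
  by (cases "x < p") (auto simp: bump_def bump'_def mult_nonneg_nonpos)

lemma bump_inside: "n > 0 \<Longrightarrow> p + 1 / n \<le> x \<Longrightarrow> x \<le> r - 1 / n \<Longrightarrow> bump p r n x = 1"
proof -
  assume n: "n > 0" and x: "p + 1 / n \<le> x" "x \<le> r - 1 / n"
  have "1 / n \<le> x - p" "1 / n \<le> r - x" using x by auto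
  then have "1 \<le> n * (x - p)" "1 \<le> n * (r - x)" using n by (simp_all add: divide_le_eq mult.commute)
  then show ?thesis by (simp add: bump_def smooth_step_ge1)
qed

lemma bump_bounds: "0 \<le> bump p r n x" "bump p r n x \<le> 1"
  using smooth_step_bounds by (auto simp: bump_def intro: mult_le_one)

lemma bump_continuous: "continuous_on A (bump p r n)"
  by (meson DERIV_isCont bump_derivative continuous_at_imp_continuous_on)

lemma bump_tendsto_1:
  assumes "p < x" "x < r" shows "(\<lambda>n. bump p r (real n) x) \<longlonglongrightarrow> 1"
proof (rule tendsto_eventually)
  define e where "e = min (x - p) (r - x)"
  have e: "e > 0" using assms by (simp add: e_def)
  obtain N where N: "1 / e < real N" using reals_Archimedean2 by blast
  have "bump p r (real n) x = 1" if "n \<ge> N" for n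
  proof -
    have "0 < 1 / e" using e by simp
    then have n: "real n > 0" "1 / e < real n" using N that by linarith+
    then have "1 / real n < e" using e by (simp add: divide_less_eq mult.commute)
    then have "1 / real n \<le> x - p" "1 / real n \<le> r - x" by (auto simp: e_def)
    then show ?thesis using n by (intro bump_inside) auto
  qed
  then show "\<forall>\<^sub>F n in sequentially. bump p r (real n) x = 1" by (rule eventually_sequentiallyI)
qed

text \<open>Steepening the bumps gives vanishing integrals over all subintervals, and Lebesgue differentiation concludes.\<close>

lemma bump_orthogonal_imp_zero:
  fixes \<kappa> :: "real \<Rightarrow> real"
  assumes \<kappa>: "\<kappa> absolutely_integrable_on {a..b}"
    and orth: "\<And>p r n. a \<le> p \<Longrightarrow> p < r \<Longrightarrow> r \<le> b \<Longrightarrow> n \<ge> 0 \<Longrightarrow> integral {a..b} (\<lambda>x. bump p r n x * \<kappa> x) = 0"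
  shows "\<exists>N. negligible N \<and> (\<forall>x\<in>{a..b} - N. \<kappa> x = 0)"
proof -
  have nk: "(\<lambda>x. \<bar>\<kappa> x\<bar>) integrable_on {a..b}" using \<kappa> by (simp add: absolutely_integrable_on_def)
  have int0: "integral {p..r} \<kappa> = 0" if pr: "a \<le> p" "p < r" "r \<le> b" for p r
  proof -
    have "(\<lambda>n. integral {a..b} (\<lambda>x. bump p r (real n) x * \<kappa> x)) \<longlonglongrightarrow> integral {a..b} (\<lambda>x. if x \<in> {p<..<r} then \<kappa> x else 0)"
    proof (rule dominated_convergence(2)[OF _ nk])
      show "(\<lambda>x. bump p r (real n) x * \<kappa> x) integrable_on {a..b}" for n
      proof (rule set_lebesgue_integral_eq_integral(1), rule absolutely_integrable_bounded_measurable_product_real[OF _ _ _ \<kappa>])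
        show "bump p r (real n) \<in> borel_measurable (lebesgue_on {a..b})"
          by (intro continuous_imp_measurable_on_sets_lebesgue bump_continuous) auto
        have "norm (bump p r (real n) x) \<le> 1" for x using bump_bounds[of p r "real n" x] by simp
        then show "bounded (bump p r (real n) ` {a..b})" unfolding bounded_iff by blast
      qed auto
      show "norm (bump p r (real n) x * \<kappa> x) \<le> \<bar>\<kappa> x\<bar>" for n x
        using bump_bounds[of p r "real n" x] by (simp add: abs_mult mult_left_le_one_le)
      show "(\<lambda>n. bump p r (real n) x * \<kappa> x) \<longlonglongrightarrow> (if x \<in> {p<..<r} then \<kappa> x else 0)" for x
      proof (cases "x \<in> {p<..<r}")
        case True
        then show ?thesis using tendsto_mult[OF bump_tendsto_1[of p x r] tendsto_const[of "\<kappa> x"]] by simp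
      next
        case False
        have "bump p r (real n) x = 0" for n
          using False smooth_step_neg[of "real n * (x - p)"] smooth_step_neg[of "real n * (r - x)"]
          by (cases "x \<le> p") (auto simp: bump_def mult_nonneg_nonpos)
        then show ?thesis unfolding if_not_P[OF False] by simp
      qed
    qed
    moreover have "integral {a..b} (\<lambda>x. bump p r (real n) x * \<kappa> x) = 0" for n using pr by (intro orth) auto
    ultimately have "integral {a..b} (\<lambda>x. if x \<in> {p<..<r} then \<kappa> x else 0) = 0"
      using LIMSEQ_unique[OF _ tendsto_const] by simp
    then have "integral ({p<..<r} \<inter> {a..b}) \<kappa> = 0" by (simp only: integral_restrict_Int)
    moreover have "{p<..<r} \<inter> {a..b} = {p<..<r}" using pr by auto
    ultimately show ?thesis by (simp add: integral_open_interval_real)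
  qed
  define f where "f = (\<lambda>x. if x \<in> {a..b} then \<kappa> x else 0)"
  have fi: "f integrable_on {c..d}" for c d
  proof -
    have "{a..b} \<inter> {c..d} = {max a c..min b d}" by auto
    moreover have "\<kappa> integrable_on {a..b}" using \<kappa> by (simp add: absolutely_integrable_on_def)
    then have "\<kappa> integrable_on {max a c..min b d}" by (rule integrable_subinterval_real) auto
    ultimately show ?thesis unfolding f_def by (simp only: integrable_restrict_Int)
  qed
  obtain N where N: "negligible N"
    "\<And>x e. x \<notin> N \<Longrightarrow> 0 < e \<Longrightarrow> \<exists>d>0. \<forall>h. 0 < h \<and> h < d \<longrightarrow>
       norm (integral {x..x+h} f - h *\<^sub>R f x) < e * h \<and> norm (integral {x-h..x} f - h *\<^sub>R f x) < e * h"
    using lebesgue_differentiation_real[OF fi] by blast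
  have "\<kappa> x = 0" if x: "x \<in> {a..b} - (insert b N)" for x
  proof -
    have "\<bar>\<kappa> x\<bar> \<le> 0 + e" if "e > 0" for e
    proof -
      obtain d where d: "d > 0" "\<And>h. 0 < h \<Longrightarrow> h < d \<Longrightarrow> norm (integral {x..x+h} f - h *\<^sub>R f x) < e * h"
        using N(2)[of x e] x \<open>e > 0\<close> by auto
      define h where "h = min (d/2) (b - x)"
      have h: "0 < h" "h < d" "x + h \<le> b" using d x by (auto simp: h_def)
      have "integral {x..x+h} f = integral {x..x+h} \<kappa>" using x h by (intro integral_cong) (auto simp: f_def)
      also have "\<dots> = 0" using x h by (intro int0) auto
      finally have "norm (h *\<^sub>R f x) < e * h" using d(2)[of h] h by simp
      then show ?thesis using h x by (simp add: f_def abs_mult mult.commute)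
    qed
    then have "\<bar>\<kappa> x\<bar> \<le> 0" by (rule field_le_epsilon)
    then show ?thesis by simp
  qed
  moreover have "negligible (insert b N)" using N(1) by simp
  ultimately show ?thesis by blast
qed

section \<open>The minimal operator\<close>

lemma vector_derivative_add_AE:
  assumes "AC_loc y" "AC_loc z"
  shows "AE x in half_line. vector_derivative (\<lambda>x. y x + z x) (at x) = vector_derivative y (at x) + vector_derivative z (at x)"
  using AC_loc_has_vector_derivative[OF assms(1)] AC_loc_has_vector_derivative[OF assms(2)]
proof eventually_elim
  case (elim x)
  show ?case by (rule vector_derivative_at[OF has_vector_derivative_add[OF elim]])
qed

lemma vector_derivative_cmult_AE:
  assumes "AC_loc y"
  shows "AE x in half_line. vector_derivative (\<lambda>x. c * y x) (at x) = c * vector_derivative y (at x)"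
  using AC_loc_has_vector_derivative[OF assms(1)]
proof eventually_elim
  case (elim x)
  show ?case by (rule vector_derivative_at[OF has_vector_derivative_mult_right[OF elim]])
qed

lemma in_minimal_domainD:
  assumes "in_minimal_domain s y u"
  shows "square_integrable y" "AC_loc y" "AC_loc u"
    "AE x in half_line. u x = vector_derivative y (at x) - s x * y x"
    "square_integrable (l_expr s y u)" "y 0 = 0" "u 0 = 0" "compact (closure {x. 0 \<le> x \<and> y x \<noteq> 0})"
  using assms unfolding in_minimal_domain_def has_quasi_derivative_def by blast+

lemma minimal_operator_zero: "(0, 0) \<in> minimal_operator s"
proof -
  have d: "vector_derivative (\<lambda>x::real. 0::complex) (at x) = 0" for x by simp
  have l: "l_expr s (\<lambda>x. 0) (\<lambda>x. 0) = (\<lambda>x. 0)" by (simp add: l_expr_def fun_eq_iff)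
  have "in_minimal_domain s (\<lambda>x. 0) (\<lambda>x. 0)"
    unfolding in_minimal_domain_def has_quasi_derivative_def l by (simp add: square_integrable_0 AC_loc_const)
  then have "(l2_class (\<lambda>x. 0), l2_class (\<lambda>x. 0)) \<in> minimal_operator s" unfolding minimal_operator_def using l by force
  then show ?thesis by (simp add: zero_l2.abs_eq)
qed

lemma minimal_operator_add:
  assumes "(x, v) \<in> minimal_operator s" "(x', v') \<in> minimal_operator s" and s: "L2_loc s"
  shows "(x + x', v + v') \<in> minimal_operator s"
proof -
  obtain y u where yu: "in_minimal_domain s y u" "x = l2_class y" "v = l2_class (l_expr s y u)"
    using assms(1) unfolding minimal_operator_def by blast
  obtain z w where zw: "in_minimal_domain s z w" "x' = l2_class z" "v' = l2_class (l_expr s z w)"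
    using assms(2) unfolding minimal_operator_def by blast
  note Y = in_minimal_domainD[OF yu(1)] and Z = in_minimal_domainD[OF zw(1)]
  let ?y = "\<lambda>x. y x + z x" and ?u = "\<lambda>x. u x + w x"
  have yAC: "AC_loc ?y" and uAC: "AC_loc ?u" using Y Z by (auto intro: AC_loc_add)
  have l: "AE x in half_line. l_expr s ?y ?u x = l_expr s y u x + l_expr s z w x"
    using vector_derivative_add_AE[OF Y(3) Z(3)]
  proof eventually_elim
    case (elim x) then show ?case unfolding l_expr_def by (simp add: algebra_simps)
  qed
  have lm: "l_expr s ?y ?u \<in> borel_measurable half_line" by (rule l_expr_measurable[OF s yAC uAC])
  have ls: "square_integrable (\<lambda>x. l_expr s y u x + l_expr s z w x)" using Y Z by (intro square_integrable_add)
  have ls': "square_integrable (l_expr s ?y ?u)"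
    unfolding square_integrable_def
  proof
    have "integrable half_line (\<lambda>x. (cmod (l_expr s ?y ?u x))\<^sup>2) \<longleftrightarrow> integrable half_line (\<lambda>x. (cmod (l_expr s y u x + l_expr s z w x))\<^sup>2)"
      by (rule integrable_cong_AE) (use lm ls l in \<open>auto simp: square_integrable_def elim: eventually_mono\<close>)
    then show "integrable half_line (\<lambda>x. (cmod (l_expr s ?y ?u x))\<^sup>2)" using ls by (simp add: square_integrable_def)
  qed (rule lm)
  have "in_minimal_domain s ?y ?u"
    unfolding in_minimal_domain_def has_quasi_derivative_def
  proof (intro conjI yAC uAC ls')
    show "square_integrable ?y" using Y Z by (intro square_integrable_add)
    show "AE x in half_line. ?u x = vector_derivative ?y (at x) - s x * ?y x"
      using Y(4) Z(4) vector_derivative_add_AE[OF Y(2) Z(2)]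
    proof eventually_elim
      case (elim x) show ?case unfolding elim by (simp add: algebra_simps)
    qed
    show "y 0 + z 0 = 0" "u 0 + w 0 = 0" using Y Z by auto
    have "{x. 0 \<le> x \<and> ?y x \<noteq> 0} \<subseteq> {x. 0 \<le> x \<and> y x \<noteq> 0} \<union> {x. 0 \<le> x \<and> z x \<noteq> 0}" by auto
    then have "bounded {x. 0 \<le> x \<and> ?y x \<noteq> 0}"
      by (rule bounded_subset[rotated])
        (intro bounded_Un[THEN iffD2] conjI bounded_subset[OF compact_imp_bounded[OF Y(8)] closure_subset]
          bounded_subset[OF compact_imp_bounded[OF Z(8)] closure_subset])
    then show "compact (closure {x. 0 \<le> x \<and> ?y x \<noteq> 0})" by (simp add: compact_closure)
  qed
  moreover have "x + x' = l2_class ?y" using yu zw Y Z by (simp add: l2_class_add)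
  moreover have "v + v' = l2_class (l_expr s ?y ?u)"
  proof -
    have "v + v' = l2_class (\<lambda>x. l_expr s y u x + l_expr s z w x)" using yu zw Y Z by (simp add: l2_class_add)
    also have "\<dots> = l2_class (l_expr s ?y ?u)"
      using l l2_class_eq_iff[OF ls ls'] by (simp add: eq_commute)
    finally show ?thesis .
  qed
  ultimately show ?thesis unfolding minimal_operator_def by blast
qed

lemma minimal_operator_scale:
  assumes "(x, v) \<in> minimal_operator s" and s: "L2_loc s"
  shows "(l2_scale c x, l2_scale c v) \<in> minimal_operator s"
proof -
  obtain y u where yu: "in_minimal_domain s y u" "x = l2_class y" "v = l2_class (l_expr s y u)"
    using assms(1) unfolding minimal_operator_def by blast
  note Y = in_minimal_domainD[OF yu(1)]
  let ?y = "\<lambda>x. c * y x" and ?u = "\<lambda>x. c * u x"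
  have yAC: "AC_loc ?y" and uAC: "AC_loc ?u" using Y by (auto intro: AC_loc_cmult)
  have l: "AE x in half_line. l_expr s ?y ?u x = c * l_expr s y u x"
    using vector_derivative_cmult_AE[OF Y(3), of c]
  proof eventually_elim
    case (elim x) then show ?case unfolding l_expr_def by (simp add: algebra_simps)
  qed
  have lm: "l_expr s ?y ?u \<in> borel_measurable half_line" by (rule l_expr_measurable[OF s yAC uAC])
  have ls: "square_integrable (\<lambda>x. c * l_expr s y u x)" using Y by (intro square_integrable_scale)
  have ls': "square_integrable (l_expr s ?y ?u)"
    unfolding square_integrable_def
  proof
    have "integrable half_line (\<lambda>x. (cmod (l_expr s ?y ?u x))\<^sup>2) \<longleftrightarrow> integrable half_line (\<lambda>x. (cmod (c * l_expr s y u x))\<^sup>2)"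
      by (rule integrable_cong_AE) (use lm ls l in \<open>auto simp: square_integrable_def elim: eventually_mono\<close>)
    then show "integrable half_line (\<lambda>x. (cmod (l_expr s ?y ?u x))\<^sup>2)" using ls by (simp add: square_integrable_def)
  qed (rule lm)
  have "in_minimal_domain s ?y ?u"
    unfolding in_minimal_domain_def has_quasi_derivative_def
  proof (intro conjI yAC uAC ls')
    show "square_integrable ?y" using Y by (intro square_integrable_scale)
    show "AE x in half_line. ?u x = vector_derivative ?y (at x) - s x * ?y x"
      using Y(4) vector_derivative_cmult_AE[OF Y(2), of c]
    proof eventually_elim
      case (elim x) show ?case unfolding elim by (simp add: algebra_simps)
    qed
    show "c * y 0 = 0" "c * u 0 = 0" using Y by auto
    have "{x. 0 \<le> x \<and> ?y x \<noteq> 0} \<subseteq> {x. 0 \<le> x \<and> y x \<noteq> 0}" by auto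
    then have "bounded {x. 0 \<le> x \<and> ?y x \<noteq> 0}"
      by (rule bounded_subset[rotated]) (rule bounded_subset[OF compact_imp_bounded[OF Y(8)] closure_subset])
    then show "compact (closure {x. 0 \<le> x \<and> ?y x \<noteq> 0})" by (simp add: compact_closure)
  qed
  moreover have "l2_scale c x = l2_class ?y" using yu Y by (simp add: l2_class_scale)
  moreover have "l2_scale c v = l2_class (l_expr s ?y ?u)"
  proof -
    have "l2_scale c v = l2_class (\<lambda>x. c * l_expr s y u x)" using yu Y by (simp add: l2_class_scale)
    also have "\<dots> = l2_class (l_expr s ?y ?u)"
      using l l2_class_eq_iff[OF ls ls'] by (simp add: eq_commute)
    finally show ?thesis .
  qed
  ultimately show ?thesis unfolding minimal_operator_def by blast
qed

lemma bump_test_functions: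
  assumes s: "L2_loc s" and a: "0 \<le> a" and ab: "a < b"
    and S: "integral {a..b} (\<lambda>x. (cmod (s x - c))\<^sup>2) \<le> S" "S > 0" and small: "64 * S * (b - a) \<le> 1"
  shows "\<exists>\<phi>. AC_loc \<phi> \<and> (\<forall>x\<ge>0. 1/2 \<le> cmod (\<phi> x) \<and> cmod (\<phi> x) \<le> 2) \<and>
     (\<forall>p r n. a \<le> p \<longrightarrow> r \<le> b \<longrightarrow> 0 \<le> n \<longrightarrow>
        (\<exists>u. in_minimal_domain s (\<lambda>x. \<phi> x * complex_of_real (bump p r n x)) u \<and>
          (norm (l2_class (l_expr s (\<lambda>x. \<phi> x * complex_of_real (bump p r n x)) u)))\<^sup>2 \<le> 10 * (40 * n\<^sup>2)\<^sup>2 * (b - a)))"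
proof -
  obtain \<phi> where \<phi>: "AC_loc \<phi>" "\<forall>x\<ge>0. 1/2 \<le> cmod (\<phi> x) \<and> cmod (\<phi> x) \<le> 2"
    and *: "\<forall>z \<zeta> L. (\<forall>x. (z has_real_derivative \<zeta> x) (at x)) \<longrightarrow> (\<forall>x x'. \<bar>\<zeta> x - \<zeta> x'\<bar> \<le> L * \<bar>x - x'\<bar>) \<longrightarrow>
        (\<forall>x. x \<notin> {a..b} \<longrightarrow> z x = 0 \<and> \<zeta> x = 0) \<longrightarrow>
        (\<exists>u. in_minimal_domain s (\<lambda>x. \<phi> x * complex_of_real (z x)) u \<and>
          (norm (l2_class (l_expr s (\<lambda>x. \<phi> x * complex_of_real (z x)) u)))\<^sup>2 \<le> 10 * L\<^sup>2 * (b - a))"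
    using minimal_domain_products[OF s a ab S small] by blast
  show ?thesis
  proof (rule exI[of _ \<phi>], intro conjI \<phi> allI impI)
    fix p r n assume prn: "a \<le> p" "r \<le> b" "(0::real) \<le> n"
    show "\<exists>u. in_minimal_domain s (\<lambda>x. \<phi> x * complex_of_real (bump p r n x)) u \<and>
          (norm (l2_class (l_expr s (\<lambda>x. \<phi> x * complex_of_real (bump p r n x)) u)))\<^sup>2 \<le> 10 * (40 * n\<^sup>2)\<^sup>2 * (b - a)"
    proof (rule *[THEN spec, THEN spec, THEN spec, THEN mp, THEN mp, THEN mp])
      show "\<forall>x. (bump p r n has_real_derivative bump' p r n x) (at x)" by (blast intro: bump_derivative)
      show "\<forall>x x'. \<bar>bump' p r n x - bump' p r n x'\<bar> \<le> 40 * n\<^sup>2 * \<bar>x - x'\<bar>" by (blast intro: bump'_lipschitz prn)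
      show "\<forall>x. x \<notin> {a..b} \<longrightarrow> bump p r n x = 0 \<and> bump' p r n x = 0"
        using prn by (auto intro!: bump_outside[THEN conjunct1] bump_outside[THEN conjunct2])
    qed
  qed
qed

text \<open>On sufficiently short intervals the products \<open>\<phi> * z\<close> with a bump \<open>z\<close> belong to the domain. A function orthogonal
to all their complex multiples vanishes almost everywhere there, since \<open>\<phi>\<close> has no zeros. The admissible length
is uniform on each bounded interval, so countably many short intervals cover the half-line.\<close>

theorem minimal_domain_dense:
  assumes s: "L2_loc s" and h: "\<And>x v. (x, v) \<in> minimal_operator s \<Longrightarrow> inner x h = 0"
  shows "h = 0"
proof -
  define k where "k = rep_l2 h"
  have k: "square_integrable k" and hk: "h = l2_class k" by (simp_all add: k_def square_integrable_rep_l2)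
  have km: "k \<in> borel_measurable half_line" using k by (simp add: square_integrable_def)
  have kL2: "L2_on a b k" if "0 \<le> a" for a b
  proof -
    have "integrable half_line (\<lambda>x. (cmod (k x))\<^sup>2)" using k by (simp add: square_integrable_def)
    then have "(\<lambda>x. (cmod (k x))\<^sup>2) integrable_on {0..}" by (rule integrable_on_lebesgue_on) simp
    then have "(\<lambda>x. (cmod (k x))\<^sup>2) integrable_on {a..b}" by (rule integrable_on_subinterval) (use that in auto)
    moreover have "k \<in> borel_measurable (lebesgue_on {a..b})" by (rule measurable_restrict_mono[OF km]) (use that in auto)
    ultimately show ?thesis by (simp add: L2_on_def)
  qed
  have loc: "\<exists>N. negligible N \<and> (\<forall>x\<in>{a..b} - N. k x = 0)"
    if a: "0 \<le> a" and ab: "a < b" and S: "integral {a..b} (\<lambda>x. (cmod (s x - 0))\<^sup>2) \<le> S" "S > 0" "64 * S * (b - a) \<le> 1" for a b S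
  proof -
    obtain \<phi> where \<phi>: "AC_loc \<phi>" "\<forall>x\<ge>0. 1/2 \<le> cmod (\<phi> x) \<and> cmod (\<phi> x) \<le> 2"
      and *: "\<forall>p r n. a \<le> p \<longrightarrow> r \<le> b \<longrightarrow> 0 \<le> n \<longrightarrow>
        (\<exists>u. in_minimal_domain s (\<lambda>x. \<phi> x * complex_of_real (bump p r n x)) u \<and>
          (norm (l2_class (l_expr s (\<lambda>x. \<phi> x * complex_of_real (bump p r n x)) u)))\<^sup>2 \<le> 10 * (40 * n\<^sup>2)\<^sup>2 * (b - a))"
      using bump_test_functions[OF s a ab S] by blast
    have \<phi>k: "(\<lambda>x. \<phi> x * cnj (k x)) absolutely_integrable_on {a..b}"
      by (intro L2_on_mult L2_on_cnj kL2 a L2_on_continuous AC_loc_continuous_on_Icc \<phi>)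
    have orth: "integral {a..b} (\<lambda>x. bump p r n x * Re (c * (\<phi> x * cnj (k x)))) = 0"
      if prn: "a \<le> p" "p < r" "r \<le> b" "n \<ge> 0" for p r n c
    proof -
      let ?y = "\<lambda>x. \<phi> x * complex_of_real (bump p r n x)"
      obtain u where u: "in_minimal_domain s ?y u" using * prn by blast
      then have "(l2_class ?y, l2_class (l_expr s ?y u)) \<in> minimal_operator s" unfolding minimal_operator_def by blast
      then have "(l2_scale c (l2_class ?y), l2_scale c (l2_class (l_expr s ?y u))) \<in> minimal_operator s"
        by (rule minimal_operator_scale[OF _ s])
      then have "inner (l2_scale c (l2_class ?y)) h = 0" by (rule h)
      moreover have sqy: "square_integrable ?y" using in_minimal_domainD(1)[OF u] .
      ultimately have "(\<integral>x. (c * ?y x) \<bullet> k x \<partial>half_line) = 0"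
        by (simp add: l2_class_scale hk l2_class_inner square_integrable_scale k)
      moreover have "(\<integral>x. (c * ?y x) \<bullet> k x \<partial>half_line) = integral {a..b} (\<lambda>x. (c * ?y x) \<bullet> k x)"
      proof (rule half_line_integral_support(2)[OF a])
        have cy: "square_integrable (\<lambda>x. c * ?y x)" using sqy by (rule square_integrable_scale)
        then show "(\<lambda>x. (c * ?y x) \<bullet> k x) \<in> borel_measurable half_line"
          using km by (intro borel_measurable_inner) (auto simp: square_integrable_def)
        show "AE x in half_line. x \<notin> {a..b} \<longrightarrow> (c * ?y x) \<bullet> k x = 0"
        proof (intro AE_I2 impI)
          fix x assume "x \<notin> {a..b}"
          then have "x \<notin> {p..r}" using prn by auto
          then show "(c * ?y x) \<bullet> k x = 0" using bump_outside[of n x p r] prn by simp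
        qed
        have "integrable half_line (\<lambda>x. (c * ?y x) \<bullet> k x)" by (rule square_integrable_inner[OF cy k])
        then have "(\<lambda>x. (c * ?y x) \<bullet> k x) absolutely_integrable_on {0..}"
          unfolding set_integrable_def by (simp add: integrable_restrict_space)
        then show "(\<lambda>x. (c * ?y x) \<bullet> k x) absolutely_integrable_on {a..b}"
          by (rule absolutely_integrable_on_subinterval) (use a in auto)
      qed
      moreover have "(c * ?y x) \<bullet> k x = bump p r n x * Re (c * (\<phi> x * cnj (k x)))" for x
        by (simp add: inner_complex_def algebra_simps)
      ultimately show ?thesis by simp
    qed
    have ai: "(\<lambda>x. Re (c * (\<phi> x * cnj (k x)))) absolutely_integrable_on {a..b}" for c
    proof -
      have "(\<lambda>x. c * (\<phi> x * cnj (k x))) absolutely_integrable_on {a..b}"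
        using L2_on_mult[of a b "\<lambda>x. c * \<phi> x" "\<lambda>x. cnj (k x)"] L2_on_cnj[OF kL2[OF a]]
          L2_on_continuous[OF AC_loc_continuous_on_Icc[OF AC_loc_cmult[OF \<phi>(1)] a]] by (simp add: mult.assoc)
      then show ?thesis by (rule absolutely_integrable_linear[OF _ bounded_linear_Re, unfolded o_def])
    qed
    obtain N1 where N1: "negligible N1" "\<forall>x\<in>{a..b} - N1. Re (1 * (\<phi> x * cnj (k x))) = 0"
      using bump_orthogonal_imp_zero[OF ai orth] by blast
    obtain N2 where N2: "negligible N2" "\<forall>x\<in>{a..b} - N2. Re (- \<i> * (\<phi> x * cnj (k x))) = 0"
      using bump_orthogonal_imp_zero[OF ai orth] by blast
    have "k x = 0" if "x \<in> {a..b} - (N1 \<union> N2)" for x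
    proof -
      have "Re (\<phi> x * cnj (k x)) = 0" "Im (\<phi> x * cnj (k x)) = 0" using N1(2) N2(2) that by auto
      then have "\<phi> x * cnj (k x) = 0" by (simp add: complex_eq_iff)
      moreover have "1/2 \<le> cmod (\<phi> x)" using \<phi>(2)[rule_format, of x] that a by auto
      then have "\<phi> x \<noteq> 0" by auto
      ultimately show ?thesis by simp
    qed
    then show ?thesis using N1(1) N2(1) by (intro exI[of _ "N1 \<union> N2"]) auto
  qed
  define S where "S R = integral {0..real R + 1} (\<lambda>x. (cmod (s x))\<^sup>2) + 1" for R :: nat
  have S0: "S R \<ge> 1" for R unfolding S_def
    using Henstock_Kurzweil_Integration.integral_nonneg[OF L2_onD(2)[OF L2_loc_L2_on[OF s order_refl]]] by auto
  \<comment> \<open>the length for which the smallness condition holds anywhere in \<open>[0, R]\<close>\<close>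
  define d where "d R = 1 / (64 * S R)" for R
  have d: "0 < d R" "d R \<le> 1" "64 * S R * d R = 1" for R using S0[of R] by (auto simp: d_def divide_le_eq)
  have "\<exists>N. negligible N \<and> (\<forall>x\<in>{real j * d R..(real j + 1) * d R} - N. k x = 0)" if "real j * d R \<le> real R" for j R :: nat
  proof -
    have e: "(real j + 1) * d R = real j * d R + d R" by (simp add: algebra_simps)
    show ?thesis
    proof (rule loc[of _ _ "S R"])
      show "0 \<le> real j * d R" using d(1)[of R] by simp
      show "real j * d R < (real j + 1) * d R" unfolding e using d(1) by simp
      have "integral {real j * d R..(real j + 1) * d R} (\<lambda>x. (cmod (s x))\<^sup>2) \<le> integral {0..real R + 1} (\<lambda>x. (cmod (s x))\<^sup>2)"
        using d[of R] that unfolding e by (intro integral_cmod_sq_mono L2_loc_L2_on s) auto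
      then show "integral {real j * d R..(real j + 1) * d R} (\<lambda>x. (cmod (s x - 0))\<^sup>2) \<le> S R" by (simp add: S_def)
      show "0 < S R" using S0[of R] by linarith
      show "64 * S R * ((real j + 1) * d R - real j * d R) \<le> 1" unfolding e using d(3)[of R] by simp
    qed
  qed
  then have "\<forall>j R. \<exists>N. real j * d R \<le> real R \<longrightarrow> negligible N \<and> (\<forall>x\<in>{real j * d R..(real j + 1) * d R} - N. k x = 0)" by blast
  then obtain N where N: "\<And>j R. real j * d R \<le> real R \<Longrightarrow> negligible (N j R)"
     "\<And>j R x. real j * d R \<le> real R \<Longrightarrow> x \<in> {real j * d R..(real j + 1) * d R} - N j R \<Longrightarrow> k x = 0" by metis
  define NN where "NN = (\<Union>R. \<Union>j. if real j * d R \<le> real R then N j R else {})"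
  have neg: "negligible NN" unfolding NN_def using N(1) by (intro negligible_countable_Union) auto
  have "AE x in half_line. k x = 0"
  proof (rule AE_half_lineI[OF neg])
    fix x :: real assume x: "0 < x" "x \<notin> NN"
    obtain R :: nat where R: "x < real R" using reals_Archimedean2 by blast
    define j where "j = nat \<lfloor>x / d R\<rfloor>"
    have j: "real j \<le> x / d R" "x / d R < real j + 1"
      using x d(1)[of R] by (auto simp: j_def)
    then have jx: "real j * d R \<le> x" "x < (real j + 1) * d R" using d(1)[of R] by (auto simp: field_simps)
    then have "real j * d R \<le> real R" using R by linarith
    moreover have "x \<notin> N j R" using x(2) \<open>real j * d R \<le> real R\<close> unfolding NN_def by auto
    ultimately show "k x = 0" using N(2)[of j R x] jx by auto
  qed
  then have "l2_class k = l2_class (\<lambda>x. 0)" using l2_class_eq_iff[OF k square_integrable_0] by simp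
  then show ?thesis by (simp add: hk zero_l2.abs_eq)
qed

section \<open>Flat potentials have no compact resolvents\<close>

text \<open>On each interval take the product \<open>y n\<close> of a bump with the solution \<open>\<phi>\<close>. Both \<open>norm (y n)\<close> and the norms of the
images under the operator are bounded, so a compact resolvent would produce a convergent subsequence. But the
\<open>y n\<close> are bounded below in norm and have disjoint supports along a subsequence, so they stay apart.\<close>

theorem no_compact_resolvent_if_flat_intervals:
  assumes s: "L2_loc s" and ext: "has_extensions_with_compact_resolvent (minimal_operator s)"
    and t: "filterlim t at_top sequentially" "\<And>n. 0 \<le> t n" and \<delta>: "\<delta> > 0"
    and S: "S > 0" "64 * S * \<delta> \<le> 1" "\<And>n::nat. integral {t n..t n + \<delta>} (\<lambda>x. (cmod (s x - c n))\<^sup>2) \<le> S"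
  shows False
proof -
  obtain D T where lin: "linear_operator D T" and exT: "extends_operator D T (minimal_operator s)"
    and cr: "has_compact_resolvent D T" using ext unfolding has_extensions_with_compact_resolvent_def by blast
  obtain z0 where z0: "z0 \<in> resolvent_set D T" using cr unfolding has_compact_resolvent_def by blast
  then have cK: "compact_operator (resolvent D T z0)" using cr unfolding has_compact_resolvent_def by blast
  \<comment> \<open>steepness for which the bump equals \<open>1\<close> on the middle half of the interval\<close>
  define m where "m = 4 / \<delta>"
  have m: "m > 0" using \<delta> by (simp add: m_def)
  define C where "C = 10 * (40 * m\<^sup>2)\<^sup>2 * \<delta>"
  let ?z = "\<lambda>n. bump (t n) (t n + \<delta>) m"
  have "\<exists>y u. in_minimal_domain s y u \<and> (norm (l2_class (l_expr s y u)))\<^sup>2 \<le> C \<and>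
      (\<forall>x. x \<notin> {t n..t n + \<delta>} \<longrightarrow> y x = 0) \<and> (norm (l2_class y))\<^sup>2 \<le> 4 * \<delta> \<and> \<delta> / 8 \<le> (norm (l2_class y))\<^sup>2" for n
  proof -
    have S': "integral {t n..t n + \<delta>} (\<lambda>x. (cmod (s x - c n))\<^sup>2) \<le> S" "64 * S * (t n + \<delta> - t n) \<le> 1" using S by auto
    have "t n < t n + \<delta>" using \<delta> by simp
    from bump_test_functions[OF s t(2) this S'(1) S(1) S'(2)] obtain \<phi> where \<phi>: "AC_loc \<phi>"
      "\<forall>x\<ge>0. 1/2 \<le> cmod (\<phi> x) \<and> cmod (\<phi> x) \<le> 2"
      and *: "\<forall>p r k. t n \<le> p \<longrightarrow> r \<le> t n + \<delta> \<longrightarrow> 0 \<le> k \<longrightarrow>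
        (\<exists>u. in_minimal_domain s (\<lambda>x. \<phi> x * complex_of_real (bump p r k x)) u \<and>
          (norm (l2_class (l_expr s (\<lambda>x. \<phi> x * complex_of_real (bump p r k x)) u)))\<^sup>2 \<le> 10 * (40 * k\<^sup>2)\<^sup>2 * (t n + \<delta> - t n))"
      by blast
    let ?y = "\<lambda>x. \<phi> x * complex_of_real (?z n x)"
    obtain u where u: "in_minimal_domain s ?y u" "(norm (l2_class (l_expr s ?y u)))\<^sup>2 \<le> C"
      using *[rule_format, of "t n" "t n + \<delta>" m] m by (auto simp: C_def)
    have y0: "?y x = 0" if "x \<notin> {t n..t n + \<delta>}" for x using bump_outside[OF _ that, of m] m by simp
    note U = in_minimal_domainD[OF u(1)]
    have yc: "continuous_on {t n..t n + \<delta>} ?y" using U(2) t(2) by (rule AC_loc_continuous_on_Icc)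
    have yi: "(\<lambda>x. (cmod (?y x))\<^sup>2) integrable_on {t n..t n + \<delta>}"
      using L2_onD(2)[OF L2_on_continuous[OF yc]] .
    have nI: "(norm (l2_class ?y))\<^sup>2 = integral {t n..t n + \<delta>} (\<lambda>x. (cmod (?y x))\<^sup>2)"
    proof -
      have "(norm (l2_class ?y))\<^sup>2 = (\<integral>x. (cmod (?y x))\<^sup>2 \<partial>half_line)" by (simp add: norm_l2_class[OF U(1)])
      also have "\<dots> = integral {t n..t n + \<delta>} (\<lambda>x. (cmod (?y x))\<^sup>2)"
        by (rule square_integrable_support(2)[OF t(2) AC_loc_measurable[OF U(2)] _ L2_on_continuous[OF yc]])
          (use y0 in auto)
      finally show ?thesis .
    qed
    have up: "integral {t n..t n + \<delta>} (\<lambda>x. (cmod (?y x))\<^sup>2) \<le> integral {t n..t n + \<delta>} (\<lambda>x. 4)"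
    proof (rule integral_le[OF yi])
      fix x assume "x \<in> {t n..t n + \<delta>}"
      then have "0 \<le> x" using t(2)[of n] by simp
      then have "cmod (?y x) \<le> 2 * 1" unfolding norm_mult using \<phi>(2) bump_bounds[of "t n" "t n + \<delta>" m x] by (intro mult_mono) auto
      then show "(cmod (?y x))\<^sup>2 \<le> 4" using power_mono[of "cmod (?y x)" 2 2] by simp
    qed auto
    have "integral {t n + \<delta>/4..t n + \<delta> - \<delta>/4} (\<lambda>x. 1/4) \<le> integral {t n + \<delta>/4..t n + \<delta> - \<delta>/4} (\<lambda>x. (cmod (?y x))\<^sup>2)"
    proof (rule integral_le)
      show "(\<lambda>x. (cmod (?y x))\<^sup>2) integrable_on {t n + \<delta>/4..t n + \<delta> - \<delta>/4}"
        using yi by (rule integrable_subinterval_real) (use \<delta> in auto)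
      fix x assume x: "x \<in> {t n + \<delta>/4..t n + \<delta> - \<delta>/4}"
      have "?z n x = 1" using x m by (intro bump_inside) (auto simp: m_def)
      moreover have "1/2 \<le> cmod (\<phi> x)" using \<phi>(2) x t(2)[of n] \<delta> by (auto dest!: spec[of _ x])
      ultimately have "1/2 \<le> cmod (?y x)" by simp
      then show "1/4 \<le> (cmod (?y x))\<^sup>2" using power_mono[of "1/2" "cmod (?y x)" 2] by (simp add: power2_eq_square)
    qed auto
    also have "\<dots> \<le> integral {t n..t n + \<delta>} (\<lambda>x. (cmod (?y x))\<^sup>2)"
      using yi \<delta> by (intro integral_subset_le integrable_subinterval_real[OF yi]) auto
    finally have low: "\<delta> / 8 \<le> integral {t n..t n + \<delta>} (\<lambda>x. (cmod (?y x))\<^sup>2)" using \<delta> by simp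
    show ?thesis using u y0 nI up low \<delta> by (intro exI[of _ ?y] exI[of _ u]) auto
  qed
  then obtain y u where yu: "\<And>n. in_minimal_domain s (y n) (u n)" "\<And>n. (norm (l2_class (l_expr s (y n) (u n))))\<^sup>2 \<le> C"
      "\<And>n x. x \<notin> {t n..t n + \<delta>} \<Longrightarrow> y n x = 0" "\<And>n. (norm (l2_class (y n)))\<^sup>2 \<le> 4 * \<delta>" "\<And>n. \<delta> / 8 \<le> (norm (l2_class (y n)))\<^sup>2"
    by metis
  define X V where "X n = l2_class (y n)" and "V n = l2_class (l_expr s (y n) (u n))" for n
  have XV: "(X n, V n) \<in> minimal_operator s" for n using yu(1) unfolding minimal_operator_def X_def V_def by blast
  have XD: "X n \<in> D" "T (X n) = V n" for n using exT XV[of n] unfolding extends_operator_def by auto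
  define W where "W n = V n - l2_scale z0 (X n)" for n
  have RW: "resolvent D T z0 (W n) = X n" for n
  proof -
    have "inj_on (\<lambda>u. T u - l2_scale z0 u) D" using z0 by (auto simp: resolvent_set_def bij_betw_def)
    then show ?thesis unfolding resolvent_def W_def using XD by (intro inv_into_f_eq) auto
  qed
  have "norm (W n) \<le> sqrt C + cmod z0 * sqrt (4 * \<delta>)" for n
  proof -
    have "norm (V n) \<le> sqrt C" unfolding V_def using yu(2)[of n] by (rule real_le_rsqrt)
    moreover have "norm (X n) \<le> sqrt (4 * \<delta>)" unfolding X_def using yu(4)[of n] by (rule real_le_rsqrt)
    then have "norm (l2_scale z0 (X n)) \<le> cmod z0 * sqrt (4 * \<delta>)" unfolding norm_l2_scale by (intro mult_left_mono) auto
    ultimately show ?thesis unfolding W_def using norm_triangle_ineq4[of "V n" "l2_scale z0 (X n)"] by linarith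
  qed
  then have "bounded (range W)" unfolding bounded_iff by blast
  then have "compact (closure (resolvent D T z0 ` range W))" using cK unfolding compact_operator_def by blast
  moreover have "X n \<in> closure (resolvent D T z0 ` range W)" for n
  proof -
    have "X n \<in> resolvent D T z0 ` range W" unfolding RW[of n, symmetric] by blast
    then show ?thesis by (rule subsetD[OF closure_subset])
  qed
  ultimately obtain l r where r: "strict_mono (r :: nat \<Rightarrow> nat)" "(X \<circ> r) \<longlonglongrightarrow> l"
    unfolding compact_def by blast
  then have "Cauchy (X \<circ> r)" by (intro LIMSEQ_imp_Cauchy)
  moreover define e where "e = sqrt (\<delta> / 8)"
  moreover have e: "e > 0" using \<delta> by (simp add: e_def)
  ultimately obtain M where M: "\<And>i j. i \<ge> M \<Longrightarrow> j \<ge> M \<Longrightarrow> norm ((X \<circ> r) i - (X \<circ> r) j) < e"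
    unfolding Cauchy_iff by blast
  have "\<forall>\<^sub>F n in sequentially. t (r M) + \<delta> < t n" using t(1) unfolding filterlim_at_top_dense by blast
  then obtain K where K: "\<And>n. n \<ge> K \<Longrightarrow> t (r M) + \<delta> < t n" unfolding eventually_sequentially by blast
  define j where "j = max M K"
  have "j \<le> r j" using seq_suble[OF r(1)] .
  then have tj: "t (r M) + \<delta> < t (r j)" by (intro K) (simp add: j_def)
  have "inner (X (r M)) (X (r j)) = (\<integral>x. y (r M) x \<bullet> y (r j) x \<partial>half_line)"
    unfolding X_def using in_minimal_domainD(1)[OF yu(1)] by (simp add: l2_class_inner)
  also have "\<dots> = (\<integral>x. 0 \<partial>half_line)"
  proof (rule Bochner_Integration.integral_cong)
    fix x show "y (r M) x \<bullet> y (r j) x = 0"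
      using yu(3)[of x "r M"] yu(3)[of x "r j"] tj by (cases "x \<in> {t (r M)..t (r M) + \<delta>}") auto
  qed simp
  finally have orth: "inner (X (r M)) (X (r j)) = 0" by simp
  have "(norm (X (r M) - X (r j)))\<^sup>2 = (norm (X (r M)))\<^sup>2 + (norm (X (r j)))\<^sup>2"
    unfolding power2_norm_eq_inner using orth by (simp add: inner_diff_left inner_diff_right inner_commute)
  then have "\<delta> / 8 \<le> (norm (X (r M) - X (r j)))\<^sup>2"
    using yu(5)[of "r M"] yu(5)[of "r j"] \<delta> unfolding X_def by simp
  then have "e \<le> norm (X (r M) - X (r j))" unfolding e_def by (intro real_le_lsqrt) auto
  then show False using M[of M j] by (simp add: j_def)
qed

section \<open>Decomposition of the potential\<close>

lemma L2_unifD: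
  assumes "L2_unif f"
  obtains B where "B > 0" "\<And>x. 0 \<le> x \<Longrightarrow> integral {x..x+1} (\<lambda>\<xi>. (cmod (f \<xi>))\<^sup>2) \<le> B"
proof -
  have l: "L2_loc f" and "bdd_above ((\<lambda>x. \<integral>\<xi>. (cmod (f \<xi>))\<^sup>2 \<partial>lebesgue_on {x..x+1}) ` {0..})"
    using assms by (auto simp: L2_unif_def)
  then obtain B where B: "\<And>x. 0 \<le> x \<Longrightarrow> (\<integral>\<xi>. (cmod (f \<xi>))\<^sup>2 \<partial>lebesgue_on {x..x+1}) \<le> B"
    unfolding bdd_above_def by auto
  have "integral {x..x+1} (\<lambda>\<xi>. (cmod (f \<xi>))\<^sup>2) \<le> max B 1" if "0 \<le> x" for x
  proof -
    have L2: "L2_on x (x+1) f" using l that by (rule L2_loc_L2_on)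
    have "(\<lambda>\<xi>. (cmod (f \<xi>))\<^sup>2) absolutely_integrable_on {x..x+1}"
      using L2 by (intro nonnegative_absolutely_integrable_1) (auto simp: L2_on_def)
    then have "integrable (lebesgue_on {x..x+1}) (\<lambda>\<xi>. (cmod (f \<xi>))\<^sup>2)"
      by (simp add: set_integrable_def integrable_restrict_space)
    then have "(\<integral>\<xi>. (cmod (f \<xi>))\<^sup>2 \<partial>lebesgue_on {x..x+1}) = integral {x..x+1} (\<lambda>\<xi>. (cmod (f \<xi>))\<^sup>2)"
      by (intro lebesgue_integral_eq_integral) auto
    then show ?thesis using B[OF that] by simp
  qed
  then show ?thesis using that[of "max B 1"] by simp
qed

lemma L2_unif_integral_bound:
  assumes "L2_unif f"
  shows "\<exists>B>0. \<forall>x\<ge>0. integral {x..x+D} (\<lambda>\<xi>. (cmod (f \<xi>))\<^sup>2) \<le> B"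
proof -
  have l: "L2_loc f" using assms by (simp add: L2_unif_def)
  obtain B where B: "B > 0" "\<And>x. 0 \<le> x \<Longrightarrow> integral {x..x+1} (\<lambda>\<xi>. (cmod (f \<xi>))\<^sup>2) \<le> B"
    using L2_unifD[OF assms] by blast
  have n: "integral {x..x+real n} (\<lambda>\<xi>. (cmod (f \<xi>))\<^sup>2) \<le> real n * B" if "0 \<le> x" for n x
  proof (induction n)
    case (Suc n)
    have "integral {x..x + real (Suc n)} (\<lambda>\<xi>. (cmod (f \<xi>))\<^sup>2) =
       integral {x..x+real n} (\<lambda>\<xi>. (cmod (f \<xi>))\<^sup>2) + integral {x+real n..x + real (Suc n)} (\<lambda>\<xi>. (cmod (f \<xi>))\<^sup>2)"
      using L2_onD(2)[OF L2_loc_L2_on[OF l that]] by (intro Henstock_Kurzweil_Integration.integral_combine[symmetric]) auto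
    also have "integral {x+real n..x + real (Suc n)} (\<lambda>\<xi>. (cmod (f \<xi>))\<^sup>2) \<le> B"
      using B(2)[of "x + real n"] that by (simp add: algebra_simps)
    finally show ?case using Suc by (simp add: algebra_simps)
  qed simp
  obtain n :: nat where "D < real n" using reals_Archimedean2 by blast
  have "integral {x..x+D} (\<lambda>\<xi>. (cmod (f \<xi>))\<^sup>2) \<le> real n * B + 1" if "0 \<le> x" for x
  proof -
    have "integral {x..x+D} (\<lambda>\<xi>. (cmod (f \<xi>))\<^sup>2) \<le> integral {x..x+real n} (\<lambda>\<xi>. (cmod (f \<xi>))\<^sup>2)"
      using \<open>D < real n\<close> by (intro integral_cmod_sq_mono L2_loc_L2_on l that) auto
    then show ?thesis using n[OF that, of n] by simp
  qed
  moreover have "real n * B + 1 > 0" using B(1) by (simp add: add_nonneg_pos)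
  ultimately show ?thesis by blast
qed

text \<open>By Chebyshev's inequality, with the uniform bound on the integrals of \<open>\<bar>f\<bar>\<^sup>2 + \<bar>g\<bar>\<^sup>2\<close> over intervals of length \<open>h\<close>.\<close>

lemma exists_point_both_small:
  assumes f: "L2_unif f" and g: "L2_unif g" and h: "h > 0"
  shows "\<exists>M>0. \<forall>x\<ge>0. \<exists>t\<in>{x..x+h}. cmod (f t) \<le> M \<and> cmod (g t) \<le> M"
proof -
  obtain B where B: "B > 0" "\<And>x. 0 \<le> x \<Longrightarrow> integral {x..x+h} (\<lambda>\<xi>. (cmod (f \<xi>))\<^sup>2) \<le> B"
    using L2_unif_integral_bound[OF f] by blast
  obtain B' where B': "B' > 0" "\<And>x. 0 \<le> x \<Longrightarrow> integral {x..x+h} (\<lambda>\<xi>. (cmod (g \<xi>))\<^sup>2) \<le> B'"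
    using L2_unif_integral_bound[OF g] by blast
  define M where "M = sqrt ((B + B') / h) + 1"
  have q: "(B + B') / h \<ge> 0" using B B' h by simp
  define w where "w = sqrt ((B + B') / h)"
  have w: "w \<ge> 0" "w\<^sup>2 = (B + B') / h" using q by (simp_all add: w_def)
  have "M\<^sup>2 = w\<^sup>2 + 2 * w + 1" unfolding M_def w_def[symmetric] by (simp add: power2_sum)
  then have M: "M > 0" "(B + B') / h < M\<^sup>2" using w by (simp_all add: M_def flip: w_def)
  have "\<exists>t\<in>{x..x+h}. cmod (f t) \<le> M \<and> cmod (g t) \<le> M" if x: "0 \<le> x" for x
  proof (rule ccontr)
    assume c: "\<not> ?thesis"
    have fL: "L2_on x (x+h) f" and gL: "L2_on x (x+h) g" using f g x by (auto simp: L2_unif_def intro: L2_loc_L2_on)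
    have "integral {x..x+h} (\<lambda>t. M\<^sup>2) \<le> integral {x..x+h} (\<lambda>t. (cmod (f t))\<^sup>2 + (cmod (g t))\<^sup>2)"
    proof (rule integral_le)
      show "(\<lambda>t. (cmod (f t))\<^sup>2 + (cmod (g t))\<^sup>2) integrable_on {x..x+h}"
        using fL gL by (intro integrable_add) (auto simp: L2_on_def)
      fix t assume "t \<in> {x..x+h}"
      then consider "M < cmod (f t)" | "M < cmod (g t)" using c by force
      then show "M\<^sup>2 \<le> (cmod (f t))\<^sup>2 + (cmod (g t))\<^sup>2"
      proof cases
        case 1
        then have "M\<^sup>2 \<le> (cmod (f t))\<^sup>2" using M(1) by (intro power_mono) auto
        then show ?thesis by (simp add: add_increasing2)
      next
        case 2
        then have "M\<^sup>2 \<le> (cmod (g t))\<^sup>2" using M(1) by (intro power_mono) auto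
        then show ?thesis by (simp add: add_increasing)
      qed
    qed auto
    also have "\<dots> \<le> B + B'" using fL gL B(2)[OF x] B'(2)[OF x]
      by (subst Henstock_Kurzweil_Integration.integral_add) (auto simp: L2_on_def)
    finally have "M\<^sup>2 * h \<le> B + B'" using h by (simp add: mult.commute)
    then show False using M(2) h by (simp add: pos_divide_less_eq)
  qed
  then show ?thesis using M(1) by blast
qed

text \<open>The inequality can be chained through points where \<open>\<psi>\<close> and \<open>\<gamma>\<close> are at most \<open>M\<close>. Such points exist in every interval of
length \<open>d / 2\<close>, so the loss over a distance is at most linear in it. Adding a linear function with large
slope turns this into monotonicity up to a bounded error, and the running supremum is the required monotone function.\<close>

lemma almost_monotone_decomposition:
  fixes \<sigma> \<psi> \<gamma> :: "real \<Rightarrow> real"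
  assumes d: "d > 0"
    and le: "\<And>x t. 0 \<le> t \<Longrightarrow> 0 \<le> x - t \<Longrightarrow> x - t \<le> d \<Longrightarrow> \<sigma> t + \<gamma> t \<le> \<sigma> x + \<psi> x"
    and M: "M > 0" "\<And>x. 0 \<le> x \<Longrightarrow> \<exists>t\<in>{x..x+d/2}. \<bar>\<psi> t\<bar> \<le> M \<and> \<bar>\<gamma> t\<bar> \<le> M"
  shows "\<exists>m c. mono m \<and> (\<forall>x\<ge>0. \<bar>\<sigma> x + c * x - m x\<bar> \<le> \<bar>\<psi> x\<bar> + \<bar>\<gamma> x\<bar> + 2 * M)"
proof -
  have chain: "\<sigma> t + \<gamma> t \<le> \<sigma> x + \<psi> x + 2 * M * real n"
    if "0 \<le> t" "t \<le> x" "x - t \<le> d + real n * (d/2)" for n t x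
    using that
  proof (induction n arbitrary: t)
    case 0
    then show ?case using le[of t x] by simp
  next
    case (Suc n)
    show ?case
    proof (cases "x - t \<le> d")
      case True
      then show ?thesis using le[of t x] Suc.prems M(1) by (simp add: add_increasing2)
    next
      case False
      obtain t1 where t1: "t1 \<in> {t + d/2..t + d/2 + d/2}" "\<bar>\<psi> t1\<bar> \<le> M" "\<bar>\<gamma> t1\<bar> \<le> M"
        using M(2)[of "t + d/2"] Suc.prems d by auto
      have "\<sigma> t + \<gamma> t \<le> \<sigma> t1 + \<psi> t1" using t1 Suc.prems d by (intro le) auto
      also have "\<dots> \<le> (\<sigma> t1 + \<gamma> t1) + 2 * M" using t1 by linarith
      also have "\<sigma> t1 + \<gamma> t1 \<le> \<sigma> x + \<psi> x + 2 * M * real n"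
      proof (rule Suc.IH)
        have e: "real (Suc n) * (d/2) = real n * (d/2) + d/2" by (simp add: algebra_simps)
        have "t + d/2 \<le> t1" using t1 by simp
        then show "x - t1 \<le> d + real n * (d/2)" using Suc.prems(3) unfolding e by linarith
      qed (use t1 Suc.prems False d in auto)
      finally show ?thesis by (simp add: algebra_simps)
    qed
  qed
  \<comment> \<open>a loss of \<open>2 * M\<close> for each step of length \<open>d / 2\<close>\<close>
  define \<Lambda> where "\<Lambda> = 4 * M / d"
  have up: "\<sigma> t + \<gamma> t + \<Lambda> * t \<le> \<sigma> x + \<psi> x + \<Lambda> * x + 2 * M" if "0 \<le> t" "t \<le> x" for t x
  proof -
    define n where "n = nat \<lceil>(x - t) / (d/2)\<rceil>"
    have n: "(x - t) / (d/2) \<le> real n" "real n \<le> (x - t) / (d/2) + 1"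
      using that d unfolding n_def by (auto simp: of_nat_nat)
    have "x - t \<le> d + real n * (d/2)" using n(1) d by (simp add: pos_divide_le_eq)
    then have "\<sigma> t + \<gamma> t \<le> \<sigma> x + \<psi> x + 2 * M * real n" using that by (intro chain)
    also have "2 * M * real n \<le> 2 * M * ((x - t) / (d/2) + 1)" using n(2) M(1) by (intro mult_left_mono) auto
    also have "\<dots> = \<Lambda> * x - \<Lambda> * t + 2 * M" using d by (simp add: \<Lambda>_def field_simps)
    finally show ?thesis by simp
  qed
  define A where "A x = (\<lambda>t. \<sigma> t + \<gamma> t + \<Lambda> * t) ` {0..max 0 x}" for x :: real
  define m where "m x = Sup (A x)" for x
  have bdd: "bdd_above (A x)" for x
    unfolding A_def using up[of _ "max 0 x"] by (intro bdd_aboveI2) auto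
  have ne: "A x \<noteq> {}" for x unfolding A_def by simp
  have "mono m"
    unfolding m_def by (intro monoI cSup_subset_mono ne bdd) (auto simp: A_def)
  moreover have "\<bar>\<sigma> x + \<Lambda> * x - m x\<bar> \<le> \<bar>\<psi> x\<bar> + \<bar>\<gamma> x\<bar> + 2 * M" if x: "0 \<le> x" for x
  proof -
    have "m x \<le> \<sigma> x + \<psi> x + \<Lambda> * x + 2 * M"
      unfolding m_def using up[of _ x] x by (intro cSup_least ne) (auto simp: A_def)
    moreover have "\<sigma> x + \<gamma> x + \<Lambda> * x \<le> m x"
      unfolding m_def using x by (intro cSup_upper bdd) (auto simp: A_def)
    ultimately show ?thesis using M(1) by linarith
  qed
  ultimately show ?thesis by blast
qed

text \<open>Coordinates in the basis formed by the directions of the two edges. They are given by Cramer's rule with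
determinant \<open>sin (\<beta> - \<alpha>)\<close>, and they are nonnegative on the sector.\<close>

lemma sector_coordinates:
  assumes "\<alpha> < \<beta>" "\<beta> - \<alpha> < pi"
  obtains P Q :: "complex \<Rightarrow> real" and K where
    "linear P" "linear Q" "K > 0" "\<And>z. \<bar>P z\<bar> \<le> K * cmod z" "\<And>z. \<bar>Q z\<bar> \<le> K * cmod z"
    "\<And>z. z = complex_of_real (P z) * cis \<alpha> + complex_of_real (Q z) * cis \<beta>"
    "\<And>z. arg_in z \<alpha> \<beta> \<Longrightarrow> 0 \<le> P z \<and> 0 \<le> Q z"
proof -
  define S where "S = sin (\<beta> - \<alpha>)"
  have S: "S > 0" unfolding S_def using assms by (intro sin_gt_zero) auto
  define P where "P z = Im (cnj z * cis \<beta>) / S" for z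
  define Q where "Q z = Im (z * cis (- \<alpha>)) / S" for z
  have lP: "linear P" unfolding P_def by (rule linearI) (simp_all add: algebra_simps add_divide_distrib diff_divide_distrib)
  have lQ: "linear Q" unfolding Q_def by (rule linearI) (simp_all add: algebra_simps add_divide_distrib diff_divide_distrib)
  have bP: "\<bar>P z\<bar> \<le> (1 / S) * cmod z" for z
    unfolding P_def using abs_Im_le_cmod[of "cnj z * cis \<beta>"] S by (simp add: norm_mult divide_right_mono)
  have bQ: "\<bar>Q z\<bar> \<le> (1 / S) * cmod z" for z
    unfolding Q_def using abs_Im_le_cmod[of "z * cis (- \<alpha>)"] S by (simp add: norm_mult divide_right_mono)
  have dec: "z = complex_of_real (P z) * cis \<alpha> + complex_of_real (Q z) * cis \<beta>" for z
  proof -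
    have s: "S = sin \<beta> * cos \<alpha> - cos \<beta> * sin \<alpha>" by (simp add: S_def sin_diff)
    have r: "P z * S = Re z * sin \<beta> - Im z * cos \<beta>" "Q z * S = Im z * cos \<alpha> - Re z * sin \<alpha>"
      using S by (simp_all add: P_def Q_def)
    have "S * Re z = (P z * S) * cos \<alpha> + (Q z * S) * cos \<beta>" unfolding r by (simp add: s algebra_simps)
    also have "\<dots> = S * (P z * cos \<alpha> + Q z * cos \<beta>)" by (simp add: algebra_simps)
    finally have 1: "Re z = P z * cos \<alpha> + Q z * cos \<beta>" using S by simp
    have "S * Im z = (P z * S) * sin \<alpha> + (Q z * S) * sin \<beta>" unfolding r by (simp add: s algebra_simps)
    also have "\<dots> = S * (P z * sin \<alpha> + Q z * sin \<beta>)" by (simp add: algebra_simps)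
    finally have 2: "Im z = P z * sin \<alpha> + Q z * sin \<beta>" using S by simp
    show ?thesis using 1 2 by (simp add: complex_eq_iff)
  qed
  have pos: "0 \<le> P z \<and> 0 \<le> Q z" if z: "arg_in z \<alpha> \<beta>" for z
  proof -
    obtain r \<theta> where r: "r \<ge> 0" "\<theta> \<in> {\<alpha>..\<beta>}" "z = rcis r \<theta>" using z by (auto simp: arg_in_def)
    have "P z = r * sin (\<beta> - \<theta>) / S" "Q z = r * sin (\<theta> - \<alpha>) / S"
      unfolding P_def Q_def r(3) by (simp_all add: rcis_def sin_diff algebra_simps)
    moreover have "0 \<le> sin (\<beta> - \<theta>)" "0 \<le> sin (\<theta> - \<alpha>)" using r(2) assms by (auto intro!: sin_ge_zero)
    ultimately show ?thesis using r(1) S by simp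
  qed
  show ?thesis by (rule that[OF lP lQ _ bP bQ dec pos]) (use S in simp)
qed

text \<open>Rotate the bisector of the smallest sector containing the given one and the positive half-axis to the positive
half-axis. The bounds on \<open>\<bar>\<alpha>\<bar>\<close> and \<open>\<bar>\<beta>\<bar>\<close> ensure that this sector has an opening less than \<open>pi\<close>.\<close>

lemma sector_rotation:
  assumes "\<alpha> \<le> \<beta>" "\<beta> - \<alpha> < pi" "\<bar>\<alpha>\<bar> < pi" "\<bar>\<beta>\<bar> < pi"
  obtains \<omega> \<kappa> where "cmod \<omega> = 1" "0 < \<kappa>" "\<kappa> \<le> Re \<omega>"
    "\<And>\<theta>. \<alpha> \<le> \<theta> \<Longrightarrow> \<theta> \<le> \<beta> \<Longrightarrow> \<kappa> \<le> Re (\<omega> * cis \<theta>)"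
proof -
  define lo hi where "lo = min \<alpha> 0" and "hi = max \<beta> 0"
  have lh: "lo \<le> 0" "0 \<le> hi" "hi - lo < pi" "lo \<le> \<alpha>" "\<beta> \<le> hi" using assms by (auto simp: lo_def hi_def)
  define \<kappa> where "\<kappa> = cos ((hi - lo) / 2)"
  have \<kappa>: "\<kappa> > 0" unfolding \<kappa>_def using lh by (intro cos_gt_zero_pi) auto
  have *: "\<kappa> \<le> Re (cis (- ((lo + hi) / 2)) * cis \<theta>)" if "lo \<le> \<theta>" "\<theta> \<le> hi" for \<theta>
  proof -
    have "Re (cis (- ((lo + hi) / 2)) * cis \<theta>) = cos \<bar>\<theta> - (lo + hi) / 2\<bar>" by (simp add: cis_mult)
    moreover have "\<bar>\<theta> - (lo + hi) / 2\<bar> \<le> (hi - lo) / 2" using that by (simp add: abs_le_iff field_simps)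
    then have "cos ((hi - lo) / 2) \<le> cos \<bar>\<theta> - (lo + hi) / 2\<bar>" using lh by (intro cos_monotone_0_pi_le) auto
    ultimately show ?thesis by (simp add: \<kappa>_def)
  qed
  show ?thesis
  proof (rule that[of "cis (- ((lo + hi) / 2))" \<kappa>])
    show "\<kappa> \<le> Re (cis (- ((lo + hi) / 2)))" using *[of 0] lh by simp
  qed (use \<kappa> * lh in auto)
qed

lemma sum3_sq_le: "(a + b + c)\<^sup>2 \<le> 3 * (a\<^sup>2 + b\<^sup>2 + c\<^sup>2)" for a b c :: real
proof -
  have "3 * (a\<^sup>2 + b\<^sup>2 + c\<^sup>2) - (a + b + c)\<^sup>2 = (a - b)\<^sup>2 + (b - c)\<^sup>2 + (a - c)\<^sup>2"
    by (simp add: power2_eq_square algebra_simps)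
  then show ?thesis by (metis add_nonneg_nonneg diff_ge_0_iff_ge zero_le_power2)
qed

text \<open>The situation reached by decomposing the potential. The remainder \<open>r\<close> is bounded in mean square over unit
intervals, and the rotation \<open>\<omega>\<close> moves \<open>1\<close>, \<open>e1\<close> and \<open>e2\<close> strictly into the right half-plane. All estimates below
only depend on these data.\<close>

locale sector_potential =
  fixes s r :: "real \<Rightarrow> complex" and m1 m2 :: "real \<Rightarrow> real" and e1 e2 \<gamma> \<omega> :: complex and \<kappa> B :: real
  assumes s: "L2_loc s" and mono1: "mono m1" and mono2: "mono m2"
    and decomp: "\<And>x. 0 \<le> x \<Longrightarrow> s x = e1 * complex_of_real (m1 x) + e2 * complex_of_real (m2 x) + \<gamma> * complex_of_real x + r x"
    and e1: "cmod e1 = 1" and e2: "cmod e2 = 1"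
    and \<omega>: "cmod \<omega> = 1" and \<kappa>: "0 < \<kappa>" and \<kappa>\<omega>: "\<kappa> \<le> Re \<omega>" and \<kappa>1: "\<kappa> \<le> Re (\<omega> * e1)" and \<kappa>2: "\<kappa> \<le> Re (\<omega> * e2)"
    and r: "\<And>a b. 0 \<le> a \<Longrightarrow> L2_on a b r" and B: "0 < B" and rB: "\<And>x. 0 \<le> x \<Longrightarrow> integral {x..x+1} (\<lambda>t. (cmod (r t))\<^sup>2) \<le> B"
begin

text \<open>Chosen such that the contribution of \<open>r\<close> to the energy takes away at most half of the term with \<open>\<bar>y'\<bar>\<^sup>2\<close>; the price is
the multiple \<open>C\<close> of \<open>\<bar>y\<bar>\<^sup>2\<close>.\<close>

definition \<eta> where "\<eta> = \<kappa>\<^sup>2 / (16 * B)"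
definition C where "C = cmod \<gamma> + 4 / \<kappa> * (B * (1 + 1 / \<eta>))"

lemma \<eta>_pos: "0 < \<eta>" using \<kappa> B by (simp add: \<eta>_def)
lemma C_nonneg: "0 \<le> C" using \<kappa> B \<eta>_pos by (auto simp: C_def intro!: add_nonneg_nonneg mult_nonneg_nonneg)

text \<open>The shift that makes the rotated operator coercive.\<close>

definition \<mu> :: real where "\<mu> = (C + 1) / \<kappa>"

end

text \<open>Both coordinates of \<open>s\<close> with respect to the edges of the sector are almost monotone.\<close>

theorem sector_decomposition:
  assumes s: "L2_loc s" and f: "L2_unif f" and g: "L2_unif g" and d: "d > 0"
    and ab: "\<alpha> \<le> \<beta>" "\<beta> - \<alpha> < pi" "\<bar>\<alpha>\<bar> < pi" "\<bar>\<beta>\<bar> < pi"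
    and arg: "\<And>x t. 0 \<le> x \<Longrightarrow> 0 \<le> t \<Longrightarrow> 0 \<le> x - t \<Longrightarrow> x - t \<le> d \<Longrightarrow> arg_in (s x + f x - s t - g t) \<alpha> \<beta>"
  shows "\<exists>r m1 m2 e1 e2 \<gamma> \<omega> \<kappa> B. sector_potential s r m1 m2 e1 e2 \<gamma> \<omega> \<kappa> B"
proof -
  \<comment> \<open>a degenerate sector is enlarged, since coordinates need two independent edges\<close>
  obtain \<beta>' where \<beta>': "\<alpha> < \<beta>'" "\<beta> \<le> \<beta>'" "\<beta>' - \<alpha> < pi" "\<bar>\<beta>'\<bar> < pi"
  proof (cases "\<alpha> < \<beta>")
    case True then show ?thesis using that[of \<beta>] ab by simp
  next
    case False
    then have "\<beta> = \<alpha>" using ab by simp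
    then show ?thesis using that[of "(\<alpha> + pi) / 2"] ab by (simp add: abs_less_iff field_simps)
  qed
  have arg': "arg_in (s x + f x - s t - g t) \<alpha> \<beta>'" if "0 \<le> t" "0 \<le> x - t" "x - t \<le> d" for x t
    using arg[of x t] that \<beta>'(2) unfolding arg_in_def by fastforce
  obtain P Q :: "complex \<Rightarrow> real" and K where PQ: "linear P" "linear Q" "K > 0"
      "\<And>z. \<bar>P z\<bar> \<le> K * cmod z" "\<And>z. \<bar>Q z\<bar> \<le> K * cmod z"
      "\<And>z. z = complex_of_real (P z) * cis \<alpha> + complex_of_real (Q z) * cis \<beta>'"
      "\<And>z. arg_in z \<alpha> \<beta>' \<Longrightarrow> 0 \<le> P z \<and> 0 \<le> Q z"
    using sector_coordinates[OF \<beta>'(1,3)] by blast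
  obtain M where M: "M > 0" "\<And>x. 0 \<le> x \<Longrightarrow> \<exists>t\<in>{x..x+d/2}. cmod (f t) \<le> M \<and> cmod (g t) \<le> M"
    using exists_point_both_small[OF f g, of "d/2"] d by auto
  have main: "\<exists>m c. mono m \<and> (\<forall>x\<ge>0. \<bar>L (s x) + c * x - m x\<bar> \<le> K * cmod (f x) + K * cmod (g x) + 2 * (K * M))"
    if L: "linear L" "\<And>z. \<bar>L z\<bar> \<le> K * cmod z" "\<And>z. arg_in z \<alpha> \<beta>' \<Longrightarrow> 0 \<le> L z" for L :: "complex \<Rightarrow> real"
  proof -
    have le: "L (s t) + L (g t) \<le> L (s x) + L (f x)" if "0 \<le> t" "0 \<le> x - t" "x - t \<le> d" for x t
      using L(3)[OF arg'[OF that]] by (simp add: linear_add[OF L(1)] linear_diff[OF L(1)])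
    have pt: "\<exists>t\<in>{x..x+d/2}. \<bar>L (f t)\<bar> \<le> K * M \<and> \<bar>L (g t)\<bar> \<le> K * M" if "0 \<le> x" for x
    proof -
      obtain t where t: "t \<in> {x..x+d/2}" "cmod (f t) \<le> M" "cmod (g t) \<le> M" using M(2)[OF \<open>0 \<le> x\<close>] by blast
      then have "K * cmod (f t) \<le> K * M" "K * cmod (g t) \<le> K * M" using PQ(3) by auto
      then have "\<bar>L (f t)\<bar> \<le> K * M \<and> \<bar>L (g t)\<bar> \<le> K * M" using L(2)[of "f t"] L(2)[of "g t"] by linarith
      then show ?thesis using t(1) by blast
    qed
    have KM: "0 < K * M" using PQ(3) M(1) by simp
    obtain m c where mc: "mono m" "\<And>x. 0 \<le> x \<Longrightarrow> \<bar>L (s x) + c * x - m x\<bar> \<le> \<bar>L (f x)\<bar> + \<bar>L (g x)\<bar> + 2 * (K * M)"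
      using almost_monotone_decomposition[of d "\<lambda>t. L (s t)" "\<lambda>t. L (g t)" "\<lambda>t. L (f t)" "K * M", OF d le KM pt] by blast
    have "\<bar>L (s x) + c * x - m x\<bar> \<le> K * cmod (f x) + K * cmod (g x) + 2 * (K * M)" if "0 \<le> x" for x
      using mc(2)[OF that] L(2)[of "f x"] L(2)[of "g x"] by linarith
    then show ?thesis using mc(1) by blast
  qed
  obtain m1 c1 where m1: "mono m1" "\<And>x. 0 \<le> x \<Longrightarrow> \<bar>P (s x) + c1 * x - m1 x\<bar> \<le> K * cmod (f x) + K * cmod (g x) + 2 * (K * M)"
    using main[OF PQ(1,4)] PQ(7) by blast
  obtain m2 c2 where m2: "mono m2" "\<And>x. 0 \<le> x \<Longrightarrow> \<bar>Q (s x) + c2 * x - m2 x\<bar> \<le> K * cmod (f x) + K * cmod (g x) + 2 * (K * M)"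
    using main[OF PQ(2,5)] PQ(7) by blast
  define e1 e2 where "e1 = cis \<alpha>" and "e2 = cis \<beta>'"
  define \<gamma> where "\<gamma> = - (e1 * complex_of_real c1 + e2 * complex_of_real c2)"
  define r where "r x = s x - e1 * complex_of_real (m1 x) - e2 * complex_of_real (m2 x) - \<gamma> * complex_of_real x" for x
  have rb: "cmod (r x) \<le> 2 * (K * cmod (f x) + K * cmod (g x) + 2 * (K * M))" if "0 \<le> x" for x
  proof -
    have "r x = complex_of_real (P (s x) + c1 * x - m1 x) * e1 + complex_of_real (Q (s x) + c2 * x - m2 x) * e2"
      unfolding r_def \<gamma>_def by (subst PQ(6)[of "s x"]) (simp add: e1_def e2_def algebra_simps)
    also have "cmod \<dots> \<le> \<bar>P (s x) + c1 * x - m1 x\<bar> + \<bar>Q (s x) + c2 * x - m2 x\<bar>"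
      by (rule order_trans[OF norm_triangle_ineq]) (simp add: norm_mult e1_def e2_def del: of_real_add of_real_diff of_real_mult)
    also have "\<dots> \<le> (K * cmod (f x) + K * cmod (g x) + 2 * (K * M)) + (K * cmod (f x) + K * cmod (g x) + 2 * (K * M))"
      using m1(2)[OF that] m2(2)[OF that] by (rule add_mono)
    finally show ?thesis by simp
  qed
  define G where "G x = 12 * K\<^sup>2 * (cmod (f x))\<^sup>2 + 12 * K\<^sup>2 * (cmod (g x))\<^sup>2 + 48 * (K * M)\<^sup>2" for x
  have rG: "(cmod (r x))\<^sup>2 \<le> G x" if "0 \<le> x" for x
  proof -
    have "(cmod (r x))\<^sup>2 \<le> (2 * (K * cmod (f x) + K * cmod (g x) + 2 * (K * M)))\<^sup>2" using rb[OF that] by (intro power_mono) auto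
    also have "\<dots> = 4 * (K * cmod (f x) + K * cmod (g x) + 2 * (K * M))\<^sup>2" by (simp only: power_mult_distrib) simp
    also have "\<dots> \<le> 4 * (3 * ((K * cmod (f x))\<^sup>2 + (K * cmod (g x))\<^sup>2 + (2 * (K * M))\<^sup>2))" by (rule mult_left_mono[OF sum3_sq_le]) simp
    also have "\<dots> = G x" unfolding G_def by (simp add: power_mult_distrib)
    finally show ?thesis .
  qed
  have fL: "L2_on a b f" and gL: "L2_on a b g" if "0 \<le> a" for a b using f g that by (auto simp: L2_unif_def intro: L2_loc_L2_on)
  have Gi: "G integrable_on {a..b}" if "0 \<le> a" for a b
    unfolding G_def using L2_onD(2)[OF fL[OF that]] L2_onD(2)[OF gL[OF that]]
    by (intro integrable_add integrable_on_mult_right) auto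
  have rL: "L2_on a b r" if "0 \<le> a" for a b
  proof (rule L2_on_bound[OF _ Gi[OF that]])
    have "s \<in> borel_measurable (lebesgue_on {a..b})" using L2_onD(1)[OF L2_loc_L2_on[OF s that]] .
    moreover have "m1 \<in> borel_measurable (lebesgue_on {a..b})" "m2 \<in> borel_measurable (lebesgue_on {a..b})"
      using m1(1) m2(1) by (auto intro!: measurable_restrict_space1 measurable_completion borel_measurable_mono)
    moreover have "complex_of_real \<in> borel_measurable (lebesgue_on {a..b})"
      by (intro continuous_imp_measurable_on_sets_lebesgue continuous_intros) auto
    ultimately show "r \<in> borel_measurable (lebesgue_on {a..b})"
      unfolding r_def by (intro borel_measurable_diff borel_measurable_times) auto
    show "(cmod (r x))\<^sup>2 \<le> G x" if "x \<in> {a..b}" for x using rG[of x] that \<open>0 \<le> a\<close> by auto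
  qed
  obtain Bf where Bf: "Bf > 0" "\<And>x. 0 \<le> x \<Longrightarrow> integral {x..x+1} (\<lambda>\<xi>. (cmod (f \<xi>))\<^sup>2) \<le> Bf" using L2_unifD[OF f] by blast
  obtain Bg where Bg: "Bg > 0" "\<And>x. 0 \<le> x \<Longrightarrow> integral {x..x+1} (\<lambda>\<xi>. (cmod (g \<xi>))\<^sup>2) \<le> Bg" using L2_unifD[OF g] by blast
  define B where "B = 12 * K\<^sup>2 * Bf + 12 * K\<^sup>2 * Bg + 48 * (K * M)\<^sup>2"
  have B0: "B > 0" unfolding B_def using Bf Bg PQ(3) by (simp add: add_pos_nonneg add_pos_pos)
  have rB: "integral {x..x+1} (\<lambda>t. (cmod (r t))\<^sup>2) \<le> B" if x: "0 \<le> x" for x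
  proof -
    have "integral {x..x+1} (\<lambda>t. (cmod (r t))\<^sup>2) \<le> integral {x..x+1} G"
      using rL[OF x] Gi[OF x] rG x by (intro integral_le) (auto simp: L2_on_def)
    also have "\<dots> = 12 * K\<^sup>2 * integral {x..x+1} (\<lambda>t. (cmod (f t))\<^sup>2) + 12 * K\<^sup>2 * integral {x..x+1} (\<lambda>t. (cmod (g t))\<^sup>2) + 48 * (K * M)\<^sup>2"
    proof -
      have i: "(\<lambda>t. 12 * K\<^sup>2 * (cmod (f t))\<^sup>2) integrable_on {x..x+1}" "(\<lambda>t. 12 * K\<^sup>2 * (cmod (g t))\<^sup>2) integrable_on {x..x+1}"
        using L2_onD(2)[OF fL[OF x]] L2_onD(2)[OF gL[OF x]] by (auto intro!: integrable_on_mult_right)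
      show ?thesis unfolding G_def
        using Henstock_Kurzweil_Integration.integral_add[OF integrable_add[OF i] integrable_const_ivl[of "48 * (K * M)\<^sup>2" x "x+1"]]
          Henstock_Kurzweil_Integration.integral_add[OF i] by simp
    qed
    also have "\<dots> \<le> B" unfolding B_def using Bf(2)[OF x] Bg(2)[OF x] by (intro add_mono mult_left_mono) auto
    finally show ?thesis .
  qed
  obtain \<omega> \<kappa> where \<omega>: "cmod \<omega> = 1" "0 < \<kappa>" "\<kappa> \<le> Re \<omega>" "\<And>\<theta>. \<alpha> \<le> \<theta> \<Longrightarrow> \<theta> \<le> \<beta>' \<Longrightarrow> \<kappa> \<le> Re (\<omega> * cis \<theta>)"
    using sector_rotation[OF less_imp_le[OF \<beta>'(1)] \<beta>'(3) ab(3) \<beta>'(4)] by blast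
  have e: "cmod e1 = 1" "cmod e2 = 1" "\<kappa> \<le> Re (\<omega> * e1)" "\<kappa> \<le> Re (\<omega> * e2)"
    using \<omega>(4)[of \<alpha>] \<omega>(4)[of \<beta>'] \<beta>' by (auto simp: e1_def e2_def)
  have dec: "\<forall>x\<ge>0. s x = e1 * complex_of_real (m1 x) + e2 * complex_of_real (m2 x) + \<gamma> * complex_of_real x + r x"
    by (simp add: r_def)
  have "sector_potential s r m1 m2 e1 e2 \<gamma> \<omega> \<kappa> B"
    by unfold_locales (use s m1(1) m2(1) e dec \<omega>(1-3) rL B0 rB in auto)
  then show ?thesis by blast
qed

section \<open>The energy of an element of the minimal domain\<close>

lemma integral_grid:
  fixes f :: "real \<Rightarrow> 'a::banach"
  assumes h: "0 \<le> h" and f: "f integrable_on {0..real N * h}"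
  shows "integral {0..real N * h} f = (\<Sum>i<N. integral {real i * h..real (Suc i) * h} f)"
  using f
proof (induction N)
  case (Suc N)
  have le: "real N * h \<le> real (Suc N) * h" using h by (intro mult_right_mono) auto
  have "f integrable_on {0..real N * h}" by (rule integrable_subinterval_real[OF Suc.prems]) (use le in auto)
  then have "integral {0..real N * h} f = (\<Sum>i<N. integral {real i * h..real (Suc i) * h} f)" by (rule Suc.IH)
  moreover have "integral {0..real (Suc N) * h} f = integral {0..real N * h} f + integral {real N * h..real (Suc N) * h} f"
    using h le Suc.prems by (intro Henstock_Kurzweil_Integration.integral_combine[symmetric]) auto
  ultimately show ?case by simp
qed simp

lemma integral_norm_square_le:
  assumes f: "L2_on a b f" and ab: "a \<le> b"
  shows "(integral {a..b} (\<lambda>x. cmod (f x)))\<^sup>2 \<le> (b - a) * integral {a..b} (\<lambda>x. (cmod (f x))\<^sup>2)"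
proof (cases "a = b")
  case False
  define A Z where "A = integral {a..b} (\<lambda>x. cmod (f x))" and "Z = integral {a..b} (\<lambda>x. (cmod (f x))\<^sup>2)"
  have L: "b - a > 0" using ab False by simp
  have A0: "A \<ge> 0" unfolding A_def
    using L2_on_absolutely_integrable[OF f] by (intro Henstock_Kurzweil_Integration.integral_nonneg) (auto simp: absolutely_integrable_on_def)
  have Z0: "Z \<ge> 0" unfolding Z_def using L2_onD(2)[OF f] by (intro Henstock_Kurzweil_Integration.integral_nonneg) auto
  show ?thesis
  proof (cases "A = 0")
    case True then show ?thesis using L Z0 by (simp flip: A_def Z_def)
  next
    case False
    then have \<eta>: "A / (b - a) > 0" using A0 L by simp
    have "A \<le> A / (b - a) / 2 * (b - a) + Z / (2 * (A / (b - a)))"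
      using L2_on_norm_integral_le[OF f ab \<eta>] unfolding A_def Z_def .
    moreover have "A / (b - a) / 2 * (b - a) = A / 2" using L by (simp only: times_divide_eq_left) simp
    moreover have "Z / (2 * (A / (b - a))) = Z * (b - a) / (2 * A)" by simp
    ultimately have "A / 2 \<le> Z * (b - a) / (2 * A)" by linarith
    then have "A / 2 * (2 * A) \<le> Z * (b - a)" using False A0 by (subst (asm) pos_le_divide_eq) auto
    then have "A\<^sup>2 \<le> (b - a) * Z" unfolding power2_eq_square[of A] by (simp add: mult.commute)
    then show ?thesis unfolding A_def Z_def .
  qed
qed simp

lemma continuous_AE_zero:
  fixes u :: "real \<Rightarrow> complex"
  assumes c: "continuous_on {0..} u" and ae: "AE x in half_line. R < x \<longrightarrow> u x = 0" and R: "0 \<le> R" and x: "R < x"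
  shows "u x = 0"
proof (rule ccontr)
  assume ux: "u x \<noteq> 0"
  obtain N where N: "negligible N" "\<And>t. 0 \<le> t \<Longrightarrow> t \<notin> N \<Longrightarrow> R < t \<longrightarrow> u t = 0" using AE_half_lineE[OF ae] by blast
  have "\<forall>e>0. \<exists>d>0. \<forall>t\<in>{0..}. dist t x < d \<longrightarrow> dist (u t) (u x) < e"
    using c R x unfolding continuous_on_iff by auto
  from this[rule_format, of "cmod (u x)"] ux obtain d where d: "d > 0" "\<And>t. t \<ge> 0 \<Longrightarrow> dist t x < d \<Longrightarrow> dist (u t) (u x) < cmod (u x)" by auto
  define S where "S = {max R (x - d)<..<x + d}"
  have "S \<subseteq> N"
  proof
    fix t assume t: "t \<in> S"
    then have "dist (u t) (u x) < cmod (u x)" using R by (intro d) (auto simp: S_def dist_real_def)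
    then have "u t \<noteq> 0" by (auto simp: dist_norm)
    then show "t \<in> N" using N(2)[of t] t R by (auto simp: S_def)
  qed
  moreover have "S \<noteq> {}" "open S" using x d by (auto simp: S_def)
  ultimately show False using N(1) open_not_negligible negligible_subset by blast
qed

text \<open>The support condition only concerns \<open>y\<close>. Beyond the support the quasi-derivative \<open>u\<close> vanishes almost everywhere, and
by continuity everywhere.\<close>

lemma minimal_domain_support:
  assumes "in_minimal_domain s y u"
  shows "\<exists>R\<ge>0. \<forall>x>R. y x = 0 \<and> u x = 0"
proof -
  note Y = in_minimal_domainD[OF assms]
  have "bounded {x. 0 \<le> x \<and> y x \<noteq> 0}"
    by (rule bounded_subset[OF compact_imp_bounded[OF Y(8)] closure_subset])
  then obtain R where R: "R > 0" "\<And>x. 0 \<le> x \<Longrightarrow> y x \<noteq> 0 \<Longrightarrow> \<bar>x\<bar> \<le> R" unfolding bounded_pos by auto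
  have y0: "y x = 0" if "R < x" for x using R(2)[of x] R(1) that by force
  have d0: "vector_derivative y (at x) = 0" if "R < x" for x
  proof (rule vector_derivative_at)
    show "(y has_vector_derivative 0) (at x)"
      by (rule has_vector_derivative_transform_within_open[OF has_vector_derivative_const open_greaterThan[of R]])
        (use y0 that in auto)
  qed
  have ae: "AE x in half_line. R < x \<longrightarrow> u x = 0" using Y(4) by (rule eventually_mono) (use y0 d0 in auto)
  have "u x = 0" if "R < x" for x
    by (rule continuous_AE_zero[OF AC_loc_continuous_on[OF Y(3)] ae less_imp_le[OF R(1)] that])
  then show ?thesis using R(1) y0 by (intro exI[of _ R]) auto
qed

text \<open>Integration by parts against a nondecreasing function. On each cell the second mean value theorem gives a point \<open>c i\<close>
at which the increment of \<open>m\<close> is evaluated, and the boundary terms telescope. The result is a substitute for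
\<open>- \<integral> \<rho> dm\<close> that displays the increments of \<open>m\<close> over the cells.\<close>

lemma second_mean_value_grid:
  fixes m \<rho> \<rho>' :: "real \<Rightarrow> real"
  assumes m: "mono m" and h: "0 \<le> h"
    and \<rho>: "\<And>a b. 0 \<le> a \<Longrightarrow> a \<le> b \<Longrightarrow> (\<rho>' has_integral (\<rho> b - \<rho> a)) {a..b}"
    and \<rho>0: "\<rho> 0 = 0" and \<rho>N: "\<rho> (real N * h) = 0"
  shows "\<exists>c. (\<forall>i. c i \<in> {real i * h..real (Suc i) * h}) \<and>
    ((\<lambda>x. m x * \<rho>' x) has_integral - (\<Sum>i<N. (m (real (Suc i) * h) - m (real i * h)) * \<rho> (c i))) {0..real N * h}"
proof -
  have cell: "\<exists>c. c \<in> {real i * h..real (Suc i) * h} \<and>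
     ((\<lambda>x. m x * \<rho>' x) has_integral (m (real (Suc i) * h) * \<rho> (real (Suc i) * h) - m (real i * h) * \<rho> (real i * h)
        - (m (real (Suc i) * h) - m (real i * h)) * \<rho> c)) {real i * h..real (Suc i) * h}" for i
  proof -
    have le: "0 \<le> real i * h" "real i * h \<le> real (Suc i) * h" using h by (auto intro!: mult_right_mono)
    have "\<rho>' integrable_on {real i * h..real (Suc i) * h}" using \<rho>[OF le] by blast
    from second_mean_value_theorem_full[OF this le(2), of m] m obtain c where c: "c \<in> {real i * h..real (Suc i) * h}"
      "((\<lambda>x. m x * \<rho>' x) has_integral (m (real i * h) * integral {real i * h..c} \<rho>' + m (real (Suc i) * h) * integral {c..real (Suc i) * h} \<rho>')) {real i * h..real (Suc i) * h}"
      unfolding mono_def by blast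
    have I: "integral {real i * h..c} \<rho>' = \<rho> c - \<rho> (real i * h)" "integral {c..real (Suc i) * h} \<rho>' = \<rho> (real (Suc i) * h) - \<rho> c"
      using c(1) le by (auto intro!: integral_unique \<rho>)
    have "m (real i * h) * integral {real i * h..c} \<rho>' + m (real (Suc i) * h) * integral {c..real (Suc i) * h} \<rho>'
      = m (real (Suc i) * h) * \<rho> (real (Suc i) * h) - m (real i * h) * \<rho> (real i * h) - (m (real (Suc i) * h) - m (real i * h)) * \<rho> c"
      unfolding I by (simp only: left_diff_distrib right_diff_distrib)
    then show ?thesis using c by (intro exI[of _ c]) (simp only: simp_thms)
  qed
  obtain c where c': "\<forall>i. c i \<in> {real i * h..real (Suc i) * h} \<and>
     ((\<lambda>x. m x * \<rho>' x) has_integral (m (real (Suc i) * h) * \<rho> (real (Suc i) * h) - m (real i * h) * \<rho> (real i * h)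
        - (m (real (Suc i) * h) - m (real i * h)) * \<rho> (c i))) {real i * h..real (Suc i) * h}"
    using choice[OF allI[of "\<lambda>i. \<exists>c. _ i c"], OF cell] by (rule exE)
  note c = conjunct1[OF c'[rule_format]] conjunct2[OF c'[rule_format]]
  have "((\<lambda>x. m x * \<rho>' x) has_integral (m (real n * h) * \<rho> (real n * h)
      - (\<Sum>i<n. (m (real (Suc i) * h) - m (real i * h)) * \<rho> (c i)))) {0..real n * h}" for n
  proof (induction n)
    case 0 then show ?case by (simp add: \<rho>0 has_integral_refl)
  next
    case (Suc n)
    have le: "0 \<le> real n * h" "real n * h \<le> real (Suc n) * h" using h by (auto intro!: mult_right_mono)
    have "((\<lambda>x. m x * \<rho>' x) has_integral ((m (real n * h) * \<rho> (real n * h) - (\<Sum>i<n. (m (real (Suc i) * h) - m (real i * h)) * \<rho> (c i)))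
        + (m (real (Suc n) * h) * \<rho> (real (Suc n) * h) - m (real n * h) * \<rho> (real n * h)
        - (m (real (Suc n) * h) - m (real n * h)) * \<rho> (c n)))) {0..real (Suc n) * h}"
      by (rule has_integral_combine[OF le Suc.IH c(2)])
    then show ?case by (simp add: algebra_simps)
  qed
  from this[of N] show ?thesis using c(1) \<rho>N by (intro exI[of _ c]) simp
qed

locale minimal_domain_element =
  fixes s y u :: "real \<Rightarrow> complex"
  assumes s: "L2_loc s" and yu: "in_minimal_domain s y u"
begin

lemmas Y = in_minimal_domainD[OF yu]

text \<open>Where \<open>y\<close> is differentiable, \<open>\<rho>1\<close> is the derivative of \<open>\<rho>\<close>.\<close>

definition y1 :: "real \<Rightarrow> complex" where "y1 x = vector_derivative y (at x)"
definition \<rho> :: "real \<Rightarrow> real" where "\<rho> x = (cmod (y x))\<^sup>2"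
definition \<rho>1 :: "real \<Rightarrow> real" where "\<rho>1 x = 2 * Re (y1 x * cnj (y x))"

lemma \<rho>_nonneg: "\<rho> x \<ge> 0" by (simp add: \<rho>_def)
lemma \<rho>_0: "\<rho> 0 = 0" by (simp add: \<rho>_def Y)

lemma y1_AE: "AE x in half_line. (y has_vector_derivative y1 x) (at x)"
  unfolding y1_def by (rule AC_loc_has_vector_derivative[OF Y(2)])

lemma y1_eq_AE: "AE x in half_line. y1 x = u x + s x * y x"
  unfolding y1_def using Y(4) by (rule eventually_mono) simp

lemma y_L2: "0 \<le> a \<Longrightarrow> L2_on a b y" and u_L2: "0 \<le> a \<Longrightarrow> L2_on a b u"
  using Y by (auto intro!: L2_on_continuous AC_loc_continuous_on_Icc)

lemma y1_L2:
  assumes a: "0 \<le> a" shows "L2_on a b y1"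
proof -
  have L: "L2_on a b (\<lambda>x. u x + s x * y x)"
    using L2_on_add[OF u_L2[OF a] L2_on_continuous_mult[OF AC_loc_continuous_on_Icc[OF Y(2) a] L2_loc_L2_on[OF s a]]]
    by (simp add: mult.commute)
  obtain N where N: "negligible N" "\<And>x. 0 \<le> x \<Longrightarrow> x \<notin> N \<Longrightarrow> y1 x = u x + s x * y x"
    using AE_half_lineE[OF y1_eq_AE] by blast
  have "y1 absolutely_integrable_on {a..b}" unfolding y1_def[abs_def] by (rule AC_loc_absolutely_integrable_derivative[OF Y(2) a])
  then have "y1 \<in> borel_measurable (lebesgue_on {a..b})" by (rule absolutely_integrable_imp_borel_measurable) simp
  moreover have "(\<lambda>x. (cmod (y1 x))\<^sup>2) integrable_on {a..b}"
    by (rule integrable_spike[OF L2_onD(2)[OF L] N(1)]) (use N(2) a in auto)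
  ultimately show ?thesis by (simp add: L2_on_def)
qed

lemma y_diff:
  assumes "0 \<le> a" "a \<le> b" shows "(y1 has_integral (y b - y a)) {a..b}"
  by (rule AC_loc_derivative_has_integral[OF Y(2) y1_AE assms])

lemma \<rho>_diff:
  assumes "0 \<le> a" "a \<le> b" shows "(\<rho>1 has_integral (\<rho> b - \<rho> a)) {a..b}"
proof -
  have AC: "AC_loc (\<lambda>x. y x * cnj (y x))" by (intro AC_loc_mult AC_loc_cnj Y)
  have D: "AE x in half_line. ((\<lambda>x. y x * cnj (y x)) has_vector_derivative (y x * cnj (y1 x) + y1 x * cnj (y x))) (at x)"
    using y1_AE
  proof (rule eventually_mono)
    fix x assume d: "(y has_vector_derivative y1 x) (at x)"
    show "((\<lambda>x. y x * cnj (y x)) has_vector_derivative (y x * cnj (y1 x) + y1 x * cnj (y x))) (at x)"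
      by (rule has_vector_derivative_mult[OF d has_vector_derivative_cnj[OF d]])
  qed
  have "((\<lambda>x. y x * cnj (y1 x) + y1 x * cnj (y x)) has_integral (y b * cnj (y b) - y a * cnj (y a))) {a..b}"
    by (rule AC_loc_derivative_has_integral[OF AC D assms])
  then have "((\<lambda>x. Re (y x * cnj (y1 x) + y1 x * cnj (y x))) has_integral Re (y b * cnj (y b) - y a * cnj (y a))) {a..b}"
    by (rule has_integral_Re)
  moreover have "Re (y x * cnj (y1 x) + y1 x * cnj (y x)) = \<rho>1 x" for x by (simp add: \<rho>1_def algebra_simps)
  moreover have "Re (y b * cnj (y b) - y a * cnj (y a)) = \<rho> b - \<rho> a" unfolding complex_norm_square[symmetric] \<rho>_def by simp
  ultimately show ?thesis by simp
qed

lemma \<rho>1_bound: "\<bar>\<rho>1 x\<bar> \<le> 2 * cmod (y x) * cmod (y1 x)"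
proof -
  have "\<bar>Re (y1 x * cnj (y x))\<bar> \<le> cmod (y x) * cmod (y1 x)"
    using abs_Re_le_cmod[of "y1 x * cnj (y x)"] by (simp only: norm_mult complex_mod_cnj mult.commute)
  then show ?thesis unfolding \<rho>1_def abs_mult by linarith
qed

lemma l_expr_L2: "L2_on 0 R (l_expr s y u)"
proof -
  have lm: "l_expr s y u \<in> borel_measurable half_line" and li: "integrable half_line (\<lambda>x. (cmod (l_expr s y u x))\<^sup>2)"
    using Y(5) by (auto simp: square_integrable_def)
  have "(\<lambda>x. (cmod (l_expr s y u x))\<^sup>2) integrable_on {0..}" using li by (rule integrable_on_lebesgue_on) simp
  then have "(\<lambda>x. (cmod (l_expr s y u x))\<^sup>2) integrable_on {0..R}" by (rule integrable_on_subinterval) auto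
  moreover have "l_expr s y u \<in> borel_measurable (lebesgue_on {0..R})" by (rule measurable_restrict_mono[OF lm]) auto
  ultimately show ?thesis by (simp add: L2_on_def)
qed

text \<open>Integrate the derivative of \<open>u * cnj y\<close>, which vanishes at both ends, and substitute \<open>u = y' - s * y\<close>: the terms
quadratic in \<open>s\<close> cancel and \<open>s\<close> only occurs against the derivative of \<open>\<bar>y\<bar>\<^sup>2\<close>.\<close>

lemma energy_identity:
  assumes R: "0 \<le> R" "u R = 0"
  shows "((\<lambda>x. complex_of_real ((cmod (y1 x))\<^sup>2) - s x * complex_of_real (\<rho>1 x))
     has_integral (integral {0..R} (\<lambda>x. l_expr s y u x * cnj (y x)))) {0..R}"
proof -
  define u1 where "u1 x = vector_derivative u (at x)" for x
  have u1: "AE x in half_line. (u has_vector_derivative u1 x) (at x)"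
    unfolding u1_def by (rule AC_loc_has_vector_derivative[OF Y(3)])
  have AC: "AC_loc (\<lambda>x. u x * cnj (y x))" by (intro AC_loc_mult AC_loc_cnj Y)
  have D: "AE x in half_line. ((\<lambda>x. u x * cnj (y x)) has_vector_derivative (u x * cnj (y1 x) + u1 x * cnj (y x))) (at x)"
    using y1_AE u1
  proof eventually_elim
    case (elim x)
    show ?case by (rule has_vector_derivative_mult[OF elim(2) has_vector_derivative_cnj[OF elim(1)]])
  qed
  have I1: "((\<lambda>x. u x * cnj (y1 x) + u1 x * cnj (y x)) has_integral 0) {0..R}"
    using AC_loc_derivative_has_integral[OF AC D order_refl R(1)] R(2) Y(7) by simp
  have I2: "((\<lambda>x. l_expr s y u x * cnj (y x)) has_integral (integral {0..R} (\<lambda>x. l_expr s y u x * cnj (y x)))) {0..R}"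
    using L2_on_mult[OF l_expr_L2 L2_on_cnj[OF y_L2[OF order_refl]]] by (intro integrable_integral) (auto simp: absolutely_integrable_on_def)
  obtain N where N: "negligible N" "\<And>x. 0 \<le> x \<Longrightarrow> x \<notin> N \<Longrightarrow> y1 x = u x + s x * y x"
    using AE_half_lineE[OF y1_eq_AE] by blast
  show ?thesis
  proof (rule has_integral_spike[OF N(1) _ has_integral_add[OF I2 I1, simplified]])
    fix x assume x: "x \<in> {0..R} - N"
    have ux: "u x = y1 x - s x * y x" using N(2)[of x] x by simp
    have "complex_of_real ((cmod (y1 x))\<^sup>2) = y1 x * cnj (y1 x)" by (rule complex_norm_square)
    moreover have "complex_of_real (\<rho>1 x) = y1 x * cnj (y x) + y x * cnj (y1 x)"
      unfolding \<rho>1_def by (simp add: complex_eq_iff)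
    ultimately show "complex_of_real ((cmod (y1 x))\<^sup>2) - s x * complex_of_real (\<rho>1 x) =
       l_expr s y u x * cnj (y x) + (u x * cnj (y1 x) + u1 x * cnj (y x))"
      unfolding l_expr_def u1_def[symmetric] ux by (simp add: algebra_simps power2_eq_square)
  qed
qed

lemma \<rho>_integrable: "0 \<le> a \<Longrightarrow> \<rho> integrable_on {a..b}"
  using L2_onD(2)[OF y_L2] by (simp add: \<rho>_def[abs_def])

lemma y1_integrable: "0 \<le> a \<Longrightarrow> (\<lambda>x. (cmod (y1 x))\<^sup>2) integrable_on {a..b}"
  using L2_onD(2)[OF y1_L2] by simp

lemma y_increment:
  assumes a: "0 \<le> a" and t: "t \<in> {a..b}" "t' \<in> {a..b}"
  shows "(cmod (y t - y t'))\<^sup>2 \<le> (b - a) * integral {a..b} (\<lambda>x. (cmod (y1 x))\<^sup>2)"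
proof -
  have ab: "a \<le> b" using t by auto
  have ni: "(\<lambda>x. cmod (y1 x)) integrable_on {a..b}"
    using L2_on_absolutely_integrable[OF y1_L2[OF a]] by (simp add: absolutely_integrable_on_def)
  have *: "cmod (y q - y p) \<le> integral {a..b} (\<lambda>x. cmod (y1 x))" if pq: "a \<le> p" "p \<le> q" "q \<le> b" for p q
  proof -
    have i: "(y1 has_integral (y q - y p)) {p..q}" using pq a by (intro y_diff) auto
    have n: "(\<lambda>x. cmod (y1 x)) integrable_on {p..q}" by (rule integrable_subinterval_real[OF ni]) (use pq in auto)
    have "cmod (y q - y p) \<le> integral {p..q} (\<lambda>x. cmod (y1 x))"
      using integral_norm_bound_integral[OF has_integral_integrable[OF i] n] integral_unique[OF i] by simp
    also have "\<dots> \<le> integral {a..b} (\<lambda>x. cmod (y1 x))" using pq n ni by (intro integral_subset_le) auto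
    finally show ?thesis .
  qed
  have "cmod (y t - y t') \<le> integral {a..b} (\<lambda>x. cmod (y1 x))"
    using *[of t t'] *[of t' t] t by (cases "t \<le> t'") (auto simp: norm_minus_commute)
  then have "(cmod (y t - y t'))\<^sup>2 \<le> (integral {a..b} (\<lambda>x. cmod (y1 x)))\<^sup>2" by (intro power_mono) auto
  also have "\<dots> \<le> (b - a) * integral {a..b} (\<lambda>x. (cmod (y1 x))\<^sup>2)" by (rule integral_norm_square_le[OF y1_L2[OF a] ab])
  finally show ?thesis .
qed

text \<open>A one-dimensional Sobolev inequality: the oscillation of \<open>\<bar>y\<bar>\<^sup>2\<close> on the interval is at most
\<open>\<integral> 2 * \<bar>y\<bar> * \<bar>y'\<bar> \<le> \<integral> (\<bar>y\<bar>\<^sup>2 / \<eta> + \<eta> * \<bar>y'\<bar>\<^sup>2)\<close>, and some value does not exceed the mean.\<close>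

lemma \<rho>_sup_unit:
  assumes a: "0 \<le> a" and x: "x \<in> {a..a+1}" and \<eta>: "\<eta> > 0"
  shows "\<rho> x \<le> (1 + 1/\<eta>) * integral {a..a+1} \<rho> + \<eta> * integral {a..a+1} (\<lambda>x. (cmod (y1 x))\<^sup>2)"
proof -
  let ?K = "(1/\<eta>) * integral {a..a+1} \<rho> + \<eta> * integral {a..a+1} (\<lambda>x. (cmod (y1 x))\<^sup>2)"
  define F where "F x = (1/\<eta>) * \<rho> x + \<eta> * (cmod (y1 x))\<^sup>2" for x
  have Fi: "F integrable_on {a..b}" for b
    unfolding F_def[abs_def] by (intro integrable_add integrable_on_mult_right \<rho>_integrable[OF a] y1_integrable[OF a])
  have FI: "integral {a..a+1} F = ?K"
    unfolding F_def
    by (subst Henstock_Kurzweil_Integration.integral_add)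
      (simp_all only: integral_mult_right integrable_on_mult_right \<rho>_integrable[OF a] y1_integrable[OF a])
  have F0: "0 \<le> F x" for x using \<eta> \<rho>_nonneg[of x] by (simp add: F_def)
  have \<rho>1F: "\<bar>\<rho>1 x\<bar> \<le> F x" for x
  proof -
    have "0 \<le> (cmod (y x) - \<eta> * cmod (y1 x))\<^sup>2" by simp
    then have "2 * \<eta> * (cmod (y x) * cmod (y1 x)) \<le> (cmod (y x))\<^sup>2 + \<eta>\<^sup>2 * (cmod (y1 x))\<^sup>2"
      by (simp add: power2_diff power_mult_distrib algebra_simps)
    then have "2 * (cmod (y x) * cmod (y1 x)) \<le> F x"
      unfolding F_def \<rho>_def using \<eta> by (simp add: field_simps power2_eq_square)
    then show ?thesis using \<rho>1_bound[of x] by simp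
  qed
  have *: "\<bar>\<rho> q - \<rho> p\<bar> \<le> ?K" if pq: "a \<le> p" "p \<le> q" "q \<le> a+1" for p q
  proof -
    have i: "(\<rho>1 has_integral (\<rho> q - \<rho> p)) {p..q}" using pq a by (intro \<rho>_diff) auto
    have Fpq: "F integrable_on {p..q}" by (rule integrable_subinterval_real[OF Fi[of "a+1"]]) (use pq in auto)
    have "norm (integral {p..q} \<rho>1) \<le> integral {p..q} F"
      using \<rho>1F by (intro integral_norm_bound_integral has_integral_integrable[OF i] Fpq) auto
    also have "\<dots> \<le> integral {a..a+1} F" using pq Fpq Fi F0 by (intro integral_subset_le) auto
    finally show ?thesis using integral_unique[OF i] FI by simp
  qed
  have "\<rho> x \<le> \<rho> t + ?K" if "t \<in> {a..a+1}" for t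
    using *[of t x] *[of x t] that x by (cases "t \<le> x") auto
  then have "integral {a..a+1} (\<lambda>t. \<rho> x) \<le> integral {a..a+1} (\<lambda>t. \<rho> t + ?K)"
    using \<rho>_integrable[OF a] by (intro integral_le integrable_add) auto
  also have "\<dots> = integral {a..a+1} \<rho> + ?K"
    using \<rho>_integrable[OF a] by (subst Henstock_Kurzweil_Integration.integral_add) auto
  finally show ?thesis by (simp add: algebra_simps)
qed

lemma inner_eq_integral:
  assumes R: "\<And>x. R < x \<Longrightarrow> y x = 0"
  shows "inner (l2_scale \<omega> (l2_class (l_expr s y u))) (l2_class y)
    = Re (\<omega> * integral {0..R} (\<lambda>x. l_expr s y u x * cnj (y x)))"
proof -
  let ?p = "\<lambda>x. l_expr s y u x * cnj (y x)"
  have eq: "(\<lambda>x. (\<omega> * l_expr s y u x) \<bullet> y x) = (\<lambda>x. Re (\<omega> * ?p x))"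
    by (simp add: fun_eq_iff inner_complex_def algebra_simps)
  have p: "?p absolutely_integrable_on {0..R}"
    using L2_on_mult[OF l_expr_L2 L2_on_cnj[OF y_L2[OF order_refl]]] .
  have bl: "bounded_linear (\<lambda>z. Re (\<omega> * z))"
    by (rule bounded_linear_compose[OF bounded_linear_Re bounded_linear_mult_right])
  have ai: "(\<lambda>x. Re (\<omega> * ?p x)) absolutely_integrable_on {0..R}"
    using absolutely_integrable_linear[OF p bl] by (simp add: o_def)
  have m: "(\<lambda>x. Re (\<omega> * ?p x)) \<in> borel_measurable half_line"
    unfolding eq[symmetric] using Y(1) Y(5) by (auto simp: square_integrable_def)
  have "inner (l2_scale \<omega> (l2_class (l_expr s y u))) (l2_class y) = (\<integral>x. (\<omega> * l_expr s y u x) \<bullet> y x \<partial>half_line)"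
    using Y(1) Y(5) by (simp add: l2_class_scale l2_class_inner square_integrable_scale)
  also have "\<dots> = integral {0..R} (\<lambda>x. Re (\<omega> * ?p x))"
    unfolding eq
  proof (rule half_line_integral_support(2)[OF order_refl m _ ai])
    show "AE x in half_line. x \<notin> {0..R} \<longrightarrow> Re (\<omega> * ?p x) = 0"
      using AE_half_line_nonneg by (rule eventually_mono) (use R in auto)
  qed
  also have "\<dots> = Re (\<omega> * integral {0..R} ?p)"
    using integral_linear[OF _ bl, of ?p "{0..R}"] p by (simp add: absolutely_integrable_on_def o_def)
  finally show ?thesis .
qed

lemma norm_square_eq:
  assumes R: "\<And>x. R < x \<Longrightarrow> y x = 0"
  shows "(norm (l2_class y))\<^sup>2 = integral {0..R} \<rho>"
proof -
  have "(\<integral>x. (cmod (y x))\<^sup>2 \<partial>half_line) = integral {0..R} \<rho>"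
    unfolding \<rho>_def[abs_def]
  proof (rule square_integrable_support(2)[OF order_refl _ _ y_L2[OF order_refl]])
    show "y \<in> borel_measurable half_line" by (rule AC_loc_measurable[OF Y(2)])
    show "AE x in half_line. x \<notin> {0..R} \<longrightarrow> y x = 0"
      using AE_half_line_nonneg by (rule eventually_mono) (use R in auto)
  qed
  moreover have "(\<integral>x. (cmod (y x))\<^sup>2 \<partial>half_line) \<ge> 0" by (intro integral_nonneg_AE) simp
  ultimately show ?thesis using Y(1) by (simp add: norm_l2_class)
qed

lemma integral_x_\<rho>1:
  assumes R: "0 \<le> R" "\<rho> R = 0"
  shows "((\<lambda>x. x * \<rho>1 x) has_integral (- integral {0..R} \<rho>)) {0..R}"
proof -
  have AC: "AC_loc (\<lambda>x. complex_of_real x * (y x * cnj (y x)))" by (intro AC_loc_mult AC_loc_cnj Y AC_loc_of_real)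
  have D: "AE x in half_line. ((\<lambda>x. complex_of_real x * (y x * cnj (y x))) has_vector_derivative
      (complex_of_real x * (y x * cnj (y1 x) + y1 x * cnj (y x)) + 1 * (y x * cnj (y x)))) (at x)"
    using y1_AE
  proof (rule eventually_mono)
    fix x assume d: "(y has_vector_derivative y1 x) (at x)"
    have d1: "(complex_of_real has_vector_derivative 1) (at x)"
      using has_vector_derivative_of_real[OF DERIV_ident] by simp
    show "((\<lambda>x. complex_of_real x * (y x * cnj (y x))) has_vector_derivative
      (complex_of_real x * (y x * cnj (y1 x) + y1 x * cnj (y x)) + 1 * (y x * cnj (y x)))) (at x)"
      by (rule has_vector_derivative_mult[OF d1 has_vector_derivative_mult[OF d has_vector_derivative_cnj[OF d]]])
  qed
  have yR: "y R = 0" using R(2) by (simp add: \<rho>_def)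
  have "((\<lambda>x. complex_of_real x * (y x * cnj (y1 x) + y1 x * cnj (y x)) + 1 * (y x * cnj (y x))) has_integral 0) {0..R}"
    using AC_loc_derivative_has_integral[OF AC D order_refl R(1)] yR by simp
  then have "((\<lambda>x. Re (complex_of_real x * (y x * cnj (y1 x) + y1 x * cnj (y x)) + 1 * (y x * cnj (y x)))) has_integral Re 0) {0..R}"
    by (rule has_integral_Re)
  moreover have "Re (complex_of_real x * (y x * cnj (y1 x) + y1 x * cnj (y x)) + 1 * (y x * cnj (y x))) = x * \<rho>1 x + \<rho> x" for x
  proof -
    have "1 * (y x * cnj (y x)) = complex_of_real (\<rho> x)" unfolding \<rho>_def using complex_norm_square[of "y x"] by simp
    moreover have "y x * cnj (y1 x) + y1 x * cnj (y x) = complex_of_real (\<rho>1 x)"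
      unfolding \<rho>1_def by (simp add: complex_eq_iff)
    ultimately show ?thesis by simp
  qed
  ultimately have "((\<lambda>x. x * \<rho>1 x + \<rho> x) has_integral 0) {0..R}" by simp
  from has_integral_diff[OF this integrable_integral[OF \<rho>_integrable[OF order_refl]]]
  show ?thesis by simp
qed

end

section \<open>Coercivity\<close>

locale sector_element = sector_potential s r m1 m2 e1 e2 \<gamma> \<omega> \<kappa> B + minimal_domain_element s y u
  for s y u r :: "real \<Rightarrow> complex" and m1 m2 :: "real \<Rightarrow> real" and e1 e2 \<gamma> \<omega> :: complex and \<kappa> B :: real
begin

text \<open>On each unit cell \<open>\<bar>r\<bar>\<^sup>2\<close> has integral at most \<open>B\<close> and \<open>\<bar>y\<bar>\<^sup>2\<close> is estimated by its supremum.\<close>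

lemma integral_r_\<rho>:
  "(\<lambda>x. (cmod (r x))\<^sup>2 * \<rho> x) integrable_on {0..real K}"
  "integral {0..real K} (\<lambda>x. (cmod (r x))\<^sup>2 * \<rho> x)
    \<le> B * (1 + 1/\<eta>) * integral {0..real K} \<rho> + B * \<eta> * integral {0..real K} (\<lambda>x. (cmod (y1 x))\<^sup>2)"
proof -
  have L: "L2_on a b (\<lambda>x. y x * r x)" if "0 \<le> a" for a b
    by (rule L2_on_continuous_mult[OF AC_loc_continuous_on_Icc[OF Y(2) that] r[OF that]])
  have eq: "(cmod (r x))\<^sup>2 * \<rho> x = (cmod (y x * r x))\<^sup>2" for x
    by (simp only: \<rho>_def norm_mult power_mult_distrib mult.commute)
  have I: "(\<lambda>x. (cmod (r x))\<^sup>2 * \<rho> x) integrable_on {a..b}" if "0 \<le> a" for a b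
    unfolding eq by (rule L2_onD(2)[OF L[OF that]])
  show "(\<lambda>x. (cmod (r x))\<^sup>2 * \<rho> x) integrable_on {0..real K}" by (rule I) simp
  let ?P = "\<lambda>i. integral {real i..real i + 1} \<rho>" and ?E = "\<lambda>i. integral {real i..real i + 1} (\<lambda>x. (cmod (y1 x))\<^sup>2)"
  have grid: "integral {0..real K} F = (\<Sum>i<K. integral {real i..real i + 1} F)" if "F integrable_on {0..real K}" for F :: "real \<Rightarrow> real"
    using integral_grid[of 1 F K] that by (simp add: add.commute)
  have cell: "integral {real i..real i + 1} (\<lambda>x. (cmod (r x))\<^sup>2 * \<rho> x) \<le> B * (1 + 1/\<eta>) * ?P i + B * \<eta> * ?E i" for i
  proof -
    let ?M = "(1 + 1/\<eta>) * ?P i + \<eta> * ?E i"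
    have sup: "\<rho> x \<le> ?M" if "x \<in> {real i..real i + 1}" for x by (rule \<rho>_sup_unit[OF _ that \<eta>_pos]) simp
    have M0: "0 \<le> ?M" using sup[of "real i"] \<rho>_nonneg[of "real i"] by simp
    have ri: "(\<lambda>x. (cmod (r x))\<^sup>2) integrable_on {real i..real i + 1}" by (rule L2_onD(2)[OF r]) simp
    have "integral {real i..real i + 1} (\<lambda>x. (cmod (r x))\<^sup>2 * \<rho> x) \<le> integral {real i..real i + 1} (\<lambda>x. (cmod (r x))\<^sup>2 * ?M)"
      by (rule integral_le[OF I integrable_on_mult_left[OF ri] mult_left_mono[OF sup]]) auto
    also have "\<dots> = integral {real i..real i + 1} (\<lambda>x. (cmod (r x))\<^sup>2) * ?M" by (rule integral_mult_left)
    also have "\<dots> \<le> B * ?M" by (rule mult_right_mono[OF rB M0]) simp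
    finally show ?thesis unfolding distrib_left[of B "(1 + 1/\<eta>) * ?P i"] mult.assoc .
  qed
  have "integral {0..real K} (\<lambda>x. (cmod (r x))\<^sup>2 * \<rho> x) \<le> (\<Sum>i<K. B * (1 + 1/\<eta>) * ?P i + B * \<eta> * ?E i)"
    unfolding grid[OF I[OF order_refl]] by (intro sum_mono cell)
  also have "\<dots> = B * (1 + 1/\<eta>) * integral {0..real K} \<rho> + B * \<eta> * integral {0..real K} (\<lambda>x. (cmod (y1 x))\<^sup>2)"
    unfolding grid[OF \<rho>_integrable[OF order_refl]] grid[OF y1_integrable[OF order_refl]] sum.distrib sum_distrib_left ..
  finally show "integral {0..real K} (\<lambda>x. (cmod (r x))\<^sup>2 * \<rho> x)
    \<le> B * (1 + 1/\<eta>) * integral {0..real K} \<rho> + B * \<eta> * integral {0..real K} (\<lambda>x. (cmod (y1 x))\<^sup>2)" .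
qed

text \<open>Insert the decomposition of \<open>s\<close> into the energy identity. After rotation the monotone parts contribute with a positive
sign, and the other parts are of lower order. The assumptions on \<open>J1\<close> and \<open>J2\<close> are met by the
sums from the second mean value theorem on any grid.\<close>

lemma energy_lower_bound:
  assumes K: "y (real K) = 0" "u (real K) = 0"
    and I1: "((\<lambda>x. m1 x * \<rho>1 x) has_integral - J1) {0..real K}" and J1: "0 \<le> J1"
    and I2: "((\<lambda>x. m2 x * \<rho>1 x) has_integral - J2) {0..real K}" and J2: "0 \<le> J2"
  shows "\<kappa> / 2 * integral {0..real K} (\<lambda>x. (cmod (y1 x))\<^sup>2) + \<kappa> * (J1 + J2) - C * integral {0..real K} \<rho>
    \<le> Re (\<omega> * integral {0..real K} (\<lambda>x. l_expr s y u x * cnj (y x)))"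
proof -
  let ?I = "{0..real K}"
  define E where "E = integral ?I (\<lambda>x. (cmod (y1 x))\<^sup>2)"
  define P where "P = integral ?I \<rho>"
  define L where "L = integral ?I (\<lambda>x. l_expr s y u x * cnj (y x))"
  define J where "J = integral ?I (\<lambda>x. r x * complex_of_real (\<rho>1 x))"
  have rK: "\<rho> (real K) = 0" using K by (simp add: \<rho>_def)
  have E0: "0 \<le> E" unfolding E_def using y1_integrable[OF order_refl] by (intro Henstock_Kurzweil_Integration.integral_nonneg) auto
  have P0: "0 \<le> P" unfolding P_def using \<rho>_integrable[OF order_refl] \<rho>_nonneg by (intro Henstock_Kurzweil_Integration.integral_nonneg) auto
  have EI: "((\<lambda>x. (cmod (y1 x))\<^sup>2) has_integral E) ?I" unfolding E_def by (rule integrable_integral[OF y1_integrable[OF order_refl]])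
  have XI: "((\<lambda>x. x * \<rho>1 x) has_integral (- P)) ?I" unfolding P_def by (rule integral_x_\<rho>1) (use rK in auto)
  have LI: "((\<lambda>x. complex_of_real ((cmod (y1 x))\<^sup>2) - s x * complex_of_real (\<rho>1 x)) has_integral L) ?I"
    unfolding L_def by (rule energy_identity) (use K in auto)
  have cI: "((\<lambda>x. e * complex_of_real (F x)) has_integral e * complex_of_real j) ?I" if "(F has_integral j) ?I" for F j e
    by (rule has_integral_mult_right[OF has_integral_of_real[OF that]])
  have "((\<lambda>x. 1 * complex_of_real ((cmod (y1 x))\<^sup>2) - (complex_of_real ((cmod (y1 x))\<^sup>2) - s x * complex_of_real (\<rho>1 x))
      - (e1 * complex_of_real (m1 x * \<rho>1 x) + e2 * complex_of_real (m2 x * \<rho>1 x) + \<gamma> * complex_of_real (x * \<rho>1 x)))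
      has_integral (1 * complex_of_real E - L - (e1 * complex_of_real (- J1) + e2 * complex_of_real (- J2) + \<gamma> * complex_of_real (- P)))) ?I"
    by (intro has_integral_diff has_integral_add cI EI LI I1 I2 XI)
  then have JI: "((\<lambda>x. r x * complex_of_real (\<rho>1 x)) has_integral
     (1 * complex_of_real E - L - (e1 * complex_of_real (- J1) + e2 * complex_of_real (- J2) + \<gamma> * complex_of_real (- P)))) ?I"
    by (rule has_integral_eq[rotated]) (simp add: decomp algebra_simps)
  then have Jeq: "L = complex_of_real E + e1 * complex_of_real J1 + e2 * complex_of_real J2 + \<gamma> * complex_of_real P - J"
    unfolding J_def by (simp add: integral_unique)
  \<comment> \<open>\<open>\<bar>r\<bar> * \<bar>(\<bar>y\<bar>\<^sup>2)'\<bar>\<close> is split by the inequality between arithmetic and geometric means, half of the loss arising in each of the two steps\<close>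
  have Jle: "cmod J \<le> \<kappa> / 2 * E + 4 / \<kappa> * (B * (1 + 1/\<eta>)) * P"
  proof -
    let ?F = "\<lambda>x. \<kappa> / 4 * (cmod (y1 x))\<^sup>2 + 4 / \<kappa> * ((cmod (r x))\<^sup>2 * \<rho> x)"
    have Fi: "?F integrable_on ?I" by (intro integrable_add integrable_on_mult_right y1_integrable[OF order_refl] integral_r_\<rho>)
    have pt: "cmod (r x * complex_of_real (\<rho>1 x)) \<le> ?F x" for x
    proof -
      define p q where "p = cmod (y1 x)" and "q = cmod (r x) * cmod (y x)"
      have "0 \<le> (\<kappa> / 2 * p - 2 * q)\<^sup>2" by simp
      then have "\<kappa> * (2 * p * q) \<le> \<kappa> * (\<kappa> / 4 * p\<^sup>2 + 4 / \<kappa> * q\<^sup>2)"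
        using \<kappa> by (simp add: power2_diff power2_eq_square algebra_simps)
      then have "2 * p * q \<le> \<kappa> / 4 * p\<^sup>2 + 4 / \<kappa> * q\<^sup>2" by (rule mult_left_le_imp_le[OF _ \<kappa>])
      moreover have "cmod (r x * complex_of_real (\<rho>1 x)) \<le> cmod (r x) * (2 * cmod (y x) * cmod (y1 x))"
        using mult_left_mono[OF \<rho>1_bound, of "cmod (r x)" x] by (simp only: norm_mult norm_of_real norm_ge_zero simp_thms)
      moreover have "cmod (r x) * (2 * cmod (y x) * cmod (y1 x)) = 2 * p * q" unfolding p_def q_def by (simp only: mult_ac)
      moreover have "q\<^sup>2 = (cmod (r x))\<^sup>2 * \<rho> x" unfolding q_def \<rho>_def by (rule power_mult_distrib)
      ultimately show ?thesis unfolding p_def by (simp only: order_trans)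
    qed
    have "cmod J \<le> integral ?I ?F" unfolding J_def by (rule integral_norm_bound_integral[OF has_integral_integrable[OF JI] Fi pt])
    also have "\<dots> = \<kappa> / 4 * E + 4 / \<kappa> * integral ?I (\<lambda>x. (cmod (r x))\<^sup>2 * \<rho> x)"
      unfolding E_def
      by (subst Henstock_Kurzweil_Integration.integral_add)
        (simp_all only: integral_mult_right integrable_on_mult_right y1_integrable[OF order_refl] integral_r_\<rho>)
    also have "\<dots> \<le> \<kappa> / 4 * E + 4 / \<kappa> * (B * (1 + 1/\<eta>) * P + B * \<eta> * E)"
      unfolding E_def P_def using \<kappa> by (intro add_left_mono mult_left_mono integral_r_\<rho>) auto
    also have "4 / \<kappa> * (B * (1 + 1/\<eta>) * P + B * \<eta> * E) = 4 / \<kappa> * (B * (1 + 1/\<eta>)) * P + 4 / \<kappa> * (B * \<eta>) * E"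
      unfolding distrib_left[of "4 / \<kappa>"] mult.assoc ..
    also have "4 / \<kappa> * (B * \<eta>) = \<kappa> / 4" using \<kappa> B by (simp add: \<eta>_def power2_eq_square)
    finally show ?thesis by linarith
  qed
  have "Re (\<omega> * L) = Re \<omega> * E + Re (\<omega> * e1) * J1 + Re (\<omega> * e2) * J2 + Re (\<omega> * (\<gamma> * complex_of_real P)) - Re (\<omega> * J)"
    unfolding Jeq by (simp add: algebra_simps)
  moreover have "\<kappa> * E \<le> Re \<omega> * E" "\<kappa> * J1 \<le> Re (\<omega> * e1) * J1" "\<kappa> * J2 \<le> Re (\<omega> * e2) * J2"
    using \<kappa>\<omega> \<kappa>1 \<kappa>2 E0 J1 J2 by (auto intro: mult_right_mono)
  moreover have "\<bar>Re (\<omega> * (\<gamma> * complex_of_real P))\<bar> \<le> cmod \<gamma> * P"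
    using abs_Re_le_cmod[of "\<omega> * (\<gamma> * complex_of_real P)"] \<omega> P0 by (simp add: norm_mult)
  moreover have "\<bar>Re (\<omega> * J)\<bar> \<le> cmod J" using abs_Re_le_cmod[of "\<omega> * J"] \<omega> by (simp add: norm_mult)
  moreover have "C * P = cmod \<gamma> * P + 4 / \<kappa> * (B * (1 + 1/\<eta>)) * P" unfolding C_def by (rule distrib_right)
  moreover have "\<kappa> / 2 * E + \<kappa> / 2 * E = \<kappa> * E" by simp
  moreover have "\<kappa> * (J1 + J2) = \<kappa> * J1 + \<kappa> * J2" by (rule distrib_left)
  ultimately have "\<kappa> / 2 * E + \<kappa> * (J1 + J2) - C * P \<le> Re (\<omega> * L)" using Jle by linarith
  then show ?thesis unfolding E_def P_def L_def .
qed

end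

lemma inner_l2_scale_self: "inner (l2_scale c x) x = Re c * (norm x)\<^sup>2"
proof -
  have "inner (l2_scale \<i> x) x = inner x (l2_scale (- \<i>) x)" by (simp add: inner_l2_scale)
  also have "\<dots> = - inner (l2_scale \<i> x) x" by (simp add: inner_commute)
  finally have "inner (l2_scale \<i> x) x = 0" by simp
  then show ?thesis by (subst l2_scale_decompose) (simp add: inner_add_left power2_norm_eq_inner)
qed

context sector_element
begin

text \<open>The estimate holds for every grid at once, with the same shift. The mesh is the reciprocal of a natural number, so that an
integer end point beyond the support of \<open>y\<close> is a grid point.\<close>

lemma coercive_cells:
  assumes q: "0 < q" and K: "\<forall>x\<ge>real K. y x = 0" "u (real K) = 0"
  defines "h \<equiv> 1 / real q"
  shows "\<exists>c1 c2. (\<forall>i. c1 i \<in> {real i * h..real (Suc i) * h} \<and> c2 i \<in> {real i * h..real (Suc i) * h}) \<and>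
    (norm (l2_class y))\<^sup>2 + \<kappa> / 2 * integral {0..real K} (\<lambda>x. (cmod (y1 x))\<^sup>2)
    + \<kappa> * (\<Sum>i<K * q. (m1 (real (Suc i) * h) - m1 (real i * h)) * \<rho> (c1 i) + (m2 (real (Suc i) * h) - m2 (real i * h)) * \<rho> (c2 i))
    \<le> inner (l2_scale \<omega> (l2_class (l_expr s y u) + l2_scale (complex_of_real \<mu>) (l2_class y))) (l2_class y)"
proof -
  have h0: "0 \<le> h" and N: "real (K * q) * h = real K" using q by (auto simp: h_def)
  have rK: "\<rho> (real K) = 0" using K(1) by (simp add: \<rho>_def)
  define D1 where "D1 i = m1 (real (Suc i) * h) - m1 (real i * h)" for i
  define D2 where "D2 i = m2 (real (Suc i) * h) - m2 (real i * h)" for i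
  have step: "real i * h \<le> real (Suc i) * h" for i using h0 by (intro mult_right_mono) auto
  have D0: "0 \<le> D1 i" "0 \<le> D2 i" for i
    using monoD[OF mono1 step] monoD[OF mono2 step] by (auto simp: D1_def D2_def)
  have rN: "\<rho> (real (K * q) * h) = 0" unfolding N by (rule rK)
  obtain c1 where c1: "\<forall>i. c1 i \<in> {real i * h..real (Suc i) * h}"
      "((\<lambda>x. m1 x * \<rho>1 x) has_integral - (\<Sum>i<K*q. D1 i * \<rho> (c1 i))) {0..real K}"
    using second_mean_value_grid[OF mono1 h0 \<rho>_diff \<rho>_0 rN] unfolding N D1_def by blast
  obtain c2 where c2: "\<forall>i. c2 i \<in> {real i * h..real (Suc i) * h}"
      "((\<lambda>x. m2 x * \<rho>1 x) has_integral - (\<Sum>i<K*q. D2 i * \<rho> (c2 i))) {0..real K}"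
    using second_mean_value_grid[OF mono2 h0 \<rho>_diff \<rho>_0 rN] unfolding N D2_def by blast
  have J0: "0 \<le> (\<Sum>i<K*q. D1 i * \<rho> (c1 i))" "0 \<le> (\<Sum>i<K*q. D2 i * \<rho> (c2 i))"
    using D0 \<rho>_nonneg by (auto intro!: sum_nonneg)
  have van: "\<And>x. real K < x \<Longrightarrow> y x = 0" using K(1) by simp
  note lower = energy_lower_bound[OF K(1)[rule_format, OF order_refl] K(2) c1(2) J0(1) c2(2) J0(2)]
  define n2 where "n2 = (norm (l2_class y))\<^sup>2"
  have n2: "integral {0..real K} \<rho> = n2" unfolding n2_def by (rule norm_square_eq[OF van, symmetric])
  have "inner (l2_scale \<omega> (l2_class (l_expr s y u) + l2_scale (complex_of_real \<mu>) (l2_class y))) (l2_class y)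
    = inner (l2_scale \<omega> (l2_class (l_expr s y u))) (l2_class y) + Re (\<omega> * complex_of_real \<mu>) * n2"
    by (simp add: l2.scale_right_distrib inner_add_left inner_l2_scale_self n2_def)
  moreover have "inner (l2_scale \<omega> (l2_class (l_expr s y u))) (l2_class y) = Re (\<omega> * integral {0..real K} (\<lambda>x. l_expr s y u x * cnj (y x)))"
    by (rule inner_eq_integral[OF van])
  moreover have "(C + 1) * n2 \<le> Re (\<omega> * complex_of_real \<mu>) * n2"
  proof (rule mult_right_mono)
    have "\<kappa> * \<mu> \<le> Re \<omega> * \<mu>" by (rule mult_right_mono[OF \<kappa>\<omega>]) (use \<kappa> C_nonneg in \<open>auto simp: \<mu>_def\<close>)
    moreover have "\<kappa> * \<mu> = C + 1" using \<kappa> by (simp add: \<mu>_def)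
    ultimately show "C + 1 \<le> Re (\<omega> * complex_of_real \<mu>)" by simp
  qed (simp add: n2_def)
  moreover have "(C + 1) * n2 = C * n2 + n2" by (simp add: distrib_right)
  ultimately have "n2 + \<kappa> / 2 * integral {0..real K} (\<lambda>x. (cmod (y1 x))\<^sup>2)
     + \<kappa> * (\<Sum>i<K * q. D1 i * \<rho> (c1 i) + D2 i * \<rho> (c2 i))
    \<le> inner (l2_scale \<omega> (l2_class (l_expr s y u) + l2_scale (complex_of_real \<mu>) (l2_class y))) (l2_class y)"
    using lower unfolding n2 sum.distrib by linarith
  then show ?thesis using c1(1) c2(1) unfolding n2_def D1_def D2_def by blast
qed

end

section \<open>Compactness by step function approximation\<close>

definition cell :: "real \<Rightarrow> nat \<Rightarrow> real set" where "cell h i = {real i * h..<real (Suc i) * h}"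

definition step_function :: "real \<Rightarrow> (nat \<Rightarrow> complex) \<Rightarrow> nat \<Rightarrow> real \<Rightarrow> complex" where
  "step_function h c n t = (\<Sum>i<n. c i * indicator (cell h i) t)"

lemma step_function_cell:
  assumes h: "0 < h" and t: "t \<in> cell h j"
  shows "step_function h c n t = (if j < n then c j else 0)"
proof -
  have "indicator (cell h i) t = (if i = j then 1 else 0 :: complex)" for i
  proof (cases i j rule: linorder_cases)
    case less
    have "real (Suc i) * h \<le> real j * h" using less h by (intro mult_right_mono) auto
    then show ?thesis using t less by (auto simp: cell_def)
  next
    case greater
    have "real (Suc j) * h \<le> real i * h" using greater h by (intro mult_right_mono) auto
    then show ?thesis using t greater by (auto simp: cell_def)
  qed (use t in auto)
  then have "step_function h c n t = (\<Sum>i<n. if j = i then c i else 0)"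
    unfolding step_function_def by (intro sum.cong) auto
  then show ?thesis by (simp add: sum.delta)
qed

lemma step_function_beyond:
  assumes "0 < h" "real n * h \<le> t" shows "step_function h c n t = 0"
  unfolding step_function_def
proof (rule sum.neutral, intro ballI)
  fix i assume "i \<in> {..<n}"
  then have "real (Suc i) * h \<le> real n * h" using assms by (intro mult_right_mono) auto
  then have "t \<notin> cell h i" using assms unfolding cell_def atLeastLessThan_iff by linarith
  then show "c i * indicator (cell h i) t = 0" by simp
qed

lemma step_function_measurable: "step_function h c n \<in> borel_measurable lebesgue"
  unfolding step_function_def[abs_def] cell_def
  by (intro borel_measurable_sum borel_measurable_times borel_measurable_const borel_measurable_indicator) auto

lemma step_function_bound: "cmod (step_function h c n t) \<le> (\<Sum>i<n. cmod (c i))"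
  unfolding step_function_def
  by (rule order.trans[OF norm_sum sum_mono]) (auto simp: norm_mult indicator_def)

lemma step_function_L2_on: "L2_on a b (step_function h c n)"
proof (rule L2_on_bound)
  show "step_function h c n \<in> borel_measurable (lebesgue_on {a..b})"
    using step_function_measurable by (rule measurable_restrict_space1)
  show "(\<lambda>x. (\<Sum>i<n. cmod (c i))\<^sup>2) integrable_on {a..b}" by auto
  show "(cmod (step_function h c n x))\<^sup>2 \<le> (\<Sum>i<n. cmod (c i))\<^sup>2" for x
    by (intro power_mono step_function_bound) auto
qed

lemma step_function_square_integrable:
  assumes h: "0 < h" shows "square_integrable (step_function h c n)"
proof (rule square_integrable_support(1)[OF order_refl])
  show "step_function h c n \<in> borel_measurable half_line"
    using step_function_measurable by (rule measurable_restrict_space1)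
  show "AE x in half_line. x \<notin> {0..real n * h} \<longrightarrow> step_function h c n x = 0"
    using AE_half_line_nonneg by (rule eventually_mono) (use step_function_beyond[OF h] in auto)
qed (rule step_function_L2_on)

text \<open>The set depends continuously on finitely many complex coefficients from a disc.\<close>

lemma compact_step_functions:
  assumes h: "0 < h"
  shows "compact {l2_class (step_function h c n) | c. \<forall>i<n. cmod (c i) \<le> D}"
proof (induction n)
  case 0
  have "step_function h c 0 = (\<lambda>t. 0)" for c by (simp add: step_function_def fun_eq_iff)
  then have "{l2_class (step_function h c 0) | c. \<forall>i<0. cmod (c i) \<le> D} = {l2_class (\<lambda>t. 0)}" by simp
  then show ?case by simp
next
  case (Suc n)
  let ?e = "\<lambda>t. indicator (cell h n) t :: complex"
  have sq: "square_integrable ?e"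
  proof -
    have "step_function h (\<lambda>i. if i = n then 1 else 0) (Suc n) = ?e"
      by (auto simp: step_function_def fun_eq_iff intro!: sum.neutral)
    then show ?thesis using step_function_square_integrable[OF h, of "\<lambda>i. if i = n then 1 else 0" "Suc n"] by simp
  qed
  have Suc_eq: "l2_class (step_function h c (Suc n)) = l2_class (step_function h c n) + l2_scale (c n) (l2_class ?e)" for c
  proof -
    have "step_function h c (Suc n) = (\<lambda>t. step_function h c n t + c n * ?e t)" by (simp add: step_function_def fun_eq_iff)
    then show ?thesis using step_function_square_integrable[OF h] sq
      by (simp add: l2_class_add l2_class_scale square_integrable_scale)
  qed
  have cong: "step_function h c n = step_function h c' n" if "\<forall>i<n. c i = c' i" for c c'
    using that by (auto simp: step_function_def fun_eq_iff intro!: sum.cong)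
  have "{l2_class (step_function h c (Suc n)) | c. \<forall>i<Suc n. cmod (c i) \<le> D}
    = {a + b | a b. a \<in> {l2_class (step_function h c n) | c. \<forall>i<n. cmod (c i) \<le> D}
        \<and> b \<in> (\<lambda>z. l2_scale z (l2_class ?e)) ` cball 0 D}" (is "?A = ?B")
  proof
    show "?A \<subseteq> ?B"
    proof
      fix x assume "x \<in> ?A"
      then obtain c where c: "x = l2_class (step_function h c (Suc n))" "\<forall>i<Suc n. cmod (c i) \<le> D" by blast
      have "c n \<in> cball 0 D" using c(2) by simp
      moreover have "\<forall>i<n. cmod (c i) \<le> D" using c(2) by simp
      ultimately show "x \<in> ?B" unfolding c(1) Suc_eq by blast
    qed
    show "?B \<subseteq> ?A"
    proof
      fix x assume "x \<in> ?B"
      then obtain c z where c: "x = l2_class (step_function h c n) + l2_scale z (l2_class ?e)" "\<forall>i<n. cmod (c i) \<le> D" "z \<in> cball 0 D"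
        by blast
      have "x = l2_class (step_function h (c(n := z)) (Suc n))"
        unfolding c(1) Suc_eq using cong[of "c(n := z)" c] by simp
      moreover have "\<forall>i<Suc n. cmod ((c(n := z)) i) \<le> D" using c(2,3) by (simp add: less_Suc_eq)
      ultimately show "x \<in> ?A" by blast
    qed
  qed
  moreover have "compact ((\<lambda>z. l2_scale z (l2_class ?e)) ` cball 0 D)"
    by (rule compact_continuous_image) (subst l2_scale_decompose, auto intro!: continuous_intros)
  ultimately show ?case using compact_sums[OF Suc.IH] by simp
qed

context sector_element
begin

text \<open>Testing the coercive estimate with \<open>y\<close> itself bounds the norm of \<open>y\<close> by \<open>1\<close>, the energy by \<open>2 / \<kappa>\<close>, and the weighted sum \<open>\<Sum> T i\<close> of
the increments by \<open>1 / \<kappa>\<close>. Within a cell \<open>y\<close> varies by at most the root of the mesh times the local energy. From cell \<open>n\<close> onwards one of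
\<open>m1\<close>, \<open>m2\<close> increases by at least \<open>1 / 2\<close>, so \<open>\<bar>y\<bar>\<^sup>2 \<le> 2 * T i\<close> somewhere in the cell. Altogether the error is
proportional to the mesh.\<close>

lemma step_approximation:
  assumes w: "norm (l2_class (l_expr s y u) + l2_scale (complex_of_real \<mu>) (l2_class y)) \<le> 1"
    and q: "0 < q" and growth: "\<And>i. n \<le> i \<Longrightarrow> 1 \<le> (m1 (real (Suc i) / real q) + m2 (real (Suc i) / real q)) - (m1 (real i / real q) + m2 (real i / real q))"
  shows "(\<forall>i. cmod (y (real i / real q)) \<le> 2 + 2 / \<kappa>) \<and>
     (norm (l2_class y - l2_class (step_function (1 / real q) (\<lambda>i. y (real i / real q)) n)))\<^sup>2 \<le> 8 / (\<kappa> * real q)"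
proof -
  define h where "h = 1 / real q"
  have h: "0 < h" "h \<le> 1" using q by (auto simp: h_def)
  obtain R where R: "0 \<le> R" "\<forall>x>R. y x = 0 \<and> u x = 0" using minimal_domain_support[OF yu] by blast
  obtain K0 where K0: "R < real K0" using reals_Archimedean2 by blast
  define K where "K = max K0 n"
  have K: "\<forall>x\<ge>real K. y x = 0" "u (real K) = 0"
    using R K0 by (auto simp: K_def)
  define E where "E = integral {0..real K} (\<lambda>x. (cmod (y1 x))\<^sup>2)"
  have E0: "0 \<le> E" unfolding E_def using y1_integrable[OF order_refl] by (intro Henstock_Kurzweil_Integration.integral_nonneg) auto
  define D1 where "D1 i = m1 (real (Suc i) * h) - m1 (real i * h)" for i
  define D2 where "D2 i = m2 (real (Suc i) * h) - m2 (real i * h)" for i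
  have le: "real i * h \<le> real (Suc i) * h" for i using h by (intro mult_right_mono) auto
  have D0: "0 \<le> D1 i" "0 \<le> D2 i" for i
    using monoD[OF mono1 le] monoD[OF mono2 le] by (auto simp: D1_def D2_def)
  have D12: "1 \<le> D1 i + D2 i" if "n \<le> i" for i using growth[OF that] by (simp add: D1_def D2_def h_def)
  obtain c1 c2 where cc: "(\<forall>i. c1 i \<in> {real i * h..real (Suc i) * h} \<and> c2 i \<in> {real i * h..real (Suc i) * h}) \<and>
    (norm (l2_class y))\<^sup>2 + \<kappa> / 2 * E + \<kappa> * (\<Sum>i<K * q. D1 i * \<rho> (c1 i) + D2 i * \<rho> (c2 i))
    \<le> inner (l2_scale \<omega> (l2_class (l_expr s y u) + l2_scale (complex_of_real \<mu>) (l2_class y))) (l2_class y)"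
    using coercive_cells[OF q K, folded h_def, folded E_def D1_def D2_def] by (elim exE)
  note c = conjunct1[OF cc] and co = conjunct2[OF cc]
  define T where "T i = D1 i * \<rho> (c1 i) + D2 i * \<rho> (c2 i)" for i
  have T0: "0 \<le> T i" for i unfolding T_def using D0 \<rho>_nonneg by simp
  define ny where "ny = norm (l2_class y)"
  have "inner (l2_scale \<omega> (l2_class (l_expr s y u) + l2_scale (complex_of_real \<mu>) (l2_class y))) (l2_class y) \<le> 1 * ny"
  proof (rule order.trans[OF norm_cauchy_schwarz], unfold ny_def, rule mult_right_mono)
    show "norm (l2_scale \<omega> (l2_class (l_expr s y u) + l2_scale (complex_of_real \<mu>) (l2_class y))) \<le> 1"
      using w \<omega> by (simp add: norm_l2_scale)
  qed simp
  then have co': "ny\<^sup>2 + \<kappa> / 2 * E + \<kappa> * (\<Sum>i<K * q. T i) \<le> ny" using co unfolding T_def ny_def by linarith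
  have nn: "0 \<le> \<kappa> / 2 * E" "0 \<le> \<kappa> * (\<Sum>i<K * q. T i)" "0 \<le> ny"
    using \<kappa> E0 T0 by (auto intro!: mult_nonneg_nonneg sum_nonneg simp: ny_def)
  have ny1: "ny \<le> 1"
  proof (rule ccontr)
    assume "\<not> ny \<le> 1"
    then have "1 * ny < ny * ny" by (intro mult_strict_right_mono) auto
    then show False using co' nn by (simp add: power2_eq_square)
  qed
  then have "\<kappa> / 2 * E \<le> 1" "\<kappa> * (\<Sum>i<K * q. T i) \<le> 1" using co' nn zero_le_power2[of ny] by linarith+
  then have E: "E \<le> 2 / \<kappa>" and TT: "(\<Sum>i<K * q. T i) \<le> 1 / \<kappa>" using \<kappa> by (auto simp: field_simps)
  have P: "integral {0..real K} \<rho> \<le> 1"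
  proof -
    have "integral {0..real K} \<rho> = ny\<^sup>2" unfolding ny_def by (rule norm_square_eq[symmetric]) (use K in auto)
    then show ?thesis using ny1 nn(3) by (simp add: power_le_one)
  qed
  have bound: "cmod (y x) \<le> 2 + 2 / \<kappa>" if x: "0 \<le> x" for x
  proof (cases "x < real K")
    case False then show ?thesis using K \<kappa> by simp
  next
    case True
    define k where "k = nat \<lfloor>x\<rfloor>"
    have k: "real k \<le> x" "x \<le> real k + 1" "real k + 1 \<le> real K"
    proof -
      have fl: "real k = of_int \<lfloor>x\<rfloor>" using x by (simp add: k_def)
      show "real k \<le> x" "x \<le> real k + 1" unfolding fl by linarith+
      have "real k < real K" using True unfolding fl by linarith
      then have "Suc k \<le> K" by simp
      then have "real (Suc k) \<le> real K" by (rule of_nat_mono)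
      then show "real k + 1 \<le> real K" by simp
    qed
    have sub: "integral {real k..real k + 1} F \<le> integral {0..real K} F" if "F integrable_on {0..real K}" "\<And>x. 0 \<le> F x" for F :: "real \<Rightarrow> real"
      using k that integrable_subinterval_real[OF that(1), of "real k" "real k + 1"] by (intro integral_subset_le) auto
    have "\<rho> x \<le> (1 + 1/1) * integral {real k..real k + 1} \<rho> + 1 * integral {real k..real k + 1} (\<lambda>x. (cmod (y1 x))\<^sup>2)"
      by (rule \<rho>_sup_unit) (use k in auto)
    also have "\<dots> \<le> 2 + 2 / \<kappa>"
      using sub[OF \<rho>_integrable[OF order_refl] \<rho>_nonneg] sub[OF y1_integrable[OF order_refl]] P E unfolding E_def by simp
    finally have r: "(cmod (y x))\<^sup>2 \<le> 2 + 2 / \<kappa>" unfolding \<rho>_def .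
    show ?thesis
    proof (rule ccontr)
      assume n: "\<not> cmod (y x) \<le> 2 + 2 / \<kappa>"
      have k0: "0 < 2 / \<kappa>" using \<kappa> by simp
      have "1 * cmod (y x) \<le> cmod (y x) * cmod (y x)" by (rule mult_right_mono) (use n k0 in linarith, simp)
      then show False using n r by (simp add: power2_eq_square)
    qed
  qed
  let ?z = "step_function h (\<lambda>i. y (real i * h)) n"
  let ?F = "\<lambda>t. y t - ?z t"
  have FL: "L2_on 0 b ?F" for b by (rule L2_on_diff[OF y_L2[OF order_refl] step_function_L2_on])
  have sz: "square_integrable ?z" by (rule step_function_square_integrable[OF h(1)])
  have Ksupp: "real n * h \<le> real K" using h K_def mult_left_le[of h "real n"] by (simp add: mult.commute)
  have "(norm (l2_class y - l2_class ?z))\<^sup>2 = integral {0..real K} (\<lambda>t. (cmod (?F t))\<^sup>2)"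
  proof -
    have sF: "square_integrable ?F" using square_integrable_add[OF Y(1) square_integrable_scale[OF sz, of "-1"]] by simp
    have "(\<integral>x. (cmod (?F x))\<^sup>2 \<partial>half_line) = integral {0..real K} (\<lambda>t. (cmod (?F t))\<^sup>2)"
    proof (rule square_integrable_support(2)[OF order_refl _ _ FL])
      show "?F \<in> borel_measurable half_line" using sF by (simp add: square_integrable_def)
      show "AE x in half_line. x \<notin> {0..real K} \<longrightarrow> ?F x = 0"
        using AE_half_line_nonneg by (rule eventually_mono) (use K step_function_beyond[OF h(1)] Ksupp in auto)
    qed
    moreover have "(\<integral>x. (cmod (?F x))\<^sup>2 \<partial>half_line) \<ge> 0" by (intro integral_nonneg_AE) simp
    ultimately show ?thesis using sF Y(1) sz by (simp add: l2_class_diff norm_l2_class)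
  qed
  also have "\<dots> = (\<Sum>i<K * q. integral {real i * h..real (Suc i) * h} (\<lambda>t. (cmod (?F t))\<^sup>2))"
  proof -
    have N: "real (K * q) * h = real K" using q by (simp add: h_def)
    show ?thesis using integral_grid[of h "\<lambda>t. (cmod (?F t))\<^sup>2" "K * q"] h L2_onD(2)[OF FL] unfolding N by simp
  qed
  also have "\<dots> \<le> (\<Sum>i<K * q. 2 * h * h * integral {real i * h..real (Suc i) * h} (\<lambda>x. (cmod (y1 x))\<^sup>2) + 4 * h * T i)"
  proof (rule sum_mono)
    fix i
    let ?C = "{real i * h..real (Suc i) * h}"
    define Ei where "Ei = integral ?C (\<lambda>x. (cmod (y1 x))\<^sup>2)"
    have i0: "0 \<le> real i * h" using h by simp
    have len: "real (Suc i) * h - real i * h = h" by (simp add: algebra_simps)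
    have Ei0: "0 \<le> Ei" unfolding Ei_def using y1_integrable[OF i0] by (intro Henstock_Kurzweil_Integration.integral_nonneg) auto
    have inc: "(cmod (y t - y t'))\<^sup>2 \<le> h * Ei" if "t \<in> ?C" "t' \<in> ?C" for t t'
      using y_increment[OF i0 that] unfolding len Ei_def .
    define a where "a = (if i < n then y (real i * h) else 0)"
    have sp: "integral ?C (\<lambda>t. (cmod (?F t))\<^sup>2) = integral ?C (\<lambda>t. (cmod (y t - a))\<^sup>2)"
    proof (rule integral_spike[of "{real (Suc i) * h}"])
      fix t assume "t \<in> ?C - {real (Suc i) * h}"
      then have "t \<in> cell h i" by (auto simp: cell_def)
      then show "(cmod (y t - a))\<^sup>2 = (cmod (?F t))\<^sup>2" using step_function_cell[OF h(1)] by (simp add: a_def)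
    qed simp
    have L2a: "(\<lambda>t. (cmod (y t - a))\<^sup>2) integrable_on ?C"
      by (rule L2_onD(2)[OF L2_on_diff[OF y_L2[OF i0] L2_on_const]])
    have up: "integral ?C (\<lambda>t. (cmod (y t - a))\<^sup>2) \<le> h * M" if "\<And>t. t \<in> ?C \<Longrightarrow> (cmod (y t - a))\<^sup>2 \<le> M" for M
    proof -
      have "integral ?C (\<lambda>t. (cmod (y t - a))\<^sup>2) \<le> integral ?C (\<lambda>t. M)" by (rule integral_le[OF L2a]) (use that in auto)
      also have "\<dots> = h * M" using le[of i] len by simp
      finally show ?thesis .
    qed
    show "integral ?C (\<lambda>t. (cmod (?F t))\<^sup>2) \<le> 2 * h * h * integral ?C (\<lambda>x. (cmod (y1 x))\<^sup>2) + 4 * h * T i"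
      unfolding sp Ei_def[symmetric]
    proof (cases "i < n")
      case True
      have "integral ?C (\<lambda>t. (cmod (y t - a))\<^sup>2) \<le> h * (h * Ei)"
        by (rule up) (use True inc le in \<open>auto simp: a_def\<close>)
      moreover have "0 \<le> h * (h * Ei)" "0 \<le> h * T i" using h Ei0 T0[of i] by auto
      ultimately show "integral ?C (\<lambda>t. (cmod (y t - a))\<^sup>2) \<le> 2 * h * h * Ei + 4 * h * T i" by simp
    next
      case False
      have "\<exists>p\<in>?C. \<rho> p \<le> 2 * T i"
      proof (cases "1/2 \<le> D1 i")
        case True
        have "1/2 * \<rho> (c1 i) \<le> D1 i * \<rho> (c1 i)" by (rule mult_right_mono[OF True \<rho>_nonneg])
        moreover have "0 \<le> D2 i * \<rho> (c2 i)" using D0 \<rho>_nonneg by simp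
        ultimately have "\<rho> (c1 i) \<le> 2 * T i" unfolding T_def distrib_left by linarith
        then show ?thesis using c by blast
      next
        case F1: False
        then have "1/2 \<le> D2 i" using D12[of i] False by simp
        then have "1/2 * \<rho> (c2 i) \<le> D2 i * \<rho> (c2 i)" by (rule mult_right_mono[OF _ \<rho>_nonneg])
        moreover have "0 \<le> D1 i * \<rho> (c1 i)" using D0 \<rho>_nonneg by simp
        ultimately have "\<rho> (c2 i) \<le> 2 * T i" unfolding T_def distrib_left by linarith
        then show ?thesis using c by blast
      qed
      then obtain p where p: "p \<in> ?C" "\<rho> p \<le> 2 * T i" by blast
      have "integral ?C (\<lambda>t. (cmod (y t - a))\<^sup>2) \<le> h * (2 * (h * Ei) + 4 * T i)"
      proof (rule up)
        fix t assume t: "t \<in> ?C"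
        have "(cmod ((y t - y p) + y p))\<^sup>2 \<le> 2 * (cmod (y t - y p))\<^sup>2 + 2 * (cmod (y p))\<^sup>2" by (rule norm_add_sq_le)
        then show "(cmod (y t - a))\<^sup>2 \<le> 2 * (h * Ei) + 4 * T i" using inc[OF t p(1)] p(2) False unfolding \<rho>_def by (simp add: a_def)
      qed
      then show "integral ?C (\<lambda>t. (cmod (y t - a))\<^sup>2) \<le> 2 * h * h * Ei + 4 * h * T i" by (simp add: algebra_simps)
    qed
  qed
  also have "\<dots> = 2 * h * h * E + 4 * h * (\<Sum>i<K * q. T i)"
  proof -
    have N: "real (K * q) * h = real K" using q by (simp add: h_def)
    have "E = (\<Sum>i<K * q. integral {real i * h..real (Suc i) * h} (\<lambda>x. (cmod (y1 x))\<^sup>2))"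
      unfolding E_def using integral_grid[of h "\<lambda>x. (cmod (y1 x))\<^sup>2" "K * q"] h y1_integrable[OF order_refl] unfolding N by simp
    then show ?thesis by (simp only: sum.distrib sum_distrib_left)
  qed
  also have "\<dots> \<le> 8 * h / \<kappa>"
  proof -
    have "2 * h * h * E \<le> 2 * h * 1 * (2 / \<kappa>)" using h E0 E \<kappa> by (intro mult_mono) auto
    moreover have "4 * h * (\<Sum>i<K * q. T i) \<le> 4 * h * (1 / \<kappa>)" using h TT by (intro mult_left_mono) auto
    ultimately show ?thesis by simp
  qed
  finally have "(norm (l2_class y - l2_class ?z))\<^sup>2 \<le> 8 * h / \<kappa>" .
  then show ?thesis using bound[of "real _ / real q"] by (auto simp: h_def mult.commute)
qed

end

text \<open>The coercive sublevel set is within \<open>e / 2\<close> of a compact set of step functions, if the mesh is chosen first and then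
the number of cells so large that the growth condition holds beyond them.\<close>

theorem (in sector_potential) growth_implies_compact_extension:
  assumes d: "0 < d" and growth: "\<And>h. 0 < h \<Longrightarrow> h \<le> d \<Longrightarrow> \<exists>X. \<forall>a\<ge>X. 1 \<le> (m1 (a + h) + m2 (a + h)) - (m1 a + m2 a)"
  shows "has_extensions_with_compact_resolvent (minimal_operator s)"
proof (rule coercive_has_compact_extension[where \<omega>=\<omega> and \<mu>="complex_of_real \<mu>"])
  show "(0, 0) \<in> minimal_operator s" by (rule minimal_operator_zero)
  show "(x + x', v + v') \<in> minimal_operator s" if "(x, v) \<in> minimal_operator s" "(x', v') \<in> minimal_operator s" for x v x' v'
    by (rule minimal_operator_add[OF that s])
  show "(l2_scale c x, l2_scale c v) \<in> minimal_operator s" if "(x, v) \<in> minimal_operator s" for c x v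
    by (rule minimal_operator_scale[OF that s])
  show "h = 0" if "\<And>x v. (x, v) \<in> minimal_operator s \<Longrightarrow> inner x h = 0" for h
    by (rule minimal_domain_dense[OF s that])
  show "cmod \<omega> = 1" by (rule \<omega>)
  have elem: "sector_element s y u r m1 m2 e1 e2 \<gamma> \<omega> \<kappa> B" if "in_minimal_domain s y u" for y u
    by (intro sector_element.intro sector_potential_axioms minimal_domain_element.intro s that)
  show "(norm x)\<^sup>2 \<le> inner (l2_scale \<omega> (v + l2_scale (complex_of_real \<mu>) x)) x" if xv: "(x, v) \<in> minimal_operator s" for x v
  proof -
    obtain y u where yu: "in_minimal_domain s y u" and x: "x = l2_class y" and v: "v = l2_class (l_expr s y u)"
      using xv unfolding minimal_operator_def by blast
    interpret sector_element s y u r m1 m2 e1 e2 \<gamma> \<omega> \<kappa> B by (rule elem[OF yu])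
    obtain R where R: "0 \<le> R" "\<forall>x>R. y x = 0 \<and> u x = 0" using minimal_domain_support[OF yu] by blast
    obtain K where K: "R < real K" using reals_Archimedean2 by blast
    have vK: "\<forall>x\<ge>real K. y x = 0" "u (real K) = 0" using R K by auto
    obtain c1 c2 where cc: "(\<forall>i. c1 i \<in> {real i * (1 / real 1)..real (Suc i) * (1 / real 1)} \<and> c2 i \<in> {real i * (1 / real 1)..real (Suc i) * (1 / real 1)}) \<and>
    (norm (l2_class y))\<^sup>2 + \<kappa> / 2 * integral {0..real K} (\<lambda>x. (cmod (y1 x))\<^sup>2)
    + \<kappa> * (\<Sum>i<K * 1. (m1 (real (Suc i) * (1 / real 1)) - m1 (real i * (1 / real 1))) * \<rho> (c1 i) + (m2 (real (Suc i) * (1 / real 1)) - m2 (real i * (1 / real 1))) * \<rho> (c2 i))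
    \<le> inner (l2_scale \<omega> (l2_class (l_expr s y u) + l2_scale (complex_of_real \<mu>) (l2_class y))) (l2_class y)"
      using coercive_cells[OF zero_less_one vK] by (elim exE)
    note co = conjunct2[OF cc]
    have "0 \<le> \<kappa> / 2 * integral {0..real K} (\<lambda>x. (cmod (y1 x))\<^sup>2)"
      using \<kappa> y1_integrable[OF order_refl] by (intro mult_nonneg_nonneg Henstock_Kurzweil_Integration.integral_nonneg) auto
    moreover have "0 \<le> \<kappa> * (\<Sum>i<K * 1. (m1 (real (Suc i) * (1 / real 1)) - m1 (real i * (1 / real 1))) * \<rho> (c1 i) + (m2 (real (Suc i) * (1 / real 1)) - m2 (real i * (1 / real 1))) * \<rho> (c2 i))"
      using \<kappa> \<rho>_nonneg monoD[OF mono1] monoD[OF mono2]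
      by (intro mult_nonneg_nonneg sum_nonneg add_nonneg_nonneg) auto
    ultimately show ?thesis using co unfolding x v by linarith
  qed
  let ?S = "{x. \<exists>v. (x, v) \<in> minimal_operator s \<and> norm (v + l2_scale (complex_of_real \<mu>) x) \<le> 1}"
  show "compact (closure ?S)"
  proof (rule compact_closure_if_totally_bounded)
    fix e :: real assume e: "e > 0"
    \<comment> \<open>the last bound makes the error \<open>8 / (\<kappa> * q)\<close> less than \<open>(e / 2)\<^sup>2\<close>\<close>
    obtain q :: nat where q': "max (max (1 / d) 1) (32 / (\<kappa> * e\<^sup>2)) < real q" using reals_Archimedean2 by blast
    then have q: "1 < real q" "1 / d < real q" "32 / (\<kappa> * e\<^sup>2) < real q" by auto
    define h where "h = 1 / real q"
    have h: "0 < h" "h \<le> d" using q d by (auto simp: h_def field_simps)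
    obtain X where X: "\<forall>a\<ge>X. 1 \<le> (m1 (a + h) + m2 (a + h)) - (m1 a + m2 a)" using growth[OF h] by blast
    obtain n :: nat where n: "X * real q < real n" using reals_Archimedean2 by blast
    have gr: "1 \<le> (m1 (real (Suc i) / real q) + m2 (real (Suc i) / real q)) - (m1 (real i / real q) + m2 (real i / real q))" if "n \<le> i" for i
    proof -
      have "X * real q \<le> real i" using n that by linarith
      then have "X \<le> real i / real q" using q by (simp add: field_simps)
      moreover have "real i / real q + h = real (Suc i) / real q" by (simp add: h_def add_divide_distrib)
      ultimately show ?thesis using X[rule_format, of "real i / real q"] by simp
    qed
    let ?Z = "{l2_class (step_function (1 / real q) c n) | c. \<forall>i<n. cmod (c i) \<le> 2 + 2 / \<kappa>}"
    have "compact ?Z" by (rule compact_step_functions) (use q in simp)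
    then obtain k where k: "finite k" "?Z \<subseteq> (\<Union>x\<in>k. ball x (e/2))"
      using e unfolding compact_eq_totally_bounded by (meson half_gt_zero)
    have "?S \<subseteq> (\<Union>x\<in>k. ball x e)"
    proof
      fix x assume "x \<in> ?S"
      then obtain v where xv: "(x, v) \<in> minimal_operator s" "norm (v + l2_scale (complex_of_real \<mu>) x) \<le> 1" by blast
      obtain y u where yu: "in_minimal_domain s y u" and x: "x = l2_class y" and v: "v = l2_class (l_expr s y u)"
        using xv(1) unfolding minimal_operator_def by blast
      interpret sector_element s y u r m1 m2 e1 e2 \<gamma> \<omega> \<kappa> B by (rule elem[OF yu])
      define z where "z = l2_class (step_function (1 / real q) (\<lambda>i. y (real i / real q)) n)"
      have A: "(\<forall>i. cmod (y (real i / real q)) \<le> 2 + 2 / \<kappa>) \<and> (norm (x - z))\<^sup>2 \<le> 8 / (\<kappa> * real q)"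
        unfolding z_def x by (rule step_approximation) (use xv(2) q gr in \<open>auto simp: x v\<close>)
      then have "z \<in> ?Z" unfolding z_def by blast
      then obtain p where p: "p \<in> k" "dist p z < e/2" using k(2) by auto
      have "8 / (\<kappa> * real q) < (e/2)\<^sup>2"
        using q(1,3) \<kappa> e by (simp add: field_simps power2_eq_square)
      then have "(norm (x - z))\<^sup>2 < (e/2)\<^sup>2" using A by linarith
      then have "norm (x - z) < e/2" by (rule power_less_imp_less_base) (use e in simp)
      then have "dist p x < e" using p(2) dist_triangle[of p x z] by (simp add: dist_norm norm_minus_commute)
      then show "x \<in> (\<Union>x\<in>k. ball x e)" using p(1) by auto
    qed
    then show "\<exists>k. finite k \<and> ?S \<subseteq> (\<Union>x\<in>k. ball x e)" using k(1) by blast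
  qed
qed

section \<open>Areas in the square\<close>

lemma negligible_times_UNIV:
  fixes N :: "real set"
  assumes "negligible N"
  shows "negligible (N \<times> (UNIV :: real set))" "negligible ((UNIV :: real set) \<times> N)"
proof -
  obtain N' where N': "N' \<in> null_sets lborel" "N \<subseteq> N'"
    using assms unfolding negligible_iff_null_sets null_sets_completion_iff2 by blast
  have b: "N' \<in> sets lborel" "emeasure lborel N' = 0" using N' by auto
  have "N' \<times> UNIV \<in> null_sets (lborel \<Otimes>\<^sub>M (lborel :: real measure))"
    using b by (intro null_setsI) (auto simp: lborel.emeasure_pair_measure_Times)
  moreover have "UNIV \<times> N' \<in> null_sets ((lborel :: real measure) \<Otimes>\<^sub>M lborel)"
    using b by (intro null_setsI) (auto simp: lborel.emeasure_pair_measure_Times)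
  ultimately have "N' \<times> (UNIV :: real set) \<in> null_sets lborel" "(UNIV :: real set) \<times> N' \<in> null_sets lborel"
    by (simp_all only: lborel_prod)
  then have n: "negligible (N' \<times> (UNIV :: real set))" "negligible ((UNIV :: real set) \<times> N')"
    unfolding negligible_iff_null_sets by (auto intro: null_sets_completionI)
  show "negligible (N \<times> (UNIV :: real set))" by (rule negligible_subset[OF n(1)]) (use N'(2) in auto)
  show "negligible ((UNIV :: real set) \<times> N)" by (rule negligible_subset[OF n(2)]) (use N'(2) in auto)
qed

lemma lebesgue_set_borel_part:
  fixes S :: "real set"
  assumes "S \<in> sets lebesgue"
  obtains B where "B \<in> sets borel" "negligible (S - B)" "B \<subseteq> S"
proof -
  obtain B N N' where B: "S = B \<union> N" "N \<subseteq> N'" "N' \<in> null_sets lborel" "B \<in> sets lborel"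
    using sets_completionE[OF assms] by metis
  have "S - B \<in> null_sets lebesgue" unfolding null_sets_completion_iff2 using B by blast
  then show ?thesis using that[of B] B by (auto simp: negligible_iff_null_sets)
qed

text \<open>The completed Lebesgue measure of the plane contains the product of the completed measures: a Lebesgue set is a
Borel set up to a null set, and null sets times a line are null.\<close>

lemma lebesgue_sets_Times:
  fixes S T :: "real set"
  assumes "S \<in> sets lebesgue" "T \<in> sets lebesgue"
  shows "S \<times> T \<in> sets lebesgue"
proof -
  obtain A where A: "A \<in> sets borel" "negligible (S - A)" "A \<subseteq> S" using lebesgue_set_borel_part[OF assms(1)] .
  obtain B where B: "B \<in> sets borel" "negligible (T - B)" "B \<subseteq> T" using lebesgue_set_borel_part[OF assms(2)] .
  have "A \<times> B \<in> sets (lborel \<Otimes>\<^sub>M lborel)" using A(1) B(1) by (intro pair_measureI) auto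
  then have m: "A \<times> B \<in> sets lebesgue" unfolding lborel_prod by simp
  have "negligible ((A \<times> B - S \<times> T) \<union> (S \<times> T - A \<times> B))"
    by (rule negligible_subset[OF negligible_Un[OF negligible_times_UNIV(1)[OF A(2)] negligible_times_UNIV(2)[OF B(2)]]])
      (use A(3) B(3) in auto)
  then show ?thesis by (rule sets_negligible_symdiff[OF m])
qed

lemma lmeasurable_Times:
  fixes S T :: "real set"
  assumes S: "S \<in> lmeasurable" and T: "T \<in> lmeasurable"
  shows "S \<times> T \<in> lmeasurable" "measure lebesgue (S \<times> T) = measure lebesgue S * measure lebesgue T"
proof -
  obtain A where A: "A \<in> sets borel" "negligible (S - A)" "A \<subseteq> S" using lebesgue_set_borel_part[OF fmeasurableD[OF S]] .
  obtain B where B: "B \<in> sets borel" "negligible (T - B)" "B \<subseteq> T" using lebesgue_set_borel_part[OF fmeasurableD[OF T]] .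
  have AS: "(S - A) \<union> (A - S) = S - A" and BT: "(T - B) \<union> (B - T) = T - B" using A(3) B(3) by auto
  have Am: "A \<in> lmeasurable" "measure lebesgue A = measure lebesgue S"
    using lmeasurable_negligible_symdiff[OF S] measure_negligible_symdiff[OF S] A(2) AS by metis+
  have Bm: "B \<in> lmeasurable" "measure lebesgue B = measure lebesgue T"
    using lmeasurable_negligible_symdiff[OF T] measure_negligible_symdiff[OF T] B(2) BT by metis+
  have AB: "A \<times> B \<in> sets (lborel \<Otimes>\<^sub>M lborel)" using A(1) B(1) by (intro pair_measureI) auto
  have "emeasure lebesgue (A \<times> B) = emeasure (lborel \<Otimes>\<^sub>M lborel) (A \<times> B)"
    using AB unfolding lborel_prod by (simp add: emeasure_completion)
  also have "\<dots> = emeasure lborel A * emeasure lborel B" using A(1) B(1) by (intro lborel.emeasure_pair_measure_Times) auto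
  also have "\<dots> = emeasure lebesgue A * emeasure lebesgue B" using A(1) B(1) by (simp add: emeasure_completion)
  also have "\<dots> = ennreal (measure lebesgue A) * ennreal (measure lebesgue B)"
    using Am(1) Bm(1) by (simp add: emeasure_eq_measure2)
  finally have e: "emeasure lebesgue (A \<times> B) = ennreal (measure lebesgue A * measure lebesgue B)" by (simp add: ennreal_mult)
  have ABm: "A \<times> B \<in> lmeasurable" using AB e unfolding lborel_prod by (intro fmeasurableI) auto
  have n: "negligible ((A \<times> B - S \<times> T) \<union> (S \<times> T - A \<times> B))"
    by (rule negligible_subset[OF negligible_Un[OF negligible_times_UNIV(1)[OF A(2)] negligible_times_UNIV(2)[OF B(2)]]])
      (use A(3) B(3) in auto)
  show "S \<times> T \<in> lmeasurable" by (rule lmeasurable_negligible_symdiff[OF ABm n])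
  show "measure lebesgue (S \<times> T) = measure lebesgue S * measure lebesgue T"
    unfolding measure_negligible_symdiff[OF ABm n] Am(2)[symmetric] Bm(2)[symmetric]
    using e by (simp add: measure_def)
qed

text \<open>Lebesgue measurability of \<open>s\<close> makes the two coordinate compositions measurable, because preimages under the
projections are products with a line.\<close>

lemma square_sublevel_lmeasurable:
  fixes s :: "real \<Rightarrow> complex"
  assumes s: "s \<in> borel_measurable half_line" and a: "0 \<le> a"
  shows "{(x, t) \<in> {a..a + d} \<times> {a..a + d}. cmod (s x - s t) < A} \<in> lmeasurable"
proof -
  define s0 where "s0 x = (if x \<in> {0..} then s x else 0)" for x
  have s0: "s0 \<in> borel_measurable lebesgue" unfolding s0_def[abs_def] using s by (subst borel_measurable_if) auto
  have fstm: "fst \<in> measurable (lebesgue :: (real \<times> real) measure) (lebesgue :: real measure)"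
  proof (rule measurableI)
    fix S :: "real set" assume "S \<in> sets lebesgue"
    moreover have "fst -` S \<inter> space (lebesgue :: (real \<times> real) measure) = S \<times> UNIV" by auto
    ultimately show "fst -` S \<inter> space (lebesgue :: (real \<times> real) measure) \<in> sets lebesgue" by (simp add: lebesgue_sets_Times)
  qed simp
  have sndm: "snd \<in> measurable (lebesgue :: (real \<times> real) measure) (lebesgue :: real measure)"
  proof (rule measurableI)
    fix S :: "real set" assume "S \<in> sets lebesgue"
    moreover have "snd -` S \<inter> space (lebesgue :: (real \<times> real) measure) = UNIV \<times> S" by auto
    ultimately show "snd -` S \<inter> space (lebesgue :: (real \<times> real) measure) \<in> sets lebesgue" by (simp add: lebesgue_sets_Times)
  qed simp
  have "(\<lambda>p. cmod (s0 (fst p) - s0 (snd p))) \<in> borel_measurable (lebesgue :: (real \<times> real) measure)"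
    using measurable_compose[OF fstm s0] measurable_compose[OF sndm s0] by simp
  then have "{p \<in> space (lebesgue :: (real \<times> real) measure). cmod (s0 (fst p) - s0 (snd p)) < A} \<in> sets lebesgue" by measurable
  then have "{p :: real \<times> real. cmod (s0 (fst p) - s0 (snd p)) < A} \<inter> {a..a + d} \<times> {a..a + d} \<in> sets lebesgue"
    by (intro sets.Int lebesgue_sets_Times) auto
  moreover have "{p :: real \<times> real. cmod (s0 (fst p) - s0 (snd p)) < A} \<inter> {a..a + d} \<times> {a..a + d}
      = {(x, t) \<in> {a..a + d} \<times> {a..a + d}. cmod (s x - s t) < A}"
    using a by (auto simp: s0_def)
  ultimately have m: "{(x, t) \<in> {a..a + d} \<times> {a..a + d}. cmod (s x - s t) < A} \<in> sets lebesgue" by simp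
  show ?thesis by (rule fmeasurableI2[OF lmeasurable_Times(1)[of "{a..a+d}" "{a..a+d}"] _ m]) auto
qed

lemma L2_on_Chebyshev:
  assumes f: "L2_on a b f" and M: "M > 0" and B: "integral {a..b} (\<lambda>x. (cmod (f x))\<^sup>2) \<le> B"
  shows "{x \<in> {a..b}. M < cmod (f x)} \<in> lmeasurable" "measure lebesgue {x \<in> {a..b}. M < cmod (f x)} \<le> B / M\<^sup>2"
proof -
  let ?S = "{x \<in> {a..b}. M < cmod (f x)}"
  have "{x \<in> space (lebesgue_on {a..b}). M < cmod (f x)} \<in> sets (lebesgue_on {a..b})"
    using L2_onD(1)[OF f] by measurable
  then have "?S \<in> sets (lebesgue_on {a..b})" by simp
  then have m: "?S \<in> sets lebesgue" by (subst (asm) sets_restrict_space_iff) auto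
  show S: "?S \<in> lmeasurable" by (rule fmeasurableI2[OF lmeasurable_interval(1)[of a b, unfolded cbox_interval] _ m]) blast
  have I: "?S \<inter> {a..b} = ?S" by auto
  have S1: "(\<lambda>x. 1 :: real) integrable_on ?S" using S unfolding lmeasurable_iff_integrable_on .
  have S2: "(\<lambda>x. M\<^sup>2) integrable_on ?S" using integrable_on_mult_right[OF S1, of "M\<^sup>2"] by (simp only: mult_1_right)
  have i: "(\<lambda>x. if x \<in> ?S then M\<^sup>2 else 0) integrable_on {a..b}"
    unfolding integrable_restrict_Int I by (rule S2)
  have "M\<^sup>2 * measure lebesgue ?S = M\<^sup>2 * integral ?S (\<lambda>x. 1)" by (simp only: lmeasure_integral[OF S])
  also have "\<dots> = integral ?S (\<lambda>x. M\<^sup>2 * 1)" by (rule integral_mult_right[symmetric])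
  also have "\<dots> = integral {a..b} (\<lambda>x. if x \<in> ?S then M\<^sup>2 else 0)" unfolding integral_restrict_Int I by (simp only: mult_1_right)
  also have "\<dots> \<le> integral {a..b} (\<lambda>x. (cmod (f x))\<^sup>2)"
    by (rule integral_le[OF i L2_onD(2)[OF f]]) (use M in \<open>auto intro!: power_mono\<close>)
  also have "\<dots> \<le> B" by (rule B)
  finally show "measure lebesgue ?S \<le> B / M\<^sup>2" using M by (simp add: field_simps)
qed

text \<open>The strip around the diagonal is covered by the rectangles \<open>Q i\<close> over the cells of a grid of mesh \<open>h\<close>. One
rectangle more than the number of cells accounts for the right end point.\<close>

lemma diagonal_strip_measure:
  assumes d: "0 < d" and n: "0 < n"
  defines "h \<equiv> d / real n"
  shows "\<exists>W. W \<in> lmeasurable \<and> measure lebesgue W \<le> 6 * d * h \<and>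
    (\<forall>x\<in>{a..a+d}. \<forall>t. \<bar>x - t\<bar> < h \<longrightarrow> (x, t) \<in> W)"
proof -
  have h: "0 < h" "real n * h = d" using d n by (auto simp: h_def)
  define Q where "Q i = {a + real i * h..a + real i * h + h} \<times> {a + real i * h - h..a + real i * h + h + h}" for i
  have Q: "Q i \<in> lmeasurable" "measure lebesgue (Q i) = 3 * h * h" for i
    unfolding Q_def using h by (auto simp: lmeasurable_Times)
  have "(\<Union>i\<in>{..n}. Q i) \<in> lmeasurable" using Q by (intro fmeasurable.finite_UN) auto
  moreover have "measure lebesgue (\<Union>i\<in>{..n}. Q i) \<le> 6 * d * h"
  proof -
    have "measure lebesgue (\<Union>i\<in>{..n}. Q i) \<le> (\<Sum>i\<in>{..n}. measure lebesgue (Q i))"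
      using Q(1) by (intro measure_UNION_le) auto
    also have "\<dots> = real (Suc n) * (3 * h * h)" by (simp add: Q(2))
    also have "\<dots> \<le> (2 * real n) * (3 * h * h)" using n h by (intro mult_right_mono) auto
    also have "\<dots> = 6 * (real n * h) * h" by simp
    finally show ?thesis unfolding h(2) .
  qed
  moreover have "(x, t) \<in> (\<Union>i\<in>{..n}. Q i)" if x: "x \<in> {a..a+d}" and t: "\<bar>x - t\<bar> < h" for x t
  proof -
    define i where "i = nat \<lfloor>(x - a) / h\<rfloor>"
    have q: "0 \<le> (x - a) / h" "(x - a) / h \<le> real n" using x h by (auto simp: field_simps)
    have fl: "real i = of_int \<lfloor>(x - a) / h\<rfloor>" unfolding i_def using q by simp
    have "real i \<le> (x - a) / h" "(x - a) / h \<le> real i + 1" unfolding fl by linarith+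
    then have i: "real i * h \<le> x - a" "x - a \<le> real i * h + h" using h by (auto simp: field_simps)
    have "real i \<le> real n" using q(2) \<open>real i \<le> (x - a) / h\<close> by linarith
    then have "i \<in> {..n}" by simp
    moreover have "(x, t) \<in> Q i" unfolding Q_def using i t by (auto simp: abs_if split: if_splits)
    ultimately show ?thesis by blast
  qed
  ultimately show ?thesis by blast
qed

section \<open>Increments of the potential and squares\<close>

text \<open>Otherwise \<open>m1 + m2\<close>, and with it each summand, increases by less than \<open>1\<close> over intervals \<open>[a n, a n + h]\<close> moving to infinity. On the set \<open>E\<close>
where \<open>\<bar>r\<bar> \<le> M\<close>, which fills at least half of the interval, the values of \<open>s\<close> differ by less than \<open>A\<close>, so the sublevel
set contains \<open>E \<times> E\<close>.\<close>

lemma (in sector_potential) squares_imply_growth: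
  assumes d: "0 < d"
    and squares: "\<And>A a. A > 0 \<Longrightarrow> (\<And>n::nat. 0 \<le> a n) \<Longrightarrow> filterlim a at_top sequentially \<Longrightarrow>
       (\<lambda>n. measure lebesgue {(x, t) \<in> {a n..a n + d} \<times> {a n..a n + d}. cmod (s x - s t) < A}) \<longlonglongrightarrow> 0"
    and h: "0 < h" "h \<le> d" "h \<le> 1"
  shows "\<exists>X. \<forall>a\<ge>X. 1 \<le> (m1 (a + h) + m2 (a + h)) - (m1 a + m2 a)"
proof (rule ccontr)
  assume "\<not> ?thesis"
  then have "\<forall>n::nat. \<exists>a. real n \<le> a \<and> (m1 (a + h) + m2 (a + h)) - (m1 a + m2 a) < 1" by (meson not_le)
  then obtain a where a: "\<forall>n::nat. real n \<le> a n \<and> (m1 (a n + h) + m2 (a n + h)) - (m1 (a n) + m2 (a n)) < 1"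
    using choice[of "\<lambda>n a. real n \<le> a \<and> (m1 (a + h) + m2 (a + h)) - (m1 a + m2 a) < 1"] by blast
  have a0: "0 \<le> a n" for n using a[rule_format, of n] of_nat_0_le_iff[of n] by linarith
  have at: "filterlim a at_top sequentially"
    by (rule filterlim_at_top_mono[OF filterlim_real_sequentially]) (use a in auto)
  \<comment> \<open>by Chebyshev, \<open>\<bar>r\<bar> > M\<close> on at most half of an interval of length \<open>h\<close>\<close>
  define M where "M = sqrt (2 * B / h)"
  have M: "0 < M" "M\<^sup>2 = 2 * B / h" using B h by (auto simp: M_def)
  define A where "A = 2 + cmod \<gamma> + 2 * M + 1"
  have A: "A > 0" using M by (simp add: A_def add_pos_nonneg)
  let ?Q = "\<lambda>n. {(x, t) \<in> {a n..a n + d} \<times> {a n..a n + d}. cmod (s x - s t) < A}"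
  have big: "(h / 2) * (h / 2) \<le> measure lebesgue (?Q n)" for n
  proof -
    let ?F = "{x \<in> {a n..a n + h}. M < cmod (r x)}"
    define E where "E = {a n..a n + h} - ?F"
    have rh: "integral {a n..a n + h} (\<lambda>x. (cmod (r x))\<^sup>2) \<le> B"
      using integral_cmod_sq_mono[OF r[OF a0[of n], of "a n + 1"], of "a n" "a n + h"] h rB[OF a0[of n]] by simp
    note F = L2_on_Chebyshev[OF r[OF a0] M(1) rh]
    have Em: "E \<in> lmeasurable" unfolding E_def using F(1) by (intro fmeasurable.Diff) auto
    have "measure lebesgue E = h - measure lebesgue ?F"
      unfolding E_def using F(1) h by (subst measurable_measure_Diff) auto
    moreover have "B / M\<^sup>2 = h / 2" using M(2) B h by simp
    ultimately have Eh: "h / 2 \<le> measure lebesgue E" using F(2) by linarith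
    have sub: "E \<times> E \<subseteq> ?Q n"
    proof (rule subrelI)
      fix x t assume "(x, t) \<in> E \<times> E"
      then have xt: "x \<in> E" "t \<in> E" by auto
      then have x: "x \<in> {a n..a n + h}" "t \<in> {a n..a n + h}" "cmod (r x) \<le> M" "cmod (r t) \<le> M" by (auto simp: E_def)
      have mm: "m1 (a n) \<le> m1 z" "m1 z \<le> m1 (a n + h)" "m2 (a n) \<le> m2 z" "m2 z \<le> m2 (a n + h)" if "z \<in> {a n..a n + h}" for z
        using that by (auto intro: monoD[OF mono1] monoD[OF mono2])
      have inc: "\<bar>m1 x - m1 t\<bar> < 1" "\<bar>m2 x - m2 t\<bar> < 1"
        using mm[OF x(1)] mm[OF x(2)] a[rule_format, of n] unfolding abs_less_iff by linarith+
      have x0: "0 \<le> x" "0 \<le> t" using x a0[of n] by auto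
      have "s x - s t = e1 * complex_of_real (m1 x - m1 t) + e2 * complex_of_real (m2 x - m2 t) + \<gamma> * complex_of_real (x - t) + (r x - r t)"
        unfolding decomp[OF x0(1)] decomp[OF x0(2)] by (simp add: algebra_simps)
      then have "cmod (s x - s t) \<le> cmod (e1 * complex_of_real (m1 x - m1 t)) + cmod (e2 * complex_of_real (m2 x - m2 t))
          + cmod (\<gamma> * complex_of_real (x - t)) + cmod (r x - r t)"
        by (metis (no_types, opaque_lifting) norm_add_rule_thm norm_triangle_ineq order_refl)
      moreover have "cmod (e1 * complex_of_real (m1 x - m1 t)) < 1" "cmod (e2 * complex_of_real (m2 x - m2 t)) < 1"
        using inc e1 e2 by (simp_all only: norm_mult norm_of_real mult_1_left)
      moreover have "cmod (\<gamma> * complex_of_real (x - t)) \<le> cmod \<gamma> * 1"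
        unfolding norm_mult norm_of_real using x h by (intro mult_left_mono) (auto simp: abs_le_iff)
      moreover have "cmod (r x - r t) \<le> 2 * M" using norm_triangle_ineq4[of "r x" "r t"] x by linarith
      ultimately have "cmod (s x - s t) < A" unfolding A_def by linarith
      then show "(x, t) \<in> ?Q n" using x h by auto
    qed
    have "(h / 2) * (h / 2) \<le> measure lebesgue E * measure lebesgue E" using Eh h by (intro mult_mono) auto
    also have "\<dots> = measure lebesgue (E \<times> E)" by (rule lmeasurable_Times(2)[OF Em Em, symmetric])
    also have "\<dots> \<le> measure lebesgue (?Q n)"
    proof (rule measure_mono_fmeasurable[OF sub fmeasurableD[OF lmeasurable_Times(1)[OF Em Em]]])
      show "?Q n \<in> lmeasurable" by (rule square_sublevel_lmeasurable[OF _ a0]) (use s in \<open>simp add: L2_loc_def\<close>)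
    qed
    finally show ?thesis .
  qed
  have "(\<lambda>n. measure lebesgue (?Q n)) \<longlonglongrightarrow> 0" by (rule squares[OF A a0 at])
  then have "(h / 2) * (h / 2) \<le> 0" by (rule tendsto_lowerbound) (use big in auto)
  then show False using h by (simp add: mult_le_0_iff)
qed

text \<open>After the rotation the modulus of a vector in the sector is controlled by its real part, hence vectors in the
sector cannot cancel each other.\<close>

lemma sector_coercive:
  assumes "\<And>\<theta>. \<alpha> \<le> \<theta> \<Longrightarrow> \<theta> \<le> \<beta> \<Longrightarrow> \<kappa> \<le> Re (\<omega> * cis \<theta>)" and z: "arg_in z \<alpha> \<beta>"
  shows "\<kappa> * cmod z \<le> Re (\<omega> * z)"
proof -
  obtain \<rho> \<phi> where z: "0 \<le> \<rho>" "\<alpha> \<le> \<phi>" "\<phi> \<le> \<beta>" "z = rcis \<rho> \<phi>" using z unfolding arg_in_def by auto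
  have "\<omega> * z = complex_of_real \<rho> * (\<omega> * cis \<phi>)" unfolding z(4) rcis_def by (simp only: mult_ac)
  moreover have "Re (complex_of_real \<rho> * w) = \<rho> * Re w" for w by simp
  ultimately have "Re (\<omega> * z) = \<rho> * Re (\<omega> * cis \<phi>)" by (simp only:)
  moreover have "\<rho> * \<kappa> \<le> \<rho> * Re (\<omega> * cis \<phi>)" using z assms(1) by (intro mult_left_mono) auto
  ultimately show ?thesis using z by (simp add: mult.commute)
qed

text \<open>Remove from the sublevel set the points with a coordinate where \<open>f\<close> or \<open>g\<close> exceeds \<open>M\<close> and a strip around the diagonal. Some area remains,
so there are \<open>t < x\<close> at distance at least \<open>h\<close> with \<open>\<bar>s x - s t\<bar> < A\<close> and \<open>f\<close>, \<open>g\<close> at most \<open>M\<close> at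
both points. For \<open>\<xi>\<close> between them, \<open>Z1\<close> and \<open>Z2\<close> are in the sector and their sum is bounded, therefore
\<open>Z1\<close> is bounded, in terms of \<open>f \<xi>\<close> and \<open>g \<xi>\<close>. This controls \<open>s \<xi> - s t\<close> in mean square, with constants
independent of \<open>a\<close>.\<close>

lemma small_square_yields_flat_interval:
  assumes s: "L2_loc s" and f: "L2_unif f" and g: "L2_unif g" and d: "d > 0"
    and ab: "\<alpha> \<le> \<beta>" "\<beta> - \<alpha> < pi" "\<bar>\<alpha>\<bar> < pi" "\<bar>\<beta>\<bar> < pi"
    and arg: "\<And>x t. 0 \<le> x \<Longrightarrow> 0 \<le> t \<Longrightarrow> 0 \<le> x - t \<Longrightarrow> x - t \<le> d \<Longrightarrow> arg_in (s x + f x - s t - g t) \<alpha> \<beta>"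
    and A: "A > 0" and \<epsilon>: "\<epsilon> > 0"
  shows "\<exists>\<delta>>0. \<exists>S>0. 64 * S * \<delta> \<le> 1 \<and> (\<forall>a\<ge>0. \<epsilon> \<le> measure lebesgue {(x, t) \<in> {a..a + d} \<times> {a..a + d}. cmod (s x - s t) < A}
     \<longrightarrow> (\<exists>t\<ge>a. integral {t..t + \<delta>} (\<lambda>x. (cmod (s x - s t))\<^sup>2) \<le> S))"
proof -
  obtain \<omega> \<kappa> where \<omega>: "cmod \<omega> = 1" "0 < \<kappa>" "\<kappa> \<le> Re \<omega>" "\<And>\<theta>. \<alpha> \<le> \<theta> \<Longrightarrow> \<theta> \<le> \<beta> \<Longrightarrow> \<kappa> \<le> Re (\<omega> * cis \<theta>)"
    using sector_rotation[OF ab] by blast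
  obtain Bf where Bf: "Bf > 0" "\<forall>x\<ge>0. integral {x..x+d} (\<lambda>\<xi>. (cmod (f \<xi>))\<^sup>2) \<le> Bf" using L2_unif_integral_bound[OF f] by blast
  obtain Bg where Bg: "Bg > 0" "\<forall>x\<ge>0. integral {x..x+d} (\<lambda>\<xi>. (cmod (g \<xi>))\<^sup>2) \<le> Bg" using L2_unif_integral_bound[OF g] by blast
  have fL: "L2_on a b f" and gL: "L2_on a b g" and sL: "L2_on a b s" if "0 \<le> a" for a b
    using f g s that by (auto simp: L2_unif_def intro: L2_loc_L2_on)
  \<comment> \<open>the points with \<open>\<bar>f\<bar> > M\<close> or \<open>\<bar>g\<bar> > M\<close> have measure at most \<open>\<epsilon> / (8 * d)\<close>, the strip has area less than \<open>\<epsilon> / 2\<close>\<close>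
  define M where "M = sqrt (8 * d * (Bf + Bg) / \<epsilon>)"
  have M: "0 < M" "M\<^sup>2 = 8 * d * (Bf + Bg) / \<epsilon>" using Bf Bg d \<epsilon> by (auto simp: M_def)
  obtain n :: nat where n: "max 1 (12 * d * d / \<epsilon>) < real n" using reals_Archimedean2 by blast
  define h where "h = d / real n"
  have n0: "0 < n" using n by auto
  have h: "0 < h" "h \<le> d" "6 * d * h < \<epsilon> / 2" using n d \<epsilon> by (auto simp: h_def field_simps)
  define C0 C1 where "C0 = (A + 2 * M) / \<kappa> + M" and "C1 = 1 / \<kappa> + 1"
  define S where "S = 3 * (d * C0\<^sup>2 + C1\<^sup>2 * Bf + C1\<^sup>2 * Bg)"
  have S: "0 < S" unfolding S_def C0_def C1_def using A M \<omega>(2) Bf Bg d by (intro mult_pos_pos add_pos_pos zero_less_power divide_pos_pos) auto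
  define \<delta> where "\<delta> = min h (1 / (64 * S))"
  have \<delta>: "0 < \<delta>" "\<delta> \<le> h" "64 * S * \<delta> \<le> 1"
  proof -
    have "\<delta> \<le> 1 / (64 * S)" by (simp add: \<delta>_def)
    then show "64 * S * \<delta> \<le> 1" using S by (simp add: field_simps)
  qed (use S h in \<open>auto simp: \<delta>_def\<close>)
  have main: "\<exists>t\<ge>a. integral {t..t + \<delta>} (\<lambda>x. (cmod (s x - s t))\<^sup>2) \<le> S"
    if a: "0 \<le> a" and big: "\<epsilon> \<le> measure lebesgue {(x, t) \<in> {a..a + d} \<times> {a..a + d}. cmod (s x - s t) < A}" for a
  proof -
    let ?I = "{a..a+d}"
    let ?Q = "{(x, t) \<in> ?I \<times> ?I. cmod (s x - s t) < A}"
    let ?Ff = "{x \<in> ?I. M < cmod (f x)}" and ?Fg = "{x \<in> ?I. M < cmod (g x)}"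
    define F where "F = ?Ff \<union> ?Fg"
    note Cf = L2_on_Chebyshev[OF fL[OF a] M(1) Bf(2)[rule_format, OF a]] and Cg = L2_on_Chebyshev[OF gL[OF a] M(1) Bg(2)[rule_format, OF a]]
    have Fm: "F \<in> lmeasurable" unfolding F_def using Cf(1) Cg(1) by (rule fmeasurable.Un)
    have "measure lebesgue F \<le> measure lebesgue ?Ff + measure lebesgue ?Fg"
      unfolding F_def using Cf(1) Cg(1) by (intro measure_Un_le) (auto dest: fmeasurableD)
    also have "\<dots> \<le> Bf / M\<^sup>2 + Bg / M\<^sup>2" using Cf(2) Cg(2) by (rule add_mono)
    also have "\<dots> = (Bf + Bg) / M\<^sup>2" by (rule add_divide_distrib[symmetric])
    also have "\<dots> = \<epsilon> / (8 * d)"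
    proof -
      have "b / (8 * d * b / \<epsilon>) = \<epsilon> / (8 * d)" if "0 < b" for b using that d \<epsilon> by (simp add: field_simps)
      then show ?thesis unfolding M(2) using Bf(1) Bg(1) by simp
    qed
    finally have Fl: "measure lebesgue F \<le> \<epsilon> / (8 * d)" .
    have Im: "?I \<in> lmeasurable" "measure lebesgue ?I = d" using d by auto
    have dF: "d * measure lebesgue F \<le> \<epsilon> / 8"
      using mult_left_mono[OF Fl less_imp_le[OF d]] d by simp
    have FI: "F \<times> ?I \<in> lmeasurable" "measure lebesgue (F \<times> ?I) \<le> \<epsilon> / 8" "?I \<times> F \<in> lmeasurable" "measure lebesgue (?I \<times> F) \<le> \<epsilon> / 8"
      using lmeasurable_Times[OF Fm Im(1)] lmeasurable_Times[OF Im(1) Fm] dF unfolding Im(2) by (auto simp: mult.commute)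
    obtain W where W: "W \<in> lmeasurable" "measure lebesgue W \<le> 6 * d * h" "\<forall>x\<in>?I. \<forall>t. \<bar>x - t\<bar> < h \<longrightarrow> (x, t) \<in> W"
      using diagonal_strip_measure[OF d n0, of a] unfolding h_def by blast
    have "\<exists>x t. x \<in> ?I \<and> t \<in> ?I \<and> cmod (s x - s t) < A \<and> x \<notin> F \<and> t \<notin> F \<and> h \<le> \<bar>x - t\<bar>"
    proof (rule ccontr)
      assume no: "\<not> ?thesis"
      have sub: "?Q \<subseteq> (F \<times> ?I \<union> ?I \<times> F) \<union> W" 
      proof (intro subrelI)
        fix x t assume "(x, t) \<in> ?Q"
        then have xt: "x \<in> ?I" "t \<in> ?I" "cmod (s x - s t) < A" by auto
        then consider "x \<in> F" | "t \<in> F" | "\<bar>x - t\<bar> < h" using no not_le by blast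
        then show "(x, t) \<in> (F \<times> ?I \<union> ?I \<times> F) \<union> W" by cases (use xt W(3) in blast)+
      qed
      have "?Q \<in> lmeasurable" by (rule square_sublevel_lmeasurable[OF _ a]) (use s in \<open>simp add: L2_loc_def\<close>)
      then have "measure lebesgue ?Q \<le> measure lebesgue ((F \<times> ?I \<union> ?I \<times> F) \<union> W)"
        by (intro measure_mono_fmeasurable[OF sub] fmeasurable.Un FI W) (rule fmeasurableD)
      also have "\<dots> \<le> measure lebesgue (F \<times> ?I \<union> ?I \<times> F) + measure lebesgue W"
        by (intro measure_Un_le fmeasurableD fmeasurable.Un FI W)
      also have "\<dots> \<le> (measure lebesgue (F \<times> ?I) + measure lebesgue (?I \<times> F)) + measure lebesgue W"
        by (intro add_right_mono measure_Un_le fmeasurableD FI)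
      also have "\<dots> < \<epsilon>" using FI W(2) h(3) \<epsilon> by linarith
      finally show False using big by simp
    qed
    then obtain p q where pq: "p \<in> ?I" "q \<in> ?I" "cmod (s p - s q) < A" "p \<notin> F" "q \<notin> F" "h \<le> \<bar>p - q\<bar>" by blast
    obtain x t where xt: "x \<in> ?I" "t \<in> ?I" "cmod (s x - s t) < A" "x \<notin> F" "t \<notin> F" "h \<le> x - t"
    proof (cases "q \<le> p")
      case True then show ?thesis using pq that[of p q] by simp
    next
      case False then show ?thesis using pq that[of q p] by (simp add: norm_minus_commute)
    qed
    have Mx: "cmod (f x) \<le> M" "cmod (g t) \<le> M" using xt by (auto simp: F_def not_less)
    have t0: "0 \<le> t" "t \<le> x" using xt a h by auto
    have bound: "cmod (s \<xi> - s t) \<le> C0 + C1 * cmod (f \<xi>) + C1 * cmod (g \<xi>)" if \<xi>: "\<xi> \<in> {t..t+\<delta>}" for \<xi>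
    proof -
      have \<xi>': "t \<le> \<xi>" "\<xi> \<le> x" using \<xi> xt(6) \<delta>(2) by auto
      define Z1 Z2 where "Z1 = s \<xi> + f \<xi> - s t - g t" and "Z2 = s x + f x - s \<xi> - g \<xi>"
      have Z1: "arg_in Z1 \<alpha> \<beta>" unfolding Z1_def by (rule arg) (use \<xi>' t0 xt in auto)
      have Z2: "arg_in Z2 \<alpha> \<beta>" unfolding Z2_def by (rule arg) (use \<xi>' t0 xt in auto)
      have "\<kappa> * cmod Z1 \<le> Re (\<omega> * Z1)" by (rule sector_coercive[OF \<omega>(4) Z1])
      moreover have "0 \<le> Re (\<omega> * Z2)" using sector_coercive[OF \<omega>(4) Z2] \<omega>(2) by (meson mult_nonneg_nonneg norm_ge_zero order.trans less_imp_le)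
      moreover have "Re (\<omega> * Z1) + Re (\<omega> * Z2) \<le> cmod (Z1 + Z2)"
      proof -
        have "Re (\<omega> * Z1) + Re (\<omega> * Z2) = Re (\<omega> * (Z1 + Z2))" by (simp only: distrib_left plus_complex.simps)
        also have "\<dots> \<le> cmod \<omega> * cmod (Z1 + Z2)" unfolding norm_mult[symmetric] by (rule complex_Re_le_cmod)
        finally show ?thesis using \<omega>(1) by simp
      qed
      moreover have "cmod (Z1 + Z2) \<le> A + 2 * M + (cmod (f \<xi>) + cmod (g \<xi>))"
      proof -
        have "Z1 + Z2 = (s x - s t) + ((f x - g t) + (f \<xi> - g \<xi>))" by (simp add: Z1_def Z2_def)
        then show ?thesis
          using norm_triangle_ineq[of "s x - s t" "(f x - g t) + (f \<xi> - g \<xi>)"] norm_triangle_ineq[of "f x - g t" "f \<xi> - g \<xi>"]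
            norm_triangle_ineq4[of "f x" "g t"] norm_triangle_ineq4[of "f \<xi>" "g \<xi>"] xt(3) Mx by simp
      qed
      ultimately have "\<kappa> * cmod Z1 \<le> A + 2 * M + (cmod (f \<xi>) + cmod (g \<xi>))" by linarith
      then have "cmod Z1 \<le> (A + 2 * M + (cmod (f \<xi>) + cmod (g \<xi>))) / \<kappa>" using \<omega>(2) by (simp add: pos_le_divide_eq mult.commute)
      then have Z1b: "cmod Z1 \<le> (A + 2 * M) / \<kappa> + (cmod (f \<xi>) + cmod (g \<xi>)) / \<kappa>" unfolding add_divide_distrib[of "A + 2 * M"] .
      have "s \<xi> - s t = Z1 - (f \<xi> - g t)" by (simp add: Z1_def)
      then have "cmod (s \<xi> - s t) \<le> cmod Z1 + (cmod (f \<xi>) + M)"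
        using norm_triangle_ineq4[of Z1 "f \<xi> - g t"] norm_triangle_ineq4[of "f \<xi>" "g t"] Mx by simp
      also have "\<dots> \<le> (A + 2 * M) / \<kappa> + (cmod (f \<xi>) + cmod (g \<xi>)) / \<kappa> + (cmod (f \<xi>) + cmod (g \<xi>) + M)"
        using Z1b norm_ge_zero[of "g \<xi>"] by linarith
      also have "\<dots> = C0 + C1 * cmod (f \<xi>) + C1 * cmod (g \<xi>)" unfolding C0_def C1_def by (simp add: algebra_simps add_divide_distrib)
      finally show ?thesis .
    qed
    have fi: "(\<lambda>\<xi>. (cmod (f \<xi>))\<^sup>2) integrable_on {t..t+\<delta>}" and gi: "(\<lambda>\<xi>. (cmod (g \<xi>))\<^sup>2) integrable_on {t..t+\<delta>}"
      using L2_onD(2)[OF fL[OF t0(1)]] L2_onD(2)[OF gL[OF t0(1)]] by auto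
    let ?G = "\<lambda>\<xi>. 3 * (C0\<^sup>2 + C1\<^sup>2 * (cmod (f \<xi>))\<^sup>2 + C1\<^sup>2 * (cmod (g \<xi>))\<^sup>2)"
    have ci: "(\<lambda>\<xi>. C0\<^sup>2) integrable_on {t..t+\<delta>}" by auto
    have GI: "(?G has_integral 3 * (\<delta> * C0\<^sup>2 + C1\<^sup>2 * integral {t..t+\<delta>} (\<lambda>\<xi>. (cmod (f \<xi>))\<^sup>2) + C1\<^sup>2 * integral {t..t+\<delta>} (\<lambda>\<xi>. (cmod (g \<xi>))\<^sup>2))) {t..t+\<delta>}"
    proof (intro has_integral_mult_right has_integral_add integrable_integral fi gi)
      show "((\<lambda>\<xi>. C0\<^sup>2) has_integral \<delta> * C0\<^sup>2) {t..t+\<delta>}"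
        using has_integral_const_real[of "C0\<^sup>2" t "t + \<delta>"] \<delta> by simp
    qed
    have "integral {t..t + \<delta>} (\<lambda>x. (cmod (s x - s t))\<^sup>2) \<le> integral {t..t+\<delta>} ?G"
    proof (rule integral_le[OF L2_onD(2)[OF L2_on_diff[OF sL[OF t0(1)] L2_on_const]] has_integral_integrable[OF GI]])
      fix \<xi> assume \<xi>: "\<xi> \<in> {t..t+\<delta>}"
      have "(cmod (s \<xi> - s t))\<^sup>2 \<le> (C0 + C1 * cmod (f \<xi>) + C1 * cmod (g \<xi>))\<^sup>2" by (rule power_mono[OF bound[OF \<xi>]]) simp
      also have "\<dots> \<le> ?G \<xi>" using sum3_sq_le[of C0 "C1 * cmod (f \<xi>)" "C1 * cmod (g \<xi>)"] by (simp only: power_mult_distrib)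
      finally show "(cmod (s \<xi> - s t))\<^sup>2 \<le> ?G \<xi>" .
    qed
    also have "\<dots> \<le> S"
    proof -
      have "integral {t..t+\<delta>} (\<lambda>\<xi>. (cmod (f \<xi>))\<^sup>2) \<le> Bf"
        using integral_cmod_sq_mono[OF fL[OF t0(1), of "t+d"], of t "t+\<delta>"] Bf(2)[rule_format, OF t0(1)] \<delta>(2) h(2) by simp
      moreover have "integral {t..t+\<delta>} (\<lambda>\<xi>. (cmod (g \<xi>))\<^sup>2) \<le> Bg"
        using integral_cmod_sq_mono[OF gL[OF t0(1), of "t+d"], of t "t+\<delta>"] Bg(2)[rule_format, OF t0(1)] \<delta>(2) h(2) by simp
      moreover have "\<delta> \<le> d" using \<delta>(2) h(2) by simp
      ultimately show ?thesis unfolding integral_unique[OF GI] S_def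
        by (intro mult_left_mono add_mono mult_right_mono) auto
    qed
    finally show ?thesis using xt(2) by (intro exI[of _ t]) auto
  qed
  show ?thesis using \<delta> S main by (intro exI[of _ \<delta>] conjI exI[of _ S]) auto
qed

text \<open>If the areas do not tend to zero, they exceed some \<open>\<epsilon>\<close> arbitrarily far out, which produces flat intervals moving
to infinity.\<close>

lemma compact_resolvent_implies_squares:
  assumes s: "L2_loc s" and f: "L2_unif f" and g: "L2_unif g" and d: "d > 0"
    and ab: "\<alpha> \<le> \<beta>" "\<beta> - \<alpha> < pi" "\<bar>\<alpha>\<bar> < pi" "\<bar>\<beta>\<bar> < pi"
    and arg: "\<And>x t. 0 \<le> x \<Longrightarrow> 0 \<le> t \<Longrightarrow> 0 \<le> x - t \<Longrightarrow> x - t \<le> d \<Longrightarrow> arg_in (s x + f x - s t - g t) \<alpha> \<beta>"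
    and ext: "has_extensions_with_compact_resolvent (minimal_operator s)"
    and A: "A > 0" and a: "\<And>n::nat. 0 \<le> a n" "filterlim a at_top sequentially"
  shows "(\<lambda>n. measure lebesgue {(x, t) \<in> {a n..a n + d} \<times> {a n..a n + d}. cmod (s x - s t) < A}) \<longlonglongrightarrow> 0"
proof (rule ccontr)
  let ?\<mu> = "\<lambda>n. measure lebesgue {(x, t) \<in> {a n..a n + d} \<times> {a n..a n + d}. cmod (s x - s t) < A}"
  assume "\<not> ?\<mu> \<longlonglongrightarrow> 0"
  then obtain \<epsilon> where \<epsilon>: "\<epsilon> > 0" "\<And>N. \<exists>n\<ge>N. \<epsilon> \<le> ?\<mu> n"
    unfolding LIMSEQ_iff by (auto simp: not_less)
  obtain \<delta> S where \<delta>: "\<delta> > 0" "S > 0" "64 * S * \<delta> \<le> 1" and fl: "\<And>a. 0 \<le> a \<Longrightarrow>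
      \<epsilon> \<le> measure lebesgue {(x, t) \<in> {a..a + d} \<times> {a..a + d}. cmod (s x - s t) < A} \<Longrightarrow>
      (\<exists>t\<ge>a. integral {t..t + \<delta>} (\<lambda>x. (cmod (s x - s t))\<^sup>2) \<le> S)"
    using small_square_yields_flat_interval[OF s f g d ab arg A \<epsilon>(1)] by blast
  have "\<exists>t. real k \<le> t \<and> 0 \<le> t \<and> integral {t..t + \<delta>} (\<lambda>x. (cmod (s x - s t))\<^sup>2) \<le> S" for k :: nat
  proof -
    obtain N where N: "\<And>n. N \<le> n \<Longrightarrow> real k \<le> a n"
      using a(2) unfolding filterlim_at_top eventually_sequentially by blast
    obtain n where n: "n \<ge> N" "\<epsilon> \<le> ?\<mu> n" using \<epsilon>(2) by blast
    obtain t where t: "t \<ge> a n" "integral {t..t + \<delta>} (\<lambda>x. (cmod (s x - s t))\<^sup>2) \<le> S" using fl[OF a(1) n(2)] by blast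
    have "real k \<le> t" "0 \<le> t" using t(1) N[OF n(1)] a(1)[of n] by linarith+
    then show ?thesis using t(2) by blast
  qed
  then have "\<forall>k::nat. \<exists>t. real k \<le> t \<and> 0 \<le> t \<and> integral {t..t + \<delta>} (\<lambda>x. (cmod (s x - s t))\<^sup>2) \<le> S" by blast
  from choice[OF this] obtain t where t: "\<forall>k::nat. real k \<le> t k \<and> 0 \<le> t k \<and> integral {t k..t k + \<delta>} (\<lambda>x. (cmod (s x - s (t k)))\<^sup>2) \<le> S"
    by blast
  have tt: "filterlim t at_top sequentially"
    by (rule filterlim_at_top_mono[OF filterlim_real_sequentially]) (use t in auto)
  show False
    by (rule no_compact_resolvent_if_flat_intervals[OF s ext tt _ \<delta>(1,2,3), of "\<lambda>k. s (t k)"]) (use t in auto)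
qed

theorem theorem3:
  fixes s f g :: "real \<Rightarrow> complex" and d \<alpha> \<beta> :: real
  assumes "L2_loc s"
    and "L2_unif f" and "L2_unif g"
    and "d > 0"
    and "0 \<le> \<beta> - \<alpha>" and "\<beta> - \<alpha> < pi" and "\<bar>\<alpha>\<bar> < pi" and "\<bar>\<beta>\<bar> < pi"
    and "\<And>x t. 0 \<le> x \<Longrightarrow> 0 \<le> t \<Longrightarrow> 0 \<le> x - t \<Longrightarrow> x - t \<le> d \<Longrightarrow>
           arg_in (s x + f x - s t - g t) \<alpha> \<beta>"
  shows "has_extensions_with_compact_resolvent (minimal_operator s) \<longleftrightarrow>
    (\<forall>A>0. \<forall>a :: nat \<Rightarrow> real. (\<forall>n. 0 \<le> a n) \<longrightarrow> filterlim a at_top sequentially \<longrightarrow>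
       (\<lambda>n. measure lebesgue
              {(x, t) \<in> {a n..a n + d} \<times> {a n..a n + d}. cmod (s x - s t) < A})
         \<longlonglongrightarrow> 0)" (is "?ext \<longleftrightarrow> ?squares")
proof
  have ab: "\<alpha> \<le> \<beta>" using assms(5) by simp
  show ?squares if ext: ?ext
    using compact_resolvent_implies_squares[OF assms(1-4) ab assms(6-9) ext] by blast
  show ?ext if sq: ?squares
  proof -
    have "\<exists>r m1 m2 e1 e2 \<gamma> \<omega> \<kappa> B. sector_potential s r m1 m2 e1 e2 \<gamma> \<omega> \<kappa> B"
      by (rule sector_decomposition[OF assms(1-4) ab assms(6-8)]) (rule assms(9))
    then obtain r m1 m2 e1 e2 \<gamma> \<omega> \<kappa> B where "sector_potential s r m1 m2 e1 e2 \<gamma> \<omega> \<kappa> B" by blast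
    then interpret sector_potential s r m1 m2 e1 e2 \<gamma> \<omega> \<kappa> B .
    show ?ext
    proof (rule growth_implies_compact_extension[of "min d 1"])
      show "0 < min d 1" using assms(4) by simp
      fix h :: real assume h: "0 < h" "h \<le> min d 1"
      show "\<exists>X. \<forall>a\<ge>X. 1 \<le> (m1 (a + h) + m2 (a + h)) - (m1 a + m2 a)"
        by (rule squares_imply_growth[OF assms(4)]) (use h sq in auto)
    qed
  qed
qed

end
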